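(* Let $(Y,\mathcal{B},\nu)$ be a probability space, let $T:Y\to Y$ be a measurable transformation for which $\nu$ is invariant, and suppose $T$ is ergodic with respect to $\nu$. Let $h\in L^2(Y,\mathcal{B},\nu)$ be such that $\int h(y)\,\nu(dy)=0$. If there is $\beta>\frac12$ such that $$\limsup_{n\to\infty} n^{\beta}\,\|\mathcal{P}_{T,\nu}^n h\|_2<\infty,$$ then the CLT and the FCLT hold for $h$ (with parameter $\sigma$) provided that $$\sigma=\lim_{n\to\infty}\frac{\left\|\sum_{j=0}^{n-1}h\circ T^j\right\|_2}{\sqrt n}>0.$$
   Context: $\nu$ is invariant for $T$ if $\nu(T^{-1}(A))=\nu(A)$ for all $A\in\mathcal{B}$; $T$ is ergodic if every $A\in\mathcal{B}$ with $T^{-1}(A)=A$ has $\nu(A)\in\{0,1\}$. $T$ is not assumed invertible. $\|\cdot\|_p$ is the norm of $L^p(Y,\mathcal{B},\nu)$; functions are real-valued. Transfer operator: $\mathcal{P}_{T,\nu}:L^1(Y,\mathcal{B},\nu)\to L^1(Y,\mathcal{B},\nu)$ is defined by letting $\mathcal{P}_{T,\nu}f$ be the unique element of $L^1(Y,\mathcal{B},\nu)$ with $\int_A \mathcal{P}_{T,\nu}f(y)\,\nu(dy)=\int_{T^{-1}(A)}f(y)\,\nu(dy)$ for all $A\in\mathcal{B}$. $\mathcal{P}_{T,\nu}^n$ denotes its $n$-th iterate. CLT for $h$ with parameter $\sigma>0$: the distributions (under $\nu$) of $\frac{1}{\sqrt n}\sum_{j=0}^{n-1}h\circ T^j$ converge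 weakly to the normal distribution $N(0,\sigma^2)$. FCLT for $h$ with parameter $\sigma>0$: let $\psi_n(t)=\frac{1}{\sigma\sqrt n}\sum_{j=0}^{[nt]-1}h\circ T^j$ for $t\in[0,1]$, $n\ge1$ (where $[\cdot]$ is the integer part and the sum from $0$ to $-1$ is $0$). The FCLT holds if the distributions of the $D[0,1]$-valued random variables $\psi_n$ on the Skorohod space $D[0,1]$ converge weakly to the standard Wiener measure (the law of standard Brownian motion on $[0,1]$). *)

theory Defs
  imports "HOL-Probability.Probability"
begin

section \<open>Measure-preserving and ergodic transformations\<close>

definition invariant_measure :: "'a measure \<Rightarrow> ('a \<Rightarrow> 'a) \<Rightarrow> bool" where
  "invariant_measure M T \<longleftrightarrow>
     T \<in> measurable M M \<and>
     (\<forall>A\<in>sets M. emeasure M (T -` A \<inter> space M) = emeasure M A)"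

definition ergodic_transformation :: "'a measure \<Rightarrow> ('a \<Rightarrow> 'a) \<Rightarrow> bool" where
  "ergodic_transformation M T \<longleftrightarrow>
     (\<forall>A\<in>sets M. T -` A \<inter> space M = A \<longrightarrow> emeasure M A = 0 \<or> emeasure M A = 1)"

definition birkhoff_sum :: "('a \<Rightarrow> 'a) \<Rightarrow> ('a \<Rightarrow> real) \<Rightarrow> nat \<Rightarrow> 'a \<Rightarrow> real" where
  "birkhoff_sum T h n y = (\<Sum>j<n. h ((T ^^ j) y))"

definition square_integrable :: "'a measure \<Rightarrow> ('a \<Rightarrow> real) \<Rightarrow> bool" where
  "square_integrable M f \<longleftrightarrow> f \<in> borel_measurable M \<and> integrable M (\<lambda>x. (f x)\<^sup>2)"

definition norm_L2 :: "'a measure \<Rightarrow> ('a \<Rightarrow> real) \<Rightarrow> real" where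
  "norm_L2 M f = sqrt (\<integral>x. (f x)\<^sup>2 \<partial>M)"


section \<open>The transfer operator\<close>

text \<open>Elements of $L^1$ are represented by integrable functions. The operator picks one
  representative of the image class; \<open>is_transfer_unique\<close> and \<open>is_transfer_exists\<close> below show that
  this class exists and is determined by the class of the argument.\<close>

definition is_transfer :: "'a measure \<Rightarrow> ('a \<Rightarrow> 'a) \<Rightarrow> ('a \<Rightarrow> real) \<Rightarrow> ('a \<Rightarrow> real) \<Rightarrow> bool" where
  "is_transfer M T f g \<longleftrightarrow> integrable M g \<and>
     (\<forall>A\<in>sets M. (LINT y:A|M. g y) = (LINT y:(T -` A \<inter> space M)|M. f y))"

definition transfer_operator :: "'a measure \<Rightarrow> ('a \<Rightarrow> 'a) \<Rightarrow> ('a \<Rightarrow> real) \<Rightarrow> 'a \<Rightarrow> real" where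
  "transfer_operator M T f = (SOME g. is_transfer M T f g)"

lemma is_transfer_unique:
  assumes "T \<in> measurable M M" "integrable M f" "integrable M f'" "AE x in M. f x = f' x"
    and g: "is_transfer M T f g" and g': "is_transfer M T f' g'"
  shows "AE x in M. g x = g' x"
proof (rule density_unique_real)
  show "integrable M g" "integrable M g'"
    using g g' by (auto simp: is_transfer_def)
  fix A assume A: "A \<in> sets M"
  have "(LINT y:(T -` A \<inter> space M)|M. f y) = (LINT y:(T -` A \<inter> space M)|M. f' y)"
    unfolding set_lebesgue_integral_def
  proof (rule integral_cong_AE)
    have B: "T -` A \<inter> space M \<in> sets M" using assms(1) A by (rule measurable_sets)
    show "(\<lambda>x. indicat_real (T -` A \<inter> space M) x *\<^sub>R f x) \<in> borel_measurable M"
      using B assms(2) by measurable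
    show "(\<lambda>x. indicat_real (T -` A \<inter> space M) x *\<^sub>R f' x) \<in> borel_measurable M"
      using B assms(3) by measurable
  qed (use assms(4) in auto)
  then show "(LINT y:A|M. g y) = (LINT y:A|M. g' y)"
    using g g' A by (auto simp: is_transfer_def)
qed

lemma is_transfer_exists_nonneg:
  assumes "prob_space M" and inv: "invariant_measure M T"
    and f: "integrable M f" and pos: "\<And>x. 0 \<le> f x"
  shows "\<exists>g. is_transfer M T f g"
proof -
  interpret prob_space M by fact
  have T[measurable]: "T \<in> measurable M M" using inv by (simp add: invariant_measure_def)
  have fm[measurable]: "f \<in> borel_measurable M" using f by auto
  define N where "N = distr (density M (\<lambda>x. ennreal (f x))) M T"
  have emN: "emeasure N A = ennreal (LINT y:(T -` A \<inter> space M)|M. f y)" if A: "A \<in> sets M" for A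
  proof -
    have B: "T -` A \<inter> space M \<in> sets M" using T A by (rule measurable_sets)
    have "emeasure N A = (\<integral>\<^sup>+x. ennreal (f x) * indicator (T -` A \<inter> space M) x \<partial>M)"
      unfolding N_def using A B by (simp add: emeasure_distr emeasure_density)
    also have "\<dots> = (\<integral>\<^sup>+x. ennreal (indicator (T -` A \<inter> space M) x *\<^sub>R f x) \<partial>M)"
      by (intro nn_integral_cong) (auto split: split_indicator)
    also have "\<dots> = ennreal (LINT y:(T -` A \<inter> space M)|M. f y)"
      unfolding set_lebesgue_integral_def
      using pos B f by (intro nn_integral_eq_integral integrable_mult_indicator) auto
    finally show ?thesis .
  qed
  have setsN: "sets N = sets M" by (simp add: N_def)
  have finN: "finite_measure N"
    by (rule finite_measureI) (use emN[of "space M"] in \<open>simp add: N_def\<close>)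
  have ac: "absolutely_continuous M N"
    unfolding absolutely_continuous_def
  proof
    fix A assume A: "A \<in> null_sets M"
    then have A': "A \<in> sets M" by auto
    have B: "T -` A \<inter> space M \<in> null_sets M"
      using A A' inv T by (auto simp: null_sets_def invariant_measure_def intro: measurable_sets)
    have "emeasure N A = (\<integral>\<^sup>+x. ennreal (f x) * indicator (T -` A \<inter> space M) x \<partial>M)"
      unfolding N_def using A' B by (simp add: emeasure_distr emeasure_density)
    also have "\<dots> = 0" using B by (rule nn_integral_null_set)
    finally show "A \<in> null_sets N" using A' setsN by (auto simp: null_sets_def)
  qed
  obtain D where D: "D \<in> borel_measurable M" "AE x in M. RN_deriv M N x = ennreal (D x)"
      "\<And>x. 0 \<le> D x"
    using real_RN_deriv[OF finN ac setsN] by auto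
  have dens: "density M (\<lambda>x. ennreal (D x)) = N"
  proof -
    have "density M (\<lambda>x. ennreal (D x)) = density M (RN_deriv M N)"
      using D by (intro density_cong) auto
    also have "\<dots> = N" using density_RN_deriv[OF ac setsN] .
    finally show ?thesis .
  qed
  have emD: "(\<integral>\<^sup>+x. ennreal (indicator A x *\<^sub>R D x) \<partial>M)
      = ennreal (LINT y:(T -` A \<inter> space M)|M. f y)" if A: "A \<in> sets M" for A
  proof -
    have "(\<integral>\<^sup>+x. ennreal (indicator A x *\<^sub>R D x) \<partial>M) = (\<integral>\<^sup>+x. ennreal (D x) * indicator A x \<partial>M)"
      by (intro nn_integral_cong) (auto split: split_indicator)
    also have "\<dots> = emeasure N A" using A D(1) by (simp add: dens[symmetric] emeasure_density)
    finally show ?thesis using emN[OF A] by simp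
  qed
  have intD: "integrable M D"
  proof (rule integrableI_nonneg)
    have "(\<integral>\<^sup>+x. ennreal (D x) \<partial>M) = (\<integral>\<^sup>+x. ennreal (indicator (space M) x *\<^sub>R D x) \<partial>M)"
      by (intro nn_integral_cong) auto
    also have "\<dots> < \<infinity>" using emD[of "space M"] by simp
    finally show "(\<integral>\<^sup>+x. ennreal (D x) \<partial>M) < \<infinity>" .
  qed (use D in auto)
  have "(LINT y:A|M. D y) = (LINT y:(T -` A \<inter> space M)|M. f y)" if A: "A \<in> sets M" for A
  proof -
    have "ennreal (LINT y:A|M. D y) = (\<integral>\<^sup>+x. ennreal (indicator A x *\<^sub>R D x) \<partial>M)"
      unfolding set_lebesgue_integral_def
      using D A intD by (intro nn_integral_eq_integral[symmetric] integrable_mult_indicator) auto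
    then have "ennreal (LINT y:A|M. D y) = ennreal (LINT y:(T -` A \<inter> space M)|M. f y)"
      by (simp only: emD[OF A])
    moreover have "0 \<le> (LINT y:A|M. D y)" "0 \<le> (LINT y:(T -` A \<inter> space M)|M. f y)"
      unfolding set_lebesgue_integral_def using D(3) pos by (auto intro!: integral_nonneg_AE)
    ultimately show ?thesis by simp
  qed
  with intD show ?thesis by (auto simp: is_transfer_def)
qed

lemma is_transfer_exists:
  assumes M: "prob_space M" and inv: "invariant_measure M T" and f: "integrable M f"
  shows "\<exists>g. is_transfer M T f g"
proof -
  have T: "T \<in> measurable M M" using inv by (simp add: invariant_measure_def)
  let ?p = "\<lambda>x. max 0 (f x)" and ?n = "\<lambda>x. max 0 (- f x)"
  have p: "integrable M ?p" "integrable M ?n" using f by auto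
  obtain g where g: "is_transfer M T ?p g"
    using is_transfer_exists_nonneg[OF M inv p(1)] by auto
  obtain k where k: "is_transfer M T ?n k"
    using is_transfer_exists_nonneg[OF M inv p(2)] by auto
  have "(LINT y:A|M. g y - k y) = (LINT y:(T -` A \<inter> space M)|M. f y)" if A: "A \<in> sets M" for A
  proof -
    have B: "T -` A \<inter> space M \<in> sets M" using T A by (rule measurable_sets)
    have "(LINT y:A|M. g y - k y) = (LINT y:A|M. g y) - (LINT y:A|M. k y)"
      using g k A by (intro set_integral_diff)
        (unfold set_integrable_def is_transfer_def, intro integrable_mult_indicator; blast)+
    also have "\<dots> = (LINT y:(T -` A \<inter> space M)|M. ?p y) - (LINT y:(T -` A \<inter> space M)|M. ?n y)"
      using g k A by (simp add: is_transfer_def)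
    also have "\<dots> = (LINT y:(T -` A \<inter> space M)|M. ?p y - ?n y)"
      using p B by (intro set_integral_diff(2)[symmetric])
        (unfold set_integrable_def, intro integrable_mult_indicator; simp)+
    also have "(\<lambda>y. ?p y - ?n y) = f" by (auto simp: max_def)
    finally show ?thesis .
  qed
  with g k have "is_transfer M T f (\<lambda>y. g y - k y)" by (auto simp: is_transfer_def)
  then show ?thesis by blast
qed

lemma is_transfer_transfer_operator:
  assumes "prob_space M" "invariant_measure M T" "integrable M f"
  shows "is_transfer M T f (transfer_operator M T f)"
  unfolding transfer_operator_def using is_transfer_exists[OF assms] by (rule someI_ex)

text \<open>For square integrable \<open>f\<close> all iterates are square integrable, so the integral in their
  \<open>norm_L2\<close> is not the default value 0 of a non-integrable function.\<close>

lemma square_integrable_transfer_operator: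
  assumes M: "prob_space M" and inv: "invariant_measure M T" and f: "square_integrable M f"
  shows "square_integrable M (transfer_operator M T f)"
proof -
  interpret prob_space M by fact
  let ?g = "transfer_operator M T f"
  let ?F = "vimage_algebra (space M) T M"
  have T[measurable]: "T \<in> measurable M M" using inv by (simp add: invariant_measure_def)
  have dT: "distr M M T = M"
    using inv by (intro measure_eqI) (auto simp: emeasure_distr invariant_measure_def)
  have fm[measurable]: "f \<in> borel_measurable M" and f2: "integrable M (\<lambda>x. (f x)\<^sup>2)"
    using f by (auto simp: square_integrable_def)
  have f1: "integrable M f" using square_integrable_imp_integrable[OF fm f2] .
  have tr: "is_transfer M T f ?g" using is_transfer_transfer_operator[OF M inv f1] .
  then have g: "integrable M ?g" by (simp add: is_transfer_def)
  then have gm[measurable]: "?g \<in> borel_measurable M" by auto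
  have gT: "integrable M (\<lambda>x. ?g (T x))"
    using g dT integrable_distr[OF T, of ?g] by simp
  have sub: "subalgebra M ?F"
    using T by (auto simp: subalgebra_def sets_vimage_algebra2 measurable_def)
  interpret S: finite_measure_subalgebra M ?F
    using sub by unfold_locales
  have ce: "AE x in M. real_cond_exp M ?F f x = ?g (T x)"
  proof (rule S.real_cond_exp_charact)
    show "(\<lambda>x. ?g (T x)) \<in> borel_measurable ?F"
      using measurable_compose[OF measurable_vimage_algebra1[of T "space M" M] gm] T
      by (auto simp: measurable_def)
    fix B assume "B \<in> sets ?F"
    then obtain A where A: "A \<in> sets M" "B = T -` A \<inter> space M"
      using T by (auto simp: sets_vimage_algebra2 measurable_def)
    have "(LINT x:B|M. f x) = (LINT y:A|M. ?g y)" using tr A by (simp add: is_transfer_def)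
    also have "\<dots> = (\<integral>y. indicator A y *\<^sub>R ?g y \<partial>distr M M T)"
      by (simp add: dT set_lebesgue_integral_def)
    also have "\<dots> = (\<integral>x. indicator A (T x) *\<^sub>R ?g (T x) \<partial>M)"
      using A by (intro integral_distr) auto
    also have "\<dots> = (LINT x:B|M. ?g (T x))"
      unfolding set_lebesgue_integral_def A(2)
      by (intro Bochner_Integration.integral_cong) (auto split: split_indicator)
    finally show "(LINT x:B|M. f x) = (LINT x:B|M. ?g (T x))" .
  qed (use f1 gT in auto)
  have "integrable M (\<lambda>x. (real_cond_exp M ?F f x)\<^sup>2)"
    by (rule S.integrable_convex_cond_exp[where I = UNIV and q = "\<lambda>x. x\<^sup>2"])
      (use f1 f2 convex_power2 in auto)
  then have "integrable M (\<lambda>x. (?g (T x))\<^sup>2)"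
    by (rule integrable_cong_AE_imp) (use ce in auto)
  then have "integrable (distr M M T) (\<lambda>x. (?g x)\<^sup>2)"
    by (subst integrable_distr_eq) auto
  then show ?thesis by (simp add: dT square_integrable_def)
qed


section \<open>The Skorohod space $D[0,1]$\<close>

definition cadlag_on_unit :: "(real \<Rightarrow> real) \<Rightarrow> bool" where
  "cadlag_on_unit x \<longleftrightarrow>
     (\<forall>t\<in>{0..<1}. (x \<longlongrightarrow> x t) (at_right t)) \<and>
     (\<forall>t\<in>{0<..1}. \<exists>l. (x \<longlongrightarrow> l) (at_left t))"

lemma step_function_cadlag:
  fixes s :: "nat \<Rightarrow> real"
  shows "cadlag_on_unit (\<lambda>t\<in>{0..1}. s (nat \<lfloor>real n * t\<rfloor>))" (is "cadlag_on_unit ?x")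
  unfolding cadlag_on_unit_def
proof (intro conjI ballI)
  fix t :: real assume t: "t \<in> {0..<1}"
  define b where "b = min 1 (t + (real_of_int \<lfloor>real n * t\<rfloor> + 1 - real n * t) / (real n + 1))"
  have b: "b > t" using t floor_less_iff[of "real n * t"] by (simp add: b_def)
  have "?x u = ?x t" if u: "t < u" "u < b" for u
  proof -
    have "(u - t) * (real n + 1) < real_of_int \<lfloor>real n * t\<rfloor> + 1 - real n * t"
      using u by (simp add: b_def field_simps)
    moreover have "real n * t \<le> real n * u" using u by (simp add: mult_left_mono)
    moreover have "real n * (u - t) \<le> (u - t) * (real n + 1)" using u by (simp add: algebra_simps)
    ultimately have "\<lfloor>real n * u\<rfloor> = \<lfloor>real n * t\<rfloor>"
      by (intro floor_unique) (linarith, simp add: algebra_simps)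
    moreover have "u \<in> {0..1}" using u t by (auto simp: b_def)
    ultimately show ?thesis using t by simp
  qed
  then have "\<forall>\<^sub>F u in at_right t. ?x u = ?x t"
    unfolding eventually_at_right_field using b by blast
  then show "(?x \<longlongrightarrow> ?x t) (at_right t)" by (rule tendsto_eventually)
next
  fix t :: real assume t: "t \<in> {0<..1}"
  define m where "m = \<lceil>real n * t\<rceil> - 1"
  define b where "b = max 0 (t - (real n * t - real_of_int m) / (real n + 1))"
  have "real n * t - real_of_int m > 0" unfolding m_def by linarith
  then have b: "b < t" using t by (auto simp: b_def)
  have "?x u = (if n = 0 then s 0 else s (nat m))" if u: "b < u" "u < t" for u
  proof -
    have u01: "u \<in> {0..1}" using u t by (auto simp: b_def)
    show ?thesis
    proof (cases "n = 0")
      case False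
      have "(t - u) * (real n + 1) < real n * t - real_of_int m"
        using u by (simp add: b_def field_simps)
      moreover have "real n * (t - u) \<le> (t - u) * (real n + 1)" using u by (simp add: algebra_simps)
      moreover have "real n * u < real n * t" using u False by simp
      moreover have "real n * t \<le> real_of_int m + 1" unfolding m_def by linarith
      ultimately have "\<lfloor>real n * u\<rfloor> = m"
        by (intro floor_unique) (simp add: algebra_simps, linarith)
      then show ?thesis using u01 False by simp
    qed (use u01 in simp)
  qed
  then have "\<forall>\<^sub>F u in at_left t. ?x u = (if n = 0 then s 0 else s (nat m))"
    unfolding eventually_at_left_field using b by blast
  then show "\<exists>l. (?x \<longlongrightarrow> l) (at_left t)" by (blast intro: tendsto_eventually)
qed

typedef skorohod = "{x :: real \<Rightarrow> real. x \<in> extensional {0..1} \<and> cadlag_on_unit x}"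
  morphisms eval_path Abs_path
  using step_function_cadlag[of "\<lambda>_. 0" 0] restrict_extensional by blast

definition time_changes :: "(real \<Rightarrow> real) set" where
  "time_changes = {\<phi>. strict_mono_on {0..1} \<phi> \<and> continuous_on {0..1} \<phi> \<and> \<phi> ` {0..1} = {0..1}}"

definition skorohod_close :: "real \<Rightarrow> skorohod \<Rightarrow> skorohod \<Rightarrow> bool" where
  "skorohod_close e x y \<longleftrightarrow> (\<exists>\<phi>\<in>time_changes. \<forall>t\<in>{0..1}.
     \<bar>\<phi> t - t\<bar> \<le> e \<and> \<bar>eval_path x t - eval_path y (\<phi> t)\<bar> \<le> e)"

lemma id_time_change: "(\<lambda>t. t) \<in> time_changes"
  by (auto simp: time_changes_def strict_mono_on_def)

lemma time_change_mem: "\<phi> \<in> time_changes \<Longrightarrow> t \<in> {0..1} \<Longrightarrow> \<phi> t \<in> {0..1}"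
  by (auto simp: time_changes_def)

lemma comp_time_change:
  assumes "\<phi> \<in> time_changes" "\<psi> \<in> time_changes"
  shows "(\<lambda>t. \<psi> (\<phi> t)) \<in> time_changes"
proof -
  have "(\<lambda>t. \<psi> (\<phi> t)) ` {0..1} = \<psi> ` (\<phi> ` {0..1})" by auto
  moreover have "continuous_on {0..1} (\<lambda>t. \<psi> (\<phi> t))"
    using assms by (intro continuous_on_compose2[of "{0..1}" \<psi> "{0..1}" \<phi>])
      (auto simp: time_changes_def)
  moreover have "strict_mono_on {0..1} (\<lambda>t. \<psi> (\<phi> t))"
    using assms time_change_mem[OF assms(1)]
    by (auto simp: time_changes_def strict_mono_on_def)
  ultimately show ?thesis using assms by (auto simp: time_changes_def)
qed

lemma inv_time_change:
  assumes "\<phi> \<in> time_changes"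
  obtains \<psi> where "\<psi> \<in> time_changes" "\<And>t. t \<in> {0..1} \<Longrightarrow> \<phi> (\<psi> t) = t"
proof
  let ?\<psi> = "inv_into {0..1} \<phi>"
  have m: "strict_mono_on {0..1} \<phi>" and c: "continuous_on {0..1} \<phi>" and i: "\<phi> ` {0..1} = {0..1}"
    using assms by (auto simp: time_changes_def)
  have inj: "inj_on \<phi> {0..1}" using m by (rule strict_mono_on_imp_inj_on)
  have inv: "\<phi> (?\<psi> t) = t" "?\<psi> t \<in> {0..1}" if "t \<in> {0..1}" for t
    using that i f_inv_into_f[of t \<phi> "{0..1}"] inv_into_into[of t \<phi> "{0..1}"] by auto
  show "\<phi> (?\<psi> t) = t" if "t \<in> {0..1}" for t using inv that by auto
  have "continuous_on {0..1} ?\<psi>"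
    using continuous_on_inv[OF c] i inv_into_f_f[OF inj] by fastforce
  moreover have "strict_mono_on {0..1} ?\<psi>"
  proof (rule strict_mono_onI)
    fix r s :: real assume rs: "r \<in> {0..1}" "s \<in> {0..1}" "r < s"
    show "?\<psi> r < ?\<psi> s"
    proof (rule ccontr)
      assume "\<not> ?\<psi> r < ?\<psi> s"
      then have "\<phi> (?\<psi> s) \<le> \<phi> (?\<psi> r)"
        using m inv(2)[OF rs(1)] inv(2)[OF rs(2)]
        by (metis linorder_not_less nless_le strict_mono_onD)
      then show False using inv rs by auto
    qed
  qed
  moreover have "?\<psi> ` {0..1} = {0..1}"
    using inv_into_image_cancel[OF inj, of "{0..1}"] i by simp
  ultimately show "?\<psi> \<in> time_changes" by (simp add: time_changes_def)
qed

lemma time_change_1: "\<phi> \<in> time_changes \<Longrightarrow> \<phi> 1 = 1"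
proof -
  assume a: "\<phi> \<in> time_changes"
  then have "1 \<in> \<phi> ` {0..1}" by (auto simp: time_changes_def)
  then obtain t where t: "t \<in> {0..1}" "\<phi> t = 1" by auto
  have "\<phi> t < \<phi> 1" if "t < 1"
    using a t(1) that strict_mono_onD[of "{0..1}" \<phi> t 1] by (auto simp: time_changes_def)
  with t time_change_mem[OF a, of 1] show "\<phi> 1 = 1" by (cases "t < 1") auto
qed

lemma skorohod_close_sym: assumes "skorohod_close e x y" shows "skorohod_close e y x"
proof -
  obtain \<phi> where \<phi>: "\<phi> \<in> time_changes" "\<forall>t\<in>{0..1}.
     \<bar>\<phi> t - t\<bar> \<le> e \<and> \<bar>eval_path x t - eval_path y (\<phi> t)\<bar> \<le> e"
    using assms by (auto simp: skorohod_close_def)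
  obtain \<psi> where \<psi>: "\<psi> \<in> time_changes" "\<And>t. t \<in> {0..1} \<Longrightarrow> \<phi> (\<psi> t) = t"
    using inv_time_change[OF \<phi>(1)] by blast
  show ?thesis unfolding skorohod_close_def
  proof (intro bexI[OF _ \<psi>(1)] ballI)
    fix t :: real assume t: "t \<in> {0..1}"
    have "\<psi> t \<in> {0..1}" using \<psi>(1) t by (rule time_change_mem)
    with \<phi>(2) \<psi>(2)[OF t]
    have "\<bar>t - \<psi> t\<bar> \<le> e \<and> \<bar>eval_path x (\<psi> t) - eval_path y t\<bar> \<le> e" by metis
    then show "\<bar>\<psi> t - t\<bar> \<le> e \<and> \<bar>eval_path y t - eval_path x (\<psi> t)\<bar> \<le> e"
      by (simp add: abs_minus_commute)
  qed
qed

lemma skorohod_close_trans: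
  assumes "skorohod_close e x y" "skorohod_close d y z"
  shows "skorohod_close (e + d) x z"
proof -
  obtain \<phi> where \<phi>: "\<phi> \<in> time_changes" "\<And>t. t\<in>{0..1} \<Longrightarrow>
     \<bar>\<phi> t - t\<bar> \<le> e \<and> \<bar>eval_path x t - eval_path y (\<phi> t)\<bar> \<le> e"
    using assms(1) by (auto simp: skorohod_close_def)
  obtain \<psi> where \<psi>: "\<psi> \<in> time_changes" "\<And>t. t\<in>{0..1} \<Longrightarrow>
     \<bar>\<psi> t - t\<bar> \<le> d \<and> \<bar>eval_path y t - eval_path z (\<psi> t)\<bar> \<le> d"
    using assms(2) by (auto simp: skorohod_close_def)
  show ?thesis unfolding skorohod_close_def
  proof (intro bexI[OF _ comp_time_change[OF \<phi>(1) \<psi>(1)]] ballI)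
    fix t :: real assume t: "t \<in> {0..1}"
    show "\<bar>\<psi> (\<phi> t) - t\<bar> \<le> e + d \<and> \<bar>eval_path x t - eval_path z (\<psi> (\<phi> t))\<bar> \<le> e + d"
      using \<phi>(2)[OF t] \<psi>(2)[OF time_change_mem[OF \<phi>(1) t]] by linarith
  qed
qed

lemma skorohod_close_mono: "skorohod_close e x y \<Longrightarrow> e \<le> d \<Longrightarrow> skorohod_close d x y"
  unfolding skorohod_close_def by (meson order_trans)

lemma eval_path_bounded: "\<exists>B. \<forall>t\<in>{0..1}. \<bar>eval_path x t\<bar> \<le> B"
proof -
  let ?P = "\<lambda>a b. \<exists>B. \<forall>t\<in>{a..b}. t \<in> {0..1} \<longrightarrow> \<bar>eval_path x t\<bar> \<le> B"
  have x: "cadlag_on_unit (eval_path x)" using eval_path by auto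
  have "?P 0 1"
  proof (rule Bolzano[where P = ?P])
    fix a b c assume "?P a b" "?P b c"
    then obtain B C where "\<forall>t\<in>{a..b}. t \<in> {0..1} \<longrightarrow> \<bar>eval_path x t\<bar> \<le> B"
      "\<forall>t\<in>{b..c}. t \<in> {0..1} \<longrightarrow> \<bar>eval_path x t\<bar> \<le> C" by auto
    then show "?P a c" by (intro exI[of _ "max B C"]) (force simp: le_max_iff_disj)
  next
    fix s :: real assume s: "0 \<le> s" "s \<le> 1"
    obtain d1 B1 where 1: "d1 > 0" "\<And>u. s < u \<Longrightarrow> u < s + d1 \<Longrightarrow> u \<le> 1 \<Longrightarrow> \<bar>eval_path x u\<bar> \<le> B1"
    proof (cases "s < 1")
      case True
      then have "(eval_path x \<longlongrightarrow> eval_path x s) (at_right s)"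
        using x s by (auto simp: cadlag_on_unit_def)
      then have "\<forall>\<^sub>F u in at_right s. dist (eval_path x u) (eval_path x s) < 1"
        by (rule tendstoD) simp
      then obtain b where "b > s" "\<And>u. s < u \<Longrightarrow> u < b \<Longrightarrow> dist (eval_path x u) (eval_path x s) < 1"
        by (auto simp: eventually_at_right_field)
      then show thesis
        by (intro that[of "b - s" "\<bar>eval_path x s\<bar> + 1"]) (force simp: dist_real_def)+
    next
      case False
      then show thesis by (intro that[of 1 0]) auto
    qed
    obtain d2 B2 where 2: "d2 > 0" "\<And>u. u < s \<Longrightarrow> s - d2 < u \<Longrightarrow> 0 \<le> u \<Longrightarrow> \<bar>eval_path x u\<bar> \<le> B2"
    proof (cases "0 < s")
      case True
      then have "\<exists>l. (eval_path x \<longlongrightarrow> l) (at_left s)"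
        using x s by (auto simp: cadlag_on_unit_def)
      then obtain l where "(eval_path x \<longlongrightarrow> l) (at_left s)" ..
      then have "\<forall>\<^sub>F u in at_left s. dist (eval_path x u) l < 1"
        by (rule tendstoD) simp
      then obtain b where "b < s" "\<And>u. b < u \<Longrightarrow> u < s \<Longrightarrow> dist (eval_path x u) l < 1"
        by (auto simp: eventually_at_left_field)
      then show thesis
        by (intro that[of "s - b" "\<bar>l\<bar> + 1"]) (force simp: dist_real_def)+
    next
      case False
      then show thesis by (intro that[of 1 0]) auto
    qed
    show "\<exists>d>0. \<forall>a b. a \<le> s \<and> s \<le> b \<and> b - a < d \<longrightarrow> ?P a b"
    proof (rule exI[of _ "min d1 d2"], intro conjI allI impI)
      fix a b assume ab: "a \<le> s \<and> s \<le> b \<and> b - a < min d1 d2"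
      show "?P a b"
      proof (intro exI[of _ "max (max B1 B2) \<bar>eval_path x s\<bar>"] ballI impI)
        fix t assume t: "t \<in> {a..b}" "t \<in> {0..1}"
        consider "t < s" | "t = s" | "t > s" by linarith
        then show "\<bar>eval_path x t\<bar> \<le> max (max B1 B2) \<bar>eval_path x s\<bar>"
          using 1(2)[of t] 2(2)[of t] ab t by cases (auto simp: le_max_iff_disj)
      qed
    qed (use 1 2 in auto)
  qed simp
  then show ?thesis by auto
qed

lemma skorohod_close_exists: "\<exists>e>0. skorohod_close e x y"
proof -
  obtain B C where "\<forall>t\<in>{0..1}. \<bar>eval_path x t\<bar> \<le> B" "\<forall>t\<in>{0..1}. \<bar>eval_path y t\<bar> \<le> C"
    using eval_path_bounded by meson
  then have "skorohod_close (\<bar>B\<bar> + \<bar>C\<bar> + 1) x y"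
    unfolding skorohod_close_def by (intro bexI[OF _ id_time_change]) force
  then show ?thesis by (intro exI[of _ "\<bar>B\<bar> + \<bar>C\<bar> + 1"]) auto
qed

lemma skorohod_close_imp_eq:
  assumes close: "\<And>e. e > 0 \<Longrightarrow> skorohod_close e x y"
  shows "x = y"
proof -
  have *: "eval_path x t = eval_path y t" if t: "t \<in> {0..1}" for t
  proof (cases "t = 1")
    case True
    have "\<bar>eval_path x 1 - eval_path y 1\<bar> \<le> 0 + e" if "e > 0" for e
    proof -
      obtain \<phi> where "\<phi> \<in> time_changes"
        "\<forall>t\<in>{0..1}. \<bar>\<phi> t - t\<bar> \<le> e \<and> \<bar>eval_path x t - eval_path y (\<phi> t)\<bar> \<le> e"
        using close[OF \<open>e > 0\<close>] unfolding skorohod_close_def by blast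
      then show ?thesis using time_change_1[of \<phi>] by (auto dest: bspec[of _ _ 1])
    qed
    then have "\<bar>eval_path x 1 - eval_path y 1\<bar> \<le> 0" by (rule field_le_epsilon)
    with True show ?thesis by simp
  next
    case False
    then have t1: "0 \<le> t" "t < 1" using t by auto
    have "\<bar>eval_path x t - eval_path y t\<bar> \<le> 0 + e" if e: "e > 0" for e
    proof -
      have r: "\<exists>b>t. \<forall>u. t < u \<longrightarrow> u < b \<longrightarrow> \<bar>eval_path z u - eval_path z t\<bar> < e / 3" for z
      proof -
        have "(eval_path z \<longlongrightarrow> eval_path z t) (at_right t)"
          using eval_path[of z] t1 by (auto simp: cadlag_on_unit_def)
        then have "\<forall>\<^sub>F u in at_right t. dist (eval_path z u) (eval_path z t) < e / 3"
          by (rule tendstoD) (use e in simp)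
        then show ?thesis by (auto simp: eventually_at_right_field dist_real_def)
      qed
      obtain b c where b: "b > t" "\<And>u. t < u \<Longrightarrow> u < b \<Longrightarrow> \<bar>eval_path x u - eval_path x t\<bar> < e / 3"
        and c: "c > t" "\<And>u. t < u \<Longrightarrow> u < c \<Longrightarrow> \<bar>eval_path y u - eval_path y t\<bar> < e / 3"
        using r[of x] r[of y] by blast
      define \<rho> where "\<rho> = min (min (b - t) (c - t)) (1 - t)"
      have \<rho>: "\<rho> > 0" "\<rho> \<le> b - t" "\<rho> \<le> c - t" "\<rho> \<le> 1 - t" using b c t1 by (auto simp: \<rho>_def)
      define s where "s = t + \<rho> / 2"
      have s: "t < s" "s < b" "s < c" "s \<in> {0..1}" using \<rho> t1 by (auto simp: s_def)
      have "min (\<rho> / 4) (e / 3) > 0" using \<rho> e by auto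
      from close[OF this] obtain \<phi> where "\<bar>\<phi> s - s\<bar> \<le> min (\<rho> / 4) (e / 3)"
        "\<bar>eval_path x s - eval_path y (\<phi> s)\<bar> \<le> min (\<rho> / 4) (e / 3)"
        using s(4) unfolding skorohod_close_def by blast
      then have "\<bar>\<phi> s - s\<bar> \<le> \<rho> / 4" "\<bar>eval_path x s - eval_path y (\<phi> s)\<bar> \<le> e / 3"
        by linarith+
      moreover from this \<rho> have "t < \<phi> s" "\<phi> s < c" unfolding s_def by linarith+
      ultimately show ?thesis using b(2)[OF s(1,2)] c(2)[of "\<phi> s"] by linarith
    qed
    then have "\<bar>eval_path x t - eval_path y t\<bar> \<le> 0" by (rule field_le_epsilon)
    then show ?thesis by simp
  qed
  have "eval_path x = eval_path y"
    using eval_path[of x] eval_path[of y] * by (intro extensionalityI[of _ "{0..1}"]) auto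
  then show ?thesis by (simp add: eval_path_inject)
qed

instantiation skorohod :: metric_space
begin

definition dist_skorohod :: "skorohod \<Rightarrow> skorohod \<Rightarrow> real" where
  "dist_skorohod x y = Inf {e. e > 0 \<and> skorohod_close e x y}"

definition uniformity_skorohod :: "(skorohod \<times> skorohod) filter" where
  "uniformity_skorohod = (INF e\<in>{0<..}. principal {(x, y). dist x y < e})"

definition open_skorohod :: "skorohod set \<Rightarrow> bool" where
  "open_skorohod U \<longleftrightarrow> (\<forall>x\<in>U. \<forall>\<^sub>F (x', y) in uniformity. x' = x \<longrightarrow> y \<in> U)"

instance
proof
  have bdd: "bdd_below {e. e > 0 \<and> skorohod_close e x y}" for x y
    by (rule bdd_belowI[of _ 0]) auto
  have le: "dist x y \<le> e" if "e > 0" "skorohod_close e x y" for e and x y :: skorohod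
    unfolding dist_skorohod_def using that bdd by (intro cInf_lower) auto
  have close: "skorohod_close e x y" if "dist x y < e" for e and x y :: skorohod
  proof -
    have "{e. e > 0 \<and> skorohod_close e x y} \<noteq> {}" using skorohod_close_exists by auto
    from cInf_lessD[OF this that[unfolded dist_skorohod_def]]
    show ?thesis using skorohod_close_mono by fastforce
  qed
  have nonneg: "0 \<le> dist x y" for x y :: skorohod
    unfolding dist_skorohod_def using skorohod_close_exists by (intro cInf_greatest) auto
  show "uniformity = (INF e\<in>{0<..}. principal {(x, y :: skorohod). dist x y < e})"
    by (rule uniformity_skorohod_def)
  show "open U \<longleftrightarrow> (\<forall>x\<in>U. \<forall>\<^sub>F (x', y) in uniformity. x' = x \<longrightarrow> y \<in> U)" for U :: "skorohod set"
    by (rule open_skorohod_def)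
  show "dist x y = 0 \<longleftrightarrow> x = y" for x y :: skorohod
  proof
    assume "dist x y = 0"
    then show "x = y" by (intro skorohod_close_imp_eq close) simp
  next
    assume "x = y"
    have "dist x y \<le> 0 + e" if "e > 0" for e
    proof -
      have "skorohod_close e x y"
        unfolding skorohod_close_def using that \<open>x = y\<close> by (intro bexI[OF _ id_time_change]) auto
      with le[OF that] show ?thesis by simp
    qed
    then have "dist x y \<le> 0" by (rule field_le_epsilon)
    with nonneg[of x y] show "dist x y = 0" by simp
  qed
  show "dist x y \<le> dist x z + dist y z" for x y z :: skorohod
  proof (rule field_le_epsilon)
    fix e :: real assume e: "e > 0"
    have "skorohod_close (dist x z + e / 2) x z" "skorohod_close (dist y z + e / 2) y z"
      using e by (auto intro: close)
    then have "skorohod_close ((dist x z + e / 2) + (dist y z + e / 2)) x y"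
      by (metis skorohod_close_sym skorohod_close_trans)
    then have "skorohod_close (dist x z + dist y z + e) x y" by (simp add: algebra_simps)
    then show "dist x y \<le> dist x z + dist y z + e"
      using e nonneg[of x z] nonneg[of y z] by (intro le) auto
  qed
qed

end


section \<open>Weak convergence and Wiener measure\<close>

definition weak_conv_measures :: "(nat \<Rightarrow> 'a::topological_space measure) \<Rightarrow> 'a measure \<Rightarrow> bool" where
  "weak_conv_measures \<mu> W \<longleftrightarrow>
     (\<forall>f :: 'a \<Rightarrow> real. continuous_on UNIV f \<and> bounded (range f) \<longrightarrow>
        (\<lambda>n. \<integral>x. f x \<partial>\<mu> n) \<longlonglongrightarrow> (\<integral>x. f x \<partial>W))"

text \<open>The law of a standard Brownian motion on $[0,1]$ as a Borel measure on $D[0,1]$, described by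
  the coordinate process. Note that \<open>normal_density\<close> takes the standard deviation, not the
  variance.\<close>

definition is_wiener_measure :: "skorohod measure \<Rightarrow> bool" where
  "is_wiener_measure W \<longleftrightarrow>
     prob_space W \<and> sets W = sets borel \<and>
     (AE x in W. eval_path x 0 = 0 \<and> continuous_on {0..1} (eval_path x)) \<and>
     (\<forall>s t. 0 \<le> s \<and> s < t \<and> t \<le> 1 \<longrightarrow>
        distributed W lborel (\<lambda>x. eval_path x t - eval_path x s) (normal_density 0 (sqrt (t - s)))) \<and>
     (\<forall>k (t :: nat \<Rightarrow> real). 0 \<le> t 0 \<and> (\<forall>i<k. t i < t (Suc i)) \<and> t k \<le> 1 \<longrightarrow>
        prob_space.indep_vars W (\<lambda>_. borel) (\<lambda>i x. eval_path x (t (Suc i)) - eval_path x (t i)) {..<k})"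


section \<open>The two limit theorems\<close>

definition CLT :: "'a measure \<Rightarrow> ('a \<Rightarrow> 'a) \<Rightarrow> ('a \<Rightarrow> real) \<Rightarrow> real \<Rightarrow> bool" where
  "CLT M T h \<sigma> \<longleftrightarrow>
     weak_conv_m (\<lambda>n. distr M borel (\<lambda>y. birkhoff_sum T h n y / sqrt (real n)))
       (density lborel (\<lambda>x. ennreal (normal_density 0 \<sigma> x)))"

definition partial_sum_path ::
    "('a \<Rightarrow> 'a) \<Rightarrow> ('a \<Rightarrow> real) \<Rightarrow> real \<Rightarrow> nat \<Rightarrow> 'a \<Rightarrow> skorohod" where
  "partial_sum_path T h \<sigma> n y =
     Abs_path (\<lambda>t\<in>{0..1}. birkhoff_sum T h (nat \<lfloor>real n * t\<rfloor>) y / (\<sigma> * sqrt (real n)))"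

lemma eval_partial_sum_path:
  assumes "t \<in> {0..1}"
  shows "eval_path (partial_sum_path T h \<sigma> n y) t
    = birkhoff_sum T h (nat \<lfloor>real n * t\<rfloor>) y / (\<sigma> * sqrt (real n))"
proof -
  have "(\<lambda>t\<in>{0..1}. birkhoff_sum T h (nat \<lfloor>real n * t\<rfloor>) y / (\<sigma> * sqrt (real n)))
      \<in> {x. x \<in> extensional {0..1} \<and> cadlag_on_unit x}"
    using step_function_cadlag[of "\<lambda>k. birkhoff_sum T h k y / (\<sigma> * sqrt (real n))" n] by simp
  then show ?thesis using assms by (simp add: partial_sum_path_def Abs_path_inverse)
qed

text \<open>Wiener measure is uniquely determined by \<open>is_wiener_measure\<close>. The libraries do not construct
  it, so its existence is part of the assertion.\<close>

definition FCLT :: "'a measure \<Rightarrow> ('a \<Rightarrow> 'a) \<Rightarrow> ('a \<Rightarrow> real) \<Rightarrow> real \<Rightarrow> bool" where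
  "FCLT M T h \<sigma> \<longleftrightarrow> (\<exists>W. is_wiener_measure W \<and>
     weak_conv_measures (\<lambda>n. distr M borel (partial_sum_path T h \<sigma> n)) W)"

end

(* Write P for the transfer operator, U f = f o T and d_k = P^k h - U P^(k+1) h. Then h telescopes into
   the sum of the U^k d_k, each d_k is a reverse martingale difference (orthogonal to the functions of
   T), and |d_k|^2 = |P^k h|^2 - |P^(k+1) h|^2, so the decay of |P^k h| gives Hannan's condition
   sum |d_k| < infinity. By Doob's inequality for the time-reversed sums, the partial sums of h stay
   within epsilon sqrt n, uniformly in L^2, of those of a bounded martingale difference m: cut off the
   sum over k, truncate the remaining d_k, and move them to time 0 by a bounded coboundary.

   For bounded m the joint characteristic functions of the block sums converge because
   prod (1 + i y_j) has mean 1 and e^(iy) is (1 + iy) e^(-y^2/2) up to O(y^3), where the sum of the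
   y_j^2 converges by the ergodic theorem. Fourth moments bound the oscillation between the points of
   a fixed grid, which carries the convergence over to Lipschitz test functions on D[0,1]. Wiener
   measure itself is the law of Levy's dyadic construction, and the CLT is the FCLT at time 1. *)

theory Submission
  imports Defs
begin

section \<open>Joint characteristic functions\<close>

text \<open>\<open>T\<close> need not be invertible, so along an orbit the natural
  \<sigma>-algebras, the preimages of the measurable sets under the powers of \<open>T\<close>,
  decrease. Inductions on martingale sums therefore peel off the first term \<open>m y\<close>, use
  that the rest is a function of \<open>T y\<close>, and return to the shorter sum by invariance.
  Boundedness of \<open>m\<close> pays twice. It bounds the product of the factors 1 + i y_j
  uniformly in n, so that pointwise convergence can be integrated. And sums over windows of length
  n/N get fourth moments of order (n/N)^2, so that N windows, divided by n^2, contribute only 1/N;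
  second moments would contribute a constant. Lipschitz functions suffice to test weak convergence,
  and the Skorohod distance is at most the uniform one. Replacing one path by another thus costs
  only the mean of a uniform distance, and no tightness argument in D[0,1] enters. The price is that
  \<open>m\<close> depends on the tolerance and its norm is only close to \<sigma>, so the change of
  normalisation has to be estimated too.\<close>

lemma (in prob_space) integrable_bounded_complex:
  fixes f :: "'a \<Rightarrow> complex"
  assumes "f \<in> borel_measurable M" "\<And>y. norm (f y) \<le> C"
  shows "integrable M f"
  by (rule integrable_const_bound[of _ C]) (use assms in auto)

lemma (in prob_space) integrable_bounded_real:
  fixes f :: "'a \<Rightarrow> real"
  assumes "f \<in> borel_measurable M" "\<And>y. \<bar>f y\<bar> \<le> C"
  shows "integrable M f"
  by (rule integrable_const_bound[of _ C]) (use assms in auto)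

lemma isCont_imp_borel_measurable:
  fixes g :: "real \<Rightarrow> real"
  shows "(\<And>x. isCont g x) \<Longrightarrow> g \<in> borel_measurable borel"
  by (intro borel_measurable_continuous_onI continuous_at_imp_continuous_on) auto

text \<open>A bounded weight \<open>Z n\<close> becomes a probability density after adding a large constant, so that
  Levy's continuity theorem applies to weighted characteristic functions.\<close>

lemma (in prob_space) weighted_levy_continuity:
  fixes X Z :: "nat \<Rightarrow> 'a \<Rightarrow> real" and g :: "real \<Rightarrow> real"
  assumes \<mu>: "real_distribution \<mu>"
    and X[measurable]: "\<And>n. X n \<in> borel_measurable M"
    and Z[measurable]: "\<And>n. Z n \<in> borel_measurable M"
    and C: "\<And>n y. \<bar>Z n y\<bar> \<le> C"
    and lim1: "\<And>t. (\<lambda>n. \<integral>y. iexp (t * X n y) \<partial>M) \<longlonglongrightarrow> char \<mu> t"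
    and limZ: "\<And>t. (\<lambda>n. \<integral>y. complex_of_real (Z n y) * iexp (t * X n y) \<partial>M) \<longlonglongrightarrow> complex_of_real z * char \<mu> t"
    and g: "\<And>x. isCont g x" "\<And>x. \<bar>g x\<bar> \<le> B"
  shows "(\<lambda>n. \<integral>y. Z n y * g (X n y) \<partial>M) \<longlonglongrightarrow> z * (\<integral>x. g x \<partial>\<mu>)"
proof -
  interpret \<mu>: real_distribution \<mu> by fact
  have C0: "0 \<le> C" using C[of 0 undefined] by linarith
  have gm[measurable]: "g \<in> borel_measurable borel" using g(1) by (rule isCont_imp_borel_measurable)
  \<comment> \<open>Weights between \<open>- C\<close> and \<open>C\<close> become densities after
    adding \<open>C + 1\<close>, with a normalisation \<open>e n\<close> of at least 1. The claim is
    used for \<open>W = Z\<close> and for \<open>W = 0\<close>; the difference removes the added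
    constant.\<close>
  have key: "(\<lambda>n. \<integral>y. (C + 1 + W n y) * g (X n y) \<partial>M) \<longlonglongrightarrow> (C + 1 + w) * (\<integral>x. g x \<partial>\<mu>)"
    if W[measurable]: "\<And>n. W n \<in> borel_measurable M" and WC: "\<And>n y. \<bar>W n y\<bar> \<le> C"
      and limW: "\<And>t. (\<lambda>n. \<integral>y. complex_of_real (W n y) * iexp (t * X n y) \<partial>M) \<longlonglongrightarrow> complex_of_real w * char \<mu> t"
    for W :: "nat \<Rightarrow> 'a \<Rightarrow> real" and w :: real
  proof -
    define e where "e n = (\<integral>y. C + 1 + W n y \<partial>M)" for n
    have intW: "integrable M (W n)" for n
      by (rule integrable_bounded_real) (use WC in auto)
    have W1: "1 \<le> C + 1 + W n y" for n y using WC[of n y] by linarith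
    have e1: "1 \<le> e n" for n
    proof -
      have "(\<integral>y. 1 \<partial>M) \<le> e n" unfolding e_def using intW W1 by (intro integral_mono) auto
      then show ?thesis by (simp add: prob_space)
    qed
    \<comment> \<open>The weighted hypothesis at frequency 0, where a characteristic function is
      1.\<close>
    have "(\<lambda>n. complex_of_real (\<integral>y. W n y \<partial>M)) \<longlonglongrightarrow> complex_of_real w"
      using limW[of 0] by (simp add: \<mu>.char_zero)
    then have "(\<lambda>n. \<integral>y. W n y \<partial>M) \<longlonglongrightarrow> w" using tendsto_of_real_iff by blast
    moreover have "e n = C + 1 + (\<integral>y. W n y \<partial>M)" for n
      unfolding e_def using intW by (simp add: prob_space)
    ultimately have elim: "e \<longlonglongrightarrow> C + 1 + w"
      using tendsto_add[OF tendsto_const, of "\<lambda>n. \<integral>y. W n y \<partial>M" w sequentially "C + 1"] by presburger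
    have w1: "1 \<le> C + 1 + w" using elim e1 by (intro LIMSEQ_le_const[OF elim]) auto
    define Q where "Q n = density M (\<lambda>y. ennreal ((C + 1 + W n y) / e n))" for n
    have pos: "0 \<le> (C + 1 + W n y) / e n" for n y
      using W1[of n y] e1[of n] by (intro divide_nonneg_nonneg) auto
    have prQ: "prob_space (Q n)" for n
    proof
      have "emeasure (Q n) (space (Q n)) = (\<integral>\<^sup>+y. ennreal ((C + 1 + W n y) / e n) \<partial>M)"
        unfolding Q_def by (subst emeasure_density) (auto intro!: nn_integral_cong)
      also have "\<dots> = ennreal (\<integral>y. (C + 1 + W n y) / e n \<partial>M)"
        using intW pos by (intro nn_integral_eq_integral) auto
      also have "(\<integral>y. (C + 1 + W n y) / e n \<partial>M) = 1"
        using e1[of n] by (simp add: e_def)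
      finally show "emeasure (Q n) (space (Q n)) = 1" by simp
    qed
    have XQ[measurable]: "X n \<in> borel_measurable (Q n)" for n by (simp add: Q_def)
    have distr: "real_distribution (distr (Q n) borel (X n))" for n
      by (intro prob_space.real_distribution_distr prQ XQ)
    have ch: "char (distr (Q n) borel (X n)) t
       = (of_real (C + 1) * (\<integral>y. iexp (t * X n y) \<partial>M) + (\<integral>y. of_real (W n y) * iexp (t * X n y) \<partial>M)) / of_real (e n)" for n t
    proof -
      have i1: "integrable M (\<lambda>y. iexp (t * X n y))"
        by (rule integrable_bounded_complex[where C = 1]) auto
      have i2: "integrable M (\<lambda>y. of_real (W n y) * iexp (t * X n y))"
        by (rule integrable_bounded_complex[where C = C]) (use WC in \<open>auto simp: norm_mult\<close>)
      have "char (distr (Q n) borel (X n)) t = (\<integral>y. iexp (t * X n y) \<partial>Q n)"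
        unfolding char_def by (subst integral_distr) auto
      also have "\<dots> = (\<integral>y. ((C + 1 + W n y) / e n) *\<^sub>R iexp (t * X n y) \<partial>M)"
        unfolding Q_def using pos by (subst integral_density) auto
      also have "\<dots> = (\<integral>y. (of_real (C + 1) * iexp (t * X n y) + of_real (W n y) * iexp (t * X n y)) / of_real (e n) \<partial>M)"
        by (intro Bochner_Integration.integral_cong refl) (simp add: scaleR_conv_of_real field_simps)
      also have "\<dots> = (of_real (C + 1) * (\<integral>y. iexp (t * X n y) \<partial>M) + (\<integral>y. of_real (W n y) * iexp (t * X n y) \<partial>M)) / of_real (e n)"
        using i1 i2 by simp
      finally show ?thesis .
    qed
    have chl: "(\<lambda>n. char (distr (Q n) borel (X n)) t) \<longlonglongrightarrow> char \<mu> t" for t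
    proof -
      have "(\<lambda>n. char (distr (Q n) borel (X n)) t) \<longlonglongrightarrow>
        (of_real (C + 1) * char \<mu> t + of_real w * char \<mu> t) / of_real (C + 1 + w)"
        unfolding ch using w1 by (intro tendsto_intros lim1 limW elim) (auto simp: of_real_eq_0_iff simp del: of_real_add)
      moreover have "(of_real (C + 1) * char \<mu> t + of_real w * char \<mu> t) / of_real (C + 1 + w) = char \<mu> t"
      proof -
        have "of_real (C + 1 + w) \<noteq> (0 :: complex)" using w1 by (simp only: of_real_eq_0_iff)
        then show ?thesis by (simp add: field_simps)
      qed
      ultimately show ?thesis by simp
    qed
    have "weak_conv_m (\<lambda>n. distr (Q n) borel (X n)) \<mu>"
      by (rule levy_continuity[OF distr \<mu> chl])
    from weak_conv_imp_integral_bdd_continuous_conv[OF distr \<mu> this, of g B]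
    have "(\<lambda>n. \<integral>x. g x \<partial>distr (Q n) borel (X n)) \<longlonglongrightarrow> (\<integral>x. g x \<partial>\<mu>)" using g by simp
    moreover have "(\<integral>x. g x \<partial>distr (Q n) borel (X n)) = (\<integral>y. (C + 1 + W n y) * g (X n y) \<partial>M) / e n" for n
    proof -
      have "(\<integral>x. g x \<partial>distr (Q n) borel (X n)) = (\<integral>y. g (X n y) \<partial>Q n)"
        by (subst integral_distr) auto
      also have "\<dots> = (\<integral>y. ((C + 1 + W n y) / e n) *\<^sub>R g (X n y) \<partial>M)"
        unfolding Q_def using pos by (subst integral_density) auto
      also have "\<dots> = (\<integral>y. (C + 1 + W n y) * g (X n y) \<partial>M) / e n" by simp
      finally show ?thesis .
    qed
    ultimately have "(\<lambda>n. e n * ((\<integral>y. (C + 1 + W n y) * g (X n y) \<partial>M) / e n)) \<longlonglongrightarrow> (C + 1 + w) * (\<integral>x. g x \<partial>\<mu>)"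
      by (intro tendsto_mult elim) simp
    moreover have "e n * ((\<integral>y. (C + 1 + W n y) * g (X n y) \<partial>M) / e n) = (\<integral>y. (C + 1 + W n y) * g (X n y) \<partial>M)" for n
      using e1[of n] by simp
    ultimately show ?thesis by simp
  qed
  have intg: "integrable M (\<lambda>y. g (X n y))" for n
    by (rule integrable_bounded_real[where C = B]) (use g in auto)
  have B0: "0 \<le> B" using g(2)[of 0] by linarith
  have intZg: "integrable M (\<lambda>y. Z n y * g (X n y))" for n
    by (rule integrable_bounded_real[where C = "C * B"]) (use C g C0 B0 in \<open>auto simp: abs_mult intro!: mult_mono\<close>)
  have "(\<lambda>n. (\<integral>y. (C + 1 + Z n y) * g (X n y) \<partial>M) - (\<integral>y. (C + 1 + 0) * g (X n y) \<partial>M))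
      \<longlonglongrightarrow> (C + 1 + z) * (\<integral>x. g x \<partial>\<mu>) - (C + 1 + 0) * (\<integral>x. g x \<partial>\<mu>)"
    by (intro tendsto_diff key Z C limZ) (use C0 in auto)
  moreover have "(\<integral>y. (C + 1 + Z n y) * g (X n y) \<partial>M) - (\<integral>y. (C + 1 + 0) * g (X n y) \<partial>M)
      = (\<integral>y. Z n y * g (X n y) \<partial>M)" for n
    using intg intZg by (simp add: distrib_right flip: Bochner_Integration.integral_diff)
  ultimately show ?thesis by (simp add: algebra_simps)
qed

lemma Re_Im_mult_cnj:
  fixes w c :: complex
  shows "(w * c + cnj w * c) / 2 = of_real (Re w) * c"
    and "(w * c - cnj w * c) / (2 * \<i>) = of_real (Im w) * c"
  by (simp_all add: complex_eq_iff complex_add_cnj complex_diff_cnj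
      flip: distrib_right left_diff_distrib)

text \<open>Real and imaginary parts of the weight are handled separately. They are combinations of
  the weight and its conjugate, hence the second weighted hypothesis \<open>limZ'\<close>.\<close>

lemma (in prob_space) weighted_levy_continuity_complex:
  fixes X :: "nat \<Rightarrow> 'a \<Rightarrow> real" and Z :: "nat \<Rightarrow> 'a \<Rightarrow> complex" and g :: "real \<Rightarrow> real"
  assumes \<mu>: "real_distribution \<mu>"
    and X[measurable]: "\<And>n. X n \<in> borel_measurable M"
    and Z[measurable]: "\<And>n. Z n \<in> borel_measurable M"
    and C: "\<And>n y. norm (Z n y) \<le> C"
    and lim1: "\<And>t. (\<lambda>n. \<integral>y. iexp (t * X n y) \<partial>M) \<longlonglongrightarrow> char \<mu> t"
    and limZ: "\<And>t. (\<lambda>n. \<integral>y. Z n y * iexp (t * X n y) \<partial>M) \<longlonglongrightarrow> z * char \<mu> t"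
    and limZ': "\<And>t. (\<lambda>n. \<integral>y. cnj (Z n y) * iexp (t * X n y) \<partial>M) \<longlonglongrightarrow> z' * char \<mu> t"
    and g: "\<And>x. isCont g x" "\<And>x. \<bar>g x\<bar> \<le> B"
  shows "(\<lambda>n. \<integral>y. Z n y * g (X n y) \<partial>M) \<longlonglongrightarrow> z * of_real (\<integral>x. g x \<partial>\<mu>)"
proof -
  interpret \<mu>: real_distribution \<mu> by fact
  have gm[measurable]: "g \<in> borel_measurable borel" using g(1) by (rule isCont_imp_borel_measurable)
  have cnj[measurable]: "cnj \<in> borel_measurable borel"
    by (intro borel_measurable_continuous_onI continuous_intros)
  have C0: "0 \<le> C" using C[of 0 undefined] norm_ge_zero order_trans by blast
  have B0: "0 \<le> B" using g(2)[of 0] by linarith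
  \<comment> \<open>Both limits are compared at frequency 0, where the conjugate weight integrates
    to the conjugate mean.\<close>
  have z': "z' = cnj z"
  proof -
    have "(\<lambda>n. cnj (\<integral>y. Z n y \<partial>M)) \<longlonglongrightarrow> cnj z"
      using limZ[of 0] by (intro tendsto_cnj) (simp add: \<mu>.char_zero)
    moreover have "(\<lambda>n. cnj (\<integral>y. Z n y \<partial>M)) \<longlonglongrightarrow> z'"
      using limZ'[of 0] by (simp add: \<mu>.char_zero)
    ultimately show ?thesis using LIMSEQ_unique by blast
  qed
  have int: "integrable M (\<lambda>y. Z n y * iexp (t * X n y))" "integrable M (\<lambda>y. cnj (Z n y) * iexp (t * X n y))" for n t
    by (rule integrable_bounded_complex[where C = C]; use C in \<open>auto simp: norm_mult\<close>)+
  have re: "(\<lambda>n. \<integral>y. Re (Z n y) * g (X n y) \<partial>M) \<longlonglongrightarrow> Re z * (\<integral>x. g x \<partial>\<mu>)"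
  proof (rule weighted_levy_continuity[OF \<mu> X _ _ lim1 _ g])
    fix t
    have "(\<lambda>n. ((\<integral>y. Z n y * iexp (t * X n y) \<partial>M) + (\<integral>y. cnj (Z n y) * iexp (t * X n y) \<partial>M)) / 2)
      \<longlonglongrightarrow> (z * char \<mu> t + z' * char \<mu> t) / 2" by (intro tendsto_intros limZ limZ') auto
    moreover have "(z * char \<mu> t + z' * char \<mu> t) / 2 = of_real (Re z) * char \<mu> t"
      unfolding z' by (rule Re_Im_mult_cnj)
    moreover have "((\<integral>y. Z n y * iexp (t * X n y) \<partial>M) + (\<integral>y. cnj (Z n y) * iexp (t * X n y) \<partial>M)) / 2
      = (\<integral>y. of_real (Re (Z n y)) * iexp (t * X n y) \<partial>M)" for n
    proof -
      have "(\<integral>y. of_real (Re (Z n y)) * iexp (t * X n y) \<partial>M)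
        = (\<integral>y. (Z n y * iexp (t * X n y) + cnj (Z n y) * iexp (t * X n y)) / 2 \<partial>M)"
        unfolding Re_Im_mult_cnj ..
      then show ?thesis using int by simp
    qed
    ultimately show "(\<lambda>n. \<integral>y. of_real (Re (Z n y)) * iexp (t * X n y) \<partial>M) \<longlonglongrightarrow> of_real (Re z) * char \<mu> t"
      by simp
  qed (use C abs_Re_le_cmod order_trans in \<open>auto, blast\<close>)
  have im: "(\<lambda>n. \<integral>y. Im (Z n y) * g (X n y) \<partial>M) \<longlonglongrightarrow> Im z * (\<integral>x. g x \<partial>\<mu>)"
  proof (rule weighted_levy_continuity[OF \<mu> X _ _ lim1 _ g])
    fix t
    have "(\<lambda>n. ((\<integral>y. Z n y * iexp (t * X n y) \<partial>M) - (\<integral>y. cnj (Z n y) * iexp (t * X n y) \<partial>M)) / (2 * \<i>))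
      \<longlonglongrightarrow> (z * char \<mu> t - z' * char \<mu> t) / (2 * \<i>)" by (intro tendsto_intros limZ limZ') auto
    moreover have "(z * char \<mu> t - z' * char \<mu> t) / (2 * \<i>) = of_real (Im z) * char \<mu> t"
      unfolding z' by (rule Re_Im_mult_cnj)
    moreover have "((\<integral>y. Z n y * iexp (t * X n y) \<partial>M) - (\<integral>y. cnj (Z n y) * iexp (t * X n y) \<partial>M)) / (2 * \<i>)
      = (\<integral>y. of_real (Im (Z n y)) * iexp (t * X n y) \<partial>M)" for n
    proof -
      have "(\<integral>y. of_real (Im (Z n y)) * iexp (t * X n y) \<partial>M)
        = (\<integral>y. (Z n y * iexp (t * X n y) - cnj (Z n y) * iexp (t * X n y)) / (2 * \<i>) \<partial>M)"
        unfolding Re_Im_mult_cnj ..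
      then show ?thesis using int by simp
    qed
    ultimately show "(\<lambda>n. \<integral>y. of_real (Im (Z n y)) * iexp (t * X n y) \<partial>M) \<longlonglongrightarrow> of_real (Im z) * char \<mu> t"
      by simp
  qed (use C abs_Im_le_cmod order_trans in \<open>auto, blast\<close>)
  have intg: "integrable M (\<lambda>y. Z n y * g (X n y))" for n
    by (rule integrable_bounded_complex[where C = "C * B"])
       (use C g B0 C0 in \<open>auto simp: norm_mult intro!: mult_mono\<close>)
  have "Re (\<integral>y. Z n y * g (X n y) \<partial>M) = (\<integral>y. Re (Z n y) * g (X n y) \<partial>M)"
    "Im (\<integral>y. Z n y * g (X n y) \<partial>M) = (\<integral>y. Im (Z n y) * g (X n y) \<partial>M)" for n
    using intg[of n] by (simp_all flip: integral_Re integral_Im)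
  with re im show ?thesis by (intro tendsto_complex_iff[THEN iffD2]) simp
qed

text \<open>Induction over the number \<open>j\<close> of exponentials already exchanged for test
  functions. The functions exchanged so far and the exponentials of the remaining indices form one
  bounded complex weight; the frequency at index \<open>j\<close> is free in the induction
  hypothesis, which is exactly the weighted convergence that Levy continuity in the
  \<open>j\<close>-th variable asks for.\<close>

lemma (in prob_space) joint_char_imp_product:
  fixes X :: "nat \<Rightarrow> nat \<Rightarrow> 'a \<Rightarrow> real" and g :: "nat \<Rightarrow> real \<Rightarrow> real"
  assumes \<mu>: "\<And>i. real_distribution (\<mu> i)"
    and X[measurable]: "\<And>n i. X n i \<in> borel_measurable M"
    and lim: "\<And>\<theta>. (\<lambda>n. \<integral>y. iexp (\<Sum>i<k. \<theta> i * X n i y) \<partial>M) \<longlonglongrightarrow> (\<Prod>i<k. char (\<mu> i) (\<theta> i))"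
    and g: "\<And>i x. isCont (g i) x" "\<And>i x. \<bar>g i x\<bar> \<le> B"
  shows "(\<lambda>n. \<integral>y. (\<Prod>i<k. g i (X n i y)) \<partial>M) \<longlonglongrightarrow> (\<Prod>i<k. \<integral>x. g i x \<partial>\<mu> i)"
proof -
  have gm[measurable]: "g i \<in> borel_measurable borel" for i using g(1) by (rule isCont_imp_borel_measurable)
  have "(\<lambda>n. \<integral>y. of_real (\<Prod>i<j. g i (X n i y)) * iexp (\<Sum>i\<in>{j..<k}. \<theta> i * X n i y) \<partial>M)
     \<longlonglongrightarrow> of_real (\<Prod>i<j. \<integral>x. g i x \<partial>\<mu> i) * (\<Prod>i\<in>{j..<k}. char (\<mu> i) (\<theta> i))" if "j \<le> k" for j \<theta>
    using that
  proof (induction j arbitrary: \<theta>)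
    case 0
    then show ?case using lim by (simp add: atLeast0LessThan)
  next
    case (Suc j)
    then have jk: "j < k" by simp
    define Z where "Z n y = complex_of_real (\<Prod>i<j. g i (X n i y)) * iexp (\<Sum>i\<in>{Suc j..<k}. \<theta> i * X n i y)" for n y
    have s: "(\<Sum>i\<in>{j..<k}. (\<phi>(j := t)) i * X n i y) = t * X n j y + (\<Sum>i\<in>{Suc j..<k}. \<phi> i * X n i y)" for \<phi> t n y
      using jk by (simp add: sum.atLeast_Suc_lessThan)
    have p: "(\<Prod>i\<in>{j..<k}. char (\<mu> i) ((\<phi>(j := t)) i)) = char (\<mu> j) t * (\<Prod>i\<in>{Suc j..<k}. char (\<mu> i) (\<phi> i))" for \<phi> t
      using jk by (simp add: prod.atLeast_Suc_lessThan)
    have "(\<lambda>n. \<integral>y. Z n y * of_real (g j (X n j y)) \<partial>M) \<longlonglongrightarrow>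
      (of_real (\<Prod>i<j. \<integral>x. g i x \<partial>\<mu> i) * (\<Prod>i\<in>{Suc j..<k}. char (\<mu> i) (\<theta> i))) * of_real (\<integral>x. g j x \<partial>\<mu> j)"
    proof (rule weighted_levy_continuity_complex[where C = "B ^ j", OF \<mu>[of j]])
      show "Z n \<in> borel_measurable M" for n unfolding Z_def by measurable
      show "cmod (Z n y) \<le> B ^ j" for n y
      proof -
        have "\<bar>\<Prod>i<j. g i (X n i y)\<bar> \<le> (\<Prod>i<j. B)" unfolding abs_prod using g by (intro prod_mono) auto
        then show ?thesis by (simp add: Z_def norm_mult flip: of_real_prod)
      qed
      \<comment> \<open>All other frequencies are set to 0, where their characteristic functions are
        1.\<close>
      show "(\<lambda>n. \<integral>y. iexp (t * X n j y) \<partial>M) \<longlonglongrightarrow> char (\<mu> j) t" for t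
      proof -
        have "(\<Sum>i<k. ((\<lambda>_. 0)(j := t)) i * X n i y) = t * X n j y" for n y
          using jk by (subst sum.remove[of _ j]) (auto intro!: sum.neutral)
        moreover have "(\<Prod>i<k. char (\<mu> i) (((\<lambda>_. 0)(j := t)) i)) = char (\<mu> j) t"
          using jk real_distribution.char_zero[OF \<mu>]
          by (subst prod.remove[of _ j]) (auto intro!: prod.neutral)
        ultimately show ?thesis using lim[of "(\<lambda>_. 0)(j := t)"] by simp
      qed
      show "(\<lambda>n. \<integral>y. Z n y * iexp (t * X n j y) \<partial>M) \<longlonglongrightarrow>
        (of_real (\<Prod>i<j. \<integral>x. g i x \<partial>\<mu> i) * (\<Prod>i\<in>{Suc j..<k}. char (\<mu> i) (\<theta> i))) * char (\<mu> j) t" for t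
      proof -
        have "(\<lambda>n. \<integral>y. of_real (\<Prod>i<j. g i (X n i y)) * iexp (\<Sum>i\<in>{j..<k}. (\<theta>(j := t)) i * X n i y) \<partial>M)
          \<longlonglongrightarrow> of_real (\<Prod>i<j. \<integral>x. g i x \<partial>\<mu> i) * (\<Prod>i\<in>{j..<k}. char (\<mu> i) ((\<theta>(j := t)) i))"
          using Suc.IH jk by simp
        then show ?thesis unfolding s p Z_def by (simp add: distrib_left exp_add mult_ac)
      qed
      \<comment> \<open>Conjugation keeps the real factors and reverses the remaining frequencies,
        so the induction hypothesis is used at \<open>- \<theta> i\<close>.\<close>
      show "(\<lambda>n. \<integral>y. cnj (Z n y) * iexp (t * X n j y) \<partial>M) \<longlonglongrightarrow>
        (of_real (\<Prod>i<j. \<integral>x. g i x \<partial>\<mu> i) * (\<Prod>i\<in>{Suc j..<k}. char (\<mu> i) (- \<theta> i))) * char (\<mu> j) t" for t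
      proof -
        have "(\<lambda>n. \<integral>y. of_real (\<Prod>i<j. g i (X n i y)) * iexp (\<Sum>i\<in>{j..<k}. ((\<lambda>i. - \<theta> i)(j := t)) i * X n i y) \<partial>M)
          \<longlonglongrightarrow> of_real (\<Prod>i<j. \<integral>x. g i x \<partial>\<mu> i) * (\<Prod>i\<in>{j..<k}. char (\<mu> i) (((\<lambda>i. - \<theta> i)(j := t)) i))"
          using Suc.IH jk by simp
        moreover have "cnj (Z n y) = of_real (\<Prod>i<j. g i (X n i y)) * iexp (\<Sum>i\<in>{Suc j..<k}. - \<theta> i * X n i y)" for n y
          by (simp add: Z_def exp_cnj sum_negf)
        ultimately show ?thesis unfolding s p by (simp add: distrib_left exp_add mult_ac)
      qed
    qed (use g in auto)
    then show ?case by (simp add: Z_def mult_ac)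
  qed
  from this[of k] have "(\<lambda>n. \<integral>y. complex_of_real (\<Prod>i<k. g i (X n i y)) \<partial>M) \<longlonglongrightarrow> of_real (\<Prod>i<k. \<integral>x. g i x \<partial>\<mu> i)"
    by simp
  then show ?thesis unfolding integral_complex_of_real tendsto_of_real_iff .
qed


lemma (in prob_space) joint_char_imp_product_eq:
  fixes X :: "nat \<Rightarrow> 'a \<Rightarrow> real" and g :: "nat \<Rightarrow> real \<Rightarrow> real"
  assumes "\<And>i. real_distribution (\<mu> i)" "\<And>i. X i \<in> borel_measurable M"
    and "\<And>\<theta>. (\<integral>y. iexp (\<Sum>i<k. \<theta> i * X i y) \<partial>M) = (\<Prod>i<k. char (\<mu> i) (\<theta> i))"
    and "\<And>i x. isCont (g i) x" "\<And>i x. \<bar>g i x\<bar> \<le> B"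
  shows "(\<integral>y. (\<Prod>i<k. g i (X i y)) \<partial>M) = (\<Prod>i<k. \<integral>x. g i x \<partial>\<mu> i)"
proof (rule LIMSEQ_unique)
  show "(\<lambda>_ :: nat. \<integral>y. (\<Prod>i<k. g i (X i y)) \<partial>M) \<longlonglongrightarrow> (\<Prod>i<k. \<integral>x. g i x \<partial>\<mu> i)"
    by (rule joint_char_imp_product[OF assms(1,2) _ assms(4,5)]) (simp only: assms(3) tendsto_const)
qed simp

text \<open>Closed sets generate the Borel sets and are stable under intersection, so it is enough
  to factor their probabilities. Their indicators are limits of the continuous functions
  \<open>max 0 (1 - m * infdist x S)\<close>, to which the product formula applies.\<close>

lemma (in prob_space) joint_char_imp_indep_vars:
  fixes X :: "nat \<Rightarrow> 'a \<Rightarrow> real"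
  assumes X[measurable]: "\<And>i. X i \<in> borel_measurable M"
    and ch: "\<And>\<theta>. (\<integral>y. iexp (\<Sum>i<k. \<theta> i * X i y) \<partial>M) = (\<Prod>i<k. char (distr M borel (X i)) (\<theta> i))"
  shows "indep_vars (\<lambda>_. borel) X {..<k}"
proof (cases "k = 0")
  case True
  then show ?thesis by (auto simp: indep_vars_def2 indep_sets_def)
next
  case False
  have rd: "real_distribution (distr M borel (X i))" for i
    by (rule real_distribution_distr) simp
  have "prob (\<Inter>j\<in>{..<k}. X j -` A j \<inter> space M) = (\<Prod>j<k. prob (X j -` A j \<inter> space M))"
    if A: "\<And>j. j < k \<Longrightarrow> closed (A j)" for A
  proof -
    \<comment> \<open>The product formula quantifies over all indices, so the family is extended by
      empty sets beyond \<open>k\<close>.\<close>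
    define S where "S j = (if j < k then A j else {})" for j
    have S: "closed (S j)" for j using A by (simp add: S_def)
    then have Sm[measurable]: "S j \<in> sets borel" for j by (rule borel_closed)
    \<comment> \<open>\<open>infdist\<close> to the empty set is 0 by convention, which would give
      the constant 1 instead of 0.\<close>
    define g :: "nat \<Rightarrow> nat \<Rightarrow> real \<Rightarrow> real"
      where "g m j x = (if S j = {} then 0 else max 0 (1 - real m * infdist x (S j)))" for m j x
    have gc: "isCont (g m j) x" for m j x
      unfolding g_def by (cases "S j = {}") (auto intro!: continuous_intros)
    have gb: "\<bar>g m j x\<bar> \<le> 1" for m j x
      by (auto simp: g_def infdist_nonneg)
    have gm[measurable]: "g m j \<in> borel_measurable borel" for m j
      using gc by (rule isCont_imp_borel_measurable)
    have gl: "(\<lambda>m. g m j x) \<longlonglongrightarrow> indicator (S j) x" for j x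
    proof (cases "x \<in> S j")
      case True
      then have "g m j x = 1" for m by (auto simp: g_def)
      then show ?thesis using True by simp
    next
      case False
      show ?thesis
      proof (cases "S j = {}")
        case True
        then show ?thesis by (simp add: g_def)
      next
        case ne: False
        then have pos: "infdist x (S j) > 0"
          using False S[of j] in_closed_iff_infdist_zero[of "S j" x] infdist_nonneg[of x "S j"] by force
        then obtain m0 where m0: "real m0 * infdist x (S j) > 1" using ex_less_of_nat_mult by blast
        have "g m j x = 0" if "m \<ge> m0" for m
        proof -
          have "real m0 * infdist x (S j) \<le> real m * infdist x (S j)"
            using that pos by (intro mult_right_mono) auto
          then show ?thesis using m0 by (auto simp: g_def max_def)
        qed
        then have "\<forall>\<^sub>F m in sequentially. g m j x = 0" using eventually_sequentially by blast
        then show ?thesis using False by (simp add: tendsto_eventually)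
      qed
    qed
    have eq: "(\<integral>y. (\<Prod>i<k. g m i (X i y)) \<partial>M) = (\<Prod>i<k. \<integral>x. g m i x \<partial>distr M borel (X i))" for m
      by (rule joint_char_imp_product_eq[OF rd X ch gc gb])
    have l1: "(\<lambda>m. \<integral>y. (\<Prod>i<k. g m i (X i y)) \<partial>M) \<longlonglongrightarrow> (\<integral>y. (\<Prod>i<k. indicator (S i) (X i y)) \<partial>M)"
    proof (rule integral_dominated_convergence[where w = "\<lambda>_. 1"])
      have "norm (\<Prod>i<k. g m i (X i y)) \<le> 1" for m y
        unfolding real_norm_def abs_prod by (rule prod_le_1) (use gb in auto)
      then show "AE y in M. norm (\<Prod>i<k. g m i (X i y)) \<le> 1" for m by simp
    qed (auto intro!: tendsto_prod gl)
    have l2: "(\<lambda>m. \<Prod>i<k. \<integral>x. g m i x \<partial>distr M borel (X i)) \<longlonglongrightarrow> (\<Prod>i<k. \<integral>x. indicator (S i) x \<partial>distr M borel (X i))"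
    proof (intro tendsto_prod integral_dominated_convergence[where w = "\<lambda>_. 1"])
      fix i
      interpret D: real_distribution "distr M borel (X i)" by (rule rd)
      show "integrable (distr M borel (X i)) (\<lambda>_. 1 :: real)" by simp
    qed (auto intro!: gl gb)
    have "(\<integral>y. (\<Prod>i<k. indicator (S i) (X i y)) \<partial>M) = (\<Prod>i<k. \<integral>x. indicat_real (S i) x \<partial>distr M borel (X i))"
      using l1 l2 unfolding eq by (rule LIMSEQ_unique)
    moreover have "(\<integral>y. (\<Prod>i<k. indicat_real (S i) (X i y)) \<partial>M) = prob (\<Inter>j\<in>{..<k}. X j -` A j \<inter> space M)"
    proof -
      have "(\<Prod>i<k. indicat_real (S i) (X i y)) = indicator (\<Inter>j\<in>{..<k}. X j -` A j \<inter> space M) y" if "y \<in> space M" for y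
        using that by (auto simp: indicator_def S_def prod_zero_iff split: if_splits)
      then have "(\<integral>y. (\<Prod>i<k. indicat_real (S i) (X i y)) \<partial>M) = (\<integral>y. indicat_real (\<Inter>j\<in>{..<k}. X j -` A j \<inter> space M) y \<partial>M)"
        by (intro Bochner_Integration.integral_cong) auto
      also have "\<dots> = prob ((\<Inter>j\<in>{..<k}. X j -` A j \<inter> space M) \<inter> space M)"
        by simp
      also have "(\<Inter>j\<in>{..<k}. X j -` A j \<inter> space M) \<inter> space M = (\<Inter>j\<in>{..<k}. X j -` A j \<inter> space M)"
        using False by auto
      finally show ?thesis .
    qed
    moreover have "(\<integral>x. indicat_real (S i) x \<partial>distr M borel (X i)) = prob (X i -` A i \<inter> space M)" if "i < k" for i
    proof -
      have "(\<integral>x. indicat_real (S i) x \<partial>distr M borel (X i)) = measure (distr M borel (X i)) (S i)"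
        by simp
      also have "\<dots> = prob (X i -` A i \<inter> space M)"
        using that Sm[of i] by (subst measure_distr) (auto simp: S_def)
      finally show ?thesis .
    qed
    ultimately show ?thesis by simp
  qed
  moreover have "sets borel = sigma_sets (space borel) {S. closed (S :: real set)}"
    by (simp add: borel_eq_closed)
  ultimately show ?thesis
    using False by (subst indep_vars_finite[where E = "\<lambda>_. {S. closed S}"]) (auto simp: Int_stable_def Pi_iff)
qed

section \<open>Tents and multilinear interpolation\<close>

definition ramp :: "real \<Rightarrow> real" where "ramp u = min 1 (max 0 u)"

text \<open>For positive \<open>\<delta>\<close>, the hat of height 1 and half-width
  \<open>\<delta>\<close> centred at \<open>\<delta> * (j - Q)\<close>; as a difference of two
  shifted ramps it telescopes when summed over \<open>j\<close>.\<close>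

definition tent :: "real \<Rightarrow> nat \<Rightarrow> nat \<Rightarrow> real \<Rightarrow> real" where
  "tent \<delta> Q j u = ramp (u / \<delta> + real Q - real j + 1) - ramp (u / \<delta> + real Q - real j)"

lemma tent_nonneg: "0 \<le> tent \<delta> Q j u" and tent_le_1: "tent \<delta> Q j u \<le> 1"
  by (auto simp: tent_def ramp_def)

lemma isCont_tent: "isCont (tent \<delta> Q j) u"
  unfolding tent_def ramp_def by (cases "\<delta> = 0") (auto intro!: continuous_intros)

lemma tent_support: "\<delta> > 0 \<Longrightarrow> tent \<delta> Q j u \<noteq> 0 \<Longrightarrow> \<bar>u - \<delta> * (real j - real Q)\<bar> \<le> \<delta>"
proof (rule ccontr)
  assume d: "\<delta> > 0" and t: "tent \<delta> Q j u \<noteq> 0" and "\<not> \<bar>u - \<delta> * (real j - real Q)\<bar> \<le> \<delta>"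
  then have "\<bar>(u - \<delta> * (real j - real Q)) / \<delta>\<bar> > 1" by simp
  moreover have "(u - \<delta> * (real j - real Q)) / \<delta> = u / \<delta> + real Q - real j" using d by (simp add: field_simps)
  ultimately have "tent \<delta> Q j u = 0" by (auto simp: tent_def ramp_def)
  with t show False by simp
qed

lemma sum_tent: "(\<Sum>j<2 * Q + 1. tent \<delta> Q j u) = ramp (u / \<delta> + real Q + 1) - ramp (u / \<delta> - real Q)"
proof -
  have "(\<Sum>j<2 * Q + 1. tent \<delta> Q j u) = (\<Sum>j<2 * Q + 1. ramp (u / \<delta> + real Q - real j + 1) - ramp (u / \<delta> + real Q - real (Suc j) + 1))"
    by (simp add: tent_def algebra_simps)
  also have "\<dots> = ramp (u / \<delta> + real Q - real 0 + 1) - ramp (u / \<delta> + real Q - real (2 * Q + 1) + 1)"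
    by (rule sum_lessThan_telescope')
  finally show ?thesis by (simp add: algebra_simps)
qed

lemma sum_tent_bounds: "0 \<le> (\<Sum>j<2 * Q + 1. tent \<delta> Q j u)" "(\<Sum>j<2 * Q + 1. tent \<delta> Q j u) \<le> 1"
  unfolding sum_tent by (auto simp: ramp_def)

lemma sum_tent_tendsto: "(\<lambda>Q. \<Sum>j<2 * Q + 1. tent \<delta> Q j u) \<longlonglongrightarrow> 1"
proof -
  obtain m :: nat where m: "\<bar>u / \<delta>\<bar> \<le> real m" using real_arch_simple by blast
  have "(\<Sum>j<2 * Q + 1. tent \<delta> Q j u) = 1" if "Q \<ge> m" for Q
  proof -
    have "\<bar>u / \<delta>\<bar> \<le> real Q" using m that by linarith
    then have "u / \<delta> \<le> real Q" "- real Q \<le> u / \<delta>" by linarith+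
    then show ?thesis unfolding sum_tent by (auto simp: ramp_def)
  qed
  then show ?thesis by (intro tendsto_eventually) (auto simp: eventually_sequentially)
qed

text \<open>The multilinear interpolant of \<open>F\<close> on a cubic grid of mesh
  \<open>\<delta>\<close> with \<open>2 * Q + 1\<close> nodes per coordinate, falling off to 0
  outside the cube. Members of \<open>PiE\<close> are undefined beyond \<open>k\<close>, which is
  harmless for an \<open>F\<close> that is Lipschitz in its first \<open>k\<close>
  coordinates.\<close>

definition tent_interpolation :: "real \<Rightarrow> nat \<Rightarrow> nat \<Rightarrow> ((nat \<Rightarrow> real) \<Rightarrow> real) \<Rightarrow> (nat \<Rightarrow> real) \<Rightarrow> real" where
  "tent_interpolation \<delta> Q k F x = (\<Sum>a\<in>PiE {..<k} (\<lambda>_. {..<2 * Q + 1}).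
     F (\<lambda>i. \<delta> * (real (a i) - real Q)) * (\<Prod>i<k. tent \<delta> Q (a i) (x i)))"

text \<open>The products of tents sum to some \<kappa> in [0,1]. The share \<kappa> of
  \<open>F x\<close> is compared with nodes within \<open>\<delta>\<close> of \<open>x\<close> in
  every coordinate; the missing share 1 - \<kappa> is bounded through \<open>B\<close>.\<close>

lemma tent_interpolation_error:
  assumes d: "\<delta> > 0" and B: "\<And>x. \<bar>F x\<bar> \<le> B" and L: "0 \<le> L"
    and F: "\<And>x y. \<bar>F x - F y\<bar> \<le> L * (\<Sum>i<k. \<bar>x i - y i\<bar>)"
  shows "\<bar>F x - tent_interpolation \<delta> Q k F x\<bar> \<le> L * real k * \<delta> + B * (1 - (\<Prod>i<k. \<Sum>j<2 * Q + 1. tent \<delta> Q j (x i)))"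
proof -
  let ?P = "PiE {..<k} (\<lambda>_. {..<2 * Q + 1})"
  let ?c = "\<lambda>a i. \<delta> * (real (a i) - real Q)"
  define \<kappa> where "\<kappa> = (\<Prod>i<k. \<Sum>j<2 * Q + 1. tent \<delta> Q j (x i))"
  have \<kappa>: "\<kappa> = (\<Sum>a\<in>?P. \<Prod>i<k. tent \<delta> Q (a i) (x i))"
    unfolding \<kappa>_def by (rule prod_sum_PiE) auto
  have \<kappa>01: "0 \<le> \<kappa>" "\<kappa> \<le> 1"
    unfolding \<kappa>_def using sum_tent_bounds by (auto intro!: prod_nonneg prod_le_1)
  have "F x - tent_interpolation \<delta> Q k F x = F x * (1 - \<kappa>) + (\<Sum>a\<in>?P. (F x - F (?c a)) * (\<Prod>i<k. tent \<delta> Q (a i) (x i)))"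
    by (simp add: tent_interpolation_def \<kappa> algebra_simps sum_subtractf sum_distrib_left)
  moreover have "\<bar>F x * (1 - \<kappa>)\<bar> \<le> B * (1 - \<kappa>)"
    using B[of x] \<kappa>01 by (auto simp: abs_mult intro!: mult_right_mono)
  moreover have "\<bar>\<Sum>a\<in>?P. (F x - F (?c a)) * (\<Prod>i<k. tent \<delta> Q (a i) (x i))\<bar> \<le> L * real k * \<delta>"
  proof -
    have "\<bar>(F x - F (?c a)) * (\<Prod>i<k. tent \<delta> Q (a i) (x i))\<bar> \<le> L * real k * \<delta> * (\<Prod>i<k. tent \<delta> Q (a i) (x i))" for a
    proof (cases "(\<Prod>i<k. tent \<delta> Q (a i) (x i)) = 0")
      case False
      then have "\<bar>x i - ?c a i\<bar> \<le> \<delta>" if "i < k" for i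
        using tent_support[OF d] that by auto
      then have "(\<Sum>i<k. \<bar>x i - ?c a i\<bar>) \<le> real k * \<delta>"
        using sum_bounded_above[of "{..<k}" "\<lambda>i. \<bar>x i - ?c a i\<bar>" \<delta>] by simp
      then have "\<bar>F x - F (?c a)\<bar> \<le> L * (real k * \<delta>)"
        using F[of x "?c a"] L by (meson mult_left_mono order_trans)
      moreover have "0 \<le> (\<Prod>i<k. tent \<delta> Q (a i) (x i))" by (intro prod_nonneg) (simp add: tent_nonneg)
      ultimately show ?thesis
        using mult_right_mono[of "\<bar>F x - F (?c a)\<bar>" "L * (real k * \<delta>)" "\<Prod>i<k. tent \<delta> Q (a i) (x i)"]
        by (simp only: abs_mult abs_of_nonneg mult.assoc)
    next
      case True
      then show ?thesis unfolding True by simp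
    qed
    then have "\<bar>\<Sum>a\<in>?P. (F x - F (?c a)) * (\<Prod>i<k. tent \<delta> Q (a i) (x i))\<bar>
      \<le> (\<Sum>a\<in>?P. L * real k * \<delta> * (\<Prod>i<k. tent \<delta> Q (a i) (x i)))"
      by (intro order_trans[OF sum_abs] sum_mono)
    also have "\<dots> = L * real k * \<delta> * \<kappa>" by (simp add: \<kappa> sum_distrib_left)
    also have "\<dots> \<le> L * real k * \<delta>"
      using \<kappa>01 L d by (intro mult_left_le) auto
    finally show ?thesis .
  qed
  ultimately show ?thesis unfolding \<kappa>_def[symmetric] by linarith
qed

text \<open>The missing mass is again the mean of a product of one-dimensional continuous functions,
  so its limit is governed by the same characteristic functions as that of the interpolant.\<close>

lemma (in prob_space)
  fixes V :: "nat \<Rightarrow> 'a \<Rightarrow> real"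
  assumes V[measurable]: "\<And>i. V i \<in> borel_measurable M"
  shows tent_interpolation_integral: "(\<integral>y. tent_interpolation \<delta> Q k F (\<lambda>i. V i y) \<partial>M) =
      (\<Sum>a\<in>PiE {..<k} (\<lambda>_. {..<2 * Q + 1}). F (\<lambda>i. \<delta> * (real (a i) - real Q)) *
        (\<integral>y. (\<Prod>i<k. tent \<delta> Q (a i) (V i y)) \<partial>M))" (is ?I)
    and tent_interpolation_integral_error: "\<delta> > 0 \<Longrightarrow> (\<And>x. \<bar>F x\<bar> \<le> B) \<Longrightarrow> 0 \<le> L \<Longrightarrow>
      (\<And>x y. \<bar>F x - F y\<bar> \<le> L * (\<Sum>i<k. \<bar>x i - y i\<bar>)) \<Longrightarrow> (\<lambda>y. F (\<lambda>i. V i y)) \<in> borel_measurable M \<Longrightarrow>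
      \<bar>(\<integral>y. F (\<lambda>i. V i y) \<partial>M) - (\<integral>y. tent_interpolation \<delta> Q k F (\<lambda>i. V i y) \<partial>M)\<bar>
        \<le> L * real k * \<delta> + B * (1 - (\<integral>y. (\<Prod>i<k. \<Sum>j<2 * Q + 1. tent \<delta> Q j (V i y)) \<partial>M))"
proof -
  let ?G = "tent_interpolation \<delta> Q k F"
  let ?\<kappa> = "\<lambda>y. \<Prod>i<k. \<Sum>j<2 * Q + 1. tent \<delta> Q j (V i y)"
  have tentm[measurable]: "tent \<delta> Q j \<in> borel_measurable borel" for j
    by (rule isCont_imp_borel_measurable[OF isCont_tent])
  have i3: "integrable M (\<lambda>y. \<Prod>i<k. tent \<delta> Q (a i) (V i y))" for a
  proof (rule integrable_bounded_real[where C = 1])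
    show "\<bar>\<Prod>i<k. tent \<delta> Q (a i) (V i y)\<bar> \<le> 1" for y
      unfolding abs_prod using tent_nonneg tent_le_1 by (intro prod_le_1) (auto simp: abs_of_nonneg)
  qed auto
  have i2: "integrable M (\<lambda>y. ?G (\<lambda>i. V i y))"
    unfolding tent_interpolation_def by (intro Bochner_Integration.integrable_sum integrable_mult_right i3)
  have i4: "integrable M ?\<kappa>"
  proof (rule integrable_bounded_real[where C = 1])
    show "\<bar>?\<kappa> y\<bar> \<le> 1" for y
      unfolding abs_prod using sum_tent_bounds[where Q = Q and \<delta> = \<delta>] by (intro prod_le_1) (auto simp: abs_of_nonneg)
  qed auto
  show ?I unfolding tent_interpolation_def using i3 by (simp add: Bochner_Integration.integral_sum)
  assume d: "\<delta> > 0" and B: "\<And>x. \<bar>F x\<bar> \<le> B" and L: "0 \<le> L"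
    and F: "\<And>x y. \<bar>F x - F y\<bar> \<le> L * (\<Sum>i<k. \<bar>x i - y i\<bar>)"
    and [measurable]: "(\<lambda>y. F (\<lambda>i. V i y)) \<in> borel_measurable M"
  have i1: "integrable M (\<lambda>y. F (\<lambda>i. V i y))" by (rule integrable_bounded_real[where C = B]) (use B in auto)
  have "\<bar>(\<integral>y. F (\<lambda>i. V i y) \<partial>M) - (\<integral>y. ?G (\<lambda>i. V i y) \<partial>M)\<bar> = \<bar>\<integral>y. F (\<lambda>i. V i y) - ?G (\<lambda>i. V i y) \<partial>M\<bar>"
    using i1 i2 by simp
  also have "\<dots> \<le> (\<integral>y. \<bar>F (\<lambda>i. V i y) - ?G (\<lambda>i. V i y)\<bar> \<partial>M)" by (rule integral_abs_bound)
  also have "\<dots> \<le> (\<integral>y. L * real k * \<delta> + B * (1 - ?\<kappa> y) \<partial>M)"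
    using i1 i2 i4 tent_interpolation_error[where F = F and B = B and L = L and k = k, OF d B L F]
    by (intro integral_mono) auto
  also have "\<dots> = L * real k * \<delta> + B * (1 - (\<integral>y. ?\<kappa> y \<partial>M))"
    using i4 by (simp add: prob_space right_diff_distrib)
  finally show "\<bar>(\<integral>y. F (\<lambda>i. V i y) \<partial>M) - (\<integral>y. ?G (\<lambda>i. V i y) \<partial>M)\<bar> \<le> L * real k * \<delta> + B * (1 - (\<integral>y. ?\<kappa> y \<partial>M))" .
qed

text \<open>A tensor product of tents turns the Lipschitz test function into a finite combination of
  products of one-dimensional test functions.\<close>

lemma joint_char_imp_lipschitz:
  fixes X :: "nat \<Rightarrow> nat \<Rightarrow> 'a \<Rightarrow> real" and Y :: "nat \<Rightarrow> 'b \<Rightarrow> real" and F :: "(nat \<Rightarrow> real) \<Rightarrow> real"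
  assumes "prob_space M" "prob_space N"
    and \<mu>: "\<And>i. real_distribution (\<mu> i)"
    and X[measurable]: "\<And>n i. X n i \<in> borel_measurable M"
    and Y[measurable]: "\<And>i. Y i \<in> borel_measurable N"
    and limX: "\<And>\<theta>. (\<lambda>n. \<integral>y. iexp (\<Sum>i<k. \<theta> i * X n i y) \<partial>M) \<longlonglongrightarrow> (\<Prod>i<k. char (\<mu> i) (\<theta> i))"
    and chY: "\<And>\<theta>. (\<integral>y. iexp (\<Sum>i<k. \<theta> i * Y i y) \<partial>N) = (\<Prod>i<k. char (\<mu> i) (\<theta> i))"
    and FX[measurable]: "\<And>n. (\<lambda>y. F (\<lambda>i. X n i y)) \<in> borel_measurable M"
    and FY[measurable]: "(\<lambda>y. F (\<lambda>i. Y i y)) \<in> borel_measurable N"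
    and B: "\<And>x. \<bar>F x\<bar> \<le> B" and L: "0 \<le> L"
    and F: "\<And>x y. \<bar>F x - F y\<bar> \<le> L * (\<Sum>i<k. \<bar>x i - y i\<bar>)"
  shows "(\<lambda>n. \<integral>y. F (\<lambda>i. X n i y) \<partial>M) \<longlonglongrightarrow> (\<integral>y. F (\<lambda>i. Y i y) \<partial>N)"
proof (rule LIMSEQ_I)
  interpret M: prob_space M by fact
  interpret N: prob_space N by fact
  fix e :: real assume e: "e > 0"
  have B0: "0 \<le> B" using B[of undefined] by linarith
  define \<delta> where "\<delta> = e / (8 * (L * real k + 1))"
  have Lk: "0 \<le> L * real k" using L by simp
  then have d: "\<delta> > 0" using e by (auto simp: \<delta>_def)
  have Lkd: "L * real k * \<delta> \<le> e / 8"
  proof -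
    have "L * real k * \<delta> = (L * real k) / (L * real k + 1) * (e / 8)" by (simp add: \<delta>_def field_simps)
    also have "\<dots> \<le> 1 * (e / 8)" using Lk e by (intro mult_right_mono) auto
    finally show ?thesis by simp
  qed
  let ?\<tau> = "\<lambda>Q u. \<Sum>j<2 * Q + 1. tent \<delta> Q j u"
  have tentm[measurable]: "tent \<delta> Q j \<in> borel_measurable borel" for Q j
    by (rule isCont_imp_borel_measurable[OF isCont_tent])
  \<comment> \<open>\<open>Q\<close> is chosen from the limit laws alone; the mass missed under
    \<open>X n\<close> converges to the mass missed under them, so the same \<open>Q\<close> serves
    all large \<open>n\<close>. The budget is five errors of size \<open>e / 8\<close>: mesh and
    missing mass on either side, and the convergence of the interpolants.\<close>
  have "(\<lambda>Q. \<Prod>i<k. \<integral>x. ?\<tau> Q x \<partial>\<mu> i) \<longlonglongrightarrow> (\<Prod>i<k. \<integral>x. 1 \<partial>\<mu> i)"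
  proof (intro tendsto_prod integral_dominated_convergence[where w = "\<lambda>_. 1"])
    fix i
    interpret \<mu>: real_distribution "\<mu> i" by (rule \<mu>)
    show "integrable (\<mu> i) (\<lambda>_. 1 :: real)" by simp
    show "?\<tau> Q \<in> borel_measurable (\<mu> i)" for Q by measurable
    show "(\<lambda>_. 1 :: real) \<in> borel_measurable (\<mu> i)" by simp
    show "AE x in \<mu> i. (\<lambda>Q. ?\<tau> Q x) \<longlonglongrightarrow> 1" using sum_tent_tendsto by simp
    show "AE x in \<mu> i. norm (?\<tau> Q x) \<le> 1" for Q
      using sum_tent_bounds[where Q = Q and \<delta> = \<delta>] by simp
  qed
  moreover have "(\<integral>x. 1 \<partial>\<mu> i) = (1 :: real)" for i
  proof -
    interpret \<mu>: real_distribution "\<mu> i" by (rule \<mu>)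
    show ?thesis by (simp add: \<mu>.prob_space del: \<mu>.space_eq_univ)
  qed
  ultimately have "(\<lambda>Q. B * (1 - (\<Prod>i<k. \<integral>x. ?\<tau> Q x \<partial>\<mu> i))) \<longlonglongrightarrow> B * (1 - 1)"
    by (intro tendsto_intros) simp
  then have "\<forall>\<^sub>F Q in sequentially. B * (1 - (\<Prod>i<k. \<integral>x. ?\<tau> Q x \<partial>\<mu> i)) < e / 8"
    using e by (intro order_tendstoD) auto
  then obtain Q where Q: "B * (1 - (\<Prod>i<k. \<integral>x. ?\<tau> Q x \<partial>\<mu> i)) < e / 8"
    by (auto simp: eventually_sequentially)
  define G where "G = tent_interpolation \<delta> Q k F"
  define \<kappa> where "\<kappa> x = (\<Prod>i<k. ?\<tau> Q (x i))" for x :: "nat \<Rightarrow> real"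
  define GL where "GL = (\<Sum>a\<in>PiE {..<k} (\<lambda>_. {..<2 * Q + 1}). F (\<lambda>i. \<delta> * (real (a i) - real Q)) *
      (\<Prod>i<k. \<integral>u. tent \<delta> Q (a i) u \<partial>\<mu> i))"
  define \<kappa>L where "\<kappa>L = (\<Prod>i<k. \<integral>x. ?\<tau> Q x \<partial>\<mu> i)"
  have tent1: "\<bar>tent \<delta> Q j u\<bar> \<le> 1" for j u using tent_nonneg tent_le_1 by (simp add: abs_of_nonneg)
  have \<tau>1: "\<bar>?\<tau> Q u\<bar> \<le> 1" for u using sum_tent_bounds[where Q = Q and \<delta> = \<delta>] by (simp add: abs_of_nonneg)
  have contt: "isCont (\<lambda>x. ?\<tau> Q x) x" for x
    by (intro continuous_sum) (use isCont_tent in \<open>auto simp: isCont_def\<close>)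
  have "(\<lambda>n. \<integral>y. \<kappa> (\<lambda>i. X n i y) \<partial>M) \<longlonglongrightarrow> \<kappa>L"
    unfolding \<kappa>_def \<kappa>L_def
    by (rule M.joint_char_imp_product[where g = "\<lambda>_ x. ?\<tau> Q x" and B = 1, OF \<mu> X limX contt \<tau>1])
  moreover have \<kappa>Y: "(\<integral>y. \<kappa> (\<lambda>i. Y i y) \<partial>N) = \<kappa>L"
    unfolding \<kappa>_def \<kappa>L_def
    by (rule N.joint_char_imp_product_eq[where g = "\<lambda>_ x. ?\<tau> Q x" and B = 1, OF \<mu> Y chY contt \<tau>1])
  moreover have GX: "(\<lambda>n. \<integral>y. G (\<lambda>i. X n i y) \<partial>M) \<longlonglongrightarrow> GL"
    unfolding G_def M.tent_interpolation_integral[OF X] GL_def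
    by (intro tendsto_sum tendsto_mult_left M.joint_char_imp_product[where B = 1, OF \<mu> X limX isCont_tent tent1])
  moreover have GY: "(\<integral>y. G (\<lambda>i. Y i y) \<partial>N) = GL"
    unfolding G_def N.tent_interpolation_integral[OF Y] GL_def
    by (intro sum.cong refl arg_cong2[where f = "(*)"] N.joint_char_imp_product_eq[where B = 1, OF \<mu> Y chY isCont_tent tent1])
  ultimately have "(\<lambda>n. B * (1 - (\<integral>y. \<kappa> (\<lambda>i. X n i y) \<partial>M))) \<longlonglongrightarrow> B * (1 - \<kappa>L)"
    by (intro tendsto_intros)
  then have ev1: "\<forall>\<^sub>F n in sequentially. B * (1 - (\<integral>y. \<kappa> (\<lambda>i. X n i y) \<partial>M)) < e / 8"
    using Q by (intro order_tendstoD(2)) (auto simp: \<kappa>L_def)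
  have ev2: "\<forall>\<^sub>F n in sequentially. dist (\<integral>y. G (\<lambda>i. X n i y) \<partial>M) GL < e / 8"
    using GX e by (intro tendstoD) auto
  have bY: "\<bar>(\<integral>y. F (\<lambda>i. Y i y) \<partial>N) - GL\<bar> \<le> e / 8 + e / 8"
    using N.tent_interpolation_integral_error[where Q = Q, OF Y d B L F FY] Q Lkd
    unfolding G_def[symmetric] \<kappa>_def[symmetric] \<kappa>L_def[symmetric] GY \<kappa>Y by linarith
  have "\<forall>\<^sub>F n in sequentially. norm ((\<integral>y. F (\<lambda>i. X n i y) \<partial>M) - (\<integral>y. F (\<lambda>i. Y i y) \<partial>N)) < e"
    using ev1 ev2
  proof eventually_elim
    case (elim n)
    then show ?case
      using M.tent_interpolation_integral_error[where Q = Q, OF X d B L F FX, of n] Lkd bY e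
      unfolding G_def[symmetric] \<kappa>_def[symmetric] dist_real_def real_norm_def by linarith
  qed
  then show "\<exists>no. \<forall>n\<ge>no. norm ((\<integral>y. F (\<lambda>i. X n i y) \<partial>M) - (\<integral>y. F (\<lambda>i. Y i y) \<partial>N)) < e"
    by (simp add: eventually_sequentially)
qed

section \<open>Normal laws\<close>

lemma char_normal:
  assumes "s > 0"
  shows "char (density lborel (normal_density 0 s)) t = of_real (exp (- (s\<^sup>2 * t\<^sup>2) / 2))"
proof -
  interpret P: prob_space std_normal_distribution by (rule prob_space_normal_density) simp
  have "distributed std_normal_distribution lborel (\<lambda>x. x) std_normal_density"
    by (auto simp: distributed_def distr_id2 sets_eq_imp_space_eq)
  then have "distributed std_normal_distribution lborel (\<lambda>x. 0 + s * x) (normal_density (0 + s * 0) (\<bar>s\<bar> * 1))"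
    by (rule P.normal_density_affine) (use assms in auto)
  then have "density lborel (normal_density 0 s) = distr std_normal_distribution lborel (\<lambda>x. s * x)"
    using assms by (simp add: distributed_def)
  also have "\<dots> = distr std_normal_distribution borel (\<lambda>x. s * x)"
    by (intro distr_cong) auto
  finally have "char (density lborel (normal_density 0 s)) t = (CLINT x|std_normal_distribution. iexp (t * (s * x)))"
    unfolding char_def by (simp add: integral_distr)
  also have "\<dots> = char std_normal_distribution (t * s)"
    by (simp add: char_def mult.assoc)
  finally show ?thesis
    by (simp add: char_std_normal_distribution power_mult_distrib mult.commute)
qed

lemma real_distribution_normal: "s > 0 \<Longrightarrow> real_distribution (density lborel (normal_density 0 s))"
  using prob_space_normal_density by (auto simp: real_distribution_def real_distribution_axioms_def)

section \<open>Step paths and evaluations on $D[0,1]$\<close>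

lemma skorohod_close_of_dist:
  assumes "dist x y < e" shows "skorohod_close e x y"
proof -
  have "{e. e > 0 \<and> skorohod_close e x y} \<noteq> {}" using skorohod_close_exists by auto
  from cInf_lessD[OF this assms[unfolded dist_skorohod_def]]
  show ?thesis using skorohod_close_mono by fastforce
qed

text \<open>The identity is an admissible time change. The slack \<open>d\<close> is there because
  the infimum defining the distance runs over positive numbers, while \<open>e\<close> may be
  0.\<close>

lemma dist_skorohod_le_sup:
  assumes "0 \<le> e" "\<And>t. t \<in> {0..1} \<Longrightarrow> \<bar>eval_path x t - eval_path y t\<bar> \<le> e"
  shows "dist x y \<le> e"
proof (rule field_le_epsilon)
  fix d :: real assume d: "d > 0"
  have "skorohod_close (e + d) x y"
    unfolding skorohod_close_def
  proof (intro bexI[OF _ id_time_change] ballI conjI)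
    fix t :: real assume "t \<in> {0..1}"
    then show "\<bar>eval_path x t - eval_path y t\<bar> \<le> e + d" using assms(2)[of t] d by linarith
  qed (use assms(1) d in simp)
  then show "dist x y \<le> e + d"
    unfolding dist_skorohod_def using assms(1) d by (intro cInf_lower) (auto intro!: bdd_belowI[of _ 0])
qed

text \<open>The common shape of the approximations: rescaled partial sums, dyadic approximations of
  Brownian motion, and sampled paths. The path sees only \<open>v 0\<close>, ...,
  \<open>v n\<close>; for positive \<open>n\<close> the last of these is taken only at time
  1.\<close>

definition step_path :: "nat \<Rightarrow> (nat \<Rightarrow> real) \<Rightarrow> skorohod" where
  "step_path n v = Abs_path (\<lambda>t\<in>{0..1}. v (nat \<lfloor>real n * t\<rfloor>))"

lemma eval_step_path: "t \<in> {0..1} \<Longrightarrow> eval_path (step_path n v) t = v (nat \<lfloor>real n * t\<rfloor>)"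
  using step_function_cadlag[of v n] by (simp add: step_path_def Abs_path_inverse)

lemma nat_floor_mult_le: "t \<in> {0..1} \<Longrightarrow> nat \<lfloor>real n * t\<rfloor> \<le> n"
proof -
  assume t: "t \<in> {0..1}"
  then have "real n * t \<le> real n * 1" by (intro mult_left_mono) auto
  then show ?thesis by linarith
qed

lemma dist_step_path_le:
  assumes "\<And>k. k \<le> n \<Longrightarrow> \<bar>v k - w k\<bar> \<le> e"
  shows "dist (step_path n v) (step_path n w) \<le> e"
proof (rule dist_skorohod_le_sup)
  show "0 \<le> e" using assms[of 0] by (auto intro: order_trans[OF abs_ge_zero])
qed (use assms nat_floor_mult_le in \<open>auto simp: eval_step_path\<close>)

text \<open>In the product topology the finitely many coordinates that matter are controlled
  together. Through this continuity, step paths with measurable values are Borel maps into D[0,1],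
  without any description of the Borel sets by coordinates.\<close>

lemma continuous_on_step_path: "continuous_on UNIV (step_path n)"
  unfolding continuous_on_def
proof (intro ballI tendstoI)
  fix v :: "nat \<Rightarrow> real" and e :: real assume e: "e > 0"
  have "\<forall>\<^sub>F w in at v. dist (w k) (v k) < e / 2" for k
  proof -
    have "((\<lambda>w. w k) \<longlongrightarrow> v k) (at v)"
      using continuous_on_product_coordinates[of k] unfolding continuous_on_def by auto
    then show ?thesis using e by (intro tendstoD) auto
  qed
  then have "\<forall>\<^sub>F w in at v. \<forall>k\<in>{..n}. dist (w k) (v k) < e / 2"
    by (intro eventually_ball_finite) auto
  then show "\<forall>\<^sub>F w in at v. dist (step_path n w) (step_path n v) < e"
  proof eventually_elim
    case (elim w)
    then have "dist (step_path n w) (step_path n v) \<le> e / 2"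
      by (intro dist_step_path_le) (auto simp: dist_real_def intro: less_imp_le)
    then show ?case using e by linarith
  qed
qed

lemma measurable_step_path:
  assumes "\<And>k. (\<lambda>y. v y k) \<in> borel_measurable M"
  shows "(\<lambda>y. step_path n (v y)) \<in> borel_measurable M"
proof -
  have "v \<in> borel_measurable M"
    using assms by (rule measurable_coordinatewise_then_product)
  then show ?thesis
    by (rule measurable_compose[OF _ borel_measurable_continuous_onI[OF continuous_on_step_path]])
qed

text \<open>Every time change fixes the endpoint 1. Evaluation at an interior time has no such bound
  and is not continuous.\<close>

lemma abs_eval_path_1_le_dist: "\<bar>eval_path x 1 - eval_path y 1\<bar> \<le> dist x y"
proof (rule field_le_epsilon)
  fix e :: real assume "e > 0"
  then have "skorohod_close (dist x y + e) x y" by (intro skorohod_close_of_dist) simp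
  then obtain \<phi> where "\<phi> \<in> time_changes" "\<bar>eval_path x 1 - eval_path y (\<phi> 1)\<bar> \<le> dist x y + e"
    unfolding skorohod_close_def by force
  then show "\<bar>eval_path x 1 - eval_path y 1\<bar> \<le> dist x y + e" by (simp add: time_change_1)
qed

lemma continuous_on_eval_path_1: "continuous_on UNIV (\<lambda>x. eval_path x 1)"
proof (rule continuous_on_iff[THEN iffD2], intro ballI allI impI)
  fix x :: skorohod and e :: real assume "e > 0"
  then show "\<exists>d>0. \<forall>y\<in>UNIV. dist y x < d \<longrightarrow> dist (eval_path y 1) (eval_path x 1) < e"
    by (intro exI[of _ e]) (auto simp: dist_real_def intro: le_less_trans[OF abs_eval_path_1_le_dist])
qed

text \<open>A value below \<open>b\<close> at a time strictly inside an interval survives small time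
  changes and small errors, so violating the condition is open. This substitutes for the missing
  continuity of evaluation at interior times.\<close>

lemma closed_eval_path_ge: "closed {x. \<forall>r\<in>{0..1}. s < r \<and> r < u \<longrightarrow> b \<le> eval_path x r}"
proof -
  have "open (- {x. \<forall>r\<in>{0..1}. s < r \<and> r < u \<longrightarrow> b \<le> eval_path x r})"
    unfolding open_dist
  proof
    fix x assume "x \<in> - {x. \<forall>r\<in>{0..1}. s < r \<and> r < u \<longrightarrow> b \<le> eval_path x r}"
    then obtain r where r: "r \<in> {0..1}" "s < r" "r < u" "eval_path x r < b" by force
    define e where "e = min ((b - eval_path x r) / 2) (min ((r - s) / 2) ((u - r) / 2))"
    have e: "e > 0" using r by (simp add: e_def)
    have "e \<le> (b - eval_path x r) / 2" "e \<le> (r - s) / 2" "e \<le> (u - r) / 2"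
      unfolding e_def by linarith+
    note e = e this
    show "\<exists>e>0. \<forall>y. dist y x < e \<longrightarrow> y \<in> - {x. \<forall>r\<in>{0..1}. s < r \<and> r < u \<longrightarrow> b \<le> eval_path x r}"
    proof (intro exI[of _ e] conjI allI impI e(1))
      fix y assume "dist y x < e"
      then have "skorohod_close e x y" by (intro skorohod_close_of_dist) (simp add: dist_commute)
      then obtain \<phi> where \<phi>: "\<phi> \<in> time_changes"
        "\<forall>t\<in>{0..1}. \<bar>\<phi> t - t\<bar> \<le> e \<and> \<bar>eval_path x t - eval_path y (\<phi> t)\<bar> \<le> e"
        unfolding skorohod_close_def by blast
      have "r - e \<le> \<phi> r" "\<phi> r \<le> r + e" "eval_path y (\<phi> r) \<le> eval_path x r + e"
        using bspec[OF \<phi>(2) r(1)] by (auto simp: abs_le_iff)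
      then have "s < \<phi> r" "\<phi> r < u" "eval_path y (\<phi> r) < b"
        using e r(2-4) by (simp_all add: field_simps)
      with time_change_mem[OF \<phi>(1) r(1)]
      show "y \<in> - {x. \<forall>r\<in>{0..1}. s < r \<and> r < u \<longrightarrow> b \<le> eval_path x r}"
        by (auto simp: not_le intro!: bexI[of _ "\<phi> r"])
    qed
  qed
  then show ?thesis by (simp add: closed_def)
qed

text \<open>By right-continuity, \<open>a < eval_path x t\<close> means that the path is at least a
  + 1/(k+1) on some open interval to the right of \<open>t\<close>: a countable union of closed
  conditions. Nothing lies to the right of time 1, but there evaluation is continuous.\<close>

lemma measurable_eval_path:
  assumes t: "t \<in> {0..1}"
  shows "(\<lambda>x. eval_path x t) \<in> borel_measurable borel"
proof (cases "t = 1")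
  case True
  then show ?thesis using continuous_on_eval_path_1 by (simp add: borel_measurable_continuous_onI)
next
  case False
  then have t1: "0 \<le> t" "t < 1" using t by auto
  show ?thesis
  proof (rule borel_measurable_iff_greater[THEN iffD2], intro allI)
    fix a
    let ?C = "\<lambda>k m. {x. \<forall>r\<in>{0..1}. t < r \<and> r < t + 1 / real (Suc m) \<longrightarrow> a + 1 / real (Suc k) \<le> eval_path x r}"
    have "a < eval_path x t \<longleftrightarrow> (\<exists>k m. x \<in> ?C k m)" for x
    proof
      have lim: "(eval_path x \<longlongrightarrow> eval_path x t) (at_right t)"
        using eval_path[of x] t1 by (auto simp: cadlag_on_unit_def)
      {
        assume "a < eval_path x t"
        then obtain k where k: "1 / real (Suc k) < eval_path x t - a"
          using reals_Archimedean[of "eval_path x t - a"] by (auto simp: inverse_eq_divide)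
        then have "\<forall>\<^sub>F r in at_right t. a + 1 / real (Suc k) < eval_path x r"
          by (intro order_tendstoD(1)[OF lim]) linarith
        then obtain c where c: "c > t" "\<And>r. t < r \<Longrightarrow> r < c \<Longrightarrow> a + 1 / real (Suc k) < eval_path x r"
          by (auto simp: eventually_at_right_field)
        obtain m where m: "1 / real (Suc m) < c - t"
          using reals_Archimedean[of "c - t"] c(1) by (auto simp: inverse_eq_divide)
        have "x \<in> ?C k m"
        proof (intro CollectI ballI impI)
          fix r assume "t < r \<and> r < t + 1 / real (Suc m)"
          then show "a + 1 / real (Suc k) \<le> eval_path x r" using c(2)[of r] m by linarith
        qed
        then show "\<exists>k m. x \<in> ?C k m" by blast
      }
      {
        assume "\<exists>k m. x \<in> ?C k m"
        then obtain k m where km: "x \<in> ?C k m" by blast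
        have "\<forall>\<^sub>F r in at_right t. a + 1 / real (Suc k) \<le> eval_path x r"
          unfolding eventually_at_right_field
          using km t1 by (intro exI[of _ "min 1 (t + 1 / real (Suc m))"]) auto
        then have "a + 1 / real (Suc k) \<le> eval_path x t"
          by (intro tendsto_lowerbound[OF lim]) auto
        moreover have "1 / real (Suc k) > 0" by simp
        ultimately show "a < eval_path x t" by linarith
      }
    qed
    then have "{x \<in> space borel. a < eval_path x t} = (\<Union>k m. ?C k m)" by auto
    also have "\<dots> \<in> sets borel"
      by (intro sets.countable_UN'' borel_closed closed_eval_path_ge) auto
    finally show "{x \<in> space borel. a < eval_path x t} \<in> sets borel" .
  qed
qed

section \<open>Lipschitz test functions\<close>

text \<open>The infimal convolution of \<open>f\<close> with \<open>k\<close> times the distance.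
  For bounded \<open>f\<close> it is the largest \<open>k\<close>-Lipschitz function below
  \<open>f\<close>.\<close>

definition lipschitz_envelope :: "nat \<Rightarrow> ('a::metric_space \<Rightarrow> real) \<Rightarrow> 'a \<Rightarrow> real" where
  "lipschitz_envelope k f x = (INF y. f y + real k * dist x y)"

context
  fixes f :: "'a::metric_space \<Rightarrow> real" and B :: real
  assumes B: "\<And>x. \<bar>f x\<bar> \<le> B"
begin

lemma lipschitz_envelope_bdd: "bdd_below (range (\<lambda>y. f y + real k * dist x y))"
proof (intro bdd_belowI[of _ "- B"])
  fix z assume "z \<in> range (\<lambda>y. f y + real k * dist x y)"
  then obtain y where z: "z = f y + real k * dist x y" by auto
  have "0 \<le> real k * dist x y" by simp
  then show "- B \<le> z" using B[of y] unfolding z by linarith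
qed

lemma lipschitz_envelope_le: "lipschitz_envelope k f x \<le> f y + real k * dist x y"
  unfolding lipschitz_envelope_def by (rule cINF_lower[OF lipschitz_envelope_bdd]) simp

lemma lipschitz_envelope_ge: "(\<And>y. c \<le> f y + real k * dist x y) \<Longrightarrow> c \<le> lipschitz_envelope k f x"
  unfolding lipschitz_envelope_def by (rule cINF_greatest) auto

lemma lipschitz_envelope_le_self: "lipschitz_envelope k f x \<le> f x"
  using lipschitz_envelope_le[of k x x] by simp

lemma abs_lipschitz_envelope_le: "\<bar>lipschitz_envelope k f x\<bar> \<le> B"
proof -
  have "- B \<le> lipschitz_envelope k f x"
  proof (rule lipschitz_envelope_ge)
    fix y
    have "0 \<le> real k * dist x y" by simp
    then show "- B \<le> f y + real k * dist x y" using B[of y] by linarith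
  qed
  then show ?thesis using lipschitz_envelope_le_self[of k x] B[of x] by linarith
qed

lemma lipschitz_envelope_lipschitz:
  "\<bar>lipschitz_envelope k f x - lipschitz_envelope k f y\<bar> \<le> real k * dist x y"
proof -
  have "lipschitz_envelope k f x - real k * dist x y \<le> lipschitz_envelope k f y" for x y
  proof (rule lipschitz_envelope_ge)
    fix z
    have "real k * dist x z \<le> real k * (dist x y + dist y z)"
      by (intro mult_left_mono dist_triangle) simp
    then show "lipschitz_envelope k f x - real k * dist x y \<le> f z + real k * dist y z"
      using lipschitz_envelope_le[of k x z] by (simp add: distrib_left)
  qed
  from this[of x y] this[of y x] show ?thesis by (simp add: dist_commute)
qed

lemma lipschitz_envelope_tendsto:
  assumes f: "continuous_on UNIV f"
  shows "(\<lambda>k. lipschitz_envelope k f x) \<longlonglongrightarrow> f x"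
proof (rule LIMSEQ_I)
  fix e :: real assume e: "e > 0"
  then have "e / 2 > 0" by simp
  then obtain d where d: "d > 0" "\<And>y. dist y x < d \<Longrightarrow> dist (f y) (f x) < e / 2"
    using f unfolding continuous_on_iff by (meson UNIV_I)
  \<comment> \<open>Beyond distance \<open>d\<close> the penalty exceeds the largest possible
    oscillation \<open>2 * B\<close>, so far points cannot pull the infimum below
    \<open>f x\<close>.\<close>
  obtain k0 where k0: "real k0 * d > 2 * B" using ex_less_of_nat_mult[OF d(1)] by blast
  have "norm (lipschitz_envelope k f x - f x) < e" if k: "k \<ge> k0" for k
  proof -
    have "f x - e / 2 \<le> lipschitz_envelope k f x"
    proof (rule lipschitz_envelope_ge)
      fix y
      have 0: "0 \<le> real k * dist x y" by simp
      show "f x - e / 2 \<le> f y + real k * dist x y"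
      proof (cases "dist y x < d")
        case True
        then show ?thesis using d(2)[OF True] 0 unfolding dist_real_def by linarith
      next
        case False
        then have "real k0 * d \<le> real k * dist x y"
          using k d(1) by (intro mult_mono) (auto simp: dist_commute)
        then show ?thesis using B[of x] B[of y] k0 e by linarith
      qed
    qed
    then show ?thesis using lipschitz_envelope_le_self[of k x] e by simp
  qed
  then show "\<exists>no. \<forall>k\<ge>no. norm (lipschitz_envelope k f x - f x) < e" by blast
qed

end

lemma lipschitz_imp_continuous_on:
  fixes f :: "'a::metric_space \<Rightarrow> real"
  assumes "\<And>x y. \<bar>f x - f y\<bar> \<le> L * dist x y"
  shows "continuous_on UNIV f"
proof -
  have "(max L 0)-lipschitz_on UNIV f"
  proof (rule lipschitz_onI)
    fix x y
    show "dist (f x) (f y) \<le> max L 0 * dist x y"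
      using assms[of x y] mult_right_mono[of L "max L 0" "dist x y"] by (simp add: dist_real_def)
  qed simp
  then show ?thesis by (rule lipschitz_on_continuous_on)
qed

text \<open>Envelopes approach \<open>f\<close> from below, so a Lipschitz test function already
  yields the lower bound for the limit of the integrals; the same bound for \<open>- f\<close> is
  the upper one.\<close>

lemma weak_conv_measuresI_lipschitz:
  fixes \<mu> :: "nat \<Rightarrow> 'a::metric_space measure"
  assumes \<mu>: "\<And>n. prob_space (\<mu> n)" "\<And>n. sets (\<mu> n) = sets borel"
    and W: "prob_space W" "sets W = sets borel"
    and conv: "\<And>(f :: 'a \<Rightarrow> real) L B. 0 \<le> L \<Longrightarrow> (\<And>x. \<bar>f x\<bar> \<le> B) \<Longrightarrow> (\<And>x y. \<bar>f x - f y\<bar> \<le> L * dist x y) \<Longrightarrow>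
      (\<lambda>n. \<integral>x. f x \<partial>\<mu> n) \<longlonglongrightarrow> (\<integral>x. f x \<partial>W)"
  shows "weak_conv_measures \<mu> W"
  unfolding weak_conv_measures_def
proof (intro allI impI)
  have int: "integrable P f" if "prob_space P" "sets P = sets borel" "continuous_on UNIV f" "\<And>x. \<bar>f x\<bar> \<le> B"
    for P :: "'a measure" and f :: "'a \<Rightarrow> real" and B :: real
  proof -
    interpret P: prob_space P by fact
    have "f \<in> borel_measurable P"
      using borel_measurable_continuous_onI[OF that(3)] measurable_cong_sets[OF that(2) refl] by blast
    then show ?thesis using that(4) by (intro P.integrable_const_bound[of _ B]) auto
  qed
  have lower: "\<forall>\<^sub>F n in sequentially. (\<integral>x. f x \<partial>W) - e < (\<integral>x. f x \<partial>\<mu> n)"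
    if f: "continuous_on UNIV f" and B: "\<And>x. \<bar>f x\<bar> \<le> B" and e: "e > 0" for f :: "'a \<Rightarrow> real" and B e :: real
  proof -
    interpret W: prob_space W by fact
    note env = lipschitz_envelope_lipschitz[of f, OF B]
    have ce: "continuous_on UNIV (lipschitz_envelope k f)" for k
      using env by (rule lipschitz_imp_continuous_on)
    note ab = abs_lipschitz_envelope_le[of f, OF B]
    have "(\<lambda>k. \<integral>x. lipschitz_envelope k f x \<partial>W) \<longlonglongrightarrow> (\<integral>x. f x \<partial>W)"
    proof (rule integral_dominated_convergence[where w = "\<lambda>_. B"])
      show "f \<in> borel_measurable W" using int[OF W f B] by auto
      show "lipschitz_envelope k f \<in> borel_measurable W" for k using int[OF W ce ab] by auto
    qed (use ab lipschitz_envelope_tendsto[of f, OF B f] in auto)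
    then have "\<forall>\<^sub>F k in sequentially. (\<integral>x. f x \<partial>W) - e < (\<integral>x. lipschitz_envelope k f x \<partial>W)"
      using e by (intro order_tendstoD(1)) auto
    then obtain k where k: "(\<integral>x. f x \<partial>W) - e < (\<integral>x. lipschitz_envelope k f x \<partial>W)"
      by (auto simp: eventually_sequentially)
    have "\<forall>\<^sub>F n in sequentially. (\<integral>x. f x \<partial>W) - e < (\<integral>x. lipschitz_envelope k f x \<partial>\<mu> n)"
      by (rule order_tendstoD(1)[OF conv[OF _ ab env] k]) simp
    then show ?thesis
    proof eventually_elim
      case (elim n)
      have "(\<integral>x. lipschitz_envelope k f x \<partial>\<mu> n) \<le> (\<integral>x. f x \<partial>\<mu> n)"
        by (intro integral_mono int[OF \<mu> ce ab] int[OF \<mu> f B] lipschitz_envelope_le_self[of f, OF B])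
      then show ?case using elim by linarith
    qed
  qed
  fix f :: "'a \<Rightarrow> real" assume "continuous_on UNIV f \<and> bounded (range f)"
  then obtain B where f: "continuous_on UNIV f" and B: "\<And>x. \<bar>f x\<bar> \<le> B"
    by (auto simp: bounded_iff)
  show "(\<lambda>n. \<integral>x. f x \<partial>\<mu> n) \<longlonglongrightarrow> (\<integral>x. f x \<partial>W)"
  proof (rule order_tendstoI)
    fix a assume "a < (\<integral>x. f x \<partial>W)"
    then show "\<forall>\<^sub>F n in sequentially. a < (\<integral>x. f x \<partial>\<mu> n)"
      using lower[OF f B, of "(\<integral>x. f x \<partial>W) - a"] by simp
  next
    fix a assume "(\<integral>x. f x \<partial>W) < a"
    then show "\<forall>\<^sub>F n in sequentially. (\<integral>x. f x \<partial>\<mu> n) < a"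
      using lower[of "\<lambda>x. - f x" B "a - (\<integral>x. f x \<partial>W)"] f B by (simp add: continuous_on_minus)
  qed
qed

lemma (in prob_space) indep_vars_imp_joint_char:
  assumes "indep_vars (\<lambda>_. borel) X {..<k::nat}"
  shows "(\<integral>y. iexp (\<Sum>i<k. \<theta> i * X i y) \<partial>M) = (\<Prod>i<k. char (distr M borel (X i)) (\<theta> i))"
proof -
  have X: "X i \<in> borel_measurable M" if "i < k" for i
    using assms that by (auto simp: indep_vars_def2)
  have "indep_vars (\<lambda>_. borel) (\<lambda>i y. \<theta> i * X i y) {..<k}"
    by (rule indep_vars_compose2[OF assms]) auto
  from char_distr_sum[OF this, of 1]
  have "(\<integral>y. iexp (\<Sum>i<k. \<theta> i * X i y) \<partial>M) = (\<Prod>i<k. char (distr M borel (\<lambda>y. \<theta> i * X i y)) 1)"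
    unfolding char_def using X by (subst (asm) integral_distr) (auto intro!: borel_measurable_sum borel_measurable_times)
  also have "\<dots> = (\<Prod>i<k. char (distr M borel (X i)) (\<theta> i))"
    unfolding char_def using X by (intro prod.cong refl) (auto simp: integral_distr)
  finally show ?thesis .
qed

section \<open>Block sums as single weighted sums\<close>

definition block_coeff :: "(nat \<Rightarrow> nat) \<Rightarrow> nat \<Rightarrow> (nat \<Rightarrow> real) \<Rightarrow> nat \<Rightarrow> real" where
  "block_coeff p k \<theta> l = (\<Sum>j<k. if p j \<le> l \<and> l < p (Suc j) then \<theta> j else 0)"

text \<open>A linear combination of block sums becomes one sum over \<open>l\<close>, the form to
  which the Gaussian computation and the martingale product apply.\<close>

lemma sum_block_coeff:
  fixes x :: "nat \<Rightarrow> real"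
  assumes "\<And>j. j < k \<Longrightarrow> p (Suc j) \<le> N"
  shows "(\<Sum>l<N. block_coeff p k \<theta> l * x l) = (\<Sum>j<k. \<theta> j * (\<Sum>l\<in>{p j..<p (Suc j)}. x l))"
proof -
  have "(\<Sum>l<N. block_coeff p k \<theta> l * x l) = (\<Sum>j<k. \<Sum>l<N. (if p j \<le> l \<and> l < p (Suc j) then \<theta> j * x l else 0))"
    unfolding block_coeff_def sum_distrib_right by (subst sum.swap) (auto intro!: sum.cong)
  also have "\<dots> = (\<Sum>j<k. \<Sum>l\<in>{p j..<p (Suc j)}. \<theta> j * x l)"
  proof (rule sum.cong[OF refl])
    fix j assume j: "j \<in> {..<k}"
    have "(\<Sum>l<N. (if p j \<le> l \<and> l < p (Suc j) then \<theta> j * x l else 0)) = (\<Sum>l\<in>{..<N} \<inter> {l. p j \<le> l \<and> l < p (Suc j)}. \<theta> j * x l)"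
      by (subst sum.inter_restrict) auto
    also have "{..<N} \<inter> {l. p j \<le> l \<and> l < p (Suc j)} = {p j..<p (Suc j)}"
      using assms[of j] j by auto
    finally show "(\<Sum>l<N. (if p j \<le> l \<and> l < p (Suc j) then \<theta> j * x l else 0)) = (\<Sum>l\<in>{p j..<p (Suc j)}. \<theta> j * x l)" .
  qed
  finally show ?thesis by (simp add: sum_distrib_left)
qed

text \<open>Monotonicity of \<open>p\<close> makes the blocks disjoint, so at most one summand of
  \<open>block_coeff\<close> survives. The block is chosen before \<theta>, so that one choice
  serves both \<theta> and its squares.\<close>

lemma block_coeff_cases:
  assumes p: "\<And>j. j < k \<Longrightarrow> p j \<le> p (Suc j)"
  shows "(\<exists>j<k. \<forall>\<theta>. block_coeff p k \<theta> l = \<theta> j) \<or> (\<forall>\<theta>. block_coeff p k \<theta> l = 0)"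
proof (cases "\<exists>j<k. p j \<le> l \<and> l < p (Suc j)")
  case True
  then obtain j where j: "j < k" "p j \<le> l" "l < p (Suc j)" by blast
  have mono: "p a \<le> p b" if "a \<le> b" "b \<le> k" for a b
    using that by (induction b rule: nat_induct_at_least) (use p in \<open>auto simp: Suc_le_eq intro: le_trans\<close>)
  have "\<not> (p i \<le> l \<and> l < p (Suc i))" if "i < k" "i \<noteq> j" for i
  proof
    assume a: "p i \<le> l \<and> l < p (Suc i)"
    consider "Suc i \<le> j" | "Suc j \<le> i" using \<open>i \<noteq> j\<close> by linarith
    then show False
      using mono[of "Suc i" j] mono[of "Suc j" i] a j that by cases linarith+
  qed
  then have "block_coeff p k \<theta> l = (\<Sum>i<k. if i = j then \<theta> i else 0)" for \<theta>
    unfolding block_coeff_def using j by (intro sum.cong) auto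
  then show ?thesis using j(1) by (intro disjI1 exI[of _ j]) (auto simp: sum.delta)
next
  case False
  then show ?thesis by (intro disjI2 allI) (auto simp: block_coeff_def intro!: sum.neutral)
qed

lemma block_coeff_power2:
  assumes "\<And>j. j < k \<Longrightarrow> p j \<le> p (Suc j)"
  shows "(block_coeff p k \<theta> l)\<^sup>2 = block_coeff p k (\<lambda>j. (\<theta> j)\<^sup>2) l"
  using block_coeff_cases[of k p l, OF assms] by (metis power2_eq_square mult_zero_left)

lemma LIMSEQ_nat_floor_div:
  assumes "0 \<le> t"
  shows "(\<lambda>n. real (nat \<lfloor>real n * t\<rfloor>) / real n) \<longlonglongrightarrow> t"
proof (rule tendsto_sandwich)
  show "\<forall>\<^sub>F n in sequentially. t - 1 / real n \<le> real (nat \<lfloor>real n * t\<rfloor>) / real n"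
    using eventually_gt_at_top[of 0]
  proof eventually_elim
    case (elim n)
    have "real n * t - 1 \<le> real (nat \<lfloor>real n * t\<rfloor>)" by linarith
    then have "(real n * t - 1) / real n \<le> real (nat \<lfloor>real n * t\<rfloor>) / real n"
      by (rule divide_right_mono) simp
    then show ?case using elim by (simp add: diff_divide_distrib)
  qed
  show "\<forall>\<^sub>F n in sequentially. real (nat \<lfloor>real n * t\<rfloor>) / real n \<le> t"
    using eventually_gt_at_top[of 0]
  proof eventually_elim
    case (elim n)
    have "0 \<le> real n * t" using assms by simp
    then have "real (nat \<lfloor>real n * t\<rfloor>) \<le> real n * t" by linarith
    then show ?case using elim by (simp add: field_simps)
  qed
  show "(\<lambda>n. t - 1 / real n) \<longlonglongrightarrow> t"
    using tendsto_diff[OF tendsto_const lim_1_over_n, of t] by simp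
qed simp

section \<open>Levy's construction of Brownian motion\<close>

text \<open>The increment of Brownian motion over the \<open>k\<close>-th dyadic interval of length $2^{-n}$; the
  node \<open>(n, k)\<close> of the dyadic tree uses the standard normal variable with index $2^n + k$.\<close>

fun levy_increment :: "(nat \<Rightarrow> real) \<Rightarrow> nat \<Rightarrow> nat \<Rightarrow> real" where
  "levy_increment \<omega> 0 k = \<omega> 0"
| "levy_increment \<omega> (Suc n) k = levy_increment \<omega> n (k div 2) / 2
     + (if even k then 1 else - 1) * (sqrt (1 / 2 ^ n) / 2) * \<omega> (2 ^ n + k div 2)"

lemma levy_increment_split:
  "levy_increment \<omega> (Suc n) (2 * k) + levy_increment \<omega> (Suc n) (Suc (2 * k)) = levy_increment \<omega> n k"
  by (simp add: field_simps)

lemma sum_lessThan_double: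
  fixes f :: "nat \<Rightarrow> 'b::comm_monoid_add"
  shows "(\<Sum>k<2 * m. f k) = (\<Sum>k<m. f (2 * k) + f (Suc (2 * k)))"
  by (induction m) (auto simp: algebra_simps)

lemma sum_lessThan_add:
  fixes f :: "nat \<Rightarrow> 'b::comm_monoid_add"
  shows "(\<Sum>k<m + n. f k) = (\<Sum>k<m. f k) + (\<Sum>k<n. f (m + k))"
  by (induction n) (auto simp: algebra_simps)

text \<open>In other words, 2^(n/2) times the map from the first 2^n variables to the increments of
  level \<open>n\<close> is orthogonal, so the increments are independent normal with variance 2^-n.
  Splitting an interval preserves this because ((a + b)/2)^2 + ((a - b)/2)^2 = (a^2 +
  b^2)/2.\<close>

lemma levy_increment_linear:
  "\<exists>b. (\<forall>\<omega>. (\<Sum>k<2 ^ n. \<theta> k * levy_increment \<omega> n k) = (\<Sum>i<2 ^ n. b i * \<omega> i)) \<and>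
     (\<Sum>i<2 ^ n. (b i)\<^sup>2) = (\<Sum>k<2 ^ n. (\<theta> k)\<^sup>2) / 2 ^ n"
proof (induction n arbitrary: \<theta>)
  case 0
  then show ?case by (intro exI[of _ \<theta>]) simp
next
  case (Suc n)
  define c where "c = sqrt (1 / 2 ^ n) / 2"
  have c2: "c\<^sup>2 = (1 / 2 ^ n) / 4" by (simp add: c_def power_divide)
  obtain b where b: "\<And>\<omega>. (\<Sum>k<2 ^ n. (\<theta> (2 * k) + \<theta> (Suc (2 * k))) / 2 * levy_increment \<omega> n k) = (\<Sum>i<2 ^ n. b i * \<omega> i)"
    and b2: "(\<Sum>i<2 ^ n. (b i)\<^sup>2) = (\<Sum>k<2 ^ n. ((\<theta> (2 * k) + \<theta> (Suc (2 * k))) / 2)\<^sup>2) / 2 ^ n"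
    using Suc.IH[of "\<lambda>k. (\<theta> (2 * k) + \<theta> (Suc (2 * k))) / 2"] by blast
  \<comment> \<open>The fresh variables of this level have the indices 2^n, ..., 2^(n+1) - 1; the
    coefficients of the older ones stay as they are.\<close>
  define b' where "b' i = (if i < 2 ^ n then b i else c * (\<theta> (2 * (i - 2 ^ n)) - \<theta> (Suc (2 * (i - 2 ^ n)))))" for i
  have "(\<Sum>k<2 ^ Suc n. \<theta> k * levy_increment \<omega> (Suc n) k) = (\<Sum>i<2 ^ Suc n. b' i * \<omega> i)" for \<omega>
  proof -
    have "(\<Sum>k<2 ^ Suc n. \<theta> k * levy_increment \<omega> (Suc n) k)
      = (\<Sum>k<2 ^ n. (\<theta> (2 * k) + \<theta> (Suc (2 * k))) / 2 * levy_increment \<omega> n k)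
        + (\<Sum>k<2 ^ n. c * (\<theta> (2 * k) - \<theta> (Suc (2 * k))) * \<omega> (2 ^ n + k))"
      by (simp add: sum_lessThan_double sum.distrib[symmetric] c_def[symmetric] del: mult_2)
         (intro sum.cong refl, simp add: algebra_simps)
    also have "\<dots> = (\<Sum>i<2 ^ n. b' i * \<omega> i) + (\<Sum>k<2 ^ n. b' (2 ^ n + k) * \<omega> (2 ^ n + k))"
      unfolding b by (simp add: b'_def)
    also have "\<dots> = (\<Sum>i<2 ^ n + 2 ^ n. b' i * \<omega> i)" by (rule sum_lessThan_add[symmetric])
    finally show ?thesis by (simp add: mult_2)
  qed
  moreover have "(\<Sum>i<2 ^ Suc n. (b' i)\<^sup>2) = (\<Sum>k<2 ^ Suc n. (\<theta> k)\<^sup>2) / 2 ^ Suc n"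
  proof -
    have "(\<Sum>i<2 ^ Suc n. (b' i)\<^sup>2) = (\<Sum>i<2 ^ n + 2 ^ n. (b' i)\<^sup>2)" by (simp add: mult_2)
    also have "\<dots> = (\<Sum>i<2 ^ n. (b i)\<^sup>2) + (\<Sum>k<2 ^ n. (c * (\<theta> (2 * k) - \<theta> (Suc (2 * k))))\<^sup>2)"
      unfolding sum_lessThan_add by (simp add: b'_def)
    also have "\<dots> = (\<Sum>k<2 ^ n. (((\<theta> (2 * k) + \<theta> (Suc (2 * k))) / 2)\<^sup>2 + (\<theta> (2 * k) - \<theta> (Suc (2 * k)))\<^sup>2 / 4) / 2 ^ n)"
      unfolding b2 power_mult_distrib c2 by (simp add: sum_divide_distrib sum.distrib add_divide_distrib mult.commute)
    also have "\<dots> = (\<Sum>k<2 ^ n. ((\<theta> (2 * k))\<^sup>2 + (\<theta> (Suc (2 * k)))\<^sup>2) / 2 ^ Suc n)"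
      by (intro sum.cong refl) (simp add: power2_eq_square field_simps)
    also have "\<dots> = (\<Sum>k<2 ^ Suc n. (\<theta> k)\<^sup>2) / 2 ^ Suc n"
      by (simp add: sum_lessThan_double sum_divide_distrib)
    finally show ?thesis .
  qed
  ultimately show ?case by blast
qed

definition levy_space :: "(nat \<Rightarrow> real) measure" where
  "levy_space = PiM UNIV (\<lambda>_. std_normal_distribution)"

lemma sets_levy_space: "sets levy_space = sets (PiM UNIV (\<lambda>_. borel))"
  unfolding levy_space_def by (intro sets_PiM_cong) auto

interpretation levy: prob_space levy_space
  unfolding levy_space_def by (intro prob_space_PiM prob_space_normal_density) simp

lemma measurable_levy_coordinate[measurable]: "(\<lambda>\<omega>. \<omega> i) \<in> borel_measurable levy_space"
  using measurable_cong_sets[OF sets_levy_space refl] measurable_component_singleton[of i UNIV "\<lambda>_. borel"] by blast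

lemma measurable_levy_increment[measurable]: "(\<lambda>\<omega>. levy_increment \<omega> n k) \<in> borel_measurable levy_space"
  by (induction n arbitrary: k) simp_all

lemma distr_levy_coordinate: "distr levy_space borel (\<lambda>\<omega>. \<omega> i) = std_normal_distribution"
proof -
  interpret product_prob_space "\<lambda>_. std_normal_distribution" UNIV
    by (intro product_prob_spaceI prob_space_normal_density) simp
  have "distr levy_space borel (\<lambda>\<omega>. \<omega> i) = distr levy_space std_normal_distribution (\<lambda>\<omega>. \<omega> i)"
    by (intro distr_cong) auto
  then show ?thesis using PiM_component[of i] by (simp add: levy_space_def)
qed

lemma indep_levy_coordinates: "levy.indep_vars (\<lambda>_. borel) (\<lambda>i \<omega>. \<omega> i) UNIV"
proof (subst levy.indep_vars_iff_distr_eq_PiM)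
  have "distr levy_space (PiM UNIV (\<lambda>_. borel)) (\<lambda>x. \<lambda>i\<in>UNIV. x i) = distr levy_space levy_space (\<lambda>x. x)"
    by (intro distr_cong) (auto simp: sets_levy_space)
  also have "\<dots> = levy_space" by (simp add: distr_id2)
  finally show "distr levy_space (PiM UNIV (\<lambda>_. borel)) (\<lambda>x. \<lambda>i\<in>UNIV. x i)
      = PiM UNIV (\<lambda>i. distr levy_space borel (\<lambda>\<omega>. \<omega> i))"
    by (simp add: distr_levy_coordinate) (simp add: levy_space_def)
qed auto

lemma levy_linear_char:
  "(\<integral>\<omega>. iexp (\<Sum>i<m. b i * \<omega> i) \<partial>levy_space) = of_real (exp (- (\<Sum>i<m. (b i)\<^sup>2) / 2))"
proof -
  have "levy.indep_vars (\<lambda>_. borel) (\<lambda>i \<omega>. \<omega> i) {..<m}"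
    by (rule levy.indep_vars_subset[OF indep_levy_coordinates]) simp
  from levy.indep_vars_imp_joint_char[OF this, of b]
  have "(\<integral>\<omega>. iexp (\<Sum>i<m. b i * \<omega> i) \<partial>levy_space) = (\<Prod>i<m. of_real (exp (- ((b i)\<^sup>2) / 2)))"
    by (simp add: distr_levy_coordinate char_std_normal_distribution)
  also have "\<dots> = of_real (exp (\<Sum>i<m. - ((b i)\<^sup>2) / 2))" by (simp add: exp_sum)
  finally show ?thesis by (simp add: sum_negf sum_divide_distrib)
qed

lemma levy_increment_char:
  "(\<integral>\<omega>. iexp (\<Sum>k<2 ^ n. \<theta> k * levy_increment \<omega> n k) \<partial>levy_space)
     = of_real (exp (- (\<Sum>k<2 ^ n. (\<theta> k)\<^sup>2) / 2 ^ n / 2))"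
proof -
  obtain b where b: "\<And>\<omega>. (\<Sum>k<2 ^ n. \<theta> k * levy_increment \<omega> n k) = (\<Sum>i<2 ^ n. b i * \<omega> i)"
     "(\<Sum>i<2 ^ n. (b i)\<^sup>2) = (\<Sum>k<2 ^ n. (\<theta> k)\<^sup>2) / 2 ^ n"
    using levy_increment_linear[where n = n and \<theta> = \<theta>] by blast
  show ?thesis unfolding b(1) levy_linear_char b(2) by simp
qed

text \<open>The joint characteristic function at a vector with a single nonzero entry. Moments of
  increments thereby become moments of \<open>\<omega> 0\<close>.\<close>

lemma levy_increment_distr:
  assumes "k < 2 ^ n"
  shows "distr levy_space borel (\<lambda>\<omega>. levy_increment \<omega> n k) = distr levy_space borel (\<lambda>\<omega>. sqrt (1 / 2 ^ n) * \<omega> 0)"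
proof (rule Levy_uniqueness)
  show "char (distr levy_space borel (\<lambda>\<omega>. levy_increment \<omega> n k)) = char (distr levy_space borel (\<lambda>\<omega>. sqrt (1 / 2 ^ n) * \<omega> 0))"
  proof
    fix t
    have e: "(\<Sum>j<2 ^ n. (if j = k then t else 0) * levy_increment \<omega> n j) = t * levy_increment \<omega> n k" for \<omega>
      using assms by (simp add: if_distrib[of "\<lambda>x. x * _"] sum.delta cong: if_cong)
    have e2: "(\<Sum>j<2 ^ n. (if j = k then t else 0)\<^sup>2) = t\<^sup>2"
      using assms by (simp add: if_distrib[of "\<lambda>x. x\<^sup>2"] sum.delta cong: if_cong)
    have "char (distr levy_space borel (\<lambda>\<omega>. levy_increment \<omega> n k)) t = of_real (exp (- t\<^sup>2 / 2 ^ n / 2))"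
      using levy_increment_char[where n = n and \<theta> = "\<lambda>j. if j = k then t else 0"] unfolding e e2 char_def
      by (subst integral_distr) auto
    moreover have "char (distr levy_space borel (\<lambda>\<omega>. sqrt (1 / 2 ^ n) * \<omega> 0)) t = of_real (exp (- t\<^sup>2 / 2 ^ n / 2))"
      using levy_linear_char[of "\<lambda>_. t * sqrt (1 / 2 ^ n)" 1] unfolding char_def
      by (subst integral_distr) (auto simp: mult.assoc power_mult_distrib)
    ultimately show "char (distr levy_space borel (\<lambda>\<omega>. levy_increment \<omega> n k)) t
      = char (distr levy_space borel (\<lambda>\<omega>. sqrt (1 / 2 ^ n) * \<omega> 0)) t" by simp
  qed
qed (auto intro!: levy.real_distribution_distr)

lemma levy_increment_moment4:
  assumes "k < 2 ^ n"
  shows "integrable levy_space (\<lambda>\<omega>. (levy_increment \<omega> n k) ^ 4)"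
    and "(\<integral>\<omega>. (levy_increment \<omega> n k) ^ 4 \<partial>levy_space) = 3 / 4 ^ n"
proof -
  let ?X = "\<lambda>\<omega>. levy_increment \<omega> n k" and ?Y = "\<lambda>\<omega> :: nat \<Rightarrow> real. sqrt (1 / 2 ^ n) * \<omega> 0"
  have s4: "(sqrt (1 / 2 ^ n)) ^ 4 = 1 / (4 :: real) ^ n"
  proof -
    have "(sqrt (1 / 2 ^ n)) ^ 4 = ((sqrt (1 / 2 ^ n))\<^sup>2)\<^sup>2" by (simp add: power4_eq_xxxx power2_eq_square)
    also have "\<dots> = 1 / (4 :: real) ^ n" by (simp add: power_divide power2_eq_square flip: power_mult_distrib)
    finally show ?thesis .
  qed
  have std: "integrable std_normal_distribution (\<lambda>x. x ^ 4)" "(\<integral>x. x ^ 4 \<partial>std_normal_distribution) = 3"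
    using integrable_std_normal_distribution_moment[of 4] std_normal_distribution_even_moments(1)[of 2]
    by (simp_all add: fact_numeral)
  have "integrable levy_space (\<lambda>\<omega>. (\<omega> 0) ^ 4)"
    using std(1) unfolding distr_levy_coordinate[of 0, symmetric] by (subst (asm) integrable_distr_eq) auto
  then have Y: "integrable levy_space (\<lambda>\<omega>. (?Y \<omega>) ^ 4)" by (simp add: power_mult_distrib)
  have "(\<integral>\<omega>. (\<omega> 0) ^ 4 \<partial>levy_space) = 3"
    using std(2) unfolding distr_levy_coordinate[of 0, symmetric] by (subst (asm) integral_distr) auto
  then have Y3: "(\<integral>\<omega>. (?Y \<omega>) ^ 4 \<partial>levy_space) = 3 / 4 ^ n" unfolding power_mult_distrib s4 by simp
  have "integrable (distr levy_space borel ?Y) (\<lambda>x. x ^ 4)"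
    using Y by (subst integrable_distr_eq) auto
  then show "integrable levy_space (\<lambda>\<omega>. (?X \<omega>) ^ 4)"
    unfolding levy_increment_distr[OF assms, symmetric] by (subst (asm) integrable_distr_eq) auto
  have "(\<integral>\<omega>. (?X \<omega>) ^ 4 \<partial>levy_space) = (\<integral>x. x ^ 4 \<partial>distr levy_space borel ?X)"
    by (subst integral_distr) auto
  also have "\<dots> = (\<integral>\<omega>. (?Y \<omega>) ^ 4 \<partial>levy_space)"
    unfolding levy_increment_distr[OF assms] by (subst integral_distr) auto
  finally show "(\<integral>\<omega>. (?X \<omega>) ^ 4 \<partial>levy_space) = 3 / 4 ^ n" using Y3 by simp
qed


section \<open>Almost sure convergence of the dyadic approximations\<close>

definition levy_fourth :: "(nat \<Rightarrow> real) \<Rightarrow> nat \<Rightarrow> real" where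
  "levy_fourth \<omega> n = (\<Sum>k<2 ^ n. (levy_increment \<omega> n k) ^ 4) / (9 / 10) ^ (3 * n)"

text \<open>With q = (9/10)^n this is q plus the sum of the fourth powers over q^3, which dominates
  the largest increment of level \<open>n\<close>. The second term has mean 2^n (3/4^n) / q^3 = 3
  (500/729)^n; any base strictly between 2^(-1/3) and 1 would make both terms summable.\<close>

definition levy_bound :: "(nat \<Rightarrow> real) \<Rightarrow> nat \<Rightarrow> real" where
  "levy_bound \<omega> n = (9 / 10) ^ n + levy_fourth \<omega> n"

text \<open>In \<open>ennreal\<close> the series always has a value, so the event is measurable at
  once and has probability 1 as soon as the mean of the series is finite.\<close>

definition levy_good :: "(nat \<Rightarrow> real) \<Rightarrow> bool" where
  "levy_good \<omega> \<longleftrightarrow> (\<Sum>n. ennreal (levy_fourth \<omega> n)) \<noteq> \<infinity>"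

definition levy_path :: "(nat \<Rightarrow> real) \<Rightarrow> nat \<Rightarrow> skorohod" where
  "levy_path \<omega> n = step_path (2 ^ n) (\<lambda>k. \<Sum>l<k. levy_increment \<omega> n l)"

lemma levy_fourth_nonneg: "0 \<le> levy_fourth \<omega> n"
  unfolding levy_fourth_def by (intro divide_nonneg_nonneg sum_nonneg) auto

lemma measurable_levy_fourth[measurable]: "(\<lambda>\<omega>. levy_fourth \<omega> n) \<in> borel_measurable levy_space"
  unfolding levy_fourth_def by measurable

lemma measurable_levy_path[measurable]: "(\<lambda>\<omega>. levy_path \<omega> n) \<in> borel_measurable levy_space"
  unfolding levy_path_def by (rule measurable_step_path) simp

lemma measurable_levy_good[measurable]: "Measurable.pred levy_space levy_good"
  unfolding levy_good_def[abs_def] by measurable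

text \<open>Either |x| \<le> q, or |x| q^3 \<le> x^4. This trades a maximum of many terms for a sum
  of fourth powers, with a free parameter; it serves the dyadic increments as well as the
  oscillation between grid points.\<close>

lemma le_add_power4_div:
  fixes x q :: real assumes "q > 0"
  shows "\<bar>x\<bar> \<le> q + x ^ 4 / q ^ 3"
proof (cases "\<bar>x\<bar> \<le> q")
  case True
  then show ?thesis using assms by (simp add: add_increasing2)
next
  case False
  then have "q ^ 3 \<le> \<bar>x\<bar> ^ 3" using assms by (intro power_mono) auto
  then have "\<bar>x\<bar> * q ^ 3 \<le> \<bar>x\<bar> * \<bar>x\<bar> ^ 3" by (intro mult_left_mono) auto
  also have "\<dots> = x ^ 4" by (simp add: power4_eq_xxxx power3_eq_cube)
  finally have "\<bar>x\<bar> \<le> x ^ 4 / q ^ 3" using assms by (simp add: pos_le_divide_eq)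
  then show ?thesis using assms by simp
qed

lemma levy_increment_le_bound:
  assumes "k < 2 ^ n" shows "\<bar>levy_increment \<omega> n k\<bar> \<le> levy_bound \<omega> n"
proof -
  have "(levy_increment \<omega> n k) ^ 4 \<le> (\<Sum>k<2 ^ n. (levy_increment \<omega> n k) ^ 4)"
    using assms by (intro member_le_sum) auto
  then have "(levy_increment \<omega> n k) ^ 4 / ((9 / 10) ^ n) ^ 3 \<le> levy_fourth \<omega> n"
    unfolding levy_fourth_def by (simp add: divide_right_mono power_mult mult.commute)
  then show ?thesis
    using le_add_power4_div[of "(9 / 10) ^ n" "levy_increment \<omega> n k"] unfolding levy_bound_def by simp
qed

lemma AE_levy_good: "AE \<omega> in levy_space. levy_good \<omega>"
  unfolding levy_good_def
proof (rule nn_integral_PInf_AE)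
  have i: "integrable levy_space (\<lambda>\<omega>. levy_fourth \<omega> n)" for n
    unfolding levy_fourth_def by (intro integrable_divide Bochner_Integration.integrable_sum levy_increment_moment4) simp
  have e: "(\<integral>\<omega>. levy_fourth \<omega> n \<partial>levy_space) = 3 * (500 / 729) ^ n" for n
  proof -
    have "(\<integral>\<omega>. levy_fourth \<omega> n \<partial>levy_space) = (\<Sum>k<(2 :: nat) ^ n. 3 / 4 ^ n) / (9 / 10) ^ (3 * n)"
      unfolding levy_fourth_def by (subst Bochner_Integration.integral_divide_zero) (simp add: Bochner_Integration.integral_sum levy_increment_moment4)
    also have "\<dots> = 3 * (2 ^ n / (4 ^ n * ((9 / 10) ^ 3) ^ n))" by (simp add: power_mult)
    also have "\<dots> = 3 * (2 / (4 * (9 / 10) ^ 3)) ^ n"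
      by (simp only: power_divide power_mult_distrib)
    finally show ?thesis by (simp add: power3_eq_cube)
  qed
  have "(\<integral>\<^sup>+\<omega>. (\<Sum>n. ennreal (levy_fourth \<omega> n)) \<partial>levy_space) = (\<Sum>n. \<integral>\<^sup>+\<omega>. ennreal (levy_fourth \<omega> n) \<partial>levy_space)"
    by (intro nn_integral_suminf) simp
  also have "\<dots> = (\<Sum>n. ennreal (3 * (500 / 729) ^ n))"
    using i by (subst nn_integral_eq_integral) (auto simp: levy_fourth_nonneg e)
  also have "\<dots> = ennreal (\<Sum>n. 3 * (500 / 729) ^ n)"
    by (intro suminf_ennreal2 summable_mult summable_geometric) auto
  finally show "(\<integral>\<^sup>+\<omega>. (\<Sum>n. ennreal (levy_fourth \<omega> n)) \<partial>levy_space) \<noteq> \<infinity>" by simp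
qed measurable

lemma summable_levy_bound: "levy_good \<omega> \<Longrightarrow> summable (levy_bound \<omega>)"
proof -
  assume "levy_good \<omega>"
  then have "summable (levy_fourth \<omega>)"
    unfolding levy_good_def by (intro summable_suminf_not_top levy_fourth_nonneg) simp
  then show ?thesis unfolding levy_bound_def[abs_def] by (intro summable_add summable_geometric) auto
qed

lemma eval_levy_path:
  "t \<in> {0..1} \<Longrightarrow> eval_path (levy_path \<omega> n) t = (\<Sum>l<nat \<lfloor>2 ^ n * t\<rfloor>. levy_increment \<omega> n l)"
  by (simp add: levy_path_def eval_step_path)

lemma levy_sum_double:
  "(\<Sum>l<2 * k. levy_increment \<omega> (Suc n) l) = (\<Sum>l<k. levy_increment \<omega> n l)"
  unfolding sum_lessThan_double levy_increment_split ..

lemma levy_bound_nonneg: "0 \<le> levy_bound \<omega> n"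
  using levy_fourth_nonneg by (simp add: levy_bound_def)

text \<open>The floor at the finer level is \<open>2 * k\<close> or \<open>2 * k + 1\<close>. Fine
  increments pair up into coarse ones, so the two paths agree or differ by the single fine increment
  of index \<open>2 * k\<close>.\<close>

lemma levy_path_step:
  assumes t: "t \<in> {0..1}"
  shows "\<bar>eval_path (levy_path \<omega> (Suc n)) t - eval_path (levy_path \<omega> n) t\<bar> \<le> levy_bound \<omega> (Suc n)"
proof -
  define k where "k = nat \<lfloor>2 ^ n * t\<rfloor>"
  have t0: "0 \<le> 2 ^ n * t" using t by simp
  then have k: "real k \<le> 2 ^ n * t" "2 ^ n * t < real k + 1" unfolding k_def by linarith+
  then have k2: "2 * real k \<le> 2 * (2 ^ n * t)" "2 * (2 ^ n * t) < 2 * real k + 2" by linarith+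
  \<comment> \<open>In the odd case this puts the index \<open>2 * k\<close> below 2^(n+1), where
    the bound on increments holds.\<close>
  have "nat \<lfloor>2 ^ Suc n * t\<rfloor> \<le> 2 ^ Suc n" using nat_floor_mult_le[OF t, of "2 ^ Suc n"] by simp
  moreover have "nat \<lfloor>2 ^ Suc n * t\<rfloor> = 2 * k \<or> nat \<lfloor>2 ^ Suc n * t\<rfloor> = Suc (2 * k)"
  proof -
    have "\<lfloor>2 * (2 ^ n * t)\<rfloor> = int (2 * k) \<or> \<lfloor>2 * (2 ^ n * t)\<rfloor> = int (2 * k) + 1"
      using k2 by linarith
    then show ?thesis by (auto simp: mult.assoc)
  qed
  ultimately show ?thesis
    using levy_bound_nonneg[of \<omega> "Suc n"] levy_increment_le_bound[of "2 * k" "Suc n" \<omega>]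
    unfolding eval_levy_path[OF t] k_def[symmetric] by (auto simp: levy_sum_double simp del: levy_increment.simps)
qed

lemma levy_path_modulus:
  assumes "s \<in> {0..1}" "t \<in> {0..1}" "\<bar>t - s\<bar> \<le> 1 / 2 ^ n"
  shows "\<bar>eval_path (levy_path \<omega> n) t - eval_path (levy_path \<omega> n) s\<bar> \<le> levy_bound \<omega> n"
proof -
  have *: "\<bar>eval_path (levy_path \<omega> n) t - eval_path (levy_path \<omega> n) s\<bar> \<le> levy_bound \<omega> n"
    if st: "s \<in> {0..1}" "t \<in> {0..1}" "s \<le> t" "t - s \<le> 1 / 2 ^ n" for s t
  proof -
    have "2 ^ n * (t - s) \<le> 2 ^ n * (1 / 2 ^ n)" using st by (intro mult_left_mono) auto
    then have a: "2 ^ n * t \<le> 2 ^ n * s + 1" "2 ^ n * s \<le> 2 ^ n * t" "0 \<le> 2 ^ n * s"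
      using st by (auto simp: algebra_simps)
    then have "nat \<lfloor>2 ^ n * t\<rfloor> = nat \<lfloor>2 ^ n * s\<rfloor> \<or> nat \<lfloor>2 ^ n * t\<rfloor> = Suc (nat \<lfloor>2 ^ n * s\<rfloor>)" by linarith
    moreover have "nat \<lfloor>2 ^ n * t\<rfloor> \<le> 2 ^ n" using nat_floor_mult_le[OF st(2), of "2 ^ n"] by simp
    ultimately show ?thesis
      using levy_bound_nonneg[of \<omega> n] levy_increment_le_bound[of "nat \<lfloor>2 ^ n * s\<rfloor>" n \<omega>]
      unfolding eval_levy_path[OF st(1)] eval_levy_path[OF st(2)] by auto
  qed
  show ?thesis
  proof (cases "s \<le> t")
    case True
    then show ?thesis using assms * by auto
  next
    case False
    then show ?thesis using assms *[of t s] by (auto simp: abs_minus_commute)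
  qed
qed

text \<open>Consecutive approximations differ by summable amounts, hence converge uniformly. They
  jump, but over times at most 2^-n apart the \<open>n\<close>-th one moves by at most
  \<open>levy_bound \<omega> n\<close>, which tends to 0; this is why the limit is
  continuous.\<close>

lemma levy_path_limit:
  assumes good: "levy_good \<omega>"
  shows "\<exists>x. (\<lambda>n. levy_path \<omega> n) \<longlonglongrightarrow> x \<and> (\<forall>t\<in>{0..1}. (\<lambda>n. eval_path (levy_path \<omega> n) t) \<longlonglongrightarrow> eval_path x t) \<and>
    continuous_on {0..1} (eval_path x)"
proof -
  let ?G = "\<lambda>n t. eval_path (levy_path \<omega> n) t"
  have sb: "summable (\<lambda>n. levy_bound \<omega> (Suc n))"
    using summable_levy_bound[OF good] by (subst summable_Suc_iff)
  define \<rho> where "\<rho> n = (\<Sum>m. levy_bound \<omega> (Suc (m + n)))" for n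
  have \<rho>0: "\<rho> \<longlonglongrightarrow> 0"
    unfolding \<rho>_def using suminf_exist_split2[OF sb] by simp
  define L where "L t = lim (\<lambda>n. ?G n t)" for t
  have L: "(\<lambda>n. ?G n t) \<longlonglongrightarrow> L t" "\<bar>?G n t - L t\<bar> \<le> \<rho> n" if t: "t \<in> {0..1}" for t n
  proof -
    have b: "norm (?G (Suc m) t - ?G m t) \<le> levy_bound \<omega> (Suc m)" for m
      using levy_path_step[OF t] by simp
    have "summable (\<lambda>m. ?G (Suc m) t - ?G m t)"
      by (rule summable_comparison_test'[OF sb b])
    then have "convergent (\<lambda>n. \<Sum>m<n. ?G (Suc m) t - ?G m t)" by (simp add: summable_iff_convergent)
    from convergent_add[OF this convergent_const[of "?G 0 t"]]
    have "convergent (\<lambda>n. ?G n t)" by (simp add: sum_lessThan_telescope[of "\<lambda>n. ?G n t"])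
    then show lim: "(\<lambda>n. ?G n t) \<longlonglongrightarrow> L t" unfolding L_def by (simp add: convergent_LIMSEQ_iff)
    have "\<bar>?G n t - ?G (n + m) t\<bar> \<le> \<rho> n" for m
    proof -
      have "\<bar>?G (n + m) t - ?G n t\<bar> = \<bar>\<Sum>i<m. ?G (n + Suc i) t - ?G (n + i) t\<bar>"
        using sum_lessThan_telescope[of "\<lambda>i. ?G (n + i) t" m] by simp
      also have "\<dots> \<le> (\<Sum>i<m. levy_bound \<omega> (Suc (i + n)))"
        using b by (intro order_trans[OF sum_abs] sum_mono) (simp add: add.commute)
      also have "\<dots> \<le> \<rho> n"
        unfolding \<rho>_def using summable_ignore_initial_segment[OF sb, of n]
        by (intro sum_le_suminf) (auto simp: levy_bound_nonneg)
      finally show ?thesis by (simp add: abs_minus_commute)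
    qed
    then show "\<bar>?G n t - L t\<bar> \<le> \<rho> n"
      using LIMSEQ_ignore_initial_segment[OF lim, of n]
      by (intro LIMSEQ_le_const2[OF tendsto_rabs[OF tendsto_diff[OF tendsto_const]]]) (auto simp: add.commute)
  qed
  have cont: "continuous_on {0..1} L"
    unfolding continuous_on_iff
  proof (intro ballI allI impI)
    fix t e :: real assume t: "t \<in> {0..1}" and e: "e > 0"
    have "(\<lambda>n. 2 * \<rho> n + levy_bound \<omega> n) \<longlonglongrightarrow> 2 * 0 + 0"
      using summable_LIMSEQ_zero[OF summable_levy_bound[OF good]] \<rho>0 by (intro tendsto_intros)
    then have "\<forall>\<^sub>F n in sequentially. 2 * \<rho> n + levy_bound \<omega> n < e"
      using e by (intro order_tendstoD) auto
    then obtain n where n: "2 * \<rho> n + levy_bound \<omega> n < e" by (auto simp: eventually_sequentially)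
    show "\<exists>d>0. \<forall>s\<in>{0..1}. dist s t < d \<longrightarrow> dist (L s) (L t) < e"
    proof (intro exI[of _ "1 / 2 ^ n"] conjI ballI impI)
      fix s :: real assume s: "s \<in> {0..1}" "dist s t < 1 / 2 ^ n"
      then have "\<bar>?G n s - ?G n t\<bar> \<le> levy_bound \<omega> n"
        using levy_path_modulus[OF t s(1), of n \<omega>] by (simp add: dist_real_def)
      then show "dist (L s) (L t) < e"
        using L(2)[OF t, of n] L(2)[OF s(1), of n] n unfolding dist_real_def by linarith
    qed simp
  qed
  define x where "x = Abs_path (restrict L {0..1})"
  have "cadlag_on_unit (restrict L {0..1})"
    unfolding cadlag_on_unit_def
  proof (intro conjI ballI)
    fix t :: real assume t: "t \<in> {0..<1}"
    have "continuous_on {t..1} L" using t by (intro continuous_on_subset[OF cont]) auto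
    then have "(L \<longlongrightarrow> L t) (at_right t)" using t by (intro continuous_on_Icc_at_rightD) auto
    moreover have "\<forall>\<^sub>F u in at_right t. restrict L {0..1} u = L u"
      unfolding eventually_at_right_field using t by (intro exI[of _ 1]) auto
    ultimately show "(restrict L {0..1} \<longlongrightarrow> restrict L {0..1} t) (at_right t)"
      using t by (simp add: tendsto_cong)
  next
    fix t :: real assume t: "t \<in> {0<..1}"
    have "continuous_on {0..t} L" using t by (intro continuous_on_subset[OF cont]) auto
    then have "(L \<longlongrightarrow> L t) (at_left t)" using t by (intro continuous_on_Icc_at_leftD) auto
    moreover have "\<forall>\<^sub>F u in at_left t. restrict L {0..1} u = L u"
      unfolding eventually_at_left_field using t by (intro exI[of _ 0]) auto
    ultimately show "\<exists>l. (restrict L {0..1} \<longlongrightarrow> l) (at_left t)"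
      by (intro exI[of _ "L t"]) (simp add: tendsto_cong)
  qed
  then have x: "eval_path x t = L t" if "t \<in> {0..1}" for t
    unfolding x_def using that by (subst Abs_path_inverse) auto
  have "(\<lambda>n. levy_path \<omega> n) \<longlonglongrightarrow> x"
  proof (rule metric_tendsto_imp_tendsto[OF \<rho>0])
    have "dist (levy_path \<omega> n) x \<le> \<rho> n" for n
      using L(2)[of _ n] by (intro dist_skorohod_le_sup) (force simp: x intro: order_trans[OF abs_ge_zero])+
    then show "\<forall>\<^sub>F n in sequentially. dist (levy_path \<omega> n) x \<le> dist (\<rho> n) 0"
      by (intro always_eventually allI) (metis abs_ge_self dist_real_def diff_zero order_trans)
  qed
  moreover have "continuous_on {0..1} (eval_path x)"
    using cont x by (subst continuous_on_cong[OF refl, of _ _ L]) auto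
  ultimately show ?thesis using L(1) x by (intro exI[of _ x]) auto
qed

section \<open>The limit path and its law\<close>

definition brownian_path :: "(nat \<Rightarrow> real) \<Rightarrow> skorohod" where
  "brownian_path \<omega> = (if levy_good \<omega> then lim (\<lambda>n. levy_path \<omega> n) else step_path 1 (\<lambda>_. 0))"

lemma brownian_path:
  assumes "levy_good \<omega>"
  shows "(\<lambda>n. levy_path \<omega> n) \<longlonglongrightarrow> brownian_path \<omega>"
    and "t \<in> {0..1} \<Longrightarrow> (\<lambda>n. eval_path (levy_path \<omega> n) t) \<longlonglongrightarrow> eval_path (brownian_path \<omega>) t"
    and "continuous_on {0..1} (eval_path (brownian_path \<omega>))"
  using levy_path_limit[OF assms] assms unfolding brownian_path_def by (auto dest: limI)

lemma measurable_brownian_path[measurable]: "brownian_path \<in> borel_measurable levy_space"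
proof (rule borel_measurable_LIMSEQ_metric)
  fix n
  show "(\<lambda>\<omega>. if levy_good \<omega> then levy_path \<omega> n else step_path 1 (\<lambda>_. 0)) \<in> borel_measurable levy_space"
    by measurable
next
  fix \<omega>
  show "(\<lambda>n. if levy_good \<omega> then levy_path \<omega> n else step_path 1 (\<lambda>_. 0)) \<longlonglongrightarrow> brownian_path \<omega>"
    by (cases "levy_good \<omega>") (use brownian_path in \<open>auto simp: brownian_path_def\<close>)
qed

text \<open>Closeness in the Skorohod distance is uniform closeness after a continuous time change,
  so the three-epsilon proof for uniform limits carries over. Closedness makes continuity of the
  path a Borel event, as the passage of almost sure statements to the image measure
  requires.\<close>

lemma closed_continuous_paths: "closed {x. continuous_on {0..1} (eval_path x)}"
proof (rule closed_sequential_limits[THEN iffD2], intro allI impI, elim conjE, intro CollectI)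
  fix X l assume X: "\<forall>n. X n \<in> {x. continuous_on {0..1} (eval_path x)}" and lim: "X \<longlonglongrightarrow> l"
  show "continuous_on {0..1} (eval_path l)"
    unfolding continuous_on_iff
  proof (intro ballI allI impI)
    fix t e :: real assume t: "t \<in> {0..1}" and e: "e > 0"
    obtain n where n: "dist (X n) l < e / 3"
      using lim e unfolding lim_sequentially by (metis divide_pos_pos le_refl zero_less_numeral)
    then have "skorohod_close (e / 3) l (X n)" by (intro skorohod_close_of_dist) (simp add: dist_commute)
    then obtain \<phi> where \<phi>: "\<phi> \<in> time_changes"
      "\<forall>t\<in>{0..1}. \<bar>\<phi> t - t\<bar> \<le> e / 3 \<and> \<bar>eval_path l t - eval_path (X n) (\<phi> t)\<bar> \<le> e / 3"
      unfolding skorohod_close_def by blast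
    have "continuous_on {0..1} (\<lambda>t. eval_path (X n) (\<phi> t))"
      using X \<phi>(1) time_change_mem[OF \<phi>(1)]
      by (intro continuous_on_compose2[of "{0..1}" "eval_path (X n)" "{0..1}" \<phi>]) (auto simp: time_changes_def)
    moreover have "e / 3 > 0" using e by simp
    ultimately obtain d where d: "d > 0" "\<forall>s\<in>{0..1}. dist s t < d \<longrightarrow> dist (eval_path (X n) (\<phi> s)) (eval_path (X n) (\<phi> t)) < e / 3"
      unfolding continuous_on_iff using t by meson
    show "\<exists>d>0. \<forall>s\<in>{0..1}. dist s t < d \<longrightarrow> dist (eval_path l s) (eval_path l t) < e"
    proof (intro exI[of _ d] conjI ballI impI d(1))
      fix s :: real assume s: "s \<in> {0..1}" "dist s t < d"
      have "\<bar>eval_path (X n) (\<phi> s) - eval_path (X n) (\<phi> t)\<bar> < e / 3" using d(2) s by (simp add: dist_real_def)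
      moreover have "\<bar>eval_path l s - eval_path (X n) (\<phi> s)\<bar> \<le> e / 3" "\<bar>eval_path l t - eval_path (X n) (\<phi> t)\<bar> \<le> e / 3"
        using \<phi>(2) s(1) t by blast+
      ultimately show "dist (eval_path l s) (eval_path l t) < e" unfolding dist_real_def by linarith
    qed
  qed
qed

text \<open>At level \<open>n\<close> the increments over the given times are block sums of dyadic
  increments, so their transform is explicit, and block lengths divided by 2^n tend to time
  differences. The same integrals converge to the transform of the limit path by dominated
  convergence.\<close>

lemma brownian_joint_char:
  fixes t :: "nat \<Rightarrow> real"
  assumes t: "0 \<le> t 0" "\<And>i. i < k \<Longrightarrow> t i \<le> t (Suc i)" "t k \<le> 1"
  shows "(\<integral>\<omega>. iexp (\<Sum>i<k. \<theta> i * (eval_path (brownian_path \<omega>) (t (Suc i)) - eval_path (brownian_path \<omega>) (t i))) \<partial>levy_space)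
    = of_real (exp (- (\<Sum>i<k. (\<theta> i)\<^sup>2 * (t (Suc i) - t i)) / 2))"
proof (rule LIMSEQ_unique)
  have lo: "0 \<le> t i" if "i \<le> k" for i
    using that 
    proof (induction i)
      case (Suc i)
      then show ?case using t(2)[of i] by simp
    qed (use t(1) in simp)
  have hi: "t i \<le> 1" if "i \<le> k" for i
    using that 
    proof (induction i rule: inc_induct)
      case (step n)
      then show ?case using t(2)[of n] by simp
    qed (use t(3) in simp)
  have t01: "t i \<in> {0..1}" if "i \<le> k" for i using lo hi that by auto
  let ?p = "\<lambda>n j. nat \<lfloor>2 ^ n * t j\<rfloor>"
  have p: "?p n j \<le> ?p n (Suc j)" if "j < k" for n j
    using t(2)[OF that] by (intro nat_mono floor_mono mult_left_mono) auto
  have pN: "?p n j \<le> 2 ^ n" if "j \<le> k" for n j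
    using nat_floor_mult_le[OF t01[OF that], of "2 ^ n"] by simp
  have inc: "(\<Sum>i<k. \<theta> i * (eval_path (levy_path \<omega> n) (t (Suc i)) - eval_path (levy_path \<omega> n) (t i)))
    = (\<Sum>l<2 ^ n. block_coeff (?p n) k \<theta> l * levy_increment \<omega> n l)" for \<omega> n
  proof -
    have "(\<Sum>l<2 ^ n. block_coeff (?p n) k \<theta> l * levy_increment \<omega> n l)
      = (\<Sum>j<k. \<theta> j * (\<Sum>l\<in>{?p n j..<?p n (Suc j)}. levy_increment \<omega> n l))"
      by (rule sum_block_coeff) (use pN in auto)
    also have "\<dots> = (\<Sum>i<k. \<theta> i * (eval_path (levy_path \<omega> n) (t (Suc i)) - eval_path (levy_path \<omega> n) (t i)))"
    proof (rule sum.cong[OF refl])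
      fix j assume j: "j \<in> {..<k}"
      have "(\<Sum>l<?p n (Suc j). levy_increment \<omega> n l) - (\<Sum>l<?p n j. levy_increment \<omega> n l)
        = (\<Sum>l\<in>{?p n j..<?p n (Suc j)}. levy_increment \<omega> n l)"
        using sum_diff_nat_ivl[of 0 "?p n j" "?p n (Suc j)" "levy_increment \<omega> n"] p[of j n] j
        by (simp add: atLeast0LessThan)
      then show "\<theta> j * (\<Sum>l\<in>{?p n j..<?p n (Suc j)}. levy_increment \<omega> n l)
        = \<theta> j * (eval_path (levy_path \<omega> n) (t (Suc j)) - eval_path (levy_path \<omega> n) (t j))"
        using eval_levy_path t01[of j] t01[of "Suc j"] j by simp
    qed
    finally show ?thesis by simp
  qed
  have sq: "(\<Sum>l<2 ^ n. (block_coeff (?p n) k \<theta> l)\<^sup>2) = (\<Sum>j<k. (\<theta> j)\<^sup>2 * (real (?p n (Suc j)) - real (?p n j)))" for n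
  proof -
    have "(\<Sum>l<2 ^ n. (block_coeff (?p n) k \<theta> l)\<^sup>2) = (\<Sum>l<2 ^ n. block_coeff (?p n) k (\<lambda>j. (\<theta> j)\<^sup>2) l * 1)"
      by (simp add: block_coeff_power2[of k "?p n", OF p])
    also have "\<dots> = (\<Sum>j<k. (\<theta> j)\<^sup>2 * (\<Sum>l\<in>{?p n j..<?p n (Suc j)}. 1))"
      by (rule sum_block_coeff) (use pN in auto)
    also have "\<dots> = (\<Sum>j<k. (\<theta> j)\<^sup>2 * (real (?p n (Suc j)) - real (?p n j)))"
      using p by (intro sum.cong refl) (simp add: of_nat_diff)
    finally show ?thesis .
  qed
  let ?I = "\<lambda>n. \<integral>\<omega>. iexp (\<Sum>i<k. \<theta> i * (eval_path (levy_path \<omega> n) (t (Suc i)) - eval_path (levy_path \<omega> n) (t i))) \<partial>levy_space"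
  have I: "?I n = of_real (exp (- (\<Sum>j<k. (\<theta> j)\<^sup>2 * (real (?p n (Suc j)) / 2 ^ n - real (?p n j) / 2 ^ n)) / 2))" for n
    unfolding inc levy_increment_char sq by (simp add: sum_divide_distrib diff_divide_distrib[symmetric])
  show "?I \<longlonglongrightarrow> of_real (exp (- (\<Sum>i<k. (\<theta> i)\<^sup>2 * (t (Suc i) - t i)) / 2))"
    unfolding I
  proof (intro tendsto_intros)
    have "(\<lambda>n. real (?p n i) / 2 ^ n) \<longlonglongrightarrow> t i" if "i \<le> k" for i
    proof -
      have "filterlim (\<lambda>n. 2 ^ n :: nat) sequentially sequentially"
        by (rule filterlim_subseq) (simp add: strict_mono_def)
      from filterlim_compose[OF LIMSEQ_nat_floor_div[OF lo[OF that]] this] show ?thesis by simp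
    qed
    then show "(\<lambda>n. real (?p n (Suc i)) / 2 ^ n) \<longlonglongrightarrow> t (Suc i)" "(\<lambda>n. real (?p n i) / 2 ^ n) \<longlonglongrightarrow> t i" if "i \<in> {..<k}" for i
      using that by auto
  qed simp
  have em: "(\<lambda>x. eval_path x (t i)) \<in> borel_measurable borel" if "i \<le> k" for i
    by (rule measurable_eval_path[OF t01[OF that]])
  show "?I \<longlonglongrightarrow> (\<integral>\<omega>. iexp (\<Sum>i<k. \<theta> i * (eval_path (brownian_path \<omega>) (t (Suc i)) - eval_path (brownian_path \<omega>) (t i))) \<partial>levy_space)"
  proof (rule integral_dominated_convergence[where w = "\<lambda>_. 1"])
    have "(\<lambda>\<omega>. \<Sum>i<k. \<theta> i * (eval_path (\<Phi> \<omega>) (t (Suc i)) - eval_path (\<Phi> \<omega>) (t i))) \<in> borel_measurable levy_space"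
      if [measurable]: "\<Phi> \<in> borel_measurable levy_space" for \<Phi>
      by (intro borel_measurable_sum borel_measurable_times borel_measurable_diff measurable_compose[OF that em]) auto
    note m = this
    show "(\<lambda>\<omega>. iexp (\<Sum>i<k. \<theta> i * (eval_path (brownian_path \<omega>) (t (Suc i)) - eval_path (brownian_path \<omega>) (t i)))) \<in> borel_measurable levy_space"
      using m[OF measurable_brownian_path] by measurable
    show "(\<lambda>\<omega>. iexp (\<Sum>i<k. \<theta> i * (eval_path (levy_path \<omega> n) (t (Suc i)) - eval_path (levy_path \<omega> n) (t i)))) \<in> borel_measurable levy_space" for n
      using m[OF measurable_levy_path] by measurable
    show "AE \<omega> in levy_space. (\<lambda>n. iexp (\<Sum>i<k. \<theta> i * (eval_path (levy_path \<omega> n) (t (Suc i)) - eval_path (levy_path \<omega> n) (t i))))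
      \<longlonglongrightarrow> iexp (\<Sum>i<k. \<theta> i * (eval_path (brownian_path \<omega>) (t (Suc i)) - eval_path (brownian_path \<omega>) (t i)))"
      using AE_levy_good
    proof eventually_elim
      case (elim \<omega>)
      show ?case by (intro tendsto_intros brownian_path(2)[OF elim] t01) auto
    qed
  qed auto
qed

theorem wiener_measure_exists: "\<exists>W. is_wiener_measure W"
proof -
  define W where "W = distr levy_space borel brownian_path"
  have pW: "prob_space W" unfolding W_def by (rule levy.prob_space_distr) simp
  interpret W: prob_space W by (rule pW)
  have sW[simp]: "sets W = sets borel" by (simp add: W_def)
  have em: "(\<lambda>x. eval_path x t) \<in> borel_measurable W" if "t \<in> {0..1}" for t
    using measurable_eval_path[OF that] by (simp add: W_def)
  have ch: "(\<integral>x. iexp (\<Sum>i<k. \<theta> i * (eval_path x (t (Suc i)) - eval_path x (t i))) \<partial>W)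
    = of_real (exp (- (\<Sum>i<k. (\<theta> i)\<^sup>2 * (t (Suc i) - t i)) / 2))"
    if t: "0 \<le> t 0" "\<And>i. i < k \<Longrightarrow> t i \<le> t (Suc i)" "t k \<le> 1" "\<And>i. i \<le> k \<Longrightarrow> t i \<in> {0..1}" for t k \<theta>
  proof -
    have "(\<lambda>x. \<Sum>i<k. \<theta> i * (eval_path x (t (Suc i)) - eval_path x (t i))) \<in> borel_measurable borel"
      by (intro borel_measurable_sum borel_measurable_times borel_measurable_diff measurable_eval_path t) auto
    then have "(\<lambda>x. iexp (\<Sum>i<k. \<theta> i * (eval_path x (t (Suc i)) - eval_path x (t i)))) \<in> borel_measurable borel"
      by measurable
    then show ?thesis
      unfolding W_def using brownian_joint_char[OF t(1-3)]
      by (subst integral_distr[OF measurable_brownian_path]) auto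
  qed
  have ch1: "char (distr W borel (\<lambda>x. eval_path x t - eval_path x s)) = char (density lborel (normal_density 0 (sqrt (t - s))))"
    and dist1: "distributed W lborel (\<lambda>x. eval_path x t - eval_path x s) (normal_density 0 (sqrt (t - s)))"
    if st: "0 \<le> s" "s < t" "t \<le> 1" for s t
  proof -
    have [measurable]: "(\<lambda>x. eval_path x t) \<in> borel_measurable W" "(\<lambda>x. eval_path x s) \<in> borel_measurable W"
      using em st by auto
    show c: "char (distr W borel (\<lambda>x. eval_path x t - eval_path x s)) = char (density lborel (normal_density 0 (sqrt (t - s))))"
    proof
      fix \<theta>
      have "char (distr W borel (\<lambda>x. eval_path x t - eval_path x s)) \<theta> = (\<integral>x. iexp (\<theta> * (eval_path x t - eval_path x s)) \<partial>W)"
        unfolding char_def by (subst integral_distr) auto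
      \<comment> \<open>The times \<open>s\<close> and \<open>t\<close> form a sequence with a
        single increment.\<close>
      also have "\<dots> = of_real (exp (- (\<theta>\<^sup>2 * (t - s)) / 2))"
        using ch[of "case_nat s (\<lambda>_. t)" 1 "\<lambda>_. \<theta>"] st by (simp split: nat.split)
      finally show "char (distr W borel (\<lambda>x. eval_path x t - eval_path x s)) \<theta> = char (density lborel (normal_density 0 (sqrt (t - s)))) \<theta>"
        using st by (simp add: char_normal mult.commute)
    qed
    have "distr W borel (\<lambda>x. eval_path x t - eval_path x s) = density lborel (normal_density 0 (sqrt (t - s)))"
      by (rule Levy_uniqueness[OF W.real_distribution_distr real_distribution_normal c]) (use st in auto)
    moreover have "distr W lborel (\<lambda>x. eval_path x t - eval_path x s) = distr W borel (\<lambda>x. eval_path x t - eval_path x s)"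
      by (intro distr_cong) auto
    ultimately show "distributed W lborel (\<lambda>x. eval_path x t - eval_path x s) (normal_density 0 (sqrt (t - s)))"
      by (simp add: distributed_def)
  qed
  have "AE x in W. eval_path x 0 = 0 \<and> continuous_on {0..1} (eval_path x)"
  proof -
    have [measurable]: "{x. continuous_on {0..1} (eval_path x)} \<in> sets borel"
      by (rule borel_closed[OF closed_continuous_paths])
    have "{x. eval_path x 0 = 0} \<in> sets borel"
      using measurable_eval_path[of 0] borel_measurable_eq[of "\<lambda>x. eval_path x 0" borel "\<lambda>_. 0"] by simp
    then have m: "{x \<in> space borel. eval_path x 0 = 0 \<and> continuous_on {0..1} (eval_path x)} \<in> sets borel"
      by (simp add: Collect_conj_eq sets.Int)
    show ?thesis
      unfolding W_def
    proof (subst AE_distr_iff[OF measurable_brownian_path m])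
      show "AE \<omega> in levy_space. eval_path (brownian_path \<omega>) 0 = 0 \<and> continuous_on {0..1} (eval_path (brownian_path \<omega>))"
        using AE_levy_good
      proof eventually_elim
        case (elim \<omega>)
        have "(\<lambda>n. eval_path (levy_path \<omega> n) 0) \<longlonglongrightarrow> eval_path (brownian_path \<omega>) 0"
          by (rule brownian_path(2)[OF elim]) simp
        moreover have "eval_path (levy_path \<omega> n) 0 = 0" for n by (simp add: eval_levy_path)
        ultimately have "eval_path (brownian_path \<omega>) 0 = 0" by (simp add: LIMSEQ_const_iff)
        then show ?case using brownian_path(3)[OF elim] by simp
      qed
    qed
  qed
  moreover have "W.indep_vars (\<lambda>_. borel) (\<lambda>i x. eval_path x (t (Suc i)) - eval_path x (t i)) {..<k}"
    if t: "0 \<le> t 0 \<and> (\<forall>i<k. t i < t (Suc i)) \<and> t k \<le> 1" for k and t :: "nat \<Rightarrow> real"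
  proof -
    have t1: "0 \<le> t 0" and t2: "\<And>i. i < k \<Longrightarrow> t i \<le> t (Suc i)" and t3: "t k \<le> 1"
      using t by (auto intro: less_imp_le)
    have lo: "0 \<le> t i" if "i \<le> k" for i
      using that 
    proof (induction i)
      case (Suc i)
      then show ?case using t2[of i] by simp
    qed (use t1 in simp)
    have hi: "t i \<le> 1" if "i \<le> k" for i
      using that 
    proof (induction i rule: inc_induct)
      case (step n)
      then show ?case using t2[of n] by simp
    qed (use t3 in simp)
    \<comment> \<open>Beyond \<open>k\<close> nothing is known about \<open>t\<close>; the extension
      by 0 keeps every time in the unit interval, so that all increments are measurable.\<close>
    define t' where "t' i = (if i \<le> k then t i else 0)" for i
    have t': "t' i \<in> {0..1}" for i using lo hi by (auto simp: t'_def)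
    have "W.indep_vars (\<lambda>_. borel) (\<lambda>i x. eval_path x (t' (Suc i)) - eval_path x (t' i)) {..<k}"
    proof (rule W.joint_char_imp_indep_vars)
      show "(\<lambda>x. eval_path x (t' (Suc i)) - eval_path x (t' i)) \<in> borel_measurable W" for i
        using em t' by (intro borel_measurable_diff) auto
      fix \<theta>
      have "(\<Prod>i<k. char (distr W borel (\<lambda>x. eval_path x (t' (Suc i)) - eval_path x (t' i))) (\<theta> i))
        = (\<Prod>i<k. of_real (exp (- ((\<theta> i)\<^sup>2 * (t' (Suc i) - t' i) / 2))))"
      proof (rule prod.cong[OF refl])
        fix i assume i: "i \<in> {..<k}"
        have "t' i < t' (Suc i)" using i t by (simp add: t'_def)
        then show "char (distr W borel (\<lambda>x. eval_path x (t' (Suc i)) - eval_path x (t' i))) (\<theta> i)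
          = of_real (exp (- ((\<theta> i)\<^sup>2 * (t' (Suc i) - t' i) / 2)))"
          using t'[of i] t'[of "Suc i"] by (subst ch1) (auto simp: char_normal mult.commute)
      qed
      also have "\<dots> = of_real (exp (\<Sum>i<k. - ((\<theta> i)\<^sup>2 * (t' (Suc i) - t' i) / 2)))"
        by (simp add: exp_sum)
      also have "\<dots> = of_real (exp (- (\<Sum>i<k. (\<theta> i)\<^sup>2 * (t' (Suc i) - t' i)) / 2))"
        by (simp add: sum_negf sum_divide_distrib)
      also have "\<dots> = (\<integral>x. iexp (\<Sum>i<k. \<theta> i * (eval_path x (t' (Suc i)) - eval_path x (t' i))) \<partial>W)"
        using t lo hi by (intro ch[symmetric]) (auto simp: t'_def less_imp_le)
      finally show "(\<integral>x. iexp (\<Sum>i<k. \<theta> i * (eval_path x (t' (Suc i)) - eval_path x (t' i))) \<partial>W)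
        = (\<Prod>i<k. char (distr W borel (\<lambda>x. eval_path x (t' (Suc i)) - eval_path x (t' i))) (\<theta> i))" by simp
    qed
    then show ?thesis by (rule W.indep_vars_cong[THEN iffD1, rotated -1]) (auto simp: t'_def)
  qed
  ultimately show ?thesis
    using pW dist1 unfolding is_wiener_measure_def by (intro exI[of _ W]) auto
qed

section \<open>Square integrable functions\<close>

lemma square_integrable_measurable[measurable_dest]: "square_integrable M f \<Longrightarrow> f \<in> borel_measurable M"
  and square_integrableD: "square_integrable M f \<Longrightarrow> integrable M (\<lambda>x. (f x)\<^sup>2)"
  by (auto simp: square_integrable_def)

lemma square_integrable_mult:
  assumes f: "square_integrable M f" and g: "square_integrable M g"
  shows "integrable M (\<lambda>x. f x * g x)"
proof (rule Bochner_Integration.integrable_bound)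
  show "integrable M (\<lambda>x. (f x)\<^sup>2 + (g x)\<^sup>2)"
    using f g by (auto simp: square_integrable_def)
  show "(\<lambda>x. f x * g x) \<in> borel_measurable M"
    using f g by (auto simp: square_integrable_def)
  have "\<bar>a * b\<bar> \<le> a\<^sup>2 + b\<^sup>2" for a b :: real
  proof -
    have "2 * \<bar>a\<bar> * \<bar>b\<bar> \<le> \<bar>a\<bar>\<^sup>2 + \<bar>b\<bar>\<^sup>2" by (rule sum_squares_bound)
    moreover have "0 \<le> \<bar>a\<bar> * \<bar>b\<bar>" by simp
    ultimately show ?thesis unfolding abs_mult power2_abs by linarith
  qed
  then show "AE x in M. norm (f x * g x) \<le> norm ((f x)\<^sup>2 + (g x)\<^sup>2)" by simp
qed

lemma square_integrable_add:
  assumes f: "square_integrable M f" and g: "square_integrable M g"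
  shows "square_integrable M (\<lambda>x. f x + g x)"
  using assms square_integrable_mult[OF f g] unfolding square_integrable_def power2_sum
  by (auto intro!: Bochner_Integration.integrable_add simp: mult.assoc)

lemma square_integrable_cmult:
  "square_integrable M f \<Longrightarrow> square_integrable M (\<lambda>x. c * f x)"
  by (auto simp: square_integrable_def power_mult_distrib)

lemma square_integrable_minus: "square_integrable M f \<Longrightarrow> square_integrable M (\<lambda>x. - f x)"
  using square_integrable_cmult[of M f "- 1"] by simp

lemma square_integrable_diff:
  "square_integrable M f \<Longrightarrow> square_integrable M g \<Longrightarrow> square_integrable M (\<lambda>x. f x - g x)"
  using square_integrable_add[of M f "\<lambda>x. - g x"] square_integrable_minus[of M g] by simp

lemma square_integrable_sum:
  "(\<And>i. i \<in> A \<Longrightarrow> square_integrable M (f i)) \<Longrightarrow> square_integrable M (\<lambda>x. \<Sum>i\<in>A. f i x)"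
proof (induction A rule: infinite_finite_induct)
  case (insert i A)
  then show ?case using square_integrable_add[of M "f i" "\<lambda>x. \<Sum>i\<in>A. f i x"] by simp
qed (auto simp: square_integrable_def)

lemma square_integrable_bound:
  assumes "f \<in> borel_measurable M" "square_integrable M g" "\<And>x. \<bar>f x\<bar> \<le> \<bar>g x\<bar>"
  shows "square_integrable M f"
  unfolding square_integrable_def
proof
  show "integrable M (\<lambda>x. (f x)\<^sup>2)"
    using assms by (intro Bochner_Integration.integrable_bound[OF square_integrableD[OF assms(2)]])
      (auto simp: abs_le_square_iff)
qed (rule assms(1))

lemma square_integrable_abs: "square_integrable M f \<Longrightarrow> square_integrable M (\<lambda>x. \<bar>f x\<bar>)"
  by (auto simp: square_integrable_def)

lemma square_integrable_max:
  assumes "square_integrable M f" "square_integrable M g"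
  shows "square_integrable M (\<lambda>x. max (f x) (g x))"
proof (rule square_integrable_bound[OF _ square_integrable_add[OF assms[THEN square_integrable_abs]]])
  show "(\<lambda>x. max (f x) (g x)) \<in> borel_measurable M" using assms by measurable
qed auto

lemma (in prob_space) square_integrable_bounded:
  assumes "f \<in> borel_measurable M" "\<And>x. \<bar>f x\<bar> \<le> b"
  shows "square_integrable M f"
  unfolding square_integrable_def
proof
  have "(f x)\<^sup>2 \<le> b\<^sup>2" for x using assms(2)[of x] abs_le_square_iff[of "f x" b] by linarith
  then show "integrable M (\<lambda>x. (f x)\<^sup>2)"
    using assms(1) by (intro integrable_const_bound[of _ "b\<^sup>2"]) auto
qed (rule assms(1))

lemma norm_L2_nonneg: "0 \<le> norm_L2 M f"
  by (simp add: norm_L2_def)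

lemma norm_L2_power2: "(norm_L2 M f)\<^sup>2 = (\<integral>x. (f x)\<^sup>2 \<partial>M)"
  by (simp add: norm_L2_def)

lemma norm_L2_mono:
  assumes "f \<in> borel_measurable M" "square_integrable M g" "\<And>x. \<bar>f x\<bar> \<le> \<bar>g x\<bar>"
  shows "norm_L2 M f \<le> norm_L2 M g"
  unfolding norm_L2_def using square_integrable_bound[OF assms] assms
  by (intro real_sqrt_le_mono integral_mono) (auto simp: square_integrable_def abs_le_square_iff)

lemma norm_L2_abs: "norm_L2 M (\<lambda>x. \<bar>f x\<bar>) = norm_L2 M f"
  by (simp add: norm_L2_def)

lemma norm_L2_minus: "norm_L2 M (\<lambda>x. - f x) = norm_L2 M f"
  by (simp add: norm_L2_def)

lemma discriminant_nonneg_imp: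
  fixes A B C :: real
  assumes "\<And>t. 0 \<le> A - 2 * t * C + t\<^sup>2 * B" "0 \<le> B"
  shows "C\<^sup>2 \<le> A * B"
proof (cases "B = 0")
  case True
  have "C = 0"
  proof (rule ccontr)
    assume "C \<noteq> 0"
    \<comment> \<open>At this point the expression equals -1.\<close>
    then show False using assms(1)[of "(A + 1) / (2 * C)"] True by simp
  qed
  then show ?thesis using True by simp
next
  case False
  then have "B > 0" using assms(2) by simp
  then show ?thesis using assms(1)[of "C / B"] by (simp add: field_simps power2_eq_square)
qed

lemma norm_L2_Cauchy_Schwarz:
  assumes f: "square_integrable M f" and g: "square_integrable M g"
  shows "\<bar>\<integral>x. f x * g x \<partial>M\<bar> \<le> norm_L2 M f * norm_L2 M g"
proof -
  have "(\<integral>x. f x * g x \<partial>M)\<^sup>2 \<le> (\<integral>x. (f x)\<^sup>2 \<partial>M) * (\<integral>x. (g x)\<^sup>2 \<partial>M)"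
  proof (rule discriminant_nonneg_imp)
    fix t
    have "0 \<le> (\<integral>x. (f x - t * g x)\<^sup>2 \<partial>M)" by simp
    also have "\<dots> = (\<integral>x. (f x)\<^sup>2 - 2 * t * (f x * g x) + t\<^sup>2 * (g x)\<^sup>2 \<partial>M)"
      by (simp add: power2_diff power_mult_distrib algebra_simps)
    also have "\<dots> = (\<integral>x. (f x)\<^sup>2 \<partial>M) - 2 * t * (\<integral>x. f x * g x \<partial>M) + t\<^sup>2 * (\<integral>x. (g x)\<^sup>2 \<partial>M)"
      using square_integrableD[OF f] square_integrableD[OF g] square_integrable_mult[OF f g] by simp
    finally show "0 \<le> (\<integral>x. (f x)\<^sup>2 \<partial>M) - 2 * t * (\<integral>x. f x * g x \<partial>M) + t\<^sup>2 * (\<integral>x. (g x)\<^sup>2 \<partial>M)" .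
  qed simp
  then have "(\<integral>x. f x * g x \<partial>M)\<^sup>2 \<le> (norm_L2 M f * norm_L2 M g)\<^sup>2"
    by (simp add: norm_L2_power2 power_mult_distrib)
  then show ?thesis
    by (simp add: abs_le_square_iff[symmetric] abs_mult abs_of_nonneg[OF norm_L2_nonneg])
qed

lemma norm_L2_triangle:
  assumes f: "square_integrable M f" and g: "square_integrable M g"
  shows "norm_L2 M (\<lambda>x. f x + g x) \<le> norm_L2 M f + norm_L2 M g"
proof (rule power2_le_imp_le)
  have "(norm_L2 M (\<lambda>x. f x + g x))\<^sup>2 = (\<integral>x. (f x)\<^sup>2 + (g x)\<^sup>2 + 2 * (f x * g x) \<partial>M)"
    by (simp add: norm_L2_power2 power2_sum mult.assoc)
  also have "\<dots> = (norm_L2 M f)\<^sup>2 + (norm_L2 M g)\<^sup>2 + 2 * (\<integral>x. f x * g x \<partial>M)"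
    unfolding norm_L2_power2
    using square_integrableD[OF f] square_integrableD[OF g] square_integrable_mult[OF f g] by simp
  also have "\<dots> \<le> (norm_L2 M f + norm_L2 M g)\<^sup>2"
    using norm_L2_Cauchy_Schwarz[OF f g] by (simp add: power2_sum)
  finally show "(norm_L2 M (\<lambda>x. f x + g x))\<^sup>2 \<le> (norm_L2 M f + norm_L2 M g)\<^sup>2" .
qed (simp add: norm_L2_nonneg)

lemma norm_L2_sum:
  assumes "\<And>i. i \<in> A \<Longrightarrow> square_integrable M (f i)"
  shows "norm_L2 M (\<lambda>x. \<Sum>i\<in>A. f i x) \<le> (\<Sum>i\<in>A. norm_L2 M (f i))"
  using assms
proof (induction A rule: infinite_finite_induct)
  case (insert i A)
  have "norm_L2 M (\<lambda>x. f i x + (\<Sum>i\<in>A. f i x)) \<le> norm_L2 M (f i) + norm_L2 M (\<lambda>x. \<Sum>i\<in>A. f i x)"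
    using insert by (intro norm_L2_triangle square_integrable_sum) auto
  then show ?case using insert by fastforce
qed (auto simp: norm_L2_def)

lemma abs_norm_L2_diff:
  assumes f: "square_integrable M f" and g: "square_integrable M g"
  shows "\<bar>norm_L2 M f - norm_L2 M g\<bar> \<le> norm_L2 M (\<lambda>x. f x - g x)"
proof -
  have "norm_L2 M f \<le> norm_L2 M g + norm_L2 M (\<lambda>x. f x - g x)"
    using norm_L2_triangle[OF g square_integrable_diff[OF f g]] by simp
  moreover have "norm_L2 M g \<le> norm_L2 M f + norm_L2 M (\<lambda>x. f x - g x)"
    using norm_L2_triangle[OF f square_integrable_diff[OF g f]] norm_L2_minus[of M "\<lambda>x. f x - g x"] by simp
  ultimately show ?thesis by linarith
qed

lemma (in prob_space) norm_L2_const_bound: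
  assumes "f \<in> borel_measurable M" "\<And>x. \<bar>f x\<bar> \<le> b"
  shows "norm_L2 M f \<le> b"
proof -
  have b: "0 \<le> b" using assms(2) abs_ge_zero order_trans by blast
  have "norm_L2 M f \<le> norm_L2 M (\<lambda>_. b)"
    using assms b by (intro norm_L2_mono square_integrable_bounded[where b = b]) auto
  then show ?thesis using b by (simp add: norm_L2_def prob_space)
qed

lemma (in prob_space) integral_abs_le_norm_L2:
  assumes "square_integrable M f"
  shows "(\<integral>x. \<bar>f x\<bar> \<partial>M) \<le> norm_L2 M f"
proof -
  have "\<bar>\<integral>x. \<bar>f x\<bar> * 1 \<partial>M\<bar> \<le> norm_L2 M (\<lambda>x. \<bar>f x\<bar>) * norm_L2 M (\<lambda>_. 1)"
    by (intro norm_L2_Cauchy_Schwarz square_integrable_abs assms square_integrable_bounded[where b = 1]) auto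
  then show ?thesis unfolding norm_L2_abs by (simp add: norm_L2_def prob_space)
qed

section \<open>Measure-preserving maps\<close>

locale measure_preserving = prob_space M for M :: "'a measure" +
  fixes T :: "'a \<Rightarrow> 'a"
  assumes invariant: "invariant_measure M T"
begin

lemma measurable_T[measurable]: "T \<in> measurable M M"
  using invariant by (simp add: invariant_measure_def)

lemma measurable_T_pow[measurable]: "(T ^^ j) \<in> measurable M M"
  by (induction j) (auto simp: comp_def id_def)

lemma distr_T: "distr M M T = M"
  using invariant by (intro measure_eqI) (auto simp: emeasure_distr invariant_measure_def)

lemma integral_T:
  fixes f :: "'a \<Rightarrow> 'b::{banach, second_countable_topology}"
  assumes "f \<in> borel_measurable M"
  shows "(\<integral>x. f (T x) \<partial>M) = (\<integral>x. f x \<partial>M)"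
  using integral_distr[OF measurable_T assms] by (simp add: distr_T)

lemma integrable_T:
  fixes f :: "'a \<Rightarrow> 'b::{banach, second_countable_topology}"
  shows "integrable M f \<Longrightarrow> integrable M (\<lambda>x. f (T x))"
  using integrable_distr[OF measurable_T, of f] by (simp add: distr_T)

lemma integral_T_pow:
  fixes f :: "'a \<Rightarrow> 'b::{banach, second_countable_topology}"
  assumes [measurable]: "f \<in> borel_measurable M"
  shows "(\<integral>x. f ((T ^^ j) x) \<partial>M) = (\<integral>x. f x \<partial>M)"
proof (induction j)
  case (Suc j)
  have "(\<integral>x. f ((T ^^ Suc j) x) \<partial>M) = (\<integral>x. f ((T ^^ j) (T x)) \<partial>M)"
    by (simp add: funpow_swap1)
  also have "\<dots> = (\<integral>x. f ((T ^^ j) x) \<partial>M)" by (rule integral_T) measurable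
  finally show ?case using Suc by simp
qed simp

lemma integrable_T_pow:
  fixes f :: "'a \<Rightarrow> 'b::{banach, second_countable_topology}"
  assumes f: "integrable M f"
  shows "integrable M (\<lambda>x. f ((T ^^ j) x))"
proof (induction j)
  case (Suc j)
  have "integrable M (\<lambda>x. f ((T ^^ j) (T x)))" by (rule integrable_T[OF Suc])
  then show ?case by (simp add: funpow_swap1)
qed (simp add: f)

lemma AE_T:
  assumes "AE x in M. P x" shows "AE x in M. P (T x)"
proof -
  have "AE x in distr M M T. P x" using assms unfolding distr_T .
  then show ?thesis by (rule AE_distrD[OF measurable_T])
qed

lemma square_integrable_T_pow: "square_integrable M f \<Longrightarrow> square_integrable M (\<lambda>x. f ((T ^^ j) x))"
  using integrable_T_pow[of "\<lambda>x. (f x)\<^sup>2" j] by (auto simp: square_integrable_def)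

lemma square_integrable_T: "square_integrable M f \<Longrightarrow> square_integrable M (\<lambda>x. f (T x))"
  using square_integrable_T_pow[of f 1] by simp

lemma norm_L2_T_pow: "f \<in> borel_measurable M \<Longrightarrow> norm_L2 M (\<lambda>x. f ((T ^^ j) x)) = norm_L2 M f"
  unfolding norm_L2_def by (subst integral_T_pow) auto

lemma norm_L2_T: "f \<in> borel_measurable M \<Longrightarrow> norm_L2 M (\<lambda>x. f (T x)) = norm_L2 M f"
  using norm_L2_T_pow[of f 1] by simp

lemma birkhoff_sum_0[simp]: "birkhoff_sum T f 0 y = 0"
  by (simp add: birkhoff_sum_def)

lemma birkhoff_sum_Suc: "birkhoff_sum T f (Suc n) y = f y + birkhoff_sum T f n (T y)"
  unfolding birkhoff_sum_def by (subst sum.lessThan_Suc_shift) (simp add: funpow_swap1)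

lemma birkhoff_sum_add_index: "birkhoff_sum T f (j + k) y = birkhoff_sum T f j y + birkhoff_sum T f k ((T ^^ j) y)"
proof (induction j arbitrary: y)
  case (Suc j)
  then show ?case by (simp add: birkhoff_sum_Suc funpow_swap1)
qed simp

lemma birkhoff_sum_diff: "birkhoff_sum T (\<lambda>x. f x - g x) n y = birkhoff_sum T f n y - birkhoff_sum T g n y"
  by (simp add: birkhoff_sum_def sum_subtractf)

lemma birkhoff_sum_minus: "birkhoff_sum T (\<lambda>x. - f x) n y = - birkhoff_sum T f n y"
  by (simp add: birkhoff_sum_def sum_negf)

lemma birkhoff_sum_comp: "birkhoff_sum T (\<lambda>x. f ((T ^^ k) x)) n y = birkhoff_sum T f n ((T ^^ k) y)"
  unfolding birkhoff_sum_def by (simp flip: funpow_add comp_apply[of "T ^^ _" "T ^^ _"] add: add.commute)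

lemma measurable_birkhoff_sum[measurable]:
  assumes [measurable]: "f \<in> borel_measurable M"
  shows "birkhoff_sum T f n \<in> borel_measurable M"
  unfolding birkhoff_sum_def[abs_def] by measurable

lemma square_integrable_birkhoff_sum: "square_integrable M f \<Longrightarrow> square_integrable M (birkhoff_sum T f n)"
  unfolding birkhoff_sum_def[abs_def] by (intro square_integrable_sum square_integrable_T_pow)

lemma abs_birkhoff_sum_le: "(\<And>x. \<bar>f x\<bar> \<le> b) \<Longrightarrow> \<bar>birkhoff_sum T f n y\<bar> \<le> real n * b"
  unfolding birkhoff_sum_def using sum_bounded_above[of "{..<n}" "\<lambda>j. \<bar>f ((T ^^ j) y)\<bar>" b]
  by (intro order_trans[OF sum_abs]) simp

section \<open>Maximal functions\<close>

definition max_birkhoff :: "('a \<Rightarrow> real) \<Rightarrow> nat \<Rightarrow> 'a \<Rightarrow> real" where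
  "max_birkhoff f n y = Max ((\<lambda>j. \<bar>birkhoff_sum T f j y\<bar>) ` {..n})"

lemma max_birkhoff_ge: "j \<le> n \<Longrightarrow> \<bar>birkhoff_sum T f j y\<bar> \<le> max_birkhoff f n y"
  unfolding max_birkhoff_def by (intro Max_ge) auto

lemma max_birkhoff_le: "(\<And>j. j \<le> n \<Longrightarrow> \<bar>birkhoff_sum T f j y\<bar> \<le> b) \<Longrightarrow> max_birkhoff f n y \<le> b"
  unfolding max_birkhoff_def by (subst Max_le_iff) auto

lemma max_birkhoff_nonneg: "0 \<le> max_birkhoff f n y"
  using max_birkhoff_ge[of 0 n f y] by simp

lemma measurable_max_birkhoff[measurable]:
  assumes [measurable]: "f \<in> borel_measurable M"
  shows "max_birkhoff f n \<in> borel_measurable M"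
  unfolding max_birkhoff_def[abs_def] by (intro borel_measurable_Max) auto

lemma max_birkhoff_le_sum: "max_birkhoff f n y \<le> (\<Sum>i<n. \<bar>f ((T ^^ i) y)\<bar>)"
proof (rule max_birkhoff_le)
  fix j assume "j \<le> n"
  have "\<bar>birkhoff_sum T f j y\<bar> \<le> (\<Sum>i<j. \<bar>f ((T ^^ i) y)\<bar>)"
    unfolding birkhoff_sum_def by (rule sum_abs)
  also have "\<dots> \<le> (\<Sum>i<n. \<bar>f ((T ^^ i) y)\<bar>)"
    using \<open>j \<le> n\<close> by (intro sum_mono2) auto
  finally show "\<bar>birkhoff_sum T f j y\<bar> \<le> (\<Sum>i<n. \<bar>f ((T ^^ i) y)\<bar>)" .
qed

lemma square_integrable_max_birkhoff:
  assumes f: "square_integrable M f"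
  shows "square_integrable M (max_birkhoff f n)"
    and norm_max_birkhoff_le: "norm_L2 M (max_birkhoff f n) \<le> real n * norm_L2 M f"
proof -
  have [measurable]: "f \<in> borel_measurable M" using f by measurable
  have s: "square_integrable M (\<lambda>y. \<Sum>i<n. \<bar>f ((T ^^ i) y)\<bar>)"
    by (intro square_integrable_sum square_integrable_abs square_integrable_T_pow f)
  have b: "\<bar>max_birkhoff f n y\<bar> \<le> \<bar>\<Sum>i<n. \<bar>f ((T ^^ i) y)\<bar>\<bar>" for y
    using max_birkhoff_le_sum[of f n y] max_birkhoff_nonneg[of f n y] by linarith
  show "square_integrable M (max_birkhoff f n)"
    by (rule square_integrable_bound[OF _ s b]) measurable
  have "norm_L2 M (max_birkhoff f n) \<le> norm_L2 M (\<lambda>y. \<Sum>i<n. \<bar>f ((T ^^ i) y)\<bar>)"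
    by (rule norm_L2_mono[OF _ s b]) measurable
  also have "\<dots> \<le> (\<Sum>i<n. norm_L2 M (\<lambda>y. \<bar>f ((T ^^ i) y)\<bar>))"
    by (intro norm_L2_sum square_integrable_abs square_integrable_T_pow f)
  also have "\<dots> = real n * norm_L2 M f" by (simp add: norm_L2_abs norm_L2_T_pow)
  finally show "norm_L2 M (max_birkhoff f n) \<le> real n * norm_L2 M f" .
qed

lemma norm_max_birkhoff_sum:
  assumes f: "\<And>i. i \<in> A \<Longrightarrow> square_integrable M (f i)"
  shows "norm_L2 M (max_birkhoff (\<lambda>x. \<Sum>i\<in>A. f i x) n) \<le> (\<Sum>i\<in>A. norm_L2 M (max_birkhoff (f i) n))"
proof -
  have b: "\<bar>max_birkhoff (\<lambda>x. \<Sum>i\<in>A. f i x) n y\<bar> \<le> \<bar>\<Sum>i\<in>A. max_birkhoff (f i) n y\<bar>" for y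
  proof -
    have "max_birkhoff (\<lambda>x. \<Sum>i\<in>A. f i x) n y \<le> (\<Sum>i\<in>A. max_birkhoff (f i) n y)"
    proof (rule max_birkhoff_le)
      fix j assume j: "j \<le> n"
      have "birkhoff_sum T (\<lambda>x. \<Sum>i\<in>A. f i x) j y = (\<Sum>i\<in>A. birkhoff_sum T (f i) j y)"
        unfolding birkhoff_sum_def by (rule sum.swap)
      then show "\<bar>birkhoff_sum T (\<lambda>x. \<Sum>i\<in>A. f i x) j y\<bar> \<le> (\<Sum>i\<in>A. max_birkhoff (f i) n y)"
        using max_birkhoff_ge[OF j] by (auto intro!: order_trans[OF sum_abs] sum_mono)
    qed
    then show ?thesis using max_birkhoff_nonneg[of _ n y] by (simp add: abs_of_nonneg sum_nonneg)
  qed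
  have "norm_L2 M (max_birkhoff (\<lambda>x. \<Sum>i\<in>A. f i x) n) \<le> norm_L2 M (\<lambda>y. \<Sum>i\<in>A. max_birkhoff (f i) n y)"
  proof (rule norm_L2_mono[OF _ _ b])
    show "max_birkhoff (\<lambda>x. \<Sum>i\<in>A. f i x) n \<in> borel_measurable M"
      using f by (intro measurable_max_birkhoff borel_measurable_sum square_integrable_measurable) auto
    show "square_integrable M (\<lambda>y. \<Sum>i\<in>A. max_birkhoff (f i) n y)"
      by (intro square_integrable_sum square_integrable_max_birkhoff f)
  qed
  also have "\<dots> \<le> (\<Sum>i\<in>A. norm_L2 M (max_birkhoff (f i) n))"
    by (intro norm_L2_sum square_integrable_max_birkhoff f)
  finally show ?thesis .
qed

lemma norm_max_birkhoff_add:
  assumes "square_integrable M f" "square_integrable M g"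
  shows "norm_L2 M (max_birkhoff (\<lambda>x. f x + g x) n) \<le> norm_L2 M (max_birkhoff f n) + norm_L2 M (max_birkhoff g n)"
  using norm_max_birkhoff_sum[of "UNIV :: bool set" "\<lambda>b. if b then f else g" n] assms by (simp add: UNIV_bool add.commute)

lemma max_birkhoff_comp: "max_birkhoff (\<lambda>x. f ((T ^^ k) x)) n y = max_birkhoff f n ((T ^^ k) y)"
  by (simp add: max_birkhoff_def birkhoff_sum_comp)

lemma norm_max_birkhoff_comp:
  "f \<in> borel_measurable M \<Longrightarrow> norm_L2 M (max_birkhoff (\<lambda>x. f ((T ^^ k) x)) n) = norm_L2 M (max_birkhoff f n)"
  by (simp add: max_birkhoff_comp[abs_def] norm_L2_T_pow)

section \<open>Reverse martingale differences\<close>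

text \<open>Vanishing conditional expectation given the preimage \<sigma>-algebra of
  \<open>T\<close>, phrased as orthogonality to the functions \<open>g o T\<close>. Along an orbit
  the values of \<open>m\<close> are then martingale differences in reversed time.\<close>

definition martingale_difference :: "('a \<Rightarrow> real) \<Rightarrow> bool" where
  "martingale_difference m \<longleftrightarrow> square_integrable M m \<and>
     (\<forall>g. square_integrable M g \<longrightarrow> (\<integral>x. m x * g (T x) \<partial>M) = 0)"

lemma martingale_differenceD:
  "martingale_difference m \<Longrightarrow> square_integrable M m"
  "martingale_difference m \<Longrightarrow> square_integrable M g \<Longrightarrow> (\<integral>x. m x * g (T x) \<partial>M) = 0"
  by (auto simp: martingale_difference_def)

lemma martingale_difference_diff:
  assumes a: "martingale_difference a" and b: "martingale_difference b"
  shows "martingale_difference (\<lambda>x. a x - b x)"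
  unfolding martingale_difference_def
proof (intro conjI allI impI)
  show "square_integrable M (\<lambda>x. a x - b x)"
    by (intro square_integrable_diff martingale_differenceD a b)
  fix g assume g: "square_integrable M g"
  have "(\<integral>x. (a x - b x) * g (T x) \<partial>M) = (\<integral>x. a x * g (T x) \<partial>M) - (\<integral>x. b x * g (T x) \<partial>M)"
    unfolding left_diff_distrib
    by (intro Bochner_Integration.integral_diff square_integrable_mult square_integrable_T g martingale_differenceD a b)
  then show "(\<integral>x. (a x - b x) * g (T x) \<partial>M) = 0"
    using martingale_differenceD(2)[OF a g] martingale_differenceD(2)[OF b g] by simp
qed

lemma martingale_difference_sum:
  "(\<And>i. i \<in> A \<Longrightarrow> martingale_difference (f i)) \<Longrightarrow> martingale_difference (\<lambda>x. \<Sum>i\<in>A. f i x)"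
proof (induction A rule: infinite_finite_induct)
  case (insert i A)
  have z: "martingale_difference (\<lambda>x. 0)"
    using square_integrable_bounded[of "\<lambda>_. 0" 0] by (simp add: martingale_difference_def)
  have "martingale_difference (\<lambda>x. f i x - (0 - (\<Sum>i\<in>A. f i x)))"
    using insert by (intro martingale_difference_diff z) auto
  then show ?case using insert by simp
qed (use square_integrable_bounded[of "\<lambda>_. 0" 0] in \<open>auto simp: martingale_difference_def\<close>)

lemma martingale_difference_minus: "martingale_difference m \<Longrightarrow> martingale_difference (\<lambda>x. - m x)"
  using square_integrable_minus[of M m] by (auto simp: martingale_difference_def)

text \<open>Pythagoras: \<open>m\<close> is orthogonal to the rest of the sum, which is a function
  of \<open>T\<close>.\<close>

lemma norm_birkhoff_sum_martingale:
  assumes m: "martingale_difference m"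
  shows "(\<integral>x. (birkhoff_sum T m n x)\<^sup>2 \<partial>M) = real n * (norm_L2 M m)\<^sup>2"
proof (induction n)
  case (Suc n)
  note m2 = martingale_differenceD(1)[OF m]
  have [measurable]: "m \<in> borel_measurable M" using m2 by measurable
  note s2 = square_integrable_birkhoff_sum[OF m2, of n]
  have "(\<integral>x. (birkhoff_sum T m (Suc n) x)\<^sup>2 \<partial>M)
    = (\<integral>x. (m x)\<^sup>2 + (birkhoff_sum T m n (T x))\<^sup>2 + 2 * (m x * birkhoff_sum T m n (T x)) \<partial>M)"
    by (simp add: birkhoff_sum_Suc power2_sum mult.assoc)
  also have "\<dots> = (\<integral>x. (m x)\<^sup>2 \<partial>M) + (\<integral>x. (birkhoff_sum T m n (T x))\<^sup>2 \<partial>M) + 2 * (\<integral>x. m x * birkhoff_sum T m n (T x) \<partial>M)"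
    using square_integrableD[OF m2] square_integrableD[OF square_integrable_T[OF s2]]
      square_integrable_mult[OF m2 square_integrable_T[OF s2]] by simp
  also have "(\<integral>x. (birkhoff_sum T m n (T x))\<^sup>2 \<partial>M) = (\<integral>x. (birkhoff_sum T m n x)\<^sup>2 \<partial>M)"
    by (rule integral_T) measurable
  finally show ?case using Suc martingale_differenceD(2)[OF m s2] by (simp add: norm_L2_power2 algebra_simps)
qed simp

text \<open>The maximum of the tail sums \<open>m (T\<^sup>j y) + \<dots> + m (T\<^sup>n\<^sup>-\<^sup>1 y)\<close>, that is, of the partial sums
  of the martingale obtained by reversing time.\<close>

fun tail_max :: "('a \<Rightarrow> real) \<Rightarrow> nat \<Rightarrow> 'a \<Rightarrow> real" where
  "tail_max m 0 y = 0"
| "tail_max m (Suc n) y = max (tail_max m n (T y)) (birkhoff_sum T m (Suc n) y)"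

lemma tail_max_nonneg: "0 \<le> tail_max m n y"
  by (induction n arbitrary: y) (auto simp: le_max_iff_disj)

lemma tail_le_tail_max: "j \<le> n \<Longrightarrow> birkhoff_sum T m (n - j) ((T ^^ j) y) \<le> tail_max m n y"
proof (induction n arbitrary: j y)
  case (Suc n)
  show ?case
  proof (cases j)
    case 0
    then show ?thesis by simp
  next
    case (Suc i)
    then have "birkhoff_sum T m (n - i) ((T ^^ i) (T y)) \<le> tail_max m n (T y)"
      using Suc.IH[of i "T y"] Suc.prems by simp
    then show ?thesis using Suc by (simp add: funpow_swap1 le_max_iff_disj)
  qed
qed simp

text \<open>A partial sum is the full sum minus a tail, and the full sum is the tail from 0; each is
  controlled by the tail maxima of \<open>m\<close> and \<open>- m\<close>. The factor 2 is the
  price for carrying a maximal inequality in reversed time over to forward sums.\<close>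

lemma max_birkhoff_le_tail_max: "max_birkhoff m n y \<le> 2 * (tail_max m n y + tail_max (\<lambda>x. - m x) n y)"
proof (rule max_birkhoff_le)
  fix j assume j: "j \<le> n"
  have t: "\<bar>birkhoff_sum T m (n - i) ((T ^^ i) y)\<bar> \<le> tail_max m n y + tail_max (\<lambda>x. - m x) n y" if "i \<le> n" for i
    using tail_le_tail_max[OF that, of m y] tail_le_tail_max[OF that, of "\<lambda>x. - m x" y]
      tail_max_nonneg[of m n y] tail_max_nonneg[of "\<lambda>x. - m x" n y] by (simp add: birkhoff_sum_minus)
  have "birkhoff_sum T m n y = birkhoff_sum T m j y + birkhoff_sum T m (n - j) ((T ^^ j) y)"
    using birkhoff_sum_add_index[of m j "n - j" y] j by simp
  then show "\<bar>birkhoff_sum T m j y\<bar> \<le> 2 * (tail_max m n y + tail_max (\<lambda>x. - m x) n y)"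
    using t[OF j] t[of 0] by simp
qed

lemma measurable_tail_max[measurable]: "m \<in> borel_measurable M \<Longrightarrow> tail_max m n \<in> borel_measurable M"
proof (induction n)
  case (Suc n)
  have [measurable]: "m \<in> borel_measurable M" "tail_max m n \<in> borel_measurable M" using Suc by auto
  show ?case unfolding tail_max.simps[abs_def] by measurable
next
  case 0
  have "tail_max m 0 = (\<lambda>_. 0)" by auto
  then show ?case by simp
qed

lemma square_integrable_tail_max: "square_integrable M m \<Longrightarrow> square_integrable M (tail_max m n)"
proof (induction n)
  case 0
  then show ?case using square_integrable_bounded[of "\<lambda>_. 0" 0] by simp
next
  case (Suc n)
  then show ?case unfolding tail_max.simps[abs_def]
    by (intro square_integrable_max square_integrable_T square_integrable_birkhoff_sum) auto
qed

text \<open>Doob's inequality: for suitable \<open>\<phi>\<close> and \<open>\<psi>\<close> the function $\phi(R) - \psi(R) S$ of the tail maximum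
  and the full sum has non-positive mean because $\phi(x) - \psi(x) s$ is minimal at $x = s$; this
  is used for $x^2 - 2 x s$ and $3 x^4 - 4 x^3 s$.\<close>

lemma tail_max_Doob:
  fixes \<phi> \<psi> :: "real \<Rightarrow> real"
  assumes m: "martingale_difference m"
    and opt: "\<And>r s. 0 \<le> r \<Longrightarrow> \<phi> (max r s) - \<psi> (max r s) * s \<le> \<phi> r - \<psi> r * s" and zero: "\<phi> 0 \<le> 0"
    and i\<phi>: "\<And>n. integrable M (\<lambda>x. \<phi> (tail_max m n x))"
    and \<psi>2: "\<And>n. square_integrable M (\<lambda>x. \<psi> (tail_max m n x))"
  shows "(\<integral>x. \<phi> (tail_max m n x) \<partial>M) \<le> (\<integral>x. \<psi> (tail_max m n x) * birkhoff_sum T m n x \<partial>M)"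
proof -
  note m2 = martingale_differenceD(1)[OF m]
  let ?R = "tail_max m" and ?S = "birkhoff_sum T m"
  note i\<psi> = square_integrable_mult[OF \<psi>2 square_integrable_birkhoff_sum[OF m2]]
  note im = square_integrable_mult[OF m2 square_integrable_T[OF \<psi>2]]
  have i: "integrable M (\<lambda>x. \<phi> (?R n x) - \<psi> (?R n x) * ?S n x)" for n
    by (intro Bochner_Integration.integrable_diff i\<phi> i\<psi>)
  have "(\<integral>x. \<phi> (?R n x) - \<psi> (?R n x) * ?S n x \<partial>M) \<le> 0"
  proof (induction n)
    case 0
    then show ?case using zero by (simp add: prob_space)
  next
    case (Suc n)
    \<comment> \<open>The new tail maximum is the larger of the shifted old one and the new full sum
      \<open>s\<close>, so \<open>opt\<close> applies with this \<open>s\<close>. Writing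
      \<open>s\<close> as \<open>m x\<close> plus the shifted sum leaves a cross term
      \<open>m x * \<psi> (?R n (T x))\<close>, which has mean zero.\<close>
    have "(\<integral>x. \<phi> (?R (Suc n) x) - \<psi> (?R (Suc n) x) * ?S (Suc n) x \<partial>M)
      \<le> (\<integral>x. (\<phi> (?R n (T x)) - \<psi> (?R n (T x)) * ?S n (T x)) - m x * \<psi> (?R n (T x)) \<partial>M)"
    proof (rule integral_mono[OF i])
      show "integrable M (\<lambda>x. (\<phi> (?R n (T x)) - \<psi> (?R n (T x)) * ?S n (T x)) - m x * \<psi> (?R n (T x)))"
        by (intro Bochner_Integration.integrable_diff[of M] integrable_T[OF i] im)
      show "\<phi> (?R (Suc n) x) - \<psi> (?R (Suc n) x) * ?S (Suc n) x
        \<le> (\<phi> (?R n (T x)) - \<psi> (?R n (T x)) * ?S n (T x)) - m x * \<psi> (?R n (T x))" for x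
        using opt[OF tail_max_nonneg, of m n "T x" "?S (Suc n) x"] by (simp add: birkhoff_sum_Suc algebra_simps)
    qed
    also have "\<dots> = (\<integral>x. \<phi> (?R n (T x)) - \<psi> (?R n (T x)) * ?S n (T x) \<partial>M) - (\<integral>x. m x * \<psi> (?R n (T x)) \<partial>M)"
      by (rule Bochner_Integration.integral_diff[OF integrable_T[OF i] im])
    also have "\<dots> = (\<integral>x. \<phi> (?R n x) - \<psi> (?R n x) * ?S n x \<partial>M)"
      using integral_T[OF borel_measurable_integrable[OF i]] martingale_differenceD(2)[OF m \<psi>2] by simp
    finally show ?case using Suc by linarith
  qed
  then show ?thesis using i\<phi> i\<psi> by simp
qed

lemma tail_max_L2:
  assumes m: "martingale_difference m"
  shows "(\<integral>x. (tail_max m n x)\<^sup>2 \<partial>M) \<le> 4 * real n * (norm_L2 M m)\<^sup>2"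
proof -
  note m2 = martingale_differenceD(1)[OF m]
  let ?R = "tail_max m n" and ?S = "birkhoff_sum T m n"
  note S2 = square_integrable_birkhoff_sum[OF m2]
  note R2 = square_integrable_tail_max[OF m2]
  note intR = square_integrableD[OF R2] and intS = square_integrableD[OF S2]
  have "(\<integral>x. (?R x)\<^sup>2 \<partial>M) \<le> (\<integral>x. 2 * ?R x * ?S x \<partial>M)"
  proof (rule tail_max_Doob[where \<phi> = "\<lambda>x. x\<^sup>2" and \<psi> = "\<lambda>x. 2 * x", OF m])
    fix r s :: real
    have "0 \<le> (r - s)\<^sup>2" by simp
    then show "(max r s)\<^sup>2 - 2 * max r s * s \<le> r\<^sup>2 - 2 * r * s"
      by (cases "r \<le> s") (simp_all add: max_def power2_eq_square algebra_simps)
  qed (simp_all add: intR square_integrable_cmult R2)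
  \<comment> \<open>Young's inequality, weighted so that half of the left-hand side remains after
    absorption; the constant becomes 2 / (1/2) = 4.\<close>
  also have "\<dots> \<le> (\<integral>x. (?R x)\<^sup>2 / 2 + 2 * (?S x)\<^sup>2 \<partial>M)"
  proof (rule integral_mono)
    show "integrable M (\<lambda>x. 2 * ?R x * ?S x)"
      by (rule square_integrable_mult[OF square_integrable_cmult[OF R2] S2])
    show "integrable M (\<lambda>x. (?R x)\<^sup>2 / 2 + 2 * (?S x)\<^sup>2)"
      by (intro Bochner_Integration.integrable_add integrable_mult_right integrable_divide intR intS)
    fix x
    have "0 \<le> (?R x - 2 * ?S x)\<^sup>2" by simp
    then show "2 * ?R x * ?S x \<le> (?R x)\<^sup>2 / 2 + 2 * (?S x)\<^sup>2"
      by (simp add: power2_eq_square algebra_simps)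
  qed
  also have "\<dots> = (\<integral>x. (?R x)\<^sup>2 \<partial>M) / 2 + 2 * (real n * (norm_L2 M m)\<^sup>2)"
    using intR intS norm_birkhoff_sum_martingale[OF m] by simp
  finally show ?thesis by simp
qed

text \<open>The square of 2 (R + R') is at most 8 R^2 + 8 R'^2, and each tail maximum contributes 4
  n times the squared norm: together 64, the square of 8.\<close>

lemma norm_max_birkhoff_martingale:
  assumes m: "martingale_difference m"
  shows "norm_L2 M (max_birkhoff m n) \<le> 8 * sqrt (real n) * norm_L2 M m"
proof (rule power2_le_imp_le)
  note m2 = martingale_differenceD(1)[OF m]
  have [measurable]: "m \<in> borel_measurable M" using m2 by measurable
  let ?R = "tail_max m n" and ?R' = "tail_max (\<lambda>x. - m x) n"
  note R = square_integrableD[OF square_integrable_tail_max[OF m2]]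
    square_integrableD[OF square_integrable_tail_max[OF square_integrable_minus[OF m2]]]
  have "(norm_L2 M (max_birkhoff m n))\<^sup>2 \<le> (\<integral>x. 8 * (?R x)\<^sup>2 + 8 * (?R' x)\<^sup>2 \<partial>M)"
    unfolding norm_L2_power2
  proof (rule integral_mono)
    show "integrable M (\<lambda>x. (max_birkhoff m n x)\<^sup>2)"
      by (intro square_integrableD square_integrable_max_birkhoff m2)
    show "integrable M (\<lambda>x. 8 * (?R x)\<^sup>2 + 8 * (?R' x)\<^sup>2)"
      by (intro Bochner_Integration.integrable_add integrable_mult_right R)
    fix x
    have "(max_birkhoff m n x)\<^sup>2 \<le> (2 * (?R x + ?R' x))\<^sup>2"
      by (intro power_mono max_birkhoff_le_tail_max max_birkhoff_nonneg)
    also have "\<dots> \<le> 8 * (?R x)\<^sup>2 + 8 * (?R' x)\<^sup>2"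
      using sum_squares_bound[of "?R x" "?R' x"] by (simp add: power2_eq_square algebra_simps)
    finally show "(max_birkhoff m n x)\<^sup>2 \<le> 8 * (?R x)\<^sup>2 + 8 * (?R' x)\<^sup>2" .
  qed
  also have "\<dots> = 8 * (\<integral>x. (?R x)\<^sup>2 \<partial>M) + 8 * (\<integral>x. (?R' x)\<^sup>2 \<partial>M)"
    using R by simp
  also have "\<dots> \<le> 64 * real n * (norm_L2 M m)\<^sup>2"
    using tail_max_L2[OF m, of n] tail_max_L2[OF martingale_difference_minus[OF m], of n] by (simp add: norm_L2_minus)
  also have "\<dots> = (8 * sqrt (real n) * norm_L2 M m)\<^sup>2" by (simp add: power_mult_distrib)
  finally show "(norm_L2 M (max_birkhoff m n))\<^sup>2 \<le> (8 * sqrt (real n) * norm_L2 M m)\<^sup>2" .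
qed (simp add: norm_L2_nonneg)


text \<open>Let s be the sum after the first term. In the expansion of (m + s)^4 the term m s^3 has
  mean zero, and m^3 s is absorbed into squares. What remains adds at most (8 n + 3) b^4 per step,
  and 4 n^2 + 8 n + 3 stays below 4 (n + 1)^2.\<close>

lemma birkhoff_sum_moment4:
  assumes m: "martingale_difference m" and b: "\<And>x. \<bar>m x\<bar> \<le> b"
  shows "(\<integral>x. (birkhoff_sum T m n x) ^ 4 \<partial>M) \<le> 4 * (real n)\<^sup>2 * b ^ 4"
proof (induction n)
  case (Suc n)
  note m2 = martingale_differenceD(1)[OF m]
  have mm[measurable]: "m \<in> borel_measurable M" using m2 by measurable
  have b0: "0 \<le> b" using b abs_ge_zero order_trans by blast
  let ?s = "\<lambda>x. birkhoff_sum T m n (T x)"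
  have sb: "\<bar>birkhoff_sum T m k x\<bar> \<le> real k * b" for k x by (rule abs_birkhoff_sum_le[OF b])
  have ib: "integrable M f" if "f \<in> borel_measurable M" "\<And>x. \<bar>f x\<bar> \<le> c" for f :: "'a \<Rightarrow> real" and c
    using that by (rule integrable_bounded_real)
  have pw: "\<bar>(birkhoff_sum T m k x) ^ j\<bar> \<le> (real k * b) ^ j" for k j x
    unfolding power_abs by (intro power_mono sb) simp
  have i4: "integrable M (\<lambda>x. (birkhoff_sum T m k x) ^ j)" for k j
    by (rule ib[OF _ pw]) measurable
  have i4T: "integrable M (\<lambda>x. (?s x) ^ j)" for j
    using integrable_T[OF i4] .
  have s3: "square_integrable M (\<lambda>x. (birkhoff_sum T m n x) ^ 3)"
    by (rule square_integrable_bounded[OF _ pw]) measurable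
  have i3: "integrable M (\<lambda>x. m x * (?s x) ^ 3)"
    by (rule square_integrable_mult[OF m2 square_integrable_T[OF s3]])
  have pt: "(m x + ?s x) ^ 4 \<le> (?s x) ^ 4 + 4 * (m x * (?s x) ^ 3) + 8 * b\<^sup>2 * (?s x)\<^sup>2 + 3 * b ^ 4" for x
  proof -
    have m2b: "(m x)\<^sup>2 \<le> b\<^sup>2" using b[of x] b0 by (simp add: abs_le_square_iff[symmetric])
    then have m4b: "(m x) ^ 4 \<le> b ^ 4"
      using mult_mono[OF m2b m2b] by (simp add: power4_eq_xxxx power2_eq_square mult.assoc)
    \<comment> \<open>Expanded, this is 4 m^3 s \<le> 2 m^2 s^2 + 2 m^4, which raises the
      coefficients 6 of m^2 s^2 and 1 of m^4 to 8 and 3.\<close>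
    have "0 \<le> 2 * (m x)\<^sup>2 * (?s x - m x)\<^sup>2" by simp
    then have "(m x + ?s x) ^ 4 \<le> (?s x) ^ 4 + 4 * (m x * (?s x) ^ 3) + 8 * (m x)\<^sup>2 * (?s x)\<^sup>2 + 3 * (m x) ^ 4"
      by (simp add: power4_eq_xxxx power3_eq_cube power2_eq_square algebra_simps)
    moreover have "8 * (m x)\<^sup>2 * (?s x)\<^sup>2 \<le> 8 * b\<^sup>2 * (?s x)\<^sup>2"
      using m2b by (intro mult_right_mono) auto
    ultimately show ?thesis using m4b by linarith
  qed
  have "(\<integral>x. (birkhoff_sum T m (Suc n) x) ^ 4 \<partial>M)
    \<le> (\<integral>x. (?s x) ^ 4 + 4 * (m x * (?s x) ^ 3) + 8 * b\<^sup>2 * (?s x)\<^sup>2 + 3 * b ^ 4 \<partial>M)"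
  proof (rule integral_mono[OF i4])
    show "integrable M (\<lambda>x. (?s x) ^ 4 + 4 * (m x * (?s x) ^ 3) + 8 * b\<^sup>2 * (?s x)\<^sup>2 + 3 * b ^ 4)"
      by (intro Bochner_Integration.integrable_add integrable_mult_right i4T i3 integrable_const)
  qed (use pt in \<open>simp add: birkhoff_sum_Suc\<close>)
  also have "\<dots> = (\<integral>x. (?s x) ^ 4 \<partial>M) + 4 * (\<integral>x. m x * (?s x) ^ 3 \<partial>M) + 8 * b\<^sup>2 * (\<integral>x. (?s x)\<^sup>2 \<partial>M) + 3 * b ^ 4"
    using i4T[of 4] i4T[of 2] i3 by (simp add: prob_space)
  also have "\<dots> \<le> 4 * (real n)\<^sup>2 * b ^ 4 + 8 * b\<^sup>2 * (real n * b\<^sup>2) + 3 * b ^ 4"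
  proof -
    have "(\<integral>x. (?s x) ^ 4 \<partial>M) \<le> 4 * (real n)\<^sup>2 * b ^ 4"
      using Suc integral_T[of "\<lambda>x. (birkhoff_sum T m n x) ^ 4"] by simp
    moreover have "(\<integral>x. m x * (?s x) ^ 3 \<partial>M) = 0" by (rule martingale_differenceD(2)[OF m s3])
    moreover have "8 * b\<^sup>2 * (\<integral>x. (?s x)\<^sup>2 \<partial>M) \<le> 8 * b\<^sup>2 * (real n * b\<^sup>2)"
    proof (intro mult_left_mono)
      have "(norm_L2 M m)\<^sup>2 \<le> b\<^sup>2"
        using norm_L2_const_bound[OF mm b] norm_L2_nonneg by (intro power_mono) auto
      then show "(\<integral>x. (?s x)\<^sup>2 \<partial>M) \<le> real n * b\<^sup>2"
        using integral_T[of "\<lambda>x. (birkhoff_sum T m n x)\<^sup>2"] norm_birkhoff_sum_martingale[OF m, of n]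
        by (simp add: mult_left_mono)
    qed simp
    ultimately show ?thesis by linarith
  qed
  also have "\<dots> \<le> 4 * (real (Suc n))\<^sup>2 * b ^ 4"
  proof -
    have "4 * (real (Suc n))\<^sup>2 * b ^ 4 = 4 * (real n)\<^sup>2 * b ^ 4 + 8 * b\<^sup>2 * (real n * b\<^sup>2) + 3 * b ^ 4 + b ^ 4"
      by (simp add: power4_eq_xxxx power2_eq_square algebra_simps)
    then show ?thesis by simp
  qed
  finally show ?case .
qed simp

text \<open>A crude bound, whose purpose is to make the powers of the maximum integrable.\<close>

lemma tail_max_le: "(\<And>x. \<bar>m x\<bar> \<le> b) \<Longrightarrow> tail_max m n y \<le> real n * b"
proof (induction n arbitrary: y)
  case (Suc n)
  have "0 \<le> b" using Suc.prems abs_ge_zero order_trans by blast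
  then have "real n * b \<le> real (Suc n) * b" by (intro mult_right_mono) auto
  moreover have "birkhoff_sum T m (Suc n) y \<le> real (Suc n) * b"
    using abs_birkhoff_sum_le[of m b "Suc n" y, OF Suc.prems] by linarith
  ultimately show ?case
    using Suc.IH[OF Suc.prems, of "T y"] unfolding tail_max.simps by (intro max.boundedI) linarith+
qed simp

lemma tail_max_L4:
  assumes m: "martingale_difference m" and b: "\<And>x. \<bar>m x\<bar> \<le> b"
  shows "(\<integral>x. (tail_max m n x) ^ 4 \<partial>M) \<le> 16 * (real n)\<^sup>2 * b ^ 4"
proof -
  note m2 = martingale_differenceD(1)[OF m]
  have mm[measurable]: "m \<in> borel_measurable M" using m2 by measurable
  let ?R = "tail_max m n" and ?S = "birkhoff_sum T m n"
  have rb: "\<bar>(tail_max m k x) ^ j\<bar> \<le> (real k * b) ^ j" for k j x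
    unfolding power_abs by (intro power_mono) (simp_all add: tail_max_nonneg tail_max_le[OF b])
  have iR: "integrable M (\<lambda>x. (tail_max m k x) ^ j)" for k j
    by (rule integrable_bounded_real[OF _ rb]) measurable
  have iS: "integrable M (\<lambda>x. (?S x) ^ 4)"
  proof (rule integrable_bounded_real)
    show "\<bar>(?S x) ^ 4\<bar> \<le> (real n * b) ^ 4" for x
      unfolding power_abs by (intro power_mono abs_birkhoff_sum_le b) simp
  qed measurable
  have R3: "square_integrable M (\<lambda>x. 4 * (tail_max m k x) ^ 3)" for k
    by (rule square_integrable_cmult[OF square_integrable_bounded[OF _ rb]]) measurable
  have "3 * (\<integral>x. (?R x) ^ 4 \<partial>M) = (\<integral>x. 3 * (?R x) ^ 4 \<partial>M)" by simp
  also have "\<dots> \<le> (\<integral>x. 4 * (?R x) ^ 3 * ?S x \<partial>M)"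
  proof (rule tail_max_Doob[where \<phi> = "\<lambda>x. 3 * x ^ 4" and \<psi> = "\<lambda>x. 4 * x ^ 3", OF m])
    fix r s :: real
    \<comment> \<open>The polynomial s^4 + 3 r^4 - 4 r^3 s vanishes to second order at r = s, hence
      the factor (s - r)^2. It settles the case r \<le> s; in the other case both sides of the goal
      coincide.\<close>
    have "0 \<le> (s - r)\<^sup>2 * ((s + r)\<^sup>2 + 2 * r\<^sup>2)" by simp
    also have "\<dots> = s ^ 4 + 3 * r ^ 4 - 4 * (r ^ 3 * s)"
      by (simp add: power4_eq_xxxx power3_eq_cube power2_eq_square algebra_simps)
    finally show "3 * (max r s) ^ 4 - 4 * (max r s) ^ 3 * s \<le> 3 * r ^ 4 - 4 * r ^ 3 * s"
      by (cases "r \<le> s") (simp_all add: max_def power4_eq_xxxx power3_eq_cube)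
  qed (use iR R3 in simp_all)
  also have "\<dots> \<le> (\<integral>x. (5 / 2) * (?R x) ^ 4 + 2 * (?S x) ^ 4 \<partial>M)"
  proof (rule integral_mono)
    show "integrable M (\<lambda>x. 4 * (?R x) ^ 3 * ?S x)"
      by (rule square_integrable_mult[OF R3 square_integrable_birkhoff_sum[OF m2]])
    show "integrable M (\<lambda>x. (5 / 2) * (?R x) ^ 4 + 2 * (?S x) ^ 4)"
      by (intro Bochner_Integration.integrable_add integrable_mult_right iR iS)
    fix x
    define r s where "r = ?R x" and "s = ?S x"
    \<comment> \<open>A sum of squares behind 4 r^3 s \<le> (5/2) r^4 + 2 s^4. The coefficient 5/2
      leaves r^4 / 2 of the 3 r^4 on the left, whence the constant 2 * 4 / (1/2) = 16.\<close>
    have "0 \<le> 2 * r\<^sup>2 * (r - s)\<^sup>2 + 2 * (r\<^sup>2 / 2 - s\<^sup>2)\<^sup>2" by simp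
    also have "\<dots> = (5 / 2) * r ^ 4 + 2 * s ^ 4 - 4 * (r ^ 3 * s)"
      by (simp add: power4_eq_xxxx power3_eq_cube power2_eq_square algebra_simps)
    finally show "4 * (?R x) ^ 3 * ?S x \<le> (5 / 2) * (?R x) ^ 4 + 2 * (?S x) ^ 4"
      by (simp add: r_def s_def)
  qed
  also have "\<dots> = (5 / 2) * (\<integral>x. (?R x) ^ 4 \<partial>M) + 2 * (\<integral>x. (?S x) ^ 4 \<partial>M)"
    using iR[of n 4] iS by simp
  finally show ?thesis using birkhoff_sum_moment4[OF m b, of n] by linarith
qed

lemma double_sum_power4_le:
  fixes a b :: real
  shows "(2 * (a + b)) ^ 4 \<le> 128 * a ^ 4 + 128 * b ^ 4"
proof -
  have sq: "(u + v)\<^sup>2 \<le> 2 * (u\<^sup>2 + v\<^sup>2)" for u v :: real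
    using sum_squares_bound[of u v] by (simp add: power2_sum)
  have p4: "u ^ 4 = (u\<^sup>2)\<^sup>2" and d2: "(2 * u)\<^sup>2 = 4 * u\<^sup>2" and d4: "(2 * u) ^ 4 = 16 * u ^ 4" for u :: real
    by (simp_all add: power4_eq_xxxx power2_eq_square)
  have "((a + b)\<^sup>2)\<^sup>2 \<le> (2 * (a\<^sup>2 + b\<^sup>2))\<^sup>2" by (rule power_mono[OF sq]) simp
  then have "((a + b)\<^sup>2)\<^sup>2 \<le> 4 * (a\<^sup>2 + b\<^sup>2)\<^sup>2" unfolding d2 .
  then show ?thesis
    using sq[of "a\<^sup>2" "b\<^sup>2"] unfolding d4 p4[of "a + b"] p4[of a] p4[of b] by simp
qed

text \<open>Both tail maxima enter with the factor 128 = 16 * 8 from the fourth power of 2 (a + b),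
  and each has fourth moment at most 16 n^2 b^4; in total 2 * 128 * 16 = 4096.\<close>

lemma max_birkhoff_moment4:
  assumes m: "martingale_difference m" and b: "\<And>x. \<bar>m x\<bar> \<le> b"
  shows "integrable M (\<lambda>x. (max_birkhoff m n x) ^ 4)"
    and "(\<integral>x. (max_birkhoff m n x) ^ 4 \<partial>M) \<le> 4096 * (real n)\<^sup>2 * b ^ 4"
proof -
  have mm[measurable]: "m \<in> borel_measurable M" using martingale_differenceD(1)[OF m] by measurable
  have b': "\<bar>- m x\<bar> \<le> b" for x using b by simp
  let ?R = "tail_max m n" and ?R' = "tail_max (\<lambda>x. - m x) n"
  have rb: "\<bar>(tail_max m k x) ^ j\<bar> \<le> (real k * b) ^ j" if "\<And>x. \<bar>m x\<bar> \<le> b" for m k j x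
    unfolding power_abs by (intro power_mono) (simp_all add: tail_max_nonneg tail_max_le[OF that])
  have iR: "integrable M (\<lambda>x. (?R x) ^ 4)" by (rule integrable_bounded_real[OF _ rb[OF b]]) measurable
  have iR': "integrable M (\<lambda>x. (?R' x) ^ 4)" by (rule integrable_bounded_real[OF _ rb[OF b']]) measurable
  have mb: "\<bar>(max_birkhoff m n x) ^ 4\<bar> \<le> (2 * (real n * b + real n * b)) ^ 4" for x
  proof -
    have "?R x + ?R' x \<le> real n * b + real n * b"
      by (intro add_mono tail_max_le b b')
    then have "max_birkhoff m n x \<le> 2 * (real n * b + real n * b)"
      by (intro order_trans[OF max_birkhoff_le_tail_max] mult_left_mono) simp_all
    from power_mono[OF this max_birkhoff_nonneg, of 4] show ?thesis
      by (simp only: power_abs abs_of_nonneg[OF max_birkhoff_nonneg])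
  qed
  show i: "integrable M (\<lambda>x. (max_birkhoff m n x) ^ 4)"
    by (rule integrable_bounded_real[OF _ mb]) measurable
  have "(\<integral>x. (max_birkhoff m n x) ^ 4 \<partial>M) \<le> (\<integral>x. 128 * (?R x) ^ 4 + 128 * (?R' x) ^ 4 \<partial>M)"
  proof (rule integral_mono[OF i])
    show "integrable M (\<lambda>x. 128 * (?R x) ^ 4 + 128 * (?R' x) ^ 4)"
      by (intro Bochner_Integration.integrable_add integrable_mult_right iR iR')
    fix x
    have "(max_birkhoff m n x) ^ 4 \<le> (2 * (?R x + ?R' x)) ^ 4"
      by (intro power_mono max_birkhoff_le_tail_max max_birkhoff_nonneg)
    also have "\<dots> \<le> 128 * (?R x) ^ 4 + 128 * (?R' x) ^ 4" by (rule double_sum_power4_le)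
    finally show "(max_birkhoff m n x) ^ 4 \<le> 128 * (?R x) ^ 4 + 128 * (?R' x) ^ 4" .
  qed
  also have "\<dots> = 128 * (\<integral>x. (?R x) ^ 4 \<partial>M) + 128 * (\<integral>x. (?R' x) ^ 4 \<partial>M)" using iR iR' by simp
  also have "\<dots> \<le> 4096 * (real n)\<^sup>2 * b ^ 4"
    using tail_max_L4[OF m b, of n] tail_max_L4[OF martingale_difference_minus[OF m] b', of n] by linarith
  finally show "(\<integral>x. (max_birkhoff m n x) ^ 4 \<partial>M) \<le> 4096 * (real n)\<^sup>2 * b ^ 4" .
qed

section \<open>The ergodic theorem for bounded functions\<close>

text \<open>The maximum of the sums of lengths 0 to \<open>n\<close>, in the recursive form that
  compares it with its own shift under \<open>T\<close>.\<close>

fun run_max :: "('a \<Rightarrow> real) \<Rightarrow> nat \<Rightarrow> 'a \<Rightarrow> real" where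
  "run_max f 0 y = 0"
| "run_max f (Suc n) y = max 0 (f y + run_max f n (T y))"

lemma run_max_nonneg: "0 \<le> run_max f n y"
  by (cases n) auto

lemma run_max_mono_Suc: "run_max f n y \<le> run_max f (Suc n) y"
proof (induction n arbitrary: y)
  case (Suc n)
  show ?case using Suc[of "T y"] by (subst run_max.simps, subst (2) run_max.simps) (auto simp: max_def)
qed simp

lemma birkhoff_sum_le_run_max: "k \<le> n \<Longrightarrow> birkhoff_sum T f k y \<le> run_max f n y"
proof (induction n arbitrary: k y)
  case (Suc n)
  show ?case
  proof (cases k)
    case 0
    then show ?thesis using run_max_nonneg[of f "Suc n" y] by simp
  next
    case (Suc i)
    then show ?thesis using Suc.IH[of i "T y"] Suc.prems by (simp add: birkhoff_sum_Suc le_max_iff_disj)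
  qed
qed simp

lemma measurable_run_max[measurable]:
  assumes [measurable]: "f \<in> borel_measurable M"
  shows "run_max f n \<in> borel_measurable M"
proof (induction n)
  case 0
  have "run_max f 0 = (\<lambda>_. 0)" by auto
  then show ?case by simp
next
  case (Suc n)
  note [measurable] = this
  show ?case unfolding run_max.simps[abs_def] by measurable
qed

lemma run_max_le: "(\<And>x. \<bar>f x\<bar> \<le> b) \<Longrightarrow> run_max f n y \<le> real n * b"
proof (induction n arbitrary: y)
  case (Suc n)
  have "0 \<le> b" using Suc.prems abs_ge_zero order_trans by blast
  moreover have "f y \<le> b" using Suc.prems[of y] by linarith
  ultimately show ?case using Suc.IH[OF Suc.prems, of "T y"] by (simp add: distrib_right)
qed simp

text \<open>A drift argument. The difference of \<open>run_max f (Suc n) y\<close> and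
  \<open>run_max f n (T y)\<close> is \<open>max (- run_max f n (T y)) (f y)\<close>. Where the sums
  are unbounded it finally equals \<open>f y\<close>, while its mean is nonnegative by invariance
  and monotonicity in \<open>n\<close>. Hence unbounded sums almost everywhere exclude a negative
  mean of \<open>f\<close>, and ergodicity leaves no third possibility.\<close>

lemma birkhoff_sum_bounded_above:
  assumes erg: "ergodic_transformation M T" and fm[measurable]: "f \<in> borel_measurable M"
    and b: "\<And>x. \<bar>f x\<bar> \<le> b" and neg: "(\<integral>x. f x \<partial>M) < 0"
  shows "AE y in M. \<exists>B. \<forall>n. birkhoff_sum T f n y \<le> real B"
proof -
  define A where "A = {y \<in> space M. \<forall>B::nat. \<exists>n. birkhoff_sum T f n y > real B}"
  have Am: "A \<in> sets M" unfolding A_def by measurable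
  have Tsp: "T y \<in> space M" if "y \<in> space M" for y using that measurable_space[OF measurable_T] by blast
  \<comment> \<open>A sum along the orbit of \<open>y\<close> differs from the one along the orbit
    of \<open>T y\<close> by the single bounded term \<open>f y\<close>. The set is thus equal to
    its preimage, as the definition of ergodicity demands, and not merely up to a null set.\<close>
  have inv: "(\<forall>B::nat. \<exists>n. birkhoff_sum T f n (T y) > real B) \<longleftrightarrow> (\<forall>B::nat. \<exists>n. birkhoff_sum T f n y > real B)" for y
  proof
    assume u: "\<forall>B::nat. \<exists>n. birkhoff_sum T f n (T y) > real B"
    show "\<forall>B::nat. \<exists>n. birkhoff_sum T f n y > real B"
    proof
      fix B :: nat
      obtain n where "birkhoff_sum T f n (T y) > real (B + nat \<lceil>b\<rceil>)" using u by blast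
      moreover have "- b \<le> f y" using b[of y] by linarith
      ultimately have "birkhoff_sum T f (Suc n) y > real B" unfolding birkhoff_sum_Suc by linarith
      then show "\<exists>n. birkhoff_sum T f n y > real B" ..
    qed
  next
    assume u: "\<forall>B::nat. \<exists>n. birkhoff_sum T f n y > real B"
    show "\<forall>B::nat. \<exists>n. birkhoff_sum T f n (T y) > real B"
    proof
      fix B :: nat
      obtain n where n: "birkhoff_sum T f n y > real (B + nat \<lceil>b\<rceil>)" using u by blast
      then obtain i where i: "n = Suc i" by (cases n) auto
      have "f y \<le> b" using b[of y] by linarith
      then have "birkhoff_sum T f i (T y) > real B" using n unfolding i birkhoff_sum_Suc by linarith
      then show "\<exists>n. birkhoff_sum T f n (T y) > real B" ..
    qed
  qed
  have "T -` A \<inter> space M = A" unfolding A_def using inv Tsp by auto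
  then have "emeasure M A = 0 \<or> emeasure M A = 1" using erg Am by (auto simp: ergodic_transformation_def)
  moreover have "emeasure M A \<noteq> 1"
  proof
    assume "emeasure M A = 1"
    then have "prob A = 1" by (simp add: emeasure_eq_measure)
    then have AA: "AE y in M. y \<in> A" using Am by (simp add: AE_in_set_eq_1)
    have rb: "\<bar>run_max f n y\<bar> \<le> real n * b" for n y
      using run_max_le[of f b n y, OF b] run_max_nonneg[of f n y] by simp
    have ir: "integrable M (run_max f n)" for n
      by (rule integrable_bounded_real[OF _ rb]) measurable
    have "(\<lambda>n. \<integral>y. run_max f (Suc n) y - run_max f n (T y) \<partial>M) \<longlonglongrightarrow> (\<integral>y. f y \<partial>M)"
    proof (rule integral_dominated_convergence[where w = "\<lambda>_. b"])
      show "AE y in M. norm (run_max f (Suc n) y - run_max f n (T y)) \<le> b" for n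
      proof (intro AE_I2)
        fix y
        show "norm (run_max f (Suc n) y - run_max f n (T y)) \<le> b"
          using b[of y] run_max_nonneg[of f n "T y"] by (auto simp: max_def)
      qed
      show "AE y in M. (\<lambda>n. run_max f (Suc n) y - run_max f n (T y)) \<longlonglongrightarrow> f y"
        using AE_T[OF AA]
      proof eventually_elim
        case (elim y)
        then obtain n0 where n0: "birkhoff_sum T f n0 (T y) > real (nat \<lceil>b\<rceil>)" unfolding A_def by blast
        have "run_max f (Suc n) y - run_max f n (T y) = f y" if "n \<ge> n0" for n
        proof -
          have "run_max f n (T y) \<ge> b" using birkhoff_sum_le_run_max[OF that, of f "T y"] n0 by linarith
          then show ?thesis using b[of y] by (auto simp: max_def)
        qed
        then show ?case by (intro tendsto_eventually) (auto simp: eventually_sequentially)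
      qed
    qed auto
    moreover have "0 \<le> (\<integral>y. run_max f (Suc n) y - run_max f n (T y) \<partial>M)" for n
    proof -
      have "(\<integral>y. run_max f (Suc n) y - run_max f n (T y) \<partial>M) = (\<integral>y. run_max f (Suc n) y \<partial>M) - (\<integral>y. run_max f n (T y) \<partial>M)"
        by (intro Bochner_Integration.integral_diff ir integrable_T[OF ir])
      also have "(\<integral>y. run_max f n (T y) \<partial>M) = (\<integral>y. run_max f n y \<partial>M)" by (rule integral_T) measurable
      finally show ?thesis using integral_mono[OF ir[of n] ir[of "Suc n"] run_max_mono_Suc] by simp
    qed
    ultimately have "0 \<le> (\<integral>y. f y \<partial>M)" by (intro LIMSEQ_le_const) auto
    then show False using neg by simp
  qed
  ultimately have "emeasure M A = 0" by blast
  then have "A \<in> null_sets M" using Am by (simp add: null_sets_def)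
  then have "AE y in M. y \<notin> A" by (rule AE_not_in)
  then show ?thesis
  proof (rule AE_mp, intro AE_I2 impI)
    fix y assume "y \<in> space M" "y \<notin> A"
    then show "\<exists>B. \<forall>n. birkhoff_sum T f n y \<le> real B" unfolding A_def by (auto simp: not_less)
  qed
qed

text \<open>After subtracting the mean and \<open>e / 2\<close>, the mean is negative, so the sums
  stay below some \<open>B\<close>, and \<open>B / n\<close> is eventually at most
  \<open>e / 2\<close>. Tolerances \<open>1 / Suc k\<close> keep the exceptional sets countably
  many.\<close>

lemma birkhoff_upper:
  assumes erg: "ergodic_transformation M T" and fm[measurable]: "f \<in> borel_measurable M"
    and b: "\<And>x. \<bar>f x\<bar> \<le> b"
  shows "AE y in M. \<forall>k. \<forall>\<^sub>F n in sequentially. birkhoff_sum T f n y / real n \<le> (\<integral>x. f x \<partial>M) + 1 / real (Suc k)"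
  unfolding AE_all_countable
proof
  fix k
  define e where "e = 1 / real (Suc k)"
  have e: "e > 0" by (simp add: e_def)
  define c where "c = (\<integral>x. f x \<partial>M) + e / 2"
  have int: "integrable M f" using fm b by (rule integrable_bounded_real)
  have "AE y in M. \<exists>B. \<forall>n. birkhoff_sum T (\<lambda>x. f x - c) n y \<le> real B"
  proof (rule birkhoff_sum_bounded_above[OF erg])
    show "\<bar>f x - c\<bar> \<le> b + \<bar>c\<bar>" for x using b[of x] by linarith
    show "(\<integral>x. f x - c \<partial>M) < 0" using int e by (simp add: prob_space c_def)
  qed measurable
  then show "AE y in M. \<forall>\<^sub>F n in sequentially. birkhoff_sum T f n y / real n \<le> (\<integral>x. f x \<partial>M) + 1 / real (Suc k)"
  proof eventually_elim
    case (elim y)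
    then obtain B where B: "\<And>n. birkhoff_sum T (\<lambda>x. f x - c) n y \<le> real B" by blast
    obtain n0 :: nat where n0: "real B / (e / 2) \<le> real n0" using real_arch_simple by blast
    show ?case
      using eventually_ge_at_top[of "Suc n0"]
    proof eventually_elim
      case (elim n)
      have n: "real n > 0" using elim by simp
      have "real B / (e / 2) \<le> real n" using n0 elim by linarith
      then have "real B \<le> real n * (e / 2)" using e by (subst (asm) pos_divide_le_eq) simp_all
      moreover have "birkhoff_sum T f n y \<le> real B + real n * c"
        using B[of n] by (simp add: birkhoff_sum_diff) (simp add: birkhoff_sum_def)
      ultimately have "birkhoff_sum T f n y \<le> real n * ((\<integral>x. f x \<partial>M) + 1 / real (Suc k))"
        unfolding c_def e_def[symmetric] by (simp add: algebra_simps)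
      then show ?case using n by (simp add: divide_le_eq mult.commute)
    qed
  qed
qed

theorem birkhoff_bounded:
  assumes erg: "ergodic_transformation M T" and fm[measurable]: "f \<in> borel_measurable M"
    and b: "\<And>x. \<bar>f x\<bar> \<le> b"
  shows "AE y in M. (\<lambda>n. birkhoff_sum T f n y / real n) \<longlonglongrightarrow> (\<integral>x. f x \<partial>M)"
proof -
  have b': "\<bar>- f x\<bar> \<le> b" for x using b by simp
  have fm': "(\<lambda>x. - f x) \<in> borel_measurable M" by measurable
  show ?thesis
    using birkhoff_upper[OF erg fm b] birkhoff_upper[OF erg fm' b']
  proof eventually_elim
    case (elim y)
    show ?case
    proof (rule order_tendstoI)
      fix a assume a: "a < (\<integral>x. f x \<partial>M)"
      then obtain k where k: "1 / real (Suc k) < (\<integral>x. f x \<partial>M) - a"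
        using reals_Archimedean[of "(\<integral>x. f x \<partial>M) - a"] by (auto simp: inverse_eq_divide)
      have "\<forall>\<^sub>F n in sequentially. birkhoff_sum T (\<lambda>x. - f x) n y / real n \<le> (\<integral>x. - f x \<partial>M) + 1 / real (Suc k)"
        using elim(2) by blast
      then show "\<forall>\<^sub>F n in sequentially. a < birkhoff_sum T f n y / real n"
      proof eventually_elim
        case (elim n)
        then show ?case using k by (simp add: birkhoff_sum_minus)
      qed
    next
      fix a assume a: "(\<integral>x. f x \<partial>M) < a"
      then obtain k where k: "1 / real (Suc k) < a - (\<integral>x. f x \<partial>M)"
        using reals_Archimedean[of "a - (\<integral>x. f x \<partial>M)"] by (auto simp: inverse_eq_divide)
      have "\<forall>\<^sub>F n in sequentially. birkhoff_sum T f n y / real n \<le> (\<integral>x. f x \<partial>M) + 1 / real (Suc k)"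
        using elim(1) by blast
      then show "\<forall>\<^sub>F n in sequentially. birkhoff_sum T f n y / real n < a"
      proof eventually_elim
        case (elim n)
        then show ?case using k by linarith
      qed
    qed
  qed
qed

section \<open>The transfer operator\<close>

abbreviation "P \<equiv> transfer_operator M T"

lemma square_integrable_P: "square_integrable M f \<Longrightarrow> square_integrable M (P f)"
  using square_integrable_transfer_operator[OF prob_space_axioms invariant] .

lemma square_integrable_P_pow: "square_integrable M f \<Longrightarrow> square_integrable M ((P ^^ k) f)"
proof (induction k)
  case (Suc k)
  then show ?case unfolding funpow.simps comp_apply by (intro square_integrable_P) simp
qed simp

lemma square_integrable_integrable: "square_integrable M f \<Longrightarrow> integrable M f"
  unfolding square_integrable_def using square_integrable_imp_integrable[of f] by blast

lemma finite_measure_subalgebra_T: "finite_measure_subalgebra M (vimage_algebra (space M) T M)"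
proof unfold_locales
  show "subalgebra M (vimage_algebra (space M) T M)"
    using measurable_T by (auto simp: subalgebra_def sets_vimage_algebra2 measurable_def)
qed

lemma measurable_comp_T_subalgebra:
  assumes "g \<in> borel_measurable M"
  shows "(\<lambda>x. g (T x)) \<in> borel_measurable (vimage_algebra (space M) T M)"
proof -
  have "T \<in> space M \<rightarrow> space M" using measurable_space[OF measurable_T] by blast
  then have "T \<in> measurable (vimage_algebra (space M) T M) M" by (rule measurable_vimage_algebra1)
  from measurable_compose[OF this assms] show ?thesis .
qed

lemma cond_exp_eq_P:
  assumes f: "square_integrable M f"
  shows "AE x in M. real_cond_exp M (vimage_algebra (space M) T M) f x = P f (T x)"
proof -
  interpret S: finite_measure_subalgebra M "vimage_algebra (space M) T M"
    by (rule finite_measure_subalgebra_T)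
  have f1: "integrable M f" using f by (rule square_integrable_integrable)
  have tr: "is_transfer M T f (P f)" using is_transfer_transfer_operator[OF prob_space_axioms invariant f1] .
  then have g: "integrable M (P f)" by (simp add: is_transfer_def)
  then have gm[measurable]: "P f \<in> borel_measurable M" by auto
  show ?thesis
  proof (rule S.real_cond_exp_charact)
    show "(\<lambda>x. P f (T x)) \<in> borel_measurable (vimage_algebra (space M) T M)"
      by (rule measurable_comp_T_subalgebra[OF gm])
    fix B assume "B \<in> sets (vimage_algebra (space M) T M)"
    then obtain A where A: "A \<in> sets M" "B = T -` A \<inter> space M"
      using measurable_T by (auto simp: sets_vimage_algebra2 measurable_def)
    have "(LINT x:B|M. f x) = (LINT y:A|M. P f y)" using tr A by (simp add: is_transfer_def)
    also have "\<dots> = (\<integral>x. indicator A (T x) *\<^sub>R P f (T x) \<partial>M)"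
      unfolding set_lebesgue_integral_def using A(1) gm
      by (intro integral_T[symmetric] borel_measurable_scaleR borel_measurable_indicator)
    also have "\<dots> = (LINT x:B|M. P f (T x))"
      unfolding set_lebesgue_integral_def A(2)
      by (intro Bochner_Integration.integral_cong) (auto split: split_indicator)
    finally show "(LINT x:B|M. f x) = (LINT x:B|M. P f (T x))" .
  qed (use f1 integrable_T[OF g] in auto)
qed

text \<open>The function \<open>g o T\<close> is measurable for the preimage \<sigma>-algebra, so
  \<open>f\<close> may be replaced by its conditional expectation \<open>P f o T\<close>; invariance
  then removes \<open>T\<close>.\<close>

lemma P_adjoint:
  assumes f: "square_integrable M f" and g: "square_integrable M g"
  shows "(\<integral>x. f x * g (T x) \<partial>M) = (\<integral>x. P f x * g x \<partial>M)"
proof -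
  interpret S: finite_measure_subalgebra M "vimage_algebra (space M) T M"
    by (rule finite_measure_subalgebra_T)
  have [measurable]: "f \<in> borel_measurable M" "g \<in> borel_measurable M" "P f \<in> borel_measurable M"
    using f g square_integrable_P[OF f] by measurable
  have "(\<integral>x. f x * g (T x) \<partial>M) = (\<integral>x. g (T x) * f x \<partial>M)" by (simp add: mult.commute)
  also have "\<dots> = (\<integral>x. g (T x) * real_cond_exp M (vimage_algebra (space M) T M) f x \<partial>M)"
    by (rule S.real_cond_exp_intg(2)[symmetric])
      (auto intro!: measurable_comp_T_subalgebra square_integrable_mult square_integrable_T f g)
  also have "\<dots> = (\<integral>x. g (T x) * P f (T x) \<partial>M)"
    by (intro integral_cong_AE) (use cond_exp_eq_P[OF f] in \<open>auto intro: borel_measurable_cond_exp2\<close>)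
  also have "\<dots> = (\<integral>x. g x * P f x \<partial>M)" by (rule integral_T) measurable
  finally show ?thesis by (simp add: mult.commute)
qed

text \<open>Conditional expectation respects bounds, and invariance carries the bound for
  \<open>P f o T\<close> over to \<open>P f\<close>. It holds only almost everywhere because
  \<open>P f\<close> is one chosen representative of its class.\<close>

lemma AE_P_bounded:
  assumes f[measurable]: "f \<in> borel_measurable M" and b: "\<And>x. \<bar>f x\<bar> \<le> b"
  shows "AE x in M. \<bar>P f x\<bar> \<le> b"
proof -
  interpret S: finite_measure_subalgebra M "vimage_algebra (space M) T M"
    by (rule finite_measure_subalgebra_T)
  have f2: "square_integrable M f" using f b by (rule square_integrable_bounded)
  have [measurable]: "P f \<in> borel_measurable M" using square_integrable_P[OF f2] by measurable
  have "AE x in M. f x \<le> b" "AE x in M. - b \<le> f x"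
    using b by (auto simp: abs_le_iff minus_le_iff)
  then have "AE x in M. real_cond_exp M (vimage_algebra (space M) T M) f x \<le> b"
    "AE x in M. - b \<le> real_cond_exp M (vimage_algebra (space M) T M) f x"
    using S.real_cond_exp_le_c S.real_cond_exp_ge_c square_integrable_integrable[OF f2] by auto
  then have "AE x in M. \<bar>P f (T x)\<bar> \<le> b"
    using cond_exp_eq_P[OF f2] by eventually_elim (simp add: abs_le_iff)
  then have "AE x in distr M M T. \<bar>P f x\<bar> \<le> b"
    by (subst AE_distr_iff) auto
  then show ?thesis unfolding distr_T .
qed

text \<open>The component of \<open>f\<close> orthogonal to the functions of \<open>T\<close>: what
  is left after subtracting the conditional expectation given the preimage \<sigma>-algebra.\<close>

definition defect :: "('a \<Rightarrow> real) \<Rightarrow> 'a \<Rightarrow> real" where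
  "defect f x = f x - P f (T x)"

lemma martingale_difference_defect:
  assumes f: "square_integrable M f"
  shows "martingale_difference (defect f)"
  unfolding martingale_difference_def
proof (intro conjI allI impI)
  note Pf = square_integrable_P[OF f]
  show "square_integrable M (defect f)"
    unfolding defect_def[abs_def] by (intro square_integrable_diff f square_integrable_T Pf)
  fix g assume g: "square_integrable M g"
  have [measurable]: "g \<in> borel_measurable M" "P f \<in> borel_measurable M"
    using g Pf by measurable
  have "(\<integral>x. defect f x * g (T x) \<partial>M) = (\<integral>x. f x * g (T x) \<partial>M) - (\<integral>x. P f (T x) * g (T x) \<partial>M)"
    unfolding defect_def left_diff_distrib
    by (intro Bochner_Integration.integral_diff square_integrable_mult square_integrable_T f g Pf)
  also have "(\<integral>x. P f (T x) * g (T x) \<partial>M) = (\<integral>x. P f x * g x \<partial>M)" by (rule integral_T) measurable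
  finally show "(\<integral>x. defect f x * g (T x) \<partial>M) = 0" by (simp add: P_adjoint[OF f g])
qed

lemma norm_defect:
  assumes f: "square_integrable M f"
  shows "(norm_L2 M (defect f))\<^sup>2 = (norm_L2 M f)\<^sup>2 - (norm_L2 M (P f))\<^sup>2"
proof -
  note Pf = square_integrable_P[OF f]
  have [measurable]: "P f \<in> borel_measurable M" using Pf by measurable
  have PfT: "(\<integral>x. (P f (T x))\<^sup>2 \<partial>M) = (\<integral>x. (P f x)\<^sup>2 \<partial>M)" by (rule integral_T) measurable
  have "(norm_L2 M (defect f))\<^sup>2 = (\<integral>x. (f x)\<^sup>2 + (P f (T x))\<^sup>2 - 2 * (f x * P f (T x)) \<partial>M)"
    unfolding norm_L2_power2 defect_def power2_diff by (simp add: mult.assoc)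
  also have "\<dots> = (\<integral>x. (f x)\<^sup>2 \<partial>M) + (\<integral>x. (P f (T x))\<^sup>2 \<partial>M) - 2 * (\<integral>x. f x * P f (T x) \<partial>M)"
    using square_integrableD[OF f] square_integrableD[OF square_integrable_T[OF Pf]]
      square_integrable_mult[OF f square_integrable_T[OF Pf]] by simp
  also have "\<dots> = (norm_L2 M f)\<^sup>2 - (norm_L2 M (P f))\<^sup>2"
    unfolding norm_L2_power2 PfT P_adjoint[OF f Pf] by (simp add: power2_eq_square)
  finally show ?thesis .
qed

end

section \<open>From the decay of norms to Hannan's condition\<close>

lemma powr_Suc_diff_le:
  fixes s :: real
  assumes s: "1 \<le> s"
  shows "real (Suc k) powr s - real k powr s \<le> s * real (Suc k) powr (s - 1)"
proof (cases "k = 0")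
  case False
  have "\<exists>z. real k < z \<and> z < real (Suc k) \<and> real (Suc k) powr s - real k powr s = (real (Suc k) - real k) * (s * z powr (s - 1))"
    using False by (intro MVT2) (auto intro!: has_real_derivative_powr)
  then obtain z where z: "real k < z" "z < real (Suc k)" "real (Suc k) powr s - real k powr s = s * z powr (s - 1)" by auto
  have "z powr (s - 1) \<le> real (Suc k) powr (s - 1)" using z s by (intro powr_mono2) auto
  then show ?thesis unfolding z(3) using s by (intro mult_left_mono) auto
qed (use s in simp)

text \<open>Cauchy-Schwarz with weights k^s: the sum of k^-s converges for s > 1, and Abel summation
  turns the sum of k^s (a_k^2 - a_(k+1)^2) into one with terms of order k^(s - 1 - 2 \<beta>), which
  converges for s < 2 \<beta>. Such an s exists because \<beta> > 1/2.\<close>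

lemma summable_sqrt_decrements:
  fixes a :: "nat \<Rightarrow> real"
  assumes nonneg: "\<And>k. 0 \<le> a k" and dec: "\<And>k. a (Suc k) \<le> a k" and \<beta>: "\<beta> > 1 / 2"
    and C: "\<And>k. 1 \<le> k \<Longrightarrow> a k \<le> C * real k powr - \<beta>"
  shows "summable (\<lambda>k. sqrt ((a k)\<^sup>2 - (a (Suc k))\<^sup>2))"
proof -
  \<comment> \<open>The midpoint of 1 and \<open>2 * \<beta>\<close>.\<close>
  define s where "s = 1 / 2 + \<beta>"
  have s: "1 < s" "s < 2 * \<beta>" using \<beta> by (auto simp: s_def)
  define b where "b k = (a k)\<^sup>2" for k
  define w where "w k = real k powr s" for k
  have b: "0 \<le> b k" "b (Suc k) \<le> b k" for k
    unfolding b_def using nonneg dec by (auto intro!: power_mono)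
  have w0: "w 0 = 0" "0 \<le> w k" for k by (auto simp: w_def)
  have abel: "(\<Sum>k<N. w k * (b k - b (Suc k))) + w N * b N = (\<Sum>k<N. (w (Suc k) - w k) * b (Suc k))" for N
    by (induction N) (auto simp: w0 algebra_simps)
  define v where "v k = s * C\<^sup>2 * real (Suc k) powr (s - 1 - 2 * \<beta>)" for k
  have sv: "summable v"
  proof -
    have "summable (\<lambda>k. real k powr (s - 1 - 2 * \<beta>))" using s by (subst summable_real_powr_iff) auto
    then have "summable (\<lambda>k. real (Suc k) powr (s - 1 - 2 * \<beta>))" by (subst summable_Suc_iff)
    then show ?thesis unfolding v_def by (rule summable_mult)
  qed
  have v: "(w (Suc k) - w k) * b (Suc k) \<le> v k" for k
  proof -
    have "b (Suc k) \<le> (C * real (Suc k) powr - \<beta>)\<^sup>2"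
      unfolding b_def using C[of "Suc k"] nonneg by (intro power_mono) auto
    also have "\<dots> = C\<^sup>2 * real (Suc k) powr (- 2 * \<beta>)"
      by (simp add: power_mult_distrib power2_eq_square flip: powr_add)
    finally have "(w (Suc k) - w k) * b (Suc k) \<le> (s * real (Suc k) powr (s - 1)) * (C\<^sup>2 * real (Suc k) powr (- 2 * \<beta>))"
      using powr_Suc_diff_le[of s k] s b unfolding w_def by (intro mult_mono) auto
    also have "\<dots> = v k" unfolding v_def
      by (simp add: mult_ac flip: powr_add)
    finally show ?thesis .
  qed
  have sum1: "summable (\<lambda>k. w k * (b k - b (Suc k)))"
  proof (rule bounded_imp_summable)
    show "0 \<le> w k * (b k - b (Suc k))" for k using w0 b by simp
    fix n
    have "0 \<le> w (Suc n) * b (Suc n)" using w0 b by simp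
    then have "(\<Sum>k<Suc n. w k * (b k - b (Suc k))) \<le> (\<Sum>k<Suc n. (w (Suc k) - w k) * b (Suc k))"
      using abel[of "Suc n"] by linarith
    also have "\<dots> \<le> (\<Sum>k<Suc n. v k)" by (intro sum_mono v)
    also have "\<dots> \<le> suminf v" using s by (intro sum_le_suminf sv) (auto simp: v_def)
    finally show "(\<Sum>k\<le>n. w k * (b k - b (Suc k))) \<le> suminf v" unfolding lessThan_Suc_atMost .
  qed
  have sum2: "summable (\<lambda>k. real k powr - s)" using s by (subst summable_real_powr_iff) auto
  have "summable (\<lambda>k. (w k * (b k - b (Suc k)) + real k powr - s) / 2)"
    by (intro summable_divide summable_add sum1 sum2)
  moreover have "norm (sqrt ((a k)\<^sup>2 - (a (Suc k))\<^sup>2)) \<le> (w k * (b k - b (Suc k)) + real k powr - s) / 2" if "k \<ge> 1" for k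
  proof -
    define x where "x = b k - b (Suc k)"
    have x: "0 \<le> x" using b by (simp add: x_def)
    have k: "real k > 0" using that by simp
    \<comment> \<open>The arithmetic-geometric mean inequality does the work of Cauchy-Schwarz term
      by term.\<close>
    have "2 * sqrt (w k * x) * sqrt (real k powr - s) \<le> (sqrt (w k * x))\<^sup>2 + (sqrt (real k powr - s))\<^sup>2"
      by (rule sum_squares_bound)
    moreover have "sqrt (w k * x) * sqrt (real k powr - s) = sqrt x"
      unfolding w_def using k by (simp add: real_sqrt_mult[symmetric] powr_minus)
    ultimately have "2 * sqrt x \<le> w k * x + real k powr - s" using x w0(2)[of k] by simp
    then show ?thesis using x unfolding x_def[symmetric] b_def[symmetric] by simp
  qed
  ultimately show ?thesis by (rule summable_comparison_test'[where N = 1])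
qed

context measure_preserving
begin

section \<open>Approximation by bounded martingale differences\<close>

definition clamp :: "real \<Rightarrow> real \<Rightarrow> real" where
  "clamp A u = max (- A) (min A u)"

lemma abs_clamp_le: "0 \<le> A \<Longrightarrow> \<bar>clamp A u\<bar> \<le> A"
  by (auto simp: clamp_def)

lemma clamp_eq: "\<bar>u\<bar> \<le> A \<Longrightarrow> clamp A u = u"
  by (auto simp: clamp_def)

lemma abs_diff_clamp_le: "0 \<le> A \<Longrightarrow> \<bar>u - clamp A u\<bar> \<le> \<bar>u\<bar>"
  by (auto simp: clamp_def)

lemma measurable_clamp[measurable]: "clamp A \<in> borel_measurable borel"
  unfolding clamp_def[abs_def] by measurable

lemma norm_L2_clamp_tendsto:
  assumes f: "square_integrable M f"
  shows "(\<lambda>A::nat. norm_L2 M (\<lambda>x. f x - clamp (real A) (f x))) \<longlonglongrightarrow> 0"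
proof -
  have [measurable]: "f \<in> borel_measurable M" using f by measurable
  have "(\<lambda>A. \<integral>x. (f x - clamp (real A) (f x))\<^sup>2 \<partial>M) \<longlonglongrightarrow> (\<integral>x. 0 \<partial>M)"
  proof (rule integral_dominated_convergence[where w = "\<lambda>x. (f x)\<^sup>2"])
    show "integrable M (\<lambda>x. (f x)\<^sup>2)" by (rule square_integrableD[OF f])
    show "AE x in M. norm ((f x - clamp (real A) (f x))\<^sup>2) \<le> (f x)\<^sup>2" for A
      using abs_diff_clamp_le[of "real A"] by (auto simp: abs_le_square_iff)
    show "AE x in M. (\<lambda>A. (f x - clamp (real A) (f x))\<^sup>2) \<longlonglongrightarrow> 0"
    proof (intro AE_I2 tendsto_eventually)
      fix x
      obtain A0 where A0: "\<bar>f x\<bar> \<le> real A0" using real_arch_simple by blast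
      have "(f x - clamp (real A) (f x))\<^sup>2 = 0" if "A \<ge> A0" for A
        using clamp_eq[of "f x" "real A"] A0 that by simp
      then show "\<forall>\<^sub>F A in sequentially. (f x - clamp (real A) (f x))\<^sup>2 = 0"
        by (auto simp: eventually_sequentially)
    qed
  qed auto
  then have "(\<lambda>A. sqrt (\<integral>x. (f x - clamp (real A) (f x))\<^sup>2 \<partial>M)) \<longlonglongrightarrow> sqrt 0"
    by (intro tendsto_real_sqrt) simp
  then show ?thesis by (simp add: norm_L2_def)
qed

lemma norm_L2_cong_AE:
  assumes "f \<in> borel_measurable M" "g \<in> borel_measurable M" "AE x in M. f x = g x"
  shows "norm_L2 M f = norm_L2 M g"
  unfolding norm_L2_def using assms by (intro arg_cong[where f = sqrt] integral_cong_AE) auto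

text \<open>Truncation destroys orthogonality, so the truncated \<open>g\<close> is recentred by
  subtracting \<open>P g o T\<close>. This correction is no larger than the truncation error:
  \<open>d\<close> is orthogonal to functions of \<open>T\<close>, so \<open>P g\<close> sees only
  the difference of \<open>g\<close> and \<open>d\<close>. Hence each of the two errors gets
  \<open>\<eta> / 2\<close>.\<close>

lemma martingale_difference_bounded_approx:
  assumes d: "martingale_difference d" and \<eta>: "\<eta> > 0"
  shows "\<exists>d' b. martingale_difference d' \<and> (\<forall>x. \<bar>d' x\<bar> \<le> b) \<and> norm_L2 M (\<lambda>x. d x - d' x) \<le> \<eta>"
proof -
  note d2 = martingale_differenceD(1)[OF d]
  have [measurable]: "d \<in> borel_measurable M" using d2 by measurable
  have "\<forall>\<^sub>F A::nat in sequentially. norm_L2 M (\<lambda>x. d x - clamp (real A) (d x)) < \<eta> / 2"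
    using \<eta> by (intro order_tendstoD[OF norm_L2_clamp_tendsto[OF d2]]) simp
  then obtain A :: nat where A: "norm_L2 M (\<lambda>x. d x - clamp (real A) (d x)) < \<eta> / 2"
    by (auto simp: eventually_sequentially)
  define g where "g x = clamp (real A) (d x)" for x
  have gm[measurable]: "g \<in> borel_measurable M" unfolding g_def[abs_def] by measurable
  have gA: "\<bar>g x\<bar> \<le> real A" for x unfolding g_def by (rule abs_clamp_le) simp
  have g2: "square_integrable M g" by (rule square_integrable_bounded[OF gm gA])
  note q2 = square_integrable_P[OF g2]
  have [measurable]: "P g \<in> borel_measurable M" using q2 by measurable
  \<comment> \<open>\<open>P g\<close> is bounded by \<open>A\<close> only almost everywhere.
    Clamping changes it on a null set and gives a bound at every point, as the conclusion
    requires.\<close>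
  define q where "q x = clamp (real A) (P g x)" for x
  have qm[measurable]: "q \<in> borel_measurable M" unfolding q_def[abs_def] by measurable
  have qA: "\<bar>q x\<bar> \<le> real A" for x unfolding q_def by (rule abs_clamp_le) simp
  have qe: "AE x in M. q x = P g x"
    using AE_P_bounded[OF gm gA] by eventually_elim (simp add: q_def clamp_eq)
  define d' where "d' x = g x - q (T x)" for x
  have d'b: "\<bar>d' x\<bar> \<le> 2 * real A" for x using gA[of x] qA[of "T x"] unfolding d'_def by linarith
  have d'm[measurable]: "d' \<in> borel_measurable M" unfolding d'_def[abs_def] by measurable
  have d'2: "square_integrable M d'" by (rule square_integrable_bounded[OF d'm d'b])
  have d'e: "AE x in M. d' x = defect g x"
    using AE_T[OF qe] by eventually_elim (simp add: d'_def defect_def)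
  have "martingale_difference d'"
    unfolding martingale_difference_def
  proof (intro conjI allI impI d'2)
    fix k assume k: "square_integrable M k"
    then have [measurable]: "k \<in> borel_measurable M" by measurable
    have [measurable]: "defect g \<in> borel_measurable M" unfolding defect_def[abs_def] by measurable
    have "(\<integral>x. d' x * k (T x) \<partial>M) = (\<integral>x. defect g x * k (T x) \<partial>M)"
      using d'e by (intro integral_cong_AE) auto
    then show "(\<integral>x. d' x * k (T x) \<partial>M) = 0"
      using martingale_differenceD(2)[OF martingale_difference_defect[OF g2] k] by simp
  qed
  moreover have "norm_L2 M (\<lambda>x. d x - d' x) \<le> \<eta>"
  proof -
    define r where "r = norm_L2 M (\<lambda>x. d x - g x)"
    have r: "r < \<eta> / 2" using A unfolding r_def g_def .
    have q0: "norm_L2 M q = norm_L2 M (P g)" by (rule norm_L2_cong_AE[OF _ _ qe]) measurable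
    have "(norm_L2 M (P g))\<^sup>2 = (\<integral>x. g x * P g (T x) \<partial>M)"
      unfolding P_adjoint[OF g2 q2] norm_L2_power2 by (simp add: power2_eq_square)
    also have "\<dots> = (\<integral>x. (g x - d x) * P g (T x) \<partial>M)"
      unfolding left_diff_distrib
      using martingale_differenceD(2)[OF d q2] square_integrable_mult[OF g2 square_integrable_T[OF q2]]
        square_integrable_mult[OF d2 square_integrable_T[OF q2]] by simp
    also have "\<dots> \<le> norm_L2 M (\<lambda>x. g x - d x) * norm_L2 M (\<lambda>x. P g (T x))"
      using norm_L2_Cauchy_Schwarz[OF square_integrable_diff[OF g2 d2] square_integrable_T[OF q2]] by simp
    also have "\<dots> = r * norm_L2 M (P g)"
      using norm_L2_minus[of M "\<lambda>x. d x - g x"] by (simp add: r_def norm_L2_T)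
    finally have "norm_L2 M (P g) * norm_L2 M (P g) \<le> r * norm_L2 M (P g)" by (simp add: power2_eq_square)
    then have "norm_L2 M (P g) \<le> r"
      using norm_L2_nonneg[of M "P g"] norm_L2_nonneg[of M "\<lambda>x. d x - g x"]
      unfolding r_def by (cases "norm_L2 M (P g) = 0") (auto simp: mult_le_cancel_right)
    moreover have "norm_L2 M (\<lambda>x. (d x - g x) + q (T x)) \<le> r + norm_L2 M (\<lambda>x. q (T x))"
      unfolding r_def by (intro norm_L2_triangle square_integrable_diff d2 g2 square_integrable_T
          square_integrable_bounded[OF qm qA])
    moreover have "(\<lambda>x. d x - d' x) = (\<lambda>x. (d x - g x) + q (T x))" by (auto simp: d'_def)
    ultimately show ?thesis using r q0 by (simp add: norm_L2_T)
  qed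
  ultimately show ?thesis using d'b by blast
qed

text \<open>An identity at every point, not only almost everywhere: each \<open>defect\<close>
  subtracts the very representative that the next one starts from.\<close>

lemma transfer_telescope:
  "h y = (\<Sum>k<N. defect ((P ^^ k) h) ((T ^^ k) y)) + (P ^^ N) h ((T ^^ N) y)"
  by (induction N) (simp_all add: defect_def)

definition increment_norm :: "('a \<Rightarrow> real) \<Rightarrow> nat \<Rightarrow> real" where
  "increment_norm h k = norm_L2 M (defect ((P ^^ k) h))"

text \<open>Hannan's condition is the summability of \<open>increment_norm h\<close>.\<close>

lemma hannan_condition:
  assumes h: "square_integrable M h" and \<beta>: "\<beta> > 1 / 2"
    and lim: "limsup (\<lambda>n. ereal (real n powr \<beta> * norm_L2 M ((P ^^ n) h))) < \<infinity>"
  shows "summable (increment_norm h)" and "(\<lambda>k. norm_L2 M ((P ^^ k) h)) \<longlonglongrightarrow> 0"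
proof -
  define a where "a k = norm_L2 M ((P ^^ k) h)" for k
  have a0: "0 \<le> a k" for k by (simp add: a_def norm_L2_nonneg)
  have inc: "(increment_norm h k)\<^sup>2 = (a k)\<^sup>2 - (a (Suc k))\<^sup>2" for k
    unfolding increment_norm_def a_def using norm_defect[OF square_integrable_P_pow[OF h], of k] by simp
  have dec: "a (Suc k) \<le> a k" for k
  proof (rule power2_le_imp_le[OF _ a0])
    have "0 \<le> (increment_norm h k)\<^sup>2" by simp
    then show "(a (Suc k))\<^sup>2 \<le> (a k)\<^sup>2" unfolding inc by simp
  qed
  obtain C0 where "limsup (\<lambda>n. ereal (real n powr \<beta> * a n)) < ereal C0"
    using lim ereal_dense2[OF lim] unfolding a_def by blast
  then have "\<forall>\<^sub>F n in sequentially. ereal (real n powr \<beta> * a n) < ereal C0" by (rule Limsup_lessD)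
  then obtain N where N: "\<And>n. n \<ge> N \<Longrightarrow> real n powr \<beta> * a n < C0" by (auto simp: eventually_sequentially)
  \<comment> \<open>The limsup controls only large \<open>n\<close>; adding the finitely many
    earlier values gives a bound valid from the start.\<close>
  define C where "C = \<bar>C0\<bar> + (\<Sum>n<N. real n powr \<beta> * a n)"
  have nn: "0 \<le> real n powr \<beta> * a n" for n using a0 by simp
  have C: "real n powr \<beta> * a n \<le> C" for n
  proof (cases "n < N")
    case True
    then have "real n powr \<beta> * a n \<le> (\<Sum>n<N. real n powr \<beta> * a n)"
      using nn by (intro member_le_sum) auto
    then show ?thesis unfolding C_def by linarith
  next
    case False
    then have "real n powr \<beta> * a n < C0" using N by simp
    moreover have "0 \<le> (\<Sum>n<N. real n powr \<beta> * a n)" by (intro sum_nonneg nn)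
    ultimately show ?thesis unfolding C_def by linarith
  qed
  have C': "a k \<le> C * real k powr - \<beta>" if "1 \<le> k" for k
  proof -
    have "real k powr \<beta> > 0" using that by simp
    then show ?thesis using C[of k] by (simp add: powr_minus field_simps)
  qed
  have "summable (\<lambda>k. sqrt ((a k)\<^sup>2 - (a (Suc k))\<^sup>2))"
    by (rule summable_sqrt_decrements[OF a0 dec \<beta> C'])
  moreover have "sqrt ((a k)\<^sup>2 - (a (Suc k))\<^sup>2) = increment_norm h k" for k
    unfolding inc[symmetric] by (simp add: increment_norm_def norm_L2_nonneg)
  ultimately show "summable (increment_norm h)" by simp
  have "a \<longlonglongrightarrow> 0"
  proof (rule tendsto_sandwich[of "\<lambda>_. 0"])
    show "\<forall>\<^sub>F k in sequentially. a k \<le> C * real k powr - \<beta>"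
      using C' eventually_sequentially by blast
    have "(\<lambda>k. real k powr - \<beta>) \<longlonglongrightarrow> 0"
      using \<beta> by (intro tendsto_neg_powr filterlim_real_sequentially) simp
    then show "(\<lambda>k. C * real k powr - \<beta>) \<longlonglongrightarrow> 0" by (rule tendsto_mult_right_zero)
  qed (use a0 in auto)
  then show "(\<lambda>k. norm_L2 M ((P ^^ k) h)) \<longlonglongrightarrow> 0" unfolding a_def .
qed

text \<open>Sums over two stretches of the orbit shifted by \<open>k\<close> cancel except for
  \<open>k\<close> terms at either end, however long the stretches are.\<close>

lemma abs_coboundary_le:
  assumes b: "\<And>x. \<bar>f x\<bar> \<le> b"
  shows "max_birkhoff (\<lambda>x. f ((T ^^ k) x) - f x) n y \<le> 2 * real k * b"
proof (rule max_birkhoff_le)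
  fix j
  have "birkhoff_sum T f (j + k) y = birkhoff_sum T f (k + j) y" by (simp add: add.commute)
  then have "birkhoff_sum T (\<lambda>x. f ((T ^^ k) x) - f x) j y = birkhoff_sum T f k ((T ^^ j) y) - birkhoff_sum T f k y"
    unfolding birkhoff_sum_add_index birkhoff_sum_diff birkhoff_sum_comp by simp
  then show "\<bar>birkhoff_sum T (\<lambda>x. f ((T ^^ k) x) - f x) j y\<bar> \<le> 2 * real k * b"
    using abs_birkhoff_sum_le[of f b k y, OF b] abs_birkhoff_sum_le[of f b k "(T ^^ j) y", OF b]
    unfolding mult.assoc by linarith
qed

text \<open>The error has four parts: truncation of the first \<open>K\<close> defects, the later
  defects, the remainder after \<open>N\<close> steps, and the coboundaries that move truncated
  defects to time 0. Only the first two grow like sqrt n, with a share of \<epsilon> / 2 each;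
  \<open>B\<close> bounds the others and depends on neither n nor \<open>N\<close>.\<close>

lemma martingale_approximation:
  assumes h: "square_integrable M h" and sm: "summable (increment_norm h)"
    and lim: "(\<lambda>k. norm_L2 M ((P ^^ k) h)) \<longlonglongrightarrow> 0" and \<epsilon>: "\<epsilon> > 0"
  shows "\<exists>m b B. martingale_difference m \<and> (\<forall>x. \<bar>m x\<bar> \<le> b) \<and>
    (\<forall>n. norm_L2 M (max_birkhoff (\<lambda>x. h x - m x) n) \<le> \<epsilon> * sqrt (real n) + B)"
proof -
  have inn: "0 \<le> increment_norm h k" for k by (simp add: increment_norm_def norm_L2_nonneg)
  define d where "d k = defect ((P ^^ k) h)" for k
  have dm: "martingale_difference (d k)" for k
    unfolding d_def by (rule martingale_difference_defect[OF square_integrable_P_pow[OF h]])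
  note d2 = martingale_differenceD(1)[OF dm]
  \<comment> \<open>The factor 8 of the maximal inequality turns \<epsilon> / 16 into \<epsilon> /
    2. The tolerance \<open>\<eta>\<close> shares the same amount among \<open>K\<close> defects,
    divided by K + 1 to allow K = 0.\<close>
  obtain K where K: "norm (\<Sum>k. increment_norm h (k + K)) < \<epsilon> / 16"
    using suminf_exist_split[of "\<epsilon> / 16" "increment_norm h", OF _ sm] \<epsilon> by auto
  have tail: "(\<Sum>k\<in>{K..<N}. increment_norm h k) \<le> \<epsilon> / 16" for N
  proof -
    have "(\<Sum>k\<in>{K..<N}. increment_norm h k) = (\<Sum>k<N - K. increment_norm h (k + K))"
      by (cases "K \<le> N") (auto simp: sum.atLeastLessThan_shift_0 atLeast0LessThan add.commute)
    also have "\<dots> \<le> (\<Sum>k. increment_norm h (k + K))"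
      by (intro sum_le_suminf summable_ignore_initial_segment sm) (auto simp: inn)
    finally show ?thesis using K by simp
  qed
  define \<eta> where "\<eta> = \<epsilon> / (16 * (real K + 1))"
  have \<eta>: "\<eta> > 0" using \<epsilon> by (simp add: \<eta>_def)
  have "\<forall>k. \<exists>d' b. martingale_difference d' \<and> (\<forall>x. \<bar>d' x\<bar> \<le> b) \<and> norm_L2 M (\<lambda>x. d k x - d' x) \<le> \<eta>"
    using martingale_difference_bounded_approx[OF dm \<eta>] by blast
  then obtain e b where e: "\<And>k. martingale_difference (e k)" "\<And>k x. \<bar>e k x\<bar> \<le> b k"
    "\<And>k. norm_L2 M (\<lambda>x. d k x - e k x) \<le> \<eta>" by metis
  note e2 = martingale_differenceD(1)[OF e(1)]
  have em[measurable]: "e k \<in> borel_measurable M" "d k \<in> borel_measurable M" for k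
    using e2 d2 by (auto intro: square_integrable_measurable)
  define m where "m x = (\<Sum>k<K. e k x)" for x
  have mm: "martingale_difference m"
    unfolding m_def[abs_def] by (rule martingale_difference_sum) (rule e)
  have mb: "\<bar>m x\<bar> \<le> (\<Sum>k<K. b k)" for x
    unfolding m_def using e(2) by (intro order_trans[OF sum_abs] sum_mono) auto
  define B where "B = 1 + (\<Sum>k<K. 2 * real k * b k)"
  have "norm_L2 M (max_birkhoff (\<lambda>x. h x - m x) n) \<le> \<epsilon> * sqrt (real n) + B" for n
  proof -
    \<comment> \<open>\<open>N\<close> may depend on \<open>n\<close> because \<open>m\<close> does
      not involve it; the crude factor \<open>n\<close> is therefore affordable for the
      remainder.\<close>
    have "(\<lambda>k. real n * norm_L2 M ((P ^^ k) h)) \<longlonglongrightarrow> real n * 0" by (intro tendsto_mult_left lim)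
    then have "\<forall>\<^sub>F k in sequentially. real n * norm_L2 M ((P ^^ k) h) < 1" by (intro order_tendstoD(2)) auto
    then obtain N0 where N0: "\<And>k. k \<ge> N0 \<Longrightarrow> real n * norm_L2 M ((P ^^ k) h) < 1" by (auto simp: eventually_sequentially)
    define N where "N = max N0 K"
    have N: "N \<ge> K" "real n * norm_L2 M ((P ^^ N) h) < 1" using N0 by (auto simp: N_def)
    define f1 where "f1 x = (\<Sum>k<K. d k ((T ^^ k) x) - e k ((T ^^ k) x))" for x
    define f2 where "f2 x = (\<Sum>k\<in>{K..<N}. d k ((T ^^ k) x))" for x
    define f3 where "f3 x = (P ^^ N) h ((T ^^ N) x)" for x
    define f4 where "f4 x = (\<Sum>k<K. e k ((T ^^ k) x) - e k x)" for x
    have de2: "square_integrable M (\<lambda>x. d k ((T ^^ k) x) - e k ((T ^^ k) x))" for k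
      by (intro square_integrable_diff square_integrable_T_pow d2 e2)
    have ee2: "square_integrable M (\<lambda>x. e k ((T ^^ k) x) - e k x)" for k
      by (intro square_integrable_diff square_integrable_T_pow e2)
    have sq: "square_integrable M f1" "square_integrable M f2" "square_integrable M f3" "square_integrable M f4"
      unfolding f1_def[abs_def] f2_def[abs_def] f3_def[abs_def] f4_def[abs_def]
      by (intro square_integrable_sum de2 ee2 square_integrable_T_pow d2 square_integrable_P_pow h)+
    have eq: "(\<lambda>x. h x - m x) = (\<lambda>x. f1 x + (f2 x + (f3 x + f4 x)))"
    proof
      fix x
      have "h x = (\<Sum>k<N. d k ((T ^^ k) x)) + f3 x"
        unfolding d_def f3_def by (rule transfer_telescope)
      also have "(\<Sum>k<N. d k ((T ^^ k) x)) = (\<Sum>k<K. d k ((T ^^ k) x)) + f2 x"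
        unfolding f2_def using sum.atLeastLessThan_concat[of 0 K N "\<lambda>k. d k ((T ^^ k) x)"] N(1)
        by (simp add: atLeast0LessThan)
      finally show "h x - m x = f1 x + (f2 x + (f3 x + f4 x))"
        by (simp add: f1_def f4_def m_def sum_subtractf)
    qed
    have "norm_L2 M (max_birkhoff (\<lambda>x. h x - m x) n) \<le> norm_L2 M (max_birkhoff f1 n) +
      (norm_L2 M (max_birkhoff f2 n) + (norm_L2 M (max_birkhoff f3 n) + norm_L2 M (max_birkhoff f4 n)))"
      unfolding eq
      by (intro order_trans[OF norm_max_birkhoff_add] add_mono order_refl square_integrable_add sq)
    moreover have "norm_L2 M (max_birkhoff f1 n) \<le> \<epsilon> / 2 * sqrt (real n)"
    proof -
      have "norm_L2 M (max_birkhoff f1 n) \<le> (\<Sum>k<K. norm_L2 M (max_birkhoff (\<lambda>x. d k ((T ^^ k) x) - e k ((T ^^ k) x)) n))"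
        unfolding f1_def[abs_def] by (rule norm_max_birkhoff_sum) (rule de2)
      also have "\<dots> \<le> (\<Sum>k<K. 8 * sqrt (real n) * \<eta>)"
      proof (rule sum_mono)
        fix k
        have "norm_L2 M (max_birkhoff (\<lambda>x. d k ((T ^^ k) x) - e k ((T ^^ k) x)) n)
          = norm_L2 M (max_birkhoff (\<lambda>x. d k x - e k x) n)"
          using norm_max_birkhoff_comp[of "\<lambda>x. d k x - e k x" k n] by simp
        also have "\<dots> \<le> 8 * sqrt (real n) * norm_L2 M (\<lambda>x. d k x - e k x)"
          by (rule norm_max_birkhoff_martingale[OF martingale_difference_diff[OF dm e(1)]])
        also have "\<dots> \<le> 8 * sqrt (real n) * \<eta>" by (intro mult_left_mono e(3)) simp
        finally show "norm_L2 M (max_birkhoff (\<lambda>x. d k ((T ^^ k) x) - e k ((T ^^ k) x)) n) \<le> 8 * sqrt (real n) * \<eta>" .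
      qed
      also have "\<dots> = (8 * real K * \<eta>) * sqrt (real n)" by simp
      also have "\<dots> \<le> \<epsilon> / 2 * sqrt (real n)"
      proof (rule mult_right_mono)
        have "8 * real K * \<eta> = \<epsilon> / 2 * (real K / (real K + 1))" by (simp add: \<eta>_def field_simps)
        also have "\<dots> \<le> \<epsilon> / 2 * 1" using \<epsilon> by (intro mult_left_mono) auto
        finally show "8 * real K * \<eta> \<le> \<epsilon> / 2" by simp
      qed simp
      finally show ?thesis .
    qed
    moreover have "norm_L2 M (max_birkhoff f2 n) \<le> \<epsilon> / 2 * sqrt (real n)"
    proof -
      have "norm_L2 M (max_birkhoff f2 n) \<le> (\<Sum>k\<in>{K..<N}. norm_L2 M (max_birkhoff (\<lambda>x. d k ((T ^^ k) x)) n))"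
        unfolding f2_def[abs_def] by (rule norm_max_birkhoff_sum) (intro square_integrable_T_pow d2)
      also have "\<dots> \<le> (\<Sum>k\<in>{K..<N}. 8 * sqrt (real n) * increment_norm h k)"
        unfolding increment_norm_def d_def[symmetric] norm_max_birkhoff_comp[OF em(2)]
        by (intro sum_mono norm_max_birkhoff_martingale dm)
      also have "\<dots> = 8 * sqrt (real n) * (\<Sum>k\<in>{K..<N}. increment_norm h k)"
        by (simp add: sum_distrib_left)
      also have "\<dots> \<le> 8 * sqrt (real n) * (\<epsilon> / 16)" by (intro mult_left_mono tail) simp
      finally show ?thesis by simp
    qed
    moreover have "norm_L2 M (max_birkhoff f3 n) \<le> 1"
    proof -
      note p2 = square_integrable_P_pow[OF h, of N]
      have "norm_L2 M (max_birkhoff f3 n) = norm_L2 M (max_birkhoff ((P ^^ N) h) n)"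
        unfolding f3_def[abs_def] by (rule norm_max_birkhoff_comp[OF square_integrable_measurable[OF p2]])
      also have "\<dots> \<le> real n * norm_L2 M ((P ^^ N) h)" by (rule norm_max_birkhoff_le[OF p2])
      finally show ?thesis using N by simp
    qed
    moreover have "norm_L2 M (max_birkhoff f4 n) \<le> (\<Sum>k<K. 2 * real k * b k)"
    proof -
      have "norm_L2 M (max_birkhoff f4 n) \<le> (\<Sum>k<K. norm_L2 M (max_birkhoff (\<lambda>x. e k ((T ^^ k) x) - e k x) n))"
        unfolding f4_def[abs_def] by (rule norm_max_birkhoff_sum) (rule ee2)
      also have "\<dots> \<le> (\<Sum>k<K. 2 * real k * b k)"
      proof (intro sum_mono norm_L2_const_bound)
        fix k x
        show "\<bar>max_birkhoff (\<lambda>x. e k ((T ^^ k) x) - e k x) n x\<bar> \<le> 2 * real k * b k"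
          using abs_coboundary_le[of "e k" "b k" k n x, OF e(2)] max_birkhoff_nonneg by (simp add: abs_of_nonneg)
      qed measurable
      finally show ?thesis .
    qed
    ultimately show ?thesis unfolding B_def by (simp add: algebra_simps)
  qed
  then show ?thesis using mm mb by blast
qed

end

section \<open>The martingale central limit theorem\<close>

lemma exp_minus_approx:
  fixes u :: real assumes "0 \<le> u"
  shows "\<bar>exp (- u) - 1 + u\<bar> \<le> u\<^sup>2"
proof -
  have "1 + - u \<le> exp (- u)" by (rule exp_ge_add_one_self)
  moreover have "exp (- u) \<le> 1 - u + u\<^sup>2"
  proof -
    have "1 + u \<le> exp u" by (rule exp_ge_add_one_self)
    then have "exp (- u) \<le> inverse (1 + u)" unfolding exp_minus using assms by (intro le_imp_inverse_le) auto
    also have "\<dots> \<le> 1 - u + u\<^sup>2"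
    proof -
      have "(1 - u + u\<^sup>2) * (1 + u) = 1 + u ^ 3" by (simp add: power2_eq_square power3_eq_cube algebra_simps)
      then have "1 \<le> (1 - u + u\<^sup>2) * (1 + u)" using assms by simp
      then show ?thesis using assms by (simp add: inverse_eq_divide divide_le_eq)
    qed
    finally show ?thesis .
  qed
  ultimately show ?thesis by (simp add: abs_le_iff)
qed

text \<open>Both functions agree with 1 + i x - x^2/2 up to third order; |x| \<le> 1 turns the
  fourth order error of the real exponential into a cubic one.\<close>

lemma iexp_factor_bound:
  assumes x: "\<bar>x\<bar> \<le> 1"
  shows "cmod (iexp x - (1 + \<i> * of_real x) * of_real (exp (- (x\<^sup>2) / 2))) \<le> 2 * \<bar>x\<bar> ^ 3"
proof -
  define e where "e = exp (- (x\<^sup>2) / 2)"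
  have "(\<Sum>k\<le>2. (\<i> * of_real x) ^ k / fact k) = 1 + \<i> * of_real x - of_real (x\<^sup>2 / 2)"
    by (simp add: numeral_2_eq_2 power_mult_distrib)
  then have 1: "cmod (iexp x - (1 + \<i> * of_real x - of_real (x\<^sup>2 / 2))) \<le> \<bar>x\<bar> ^ 3 / 6"
    using iexp_approx1[of x 2] by (simp add: fact_numeral numeral_3_eq_3)
  have e: "\<bar>e - 1 + x\<^sup>2 / 2\<bar> \<le> \<bar>x\<bar> ^ 3 / 4"
  proof -
    have "\<bar>e - 1 + x\<^sup>2 / 2\<bar> \<le> (x\<^sup>2 / 2)\<^sup>2" using exp_minus_approx[of "x\<^sup>2 / 2"] by (simp add: e_def)
    also have "\<dots> = x ^ 4 / 4" by (simp add: power2_eq_square power4_eq_xxxx)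
    also have "x ^ 4 = \<bar>x\<bar> ^ 3 * \<bar>x\<bar>" by (simp add: power3_eq_cube power4_eq_xxxx)
    also have "\<bar>x\<bar> ^ 3 * \<bar>x\<bar> / 4 \<le> \<bar>x\<bar> ^ 3 * 1 / 4" using x by (intro divide_right_mono mult_left_mono) auto
    finally show ?thesis by simp
  qed
  have split: "(1 + \<i> * w - v) - (1 + \<i> * w) * E = w * (\<i> * v) - (1 + \<i> * w) * (E - 1 + v)" for w v E :: complex
    by (simp add: algebra_simps)
  have "(1 + \<i> * of_real x - of_real (x\<^sup>2 / 2)) - (1 + \<i> * of_real x) * of_real e
      = of_real x * (\<i> * of_real (x\<^sup>2 / 2)) - (1 + \<i> * of_real x) * of_real (e - 1 + x\<^sup>2 / 2)"
    unfolding of_real_add[of "e - 1"] of_real_diff of_real_1 by (rule split)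
  also have "cmod \<dots> \<le> \<bar>x\<bar> ^ 3 / 2 + 2 * (\<bar>x\<bar> ^ 3 / 4)"
  proof (rule order_trans[OF norm_triangle_ineq4 add_mono])
    show "cmod (of_real x * (\<i> * of_real (x\<^sup>2 / 2))) \<le> \<bar>x\<bar> ^ 3 / 2"
      unfolding norm_mult norm_of_real by (simp add: power2_eq_square power3_eq_cube abs_mult)
    have "cmod (1 + \<i> * of_real x) \<le> 1 + \<bar>x\<bar>"
      using norm_triangle_ineq[of 1 "\<i> * of_real x"] by (simp add: norm_mult)
    then have "cmod (1 + \<i> * of_real x) \<le> 2" using x by linarith
    then show "cmod ((1 + \<i> * of_real x) * of_real (e - 1 + x\<^sup>2 / 2)) \<le> 2 * (\<bar>x\<bar> ^ 3 / 4)"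
      unfolding norm_mult norm_of_real using e by (intro mult_mono) auto
  qed
  finally have 2: "cmod ((1 + \<i> * of_real x - of_real (x\<^sup>2 / 2)) - (1 + \<i> * of_real x) * of_real e) \<le> \<bar>x\<bar> ^ 3" by simp
  have "cmod (iexp x - (1 + \<i> * of_real x) * of_real e) \<le> \<bar>x\<bar> ^ 3 / 6 + \<bar>x\<bar> ^ 3"
    using norm_diff_triangle_le[OF 1 2] .
  then show ?thesis unfolding e_def[symmetric] using zero_le_power[of "\<bar>x\<bar>" 3] by linarith
qed

lemma cmod_one_plus_i: "cmod (1 + \<i> * of_real x) \<le> exp (x\<^sup>2 / 2)"
proof (rule power2_le_imp_le)
  have "(cmod (1 + \<i> * of_real x))\<^sup>2 = 1 + x\<^sup>2" by (simp add: cmod_power2)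
  also have "\<dots> \<le> exp (x\<^sup>2)" by (rule exp_ge_add_one_self)
  also have "\<dots> = (exp (x\<^sup>2 / 2))\<^sup>2" by (simp add: power2_eq_square flip: exp_add)
  finally show "(cmod (1 + \<i> * of_real x))\<^sup>2 \<le> (exp (x\<^sup>2 / 2))\<^sup>2" .
qed simp

lemma cmod_prod_one_plus_i:
  fixes y :: "nat \<Rightarrow> real"
  shows "cmod (\<Prod>l<n. 1 + \<i> * of_real (y l)) \<le> exp ((\<Sum>l<n. (y l)\<^sup>2) / 2)"
proof -
  have "cmod (\<Prod>l<n. 1 + \<i> * of_real (y l)) = (\<Prod>l<n. cmod (1 + \<i> * of_real (y l)))" by (simp add: prod_norm)
  also have "\<dots> \<le> (\<Prod>l<n. exp ((y l)\<^sup>2 / 2))" by (intro prod_mono) (simp add: cmod_one_plus_i)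
  also have "\<dots> = exp ((\<Sum>l<n. (y l)\<^sup>2) / 2)"
    by (subst exp_sum[symmetric]) (simp_all add: sum_divide_distrib)
  finally show ?thesis .
qed

text \<open>A difference of products is at most the sum of the differences of the factors when all
  factors lie in the unit disc; the damping exp (- y^2/2) compensates the growth of 1 + i y.\<close>

lemma iexp_sum_approx:
  fixes y :: "nat \<Rightarrow> real"
  assumes y: "\<And>l. l < n \<Longrightarrow> \<bar>y l\<bar> \<le> 1"
  shows "cmod (iexp (\<Sum>l<n. y l) - (\<Prod>l<n. 1 + \<i> * of_real (y l)) * of_real (exp (- (\<Sum>l<n. (y l)\<^sup>2) / 2)))
    \<le> (\<Sum>l<n. 2 * \<bar>y l\<bar> ^ 3)"
proof -
  have 1: "iexp (\<Sum>l<n. y l) = (\<Prod>l<n. iexp (y l))"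
    by (simp add: exp_sum[symmetric] sum_distrib_left)
  have "exp (- (\<Sum>l<n. (y l)\<^sup>2) / 2) = (\<Prod>l<n. exp (- ((y l)\<^sup>2) / 2))"
    by (simp add: exp_sum[symmetric] sum_negf sum_divide_distrib)
  then have 2: "(\<Prod>l<n. 1 + \<i> * of_real (y l)) * of_real (exp (- (\<Sum>l<n. (y l)\<^sup>2) / 2))
    = (\<Prod>l<n. (1 + \<i> * of_real (y l)) * of_real (exp (- ((y l)\<^sup>2) / 2)))"
    by (simp add: prod.distrib)
  have "cmod ((1 + \<i> * of_real x) * of_real (exp (- (x\<^sup>2) / 2))) \<le> 1" for x
  proof -
    have "cmod (1 + \<i> * of_real x) * exp (- (x\<^sup>2) / 2) \<le> exp (x\<^sup>2 / 2) * exp (- (x\<^sup>2) / 2)"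
      by (intro mult_right_mono cmod_one_plus_i) simp
    also have "\<dots> = 1" by (simp flip: exp_add)
    finally show ?thesis by (simp add: norm_mult del: of_real_exp)
  qed
  then have "cmod ((\<Prod>l<n. iexp (y l)) - (\<Prod>l<n. (1 + \<i> * of_real (y l)) * of_real (exp (- ((y l)\<^sup>2) / 2))))
    \<le> (\<Sum>l<n. cmod (iexp (y l) - (1 + \<i> * of_real (y l)) * of_real (exp (- ((y l)\<^sup>2) / 2))))"
    by (intro norm_prod_diff) auto
  also have "\<dots> \<le> (\<Sum>l<n. 2 * \<bar>y l\<bar> ^ 3)" by (intro sum_mono iexp_factor_bound) (simp add: y)
  finally show ?thesis unfolding 1 2 .
qed

context measure_preserving
begin

lemma martingale_difference_complex:
  fixes G :: "'a \<Rightarrow> complex"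
  assumes m: "martingale_difference m" and G[measurable]: "G \<in> borel_measurable M" and C: "\<And>x. cmod (G x) \<le> C"
  shows "integrable M (\<lambda>x. of_real (m x) * G (T x))" and "(\<integral>x. of_real (m x) * G (T x) \<partial>M) = 0"
proof -
  note m2 = martingale_differenceD(1)[OF m]
  have [measurable]: "m \<in> borel_measurable M" using m2 by measurable
  have R: "square_integrable M (\<lambda>x. Re (G x))" "square_integrable M (\<lambda>x. Im (G x))"
    by (auto intro!: square_integrable_bounded[where b = C] order_trans[OF abs_Re_le_cmod C] order_trans[OF abs_Im_le_cmod C])
  note iR = square_integrable_mult[OF m2 square_integrable_T[OF R(1)]]
    and iI = square_integrable_mult[OF m2 square_integrable_T[OF R(2)]]
  have eq: "of_real (m x) * G (T x) = of_real (m x * Re (G (T x))) + \<i> * of_real (m x * Im (G (T x)))" for x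
    by (simp add: complex_eq_iff)
  show "integrable M (\<lambda>x. of_real (m x) * G (T x))"
    unfolding eq by (intro Bochner_Integration.integrable_add integrable_mult_right integrable_of_real iR iI)
  show "(\<integral>x. of_real (m x) * G (T x) \<partial>M) = 0"
    unfolding eq
    using iR iI martingale_differenceD(2)[OF m R(1)] martingale_differenceD(2)[OF m R(2)]
    by (subst Bochner_Integration.integral_add)
      (auto simp del: of_real_mult simp: integral_complex_of_real)
qed

text \<open>Since \<open>m\<close> is bounded, the estimate is the same at all points, and it stays
  finite as n grows if the squares of the weights have bounded sums; this supplies the dominating
  constant for the limit theorem.\<close>

lemma prod_bounded:
  assumes b: "\<And>x. \<bar>m x\<bar> \<le> b"
  shows "cmod (\<Prod>l<n. 1 + \<i> * of_real (c l * m ((T ^^ l) x))) \<le> exp ((\<Sum>l<n. (c l)\<^sup>2 * b\<^sup>2) / 2)"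
proof -
  have "(c l * m ((T ^^ l) x))\<^sup>2 \<le> (c l)\<^sup>2 * b\<^sup>2" for l
  proof -
    have "\<bar>m ((T ^^ l) x)\<bar>\<^sup>2 \<le> b\<^sup>2" using b by (intro power_mono) auto
    then show ?thesis by (simp add: power_mult_distrib mult_left_mono)
  qed
  then have "(\<Sum>l<n. (c l * m ((T ^^ l) x))\<^sup>2) \<le> (\<Sum>l<n. (c l)\<^sup>2 * b\<^sup>2)" by (intro sum_mono)
  then show ?thesis
    by (intro order_trans[OF cmod_prod_one_plus_i[of "\<lambda>l. c l * m ((T ^^ l) x)" n]]) simp
qed

text \<open>All factors but the first depend on \<open>T x\<close> only, and \<open>m\<close> is
  orthogonal to such functions, so the first factor contributes 1; invariance then shifts the
  weights \<open>c\<close> by one.\<close>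

lemma martingale_product:
  assumes m: "martingale_difference m" and b: "\<And>x. \<bar>m x\<bar> \<le> b"
  shows "(\<integral>x. (\<Prod>l<n. 1 + \<i> * of_real (c l * m ((T ^^ l) x))) \<partial>M) = 1"
proof (induction n arbitrary: c)
  case 0
  then show ?case by (simp add: prob_space)
next
  case (Suc n)
  have [measurable]: "m \<in> borel_measurable M" using martingale_differenceD(1)[OF m] by measurable
  define G where "G x = (\<Prod>l<n. 1 + \<i> * of_real (c (Suc l) * m ((T ^^ l) x)))" for x
  have Gm[measurable]: "G \<in> borel_measurable M" unfolding G_def[abs_def] by measurable
  have Gb: "cmod (G x) \<le> exp ((\<Sum>l<n. (c (Suc l))\<^sup>2 * b\<^sup>2) / 2)" for x
    unfolding G_def by (rule prod_bounded[of m b "\<lambda>l. c (Suc l)", OF b])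
  have iG: "integrable M G" by (rule integrable_bounded_complex[OF Gm Gb])
  have "(\<Prod>l<Suc n. 1 + \<i> * of_real (c l * m ((T ^^ l) x))) = G (T x) + (\<i> * of_real (c 0)) * (of_real (m x) * G (T x))" for x
    unfolding G_def by (subst prod.lessThan_Suc_shift) (simp add: funpow_swap1 algebra_simps)
  then have "(\<integral>x. (\<Prod>l<Suc n. 1 + \<i> * of_real (c l * m ((T ^^ l) x))) \<partial>M)
    = (\<integral>x. G (T x) \<partial>M) + (\<i> * of_real (c 0)) * (\<integral>x. of_real (m x) * G (T x) \<partial>M)"
    using integrable_T[OF iG] martingale_difference_complex(1)[OF m Gm Gb] by simp
  also have "\<dots> = (\<integral>x. G x \<partial>M)"
    using integral_T[OF Gm] martingale_difference_complex(2)[OF m Gm Gb] by simp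
  finally show ?case using Suc by (simp add: G_def)
qed

lemma birkhoff_floor:
  assumes lim: "(\<lambda>n. birkhoff_sum T f n y / real n) \<longlonglongrightarrow> c" and t: "0 \<le> t"
  shows "(\<lambda>n. birkhoff_sum T f (nat \<lfloor>real n * t\<rfloor>) y / real n) \<longlonglongrightarrow> t * c"
proof (cases "t = 0")
  case False
  then have t: "t > 0" using t by simp
  have fl: "filterlim (\<lambda>n. nat \<lfloor>real n * t\<rfloor>) sequentially sequentially"
    unfolding filterlim_at_top
  proof
    fix Z :: nat
    obtain n0 :: nat where n0: "real (Z + 1) / t \<le> real n0" using real_arch_simple by blast
    have "Z \<le> nat \<lfloor>real n * t\<rfloor>" if "n \<ge> n0" for n
    proof -
      have "real (Z + 1) / t \<le> real n" using n0 that by linarith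
      then have "real (Z + 1) \<le> real n * t" using t by (simp add: divide_le_eq)
      then show ?thesis by linarith
    qed
    then show "\<forall>\<^sub>F n in sequentially. Z \<le> nat \<lfloor>real n * t\<rfloor>" using eventually_sequentially by blast
  qed
  have "(\<lambda>n. (real (nat \<lfloor>real n * t\<rfloor>) / real n) *
      (birkhoff_sum T f (nat \<lfloor>real n * t\<rfloor>) y / real (nat \<lfloor>real n * t\<rfloor>))) \<longlonglongrightarrow> t * c"
    using t by (intro tendsto_mult LIMSEQ_nat_floor_div filterlim_compose[OF lim fl]) auto
  \<comment> \<open>If the floor is 0, the second quotient is 0 / 0, which is 0, as is the empty sum
    on the right.\<close>
  moreover have "(real (nat \<lfloor>real n * t\<rfloor>) / real n) *
      (birkhoff_sum T f (nat \<lfloor>real n * t\<rfloor>) y / real (nat \<lfloor>real n * t\<rfloor>)) = birkhoff_sum T f (nat \<lfloor>real n * t\<rfloor>) y / real n" for n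
    by (cases "nat \<lfloor>real n * t\<rfloor> = 0") auto
  ultimately show ?thesis by simp
qed simp

lemma birkhoff_sum_diff_blocks:
  "p \<le> q \<Longrightarrow> birkhoff_sum T f q y - birkhoff_sum T f p y = (\<Sum>l\<in>{p..<q}. f ((T ^^ l) y))"
  unfolding birkhoff_sum_def using sum_diff_nat_ivl[of 0 p q "\<lambda>l. f ((T ^^ l) y)"] by (simp add: atLeast0LessThan)

lemma abs_block_coeff_le: "\<bar>block_coeff p k \<theta> l\<bar> \<le> (\<Sum>j<k. \<bar>\<theta> j\<bar>)"
  unfolding block_coeff_def by (intro order_trans[OF sum_abs] sum_mono) auto

text \<open>McLeish's method. The combination of increments is a sum of terms \<open>Y n l\<close>
  of order 1/sqrt n whose squares add up to nearly \<open>V\<close>. Its complex exponential is thus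
  close to exp (- V/2) times the product, with a uniform bound, and the mean of the product is
  known.\<close>

lemma martingale_joint_char:
  fixes t :: "nat \<Rightarrow> real"
  assumes erg: "ergodic_transformation M T"
    and m: "martingale_difference m" and b: "\<And>x. \<bar>m x\<bar> \<le> b"
    and t: "0 \<le> t 0" "\<And>i. i < k \<Longrightarrow> t i \<le> t (Suc i)" "t k \<le> 1" "\<And>i. i \<le> k \<Longrightarrow> t i \<in> {0..1}"
  defines "p n i \<equiv> nat \<lfloor>real n * t i\<rfloor>"
  shows "(\<lambda>n. \<integral>y. iexp (\<Sum>i<k. \<theta> i * ((birkhoff_sum T m (p n (Suc i)) y - birkhoff_sum T m (p n i) y) / sqrt (real n))) \<partial>M)
    \<longlonglongrightarrow> of_real (exp (- (\<Sum>i<k. (\<theta> i)\<^sup>2 * (t (Suc i) - t i)) * (norm_L2 M m)\<^sup>2 / 2))"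
proof -
  note m2 = martingale_differenceD(1)[OF m]
  have mm[measurable]: "m \<in> borel_measurable M" using m2 by measurable
  have b0: "0 \<le> b" using b abs_ge_zero order_trans by blast
  define \<Theta> where "\<Theta> = (\<Sum>j<k. \<bar>\<theta> j\<bar>)"
  have \<Theta>0: "0 \<le> \<Theta>" unfolding \<Theta>_def by (intro sum_nonneg) auto
  define c where "c n l = block_coeff (p n) k \<theta> l / sqrt (real n)" for n l
  define Y where "Y n l y = c n l * m ((T ^^ l) y)" for n l y
  define V where "V = (\<Sum>i<k. (\<theta> i)\<^sup>2 * (t (Suc i) - t i)) * (norm_L2 M m)\<^sup>2"
  have p: "p n j \<le> p n (Suc j)" if "j < k" for n j
    unfolding p_def using t(2)[OF that] by (intro nat_mono floor_mono mult_left_mono) auto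
  have pN: "p n j \<le> n" if "j \<le> k" for n j
    unfolding p_def by (rule nat_floor_mult_le[OF t(4)[OF that]])
  have Ysum: "(\<Sum>i<k. \<theta> i * ((birkhoff_sum T m (p n (Suc i)) y - birkhoff_sum T m (p n i) y) / sqrt (real n))) = (\<Sum>l<n. Y n l y)" for n y
  proof -
    have "(\<Sum>l<n. Y n l y) = (\<Sum>l<n. block_coeff (p n) k \<theta> l * m ((T ^^ l) y)) / sqrt (real n)"
      by (simp add: Y_def c_def sum_divide_distrib)
    also have "\<dots> = (\<Sum>j<k. \<theta> j * (\<Sum>l\<in>{p n j..<p n (Suc j)}. m ((T ^^ l) y))) / sqrt (real n)"
      by (subst sum_block_coeff) (use pN in auto)
    also have "\<dots> = (\<Sum>i<k. \<theta> i * ((birkhoff_sum T m (p n (Suc i)) y - birkhoff_sum T m (p n i) y) / sqrt (real n)))"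
      unfolding sum_divide_distrib
      by (intro sum.cong refl) (simp add: birkhoff_sum_diff_blocks[OF p])
    finally show ?thesis by simp
  qed
  \<comment> \<open>The blocks are disjoint, so squaring the weights squares each \<theta>, and the
    squares become Birkhoff sums of m^2, to which the ergodic theorem applies.\<close>
  have Ysq: "(\<Sum>l<n. (Y n l y)\<^sup>2) = (\<Sum>i<k. (\<theta> i)\<^sup>2 * (birkhoff_sum T (\<lambda>x. (m x)\<^sup>2) (p n (Suc i)) y / real n - birkhoff_sum T (\<lambda>x. (m x)\<^sup>2) (p n i) y / real n))" for n y
  proof -
    have "(\<Sum>l<n. (Y n l y)\<^sup>2) = (\<Sum>l<n. block_coeff (p n) k (\<lambda>i. (\<theta> i)\<^sup>2) l * (m ((T ^^ l) y))\<^sup>2) / real n"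
      by (simp add: Y_def c_def sum_divide_distrib power_mult_distrib power_divide block_coeff_power2[of k "p n", OF p])
    also have "\<dots> = (\<Sum>j<k. (\<theta> j)\<^sup>2 * (\<Sum>l\<in>{p n j..<p n (Suc j)}. (m ((T ^^ l) y))\<^sup>2)) / real n"
      by (subst sum_block_coeff) (use pN in auto)
    also have "\<dots> = (\<Sum>i<k. (\<theta> i)\<^sup>2 * (birkhoff_sum T (\<lambda>x. (m x)\<^sup>2) (p n (Suc i)) y / real n - birkhoff_sum T (\<lambda>x. (m x)\<^sup>2) (p n i) y / real n))"
      unfolding sum_divide_distrib
      by (intro sum.cong refl) (simp add: birkhoff_sum_diff_blocks[OF p] flip: diff_divide_distrib)
    finally show ?thesis .
  qed
  have cb: "\<bar>c n l\<bar> \<le> \<Theta> / sqrt (real n)" for n l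
  proof -
    have "\<bar>block_coeff (p n) k \<theta> l\<bar> \<le> \<Theta>" unfolding \<Theta>_def by (rule abs_block_coeff_le)
    then show ?thesis unfolding c_def abs_divide by (simp add: divide_right_mono)
  qed
  have Yb: "\<bar>Y n l y\<bar> \<le> \<Theta> * b / sqrt (real n)" for n l y
  proof -
    have "\<bar>Y n l y\<bar> \<le> \<Theta> / sqrt (real n) * b" unfolding Y_def abs_mult
      by (intro mult_mono cb b) (use \<Theta>0 in auto)
    then show ?thesis by simp
  qed
  have csum: "(\<Sum>l<n. (c n l)\<^sup>2 * b\<^sup>2) \<le> \<Theta>\<^sup>2 * b\<^sup>2" for n
  proof -
    have "(c n l)\<^sup>2 * b\<^sup>2 \<le> (\<Theta>\<^sup>2 / real n) * b\<^sup>2" for l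
    proof (rule mult_right_mono)
      have "\<bar>c n l\<bar>\<^sup>2 \<le> (\<Theta> / sqrt (real n))\<^sup>2" by (intro power_mono cb) simp
      then show "(c n l)\<^sup>2 \<le> \<Theta>\<^sup>2 / real n" by (simp add: power_divide)
    qed simp
    then have "(\<Sum>l<n. (c n l)\<^sup>2 * b\<^sup>2) \<le> (\<Sum>l<n. (\<Theta>\<^sup>2 / real n) * b\<^sup>2)" by (intro sum_mono)
    also have "\<dots> \<le> \<Theta>\<^sup>2 * b\<^sup>2" by (cases "n = 0") auto
    finally show ?thesis .
  qed
  let ?\<Pi> = "\<lambda>n y. \<Prod>l<n. 1 + \<i> * of_real (Y n l y)"
  have \<Pi>b: "cmod (?\<Pi> n y) \<le> exp (\<Theta>\<^sup>2 * b\<^sup>2 / 2)" for n y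
  proof -
    have "cmod (?\<Pi> n y) \<le> exp ((\<Sum>l<n. (c n l)\<^sup>2 * b\<^sup>2) / 2)" unfolding Y_def by (rule prod_bounded[of m b, OF b])
    also have "\<dots> \<le> exp (\<Theta>\<^sup>2 * b\<^sup>2 / 2)" using csum[of n] by simp
    finally show ?thesis .
  qed
  have [measurable]: "Y n l \<in> borel_measurable M" for n l unfolding Y_def[abs_def] by measurable
  have V0: "0 \<le> V" unfolding V_def using t(2) by (intro mult_nonneg_nonneg sum_nonneg) auto
  let ?D = "\<lambda>n y. iexp (\<Sum>l<n. Y n l y) - of_real (exp (- V / 2)) * ?\<Pi> n y"
  have Dlim: "(\<lambda>n. \<integral>y. ?D n y \<partial>M) \<longlonglongrightarrow> (\<integral>y. 0 \<partial>M)"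
  proof (rule integral_dominated_convergence[where w = "\<lambda>_. 1 + exp (\<Theta>\<^sup>2 * b\<^sup>2 / 2)"])
    show "AE y in M. norm (?D n y) \<le> 1 + exp (\<Theta>\<^sup>2 * b\<^sup>2 / 2)" for n
    proof (intro AE_I2 order_trans[OF norm_triangle_ineq4 add_mono])
      fix y
      show "cmod (iexp (\<Sum>l<n. Y n l y)) \<le> 1" by (simp del: of_real_sum)
      have "cmod (of_real (exp (- V / 2)) * ?\<Pi> n y) \<le> 1 * exp (\<Theta>\<^sup>2 * b\<^sup>2 / 2)"
        unfolding norm_mult using V0 by (intro mult_mono \<Pi>b) (simp_all del: of_real_exp)
      then show "cmod (of_real (exp (- V / 2)) * ?\<Pi> n y) \<le> exp (\<Theta>\<^sup>2 * b\<^sup>2 / 2)" by simp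
    qed
    have m2m: "(\<lambda>x. (m x)\<^sup>2) \<in> borel_measurable M" by measurable
    have m2b: "\<bar>(m x)\<^sup>2\<bar> \<le> b\<^sup>2" for x using b[of x] b0 by (simp add: abs_le_square_iff[symmetric])
    show "AE y in M. (\<lambda>n. ?D n y) \<longlonglongrightarrow> 0"
      using birkhoff_bounded[OF erg m2m m2b]
    proof eventually_elim
      case (elim y)
      have "(\<lambda>n. birkhoff_sum T (\<lambda>x. (m x)\<^sup>2) (p n i) y / real n) \<longlonglongrightarrow> t i * (norm_L2 M m)\<^sup>2" if "i \<le> k" for i
        unfolding p_def norm_L2_power2 using t(4)[OF that] by (intro birkhoff_floor elim) auto
      then have "(\<lambda>n. \<Sum>l<n. (Y n l y)\<^sup>2) \<longlonglongrightarrow> (\<Sum>i<k. (\<theta> i)\<^sup>2 * (t (Suc i) * (norm_L2 M m)\<^sup>2 - t i * (norm_L2 M m)\<^sup>2))"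
        unfolding Ysq by (intro tendsto_intros) auto
      also have "(\<Sum>i<k. (\<theta> i)\<^sup>2 * (t (Suc i) * (norm_L2 M m)\<^sup>2 - t i * (norm_L2 M m)\<^sup>2)) = V"
        unfolding V_def sum_distrib_right by (intro sum.cong refl) (simp add: algebra_simps)
      finally have lim: "(\<lambda>n. \<Sum>l<n. (Y n l y)\<^sup>2) \<longlonglongrightarrow> V" .
      define u where "u n = \<bar>exp (- (\<Sum>l<n. (Y n l y)\<^sup>2) / 2) - exp (- V / 2)\<bar>" for n
      have u0: "u \<longlonglongrightarrow> 0"
      proof -
        have "(\<lambda>n. \<bar>exp (- (\<Sum>l<n. (Y n l y)\<^sup>2) / 2) - exp (- V / 2)\<bar>) \<longlonglongrightarrow> \<bar>exp (- V / 2) - exp (- V / 2)\<bar>"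
          by (intro tendsto_intros lim) auto
        then show ?thesis by (simp add: u_def[abs_def])
      qed
      define K where "K = \<Theta> * b"
      have K0: "0 \<le> K" unfolding K_def using \<Theta>0 b0 by simp
      \<comment> \<open>Beyond \<open>n0\<close> all terms are at most 1 in modulus, as the cubic
        estimate requires; n errors of order n^(-3/2) then add up to order 1/sqrt n.\<close>
      obtain n0 :: nat where n0: "K\<^sup>2 \<le> real n0" using real_arch_simple by blast
      have bound: "norm (?D n y) \<le> 2 * K ^ 3 / sqrt (real n) + exp (\<Theta>\<^sup>2 * b\<^sup>2 / 2) * u n" if n: "n \<ge> Suc n0" for n
      proof -
        have npos: "real n > 0" using n by simp
        have "K\<^sup>2 \<le> real n" using n n0 by linarith
        then have "K \<le> sqrt (real n)" by (rule real_le_rsqrt)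
        then have Kn: "K / sqrt (real n) \<le> 1" using npos by simp
        have Y1: "\<bar>Y n l y\<bar> \<le> 1" for l using Yb[of n l y] Kn unfolding K_def by linarith
        have "(\<Sum>l<n. 2 * \<bar>Y n l y\<bar> ^ 3) \<le> (\<Sum>l<n. 2 * (K / sqrt (real n)) ^ 3)"
          using Yb unfolding K_def by (intro sum_mono mult_left_mono power_mono) auto
        also have "\<dots> = 2 * K ^ 3 / sqrt (real n)"
          using npos by (simp add: power_divide power3_eq_cube)
        finally have 1: "cmod (iexp (\<Sum>l<n. Y n l y) - ?\<Pi> n y * of_real (exp (- (\<Sum>l<n. (Y n l y)\<^sup>2) / 2))) \<le> 2 * K ^ 3 / sqrt (real n)"
          using iexp_sum_approx[of n "\<lambda>l. Y n l y", OF Y1] by linarith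
        have "?\<Pi> n y * of_real (exp (- (\<Sum>l<n. (Y n l y)\<^sup>2) / 2)) - of_real (exp (- V / 2)) * ?\<Pi> n y
           = ?\<Pi> n y * of_real (exp (- (\<Sum>l<n. (Y n l y)\<^sup>2) / 2) - exp (- V / 2))"
          by (simp add: algebra_simps)
        then have 2: "cmod (?\<Pi> n y * of_real (exp (- (\<Sum>l<n. (Y n l y)\<^sup>2) / 2)) - of_real (exp (- V / 2)) * ?\<Pi> n y)
           \<le> exp (\<Theta>\<^sup>2 * b\<^sup>2 / 2) * u n"
          unfolding u_def using \<Pi>b by (simp only: norm_mult norm_of_real) (intro mult_right_mono, auto)
        show ?thesis using norm_diff_triangle_le[OF 1 2] .
      qed
      have "(\<lambda>n. 2 * K ^ 3 / sqrt (real n) + exp (\<Theta>\<^sup>2 * b\<^sup>2 / 2) * u n) \<longlonglongrightarrow> 0 + exp (\<Theta>\<^sup>2 * b\<^sup>2 / 2) * 0"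
        by (intro tendsto_add tendsto_mult_left u0 tendsto_divide_0[OF tendsto_const]
          filterlim_at_top_imp_at_infinity filterlim_compose[OF sqrt_at_top filterlim_real_sequentially])
      then have "(\<lambda>n. 2 * K ^ 3 / sqrt (real n) + exp (\<Theta>\<^sup>2 * b\<^sup>2 / 2) * u n) \<longlonglongrightarrow> 0" by simp
      moreover have "\<forall>\<^sub>F n in sequentially. norm (?D n y) \<le> 2 * K ^ 3 / sqrt (real n) + exp (\<Theta>\<^sup>2 * b\<^sup>2 / 2) * u n"
        using bound eventually_sequentially by blast
      ultimately show ?case by (rule Lim_null_comparison[rotated])
    qed
  qed auto
  have iE: "integrable M (\<lambda>y. iexp (\<Sum>l<n. Y n l y))" for n
    by (rule integrable_bounded_complex[where C = 1]) (auto simp del: of_real_sum)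
  have i\<Pi>: "integrable M (?\<Pi> n)" for n
    by (rule integrable_bounded_complex[OF _ \<Pi>b]) measurable
  have "(\<integral>y. ?D n y \<partial>M) = (\<integral>y. iexp (\<Sum>l<n. Y n l y) \<partial>M) - of_real (exp (- V / 2))" for n
    using iE i\<Pi> martingale_product[OF m b, of "c n" n] unfolding Y_def[symmetric]
    by (subst Bochner_Integration.integral_diff) (auto simp del: of_real_sum of_real_exp)
  then have "(\<lambda>n. ((\<integral>y. iexp (\<Sum>l<n. Y n l y) \<partial>M) - of_real (exp (- V / 2))) + of_real (exp (- V / 2))) \<longlonglongrightarrow> 0 + of_real (exp (- V / 2))"
    using Dlim by (intro tendsto_add tendsto_const) simp
  then show ?thesis unfolding Ysum V_def by simp
qed

end

section \<open>The functional central limit theorem\<close>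

text \<open>The minimum keeps points of index above \<open>N\<close> in the unit interval as well,
  so measurability holds for every index.\<close>

definition grid :: "nat \<Rightarrow> nat \<Rightarrow> real" where
  "grid N i = min 1 (real i / real N)"

lemma grid_mem: "grid N i \<in> {0..1}"
  by (auto simp: grid_def)

lemma grid_0[simp]: "grid N 0 = 0"
  by (simp add: grid_def)

lemma grid_eq: "i \<le> N \<Longrightarrow> 0 < N \<Longrightarrow> grid N i = real i / real N"
  by (simp add: grid_def)

lemma grid_less: "i < N \<Longrightarrow> grid N i < grid N (Suc i)"
  by (simp add: grid_eq divide_strict_right_mono)

lemma grid_Suc_diff: "i < N \<Longrightarrow> grid N (Suc i) - grid N i = 1 / real N"
  by (simp add: grid_eq diff_divide_distrib[symmetric])

text \<open>Subtracting the starting value, almost surely 0 under Wiener measure, makes the result a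
  function of the grid increments for every path.\<close>

definition brownian_grid :: "nat \<Rightarrow> skorohod \<Rightarrow> skorohod" where
  "brownian_grid N x = step_path N (\<lambda>k. eval_path x (grid N k) - eval_path x 0)"

lemma is_wiener_measureD:
  assumes "is_wiener_measure W"
  shows "prob_space W" "sets W = sets borel"
    "AE x in W. eval_path x 0 = 0 \<and> continuous_on {0..1} (eval_path x)"
    "0 \<le> s \<Longrightarrow> s < t \<Longrightarrow> t \<le> 1 \<Longrightarrow>
      distributed W lborel (\<lambda>x. eval_path x t - eval_path x s) (normal_density 0 (sqrt (t - s)))"
    "0 \<le> u 0 \<Longrightarrow> \<forall>i<k. u i < u (Suc i) \<Longrightarrow> u k \<le> 1 \<Longrightarrow>
      prob_space.indep_vars W (\<lambda>_. borel) (\<lambda>i x. eval_path x (u (Suc i)) - eval_path x (u i)) {..<k}"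
  using assms unfolding is_wiener_measure_def by blast+

lemma measurable_eval_path_wiener:
  "is_wiener_measure W \<Longrightarrow> t \<in> {0..1} \<Longrightarrow> (\<lambda>x. eval_path x t) \<in> borel_measurable W"
  using measurable_eval_path[of t] measurable_cong_sets[OF is_wiener_measureD(2) refl] by blast

lemma wiener_grid_char:
  assumes W: "is_wiener_measure W" and N: "0 < N"
  shows "(\<integral>x. iexp (\<Sum>i<N. \<theta> i * (eval_path x (grid N (Suc i)) - eval_path x (grid N i))) \<partial>W)
    = (\<Prod>i<N. char (density lborel (normal_density 0 (sqrt (1 / real N)))) (\<theta> i))"
proof -
  interpret W: prob_space W by (rule is_wiener_measureD(1)[OF W])
  have "W.indep_vars (\<lambda>_. borel) (\<lambda>i x. eval_path x (grid N (Suc i)) - eval_path x (grid N i)) {..<N}"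
    using grid_mem[of N N] by (intro is_wiener_measureD(5)[OF W]) (auto simp: grid_less)
  from W.indep_vars_imp_joint_char[OF this]
  have "(\<integral>x. iexp (\<Sum>i<N. \<theta> i * (eval_path x (grid N (Suc i)) - eval_path x (grid N i))) \<partial>W)
    = (\<Prod>i<N. char (distr W borel (\<lambda>x. eval_path x (grid N (Suc i)) - eval_path x (grid N i))) (\<theta> i))" .
  also have "\<dots> = (\<Prod>i<N. char (density lborel (normal_density 0 (sqrt (1 / real N)))) (\<theta> i))"
  proof (rule prod.cong[OF refl])
    fix i assume "i \<in> {..<N}"
    then have i: "i < N" by simp
    have "distributed W lborel (\<lambda>x. eval_path x (grid N (Suc i)) - eval_path x (grid N i))
        (normal_density 0 (sqrt (grid N (Suc i) - grid N i)))"
      using grid_mem[of N i] grid_mem[of N "Suc i"] grid_less[OF i] by (intro is_wiener_measureD(4)[OF W]) auto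
    then have "distr W lborel (\<lambda>x. eval_path x (grid N (Suc i)) - eval_path x (grid N i))
        = density lborel (normal_density 0 (sqrt (1 / real N)))"
      unfolding grid_Suc_diff[OF i] by (rule distributed_distr_eq_density)
    moreover have "distr W lborel (\<lambda>x. eval_path x (grid N (Suc i)) - eval_path x (grid N i))
        = distr W borel (\<lambda>x. eval_path x (grid N (Suc i)) - eval_path x (grid N i))"
      by (intro distr_cong) auto
    ultimately show "char (distr W borel (\<lambda>x. eval_path x (grid N (Suc i)) - eval_path x (grid N i))) (\<theta> i)
      = char (density lborel (normal_density 0 (sqrt (1 / real N)))) (\<theta> i)" by simp
  qed
  finally show ?thesis .
qed

context
  fixes f :: "skorohod \<Rightarrow> real" and L B :: real
  assumes L: "0 \<le> L" and B: "\<And>x. \<bar>f x\<bar> \<le> B" and f: "\<And>x y. \<bar>f x - f y\<bar> \<le> L * dist x y"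
begin

lemma lipschitz_test_measurable: "f \<in> borel_measurable borel"
  by (rule borel_measurable_continuous_onI[OF lipschitz_imp_continuous_on[OF f]])

lemma brownian_grid_tendsto:
  assumes W: "is_wiener_measure W"
  shows "(\<lambda>N. \<integral>x. f (brownian_grid N x) \<partial>W) \<longlonglongrightarrow> (\<integral>x. f x \<partial>W)"
proof (rule integral_dominated_convergence[where w = "\<lambda>_. B"])
  interpret W: prob_space W by (rule is_wiener_measureD(1)[OF W])
  note sW = is_wiener_measureD(2)[OF W]
  show "f \<in> borel_measurable W" using lipschitz_test_measurable measurable_cong_sets[OF sW refl] by blast
  show "(\<lambda>x. f (brownian_grid N x)) \<in> borel_measurable W" for N
    unfolding brownian_grid_def
    by (intro measurable_compose[OF measurable_step_path lipschitz_test_measurable] borel_measurable_diff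
        measurable_eval_path_wiener[OF W] grid_mem) auto
  show "integrable W (\<lambda>_. B)" by simp
  show "AE x in W. norm (f (brownian_grid N x)) \<le> B" for N using B by simp
  show "AE x in W. (\<lambda>N. f (brownian_grid N x)) \<longlonglongrightarrow> f x"
    using is_wiener_measureD(3)[OF W]
  proof eventually_elim
    case (elim x)
    have uc: "uniformly_continuous_on {0..1} (eval_path x)"
      using elim by (intro compact_uniformly_continuous) auto
    have "(\<lambda>N. brownian_grid N x) \<longlonglongrightarrow> x"
    proof (rule metric_LIMSEQ_I)
      fix e :: real assume e: "e > 0"
      then have "e / 2 > 0" by simp
      then obtain d where d: "d > 0" "\<forall>s\<in>{0..1}. \<forall>t\<in>{0..1}. dist t s < d \<longrightarrow> dist (eval_path x t) (eval_path x s) < e / 2"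
        using uc unfolding uniformly_continuous_on_def by meson
      obtain N0 :: nat where N0: "1 / d < real N0" using reals_Archimedean2 by blast
      have "dist (brownian_grid N x) x < e" if N: "N \<ge> Suc N0" for N
      proof -
        have Np: "real N > 0" using N by simp
        have "1 / d < real N" using N0 N by linarith
        then have Nd: "1 / real N < d" using d(1) Np by (simp add: field_simps)
        have "dist (brownian_grid N x) x \<le> e / 2"
        proof (rule dist_skorohod_le_sup)
          fix t :: real assume t: "t \<in> {0..1}"
          define k where "k = nat \<lfloor>real N * t\<rfloor>"
          have kN: "k \<le> N" unfolding k_def by (rule nat_floor_mult_le[OF t])
          have "0 \<le> real N * t" using t by simp
          then have "real k \<le> real N * t" "real N * t < real k + 1" unfolding k_def by linarith+
          then have "0 \<le> (real N * t - real k) / real N" "(real N * t - real k) / real N < 1 / real N"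
            using Np by (auto intro!: divide_nonneg_nonneg divide_strict_right_mono)
          moreover have "t - grid N k = (real N * t - real k) / real N"
            using kN Np by (simp add: grid_eq field_simps)
          ultimately have "0 \<le> t - grid N k" "t - grid N k < 1 / real N" by simp_all
          then have "dist (grid N k) t < d" using Nd by (simp add: dist_real_def)
          then have "dist (eval_path x (grid N k)) (eval_path x t) < e / 2"
            using d(2) grid_mem[of N k] t by blast
          then show "\<bar>eval_path (brownian_grid N x) t - eval_path x t\<bar> \<le> e / 2"
            unfolding brownian_grid_def eval_step_path[OF t] k_def[symmetric]
            using elim by (simp add: dist_real_def)
        qed (use e in simp)
        then show ?thesis using e by simp
      qed
      then show "\<exists>no. \<forall>N\<ge>no. dist (brownian_grid N x) x < e" by blast
    qed
    moreover have "isCont f x"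
      using lipschitz_imp_continuous_on[OF f] by (simp add: continuous_on_eq_continuous_at)
    ultimately show ?case by (rule isCont_tendsto_compose[rotated])
  qed
qed


end

context measure_preserving
begin

section \<open>Partial sums sampled on a fixed grid\<close>

lemma partial_sum_path_eq_step_path:
  "partial_sum_path T h s n y = step_path n (\<lambda>k. birkhoff_sum T h k y / (s * sqrt (real n)))"
  by (simp add: partial_sum_path_def step_path_def)

lemma measurable_partial_sum_path:
  assumes [measurable]: "h \<in> borel_measurable M"
  shows "partial_sum_path T h s n \<in> borel_measurable M"
  unfolding partial_sum_path_eq_step_path[abs_def] by (rule measurable_step_path) measurable

definition grid_path :: "('a \<Rightarrow> real) \<Rightarrow> real \<Rightarrow> nat \<Rightarrow> nat \<Rightarrow> 'a \<Rightarrow> skorohod" where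
  "grid_path m s N n y = step_path N (\<lambda>k. birkhoff_sum T m (nat \<lfloor>real n * grid N k\<rfloor>) y / (s * sqrt (real n)))"

text \<open>A sampled path is the cumulative sum of its increments, and two such paths are no
  further apart than the l1 distance of the increments. So \<open>f\<close> becomes a Lipschitz
  function of \<open>N\<close> variables, and joint characteristic functions decide.\<close>

lemma grid_path_tendsto:
  assumes L: "0 \<le> L" and B: "\<And>x. \<bar>f x\<bar> \<le> B" and f: "\<And>x y. \<bar>f x - f y\<bar> \<le> L * dist x y"
    and W: "is_wiener_measure W" and N: "0 < N"
    and erg: "ergodic_transformation M T"
    and m: "martingale_difference m" and b: "\<And>x. \<bar>m x\<bar> \<le> b" and s: "norm_L2 M m > 0"
  shows "(\<lambda>n. \<integral>y. f (grid_path m (norm_L2 M m) N n y) \<partial>M) \<longlonglongrightarrow> (\<integral>x. f (brownian_grid N x) \<partial>W)"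
proof -
  define s where "s = norm_L2 M m"
  have s0: "s > 0" using s by (simp add: s_def)
  have mm[measurable]: "m \<in> borel_measurable M" using martingale_differenceD(1)[OF m] by measurable
  let ?\<mu> = "density lborel (normal_density 0 (sqrt (1 / real N)))"
  let ?p = "\<lambda>n i. nat \<lfloor>real n * grid N i\<rfloor>"
  define X where "X n i y = (birkhoff_sum T m (?p n (Suc i)) y - birkhoff_sum T m (?p n i) y) / (s * sqrt (real n))" for n i y
  define Y where "Y i x = eval_path x (grid N (Suc i)) - eval_path x (grid N i)" for i x
  define F where "F v = f (step_path N (\<lambda>k. \<Sum>i<k. v i))" for v :: "nat \<Rightarrow> real"
  have FX: "F (\<lambda>i. X n i y) = f (grid_path m (norm_L2 M m) N n y)" for n y
  proof -
    have "(\<Sum>i<k. X n i y) = birkhoff_sum T m (?p n k) y / (s * sqrt (real n))" for k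
      unfolding X_def sum_divide_distrib[symmetric] sum_lessThan_telescope[of "\<lambda>i. birkhoff_sum T m (?p n i) y"] by simp
    then show ?thesis unfolding F_def grid_path_def s_def by simp
  qed
  have FY: "F (\<lambda>i. Y i x) = f (brownian_grid N x)" for x
    unfolding F_def brownian_grid_def Y_def sum_lessThan_telescope[of "\<lambda>i. eval_path x (grid N i)"] by simp
  have ch: "(\<Prod>i<N. char ?\<mu> (\<theta> i)) = of_real (exp (- (\<Sum>i<N. (\<theta> i)\<^sup>2) / real N / 2))" for \<theta>
  proof -
    have "(\<Prod>i<N. char ?\<mu> (\<theta> i)) = (\<Prod>i<N. of_real (exp (- ((\<theta> i)\<^sup>2) / real N / 2)))"
      using N by (intro prod.cong refl) (subst char_normal, auto)
    also have "\<dots> = of_real (exp (\<Sum>i<N. - ((\<theta> i)\<^sup>2) / real N / 2))" by (simp add: exp_sum)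
    finally show ?thesis by (simp add: sum_negf sum_divide_distrib)
  qed
  have "(\<lambda>n. \<integral>y. F (\<lambda>i. X n i y) \<partial>M) \<longlonglongrightarrow> (\<integral>x. F (\<lambda>i. Y i x) \<partial>W)"
  proof (rule joint_char_imp_lipschitz[where X = X and Y = Y and F = F and \<mu> = "\<lambda>_. ?\<mu>" and k = N and B = B and L = L])
    show "prob_space M" "prob_space W" using prob_space_axioms is_wiener_measureD(1)[OF W] by auto
    show "real_distribution ?\<mu>" using N by (intro real_distribution_normal) simp
    show "X n i \<in> borel_measurable M" for n i unfolding X_def[abs_def] by measurable
    show "Y i \<in> borel_measurable W" for i
      unfolding Y_def[abs_def] by (intro borel_measurable_diff measurable_eval_path_wiener[OF W] grid_mem)
    show "(\<integral>x. iexp (\<Sum>i<N. \<theta> i * Y i x) \<partial>W) = (\<Prod>i<N. char ?\<mu> (\<theta> i))" for \<theta>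
      unfolding Y_def by (rule wiener_grid_char[OF W N])
    show "(\<lambda>n. \<integral>y. iexp (\<Sum>i<N. \<theta> i * X n i y) \<partial>M) \<longlonglongrightarrow> (\<Prod>i<N. char ?\<mu> (\<theta> i))" for \<theta>
    proof -
      \<comment> \<open>Dividing the frequencies by \<open>s\<close> cancels the variance of
        \<open>m\<close>, which leaves the transform of the Brownian increments.\<close>
      have "(\<lambda>n. \<integral>y. iexp (\<Sum>i<N. (\<theta> i / s) * ((birkhoff_sum T m (?p n (Suc i)) y - birkhoff_sum T m (?p n i) y) / sqrt (real n))) \<partial>M)
        \<longlonglongrightarrow> of_real (exp (- (\<Sum>i<N. (\<theta> i / s)\<^sup>2 * (grid N (Suc i) - grid N i)) * (norm_L2 M m)\<^sup>2 / 2))"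
        using grid_mem[of N N] grid_mem
        by (intro martingale_joint_char[OF erg m b]) (auto intro: less_imp_le[OF grid_less])
      moreover have "(\<Sum>i<N. (\<theta> i / s) * ((birkhoff_sum T m (?p n (Suc i)) y - birkhoff_sum T m (?p n i) y) / sqrt (real n)))
        = (\<Sum>i<N. \<theta> i * X n i y)" for n y
        by (simp add: X_def)
      moreover have "(\<Sum>i<N. (\<theta> i / s)\<^sup>2 * (grid N (Suc i) - grid N i)) * (norm_L2 M m)\<^sup>2 = (\<Sum>i<N. (\<theta> i)\<^sup>2) / real N"
        unfolding s_def[symmetric] sum_distrib_right sum_divide_distrib
        using s0 by (intro sum.cong refl) (simp add: grid_Suc_diff power_divide)
      ultimately show ?thesis unfolding ch by (simp only: mult_minus_left minus_divide_left)
    qed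
    show "(\<lambda>y. F (\<lambda>i. X n i y)) \<in> borel_measurable M" for n
      unfolding F_def X_def
      by (intro measurable_compose[OF measurable_step_path lipschitz_test_measurable[OF L B f]]) measurable
    show "(\<lambda>y. F (\<lambda>i. Y i y)) \<in> borel_measurable W"
      unfolding F_def Y_def
      by (intro measurable_compose[OF measurable_step_path lipschitz_test_measurable[OF L B f]]
          borel_measurable_sum borel_measurable_diff measurable_eval_path_wiener[OF W] grid_mem)
    show "\<bar>F v\<bar> \<le> B" for v unfolding F_def by (rule B)
    show "\<bar>F v - F w\<bar> \<le> L * (\<Sum>i<N. \<bar>v i - w i\<bar>)" for v w
    proof -
      have "dist (step_path N (\<lambda>k. \<Sum>i<k. v i)) (step_path N (\<lambda>k. \<Sum>i<k. w i)) \<le> (\<Sum>i<N. \<bar>v i - w i\<bar>)"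
      proof (rule dist_step_path_le)
        fix k assume "k \<le> N"
        have "\<bar>(\<Sum>i<k. v i) - (\<Sum>i<k. w i)\<bar> \<le> (\<Sum>i<k. \<bar>v i - w i\<bar>)"
          unfolding sum_subtractf[symmetric] by (rule sum_abs)
        also have "\<dots> \<le> (\<Sum>i<N. \<bar>v i - w i\<bar>)" using \<open>k \<le> N\<close> by (intro sum_mono2) auto
        finally show "\<bar>(\<Sum>i<k. v i) - (\<Sum>i<k. w i)\<bar> \<le> (\<Sum>i<N. \<bar>v i - w i\<bar>)" .
      qed
      then show ?thesis unfolding F_def using f L by (meson mult_left_mono order_trans)
    qed
  qed (rule L)
  then show ?thesis unfolding FX FY .
qed

text \<open>After the last grid point before \<open>t\<close> at most \<open>q\<close> terms are
  added, and their maximum depends on that grid point. Adding the fourth powers over all windows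
  gives one bound for all \<open>t\<close>, linear in quantities with known means.\<close>

lemma dist_grid_path_le:
  assumes s: "s > 0" and N: "0 < N" and n: "0 < n" and \<delta>: "\<delta> > 0"
  defines "q \<equiv> n div N + 1"
  shows "dist (partial_sum_path T m s n y) (grid_path m s N n y)
    \<le> \<delta> + (\<Sum>k\<le>N. (max_birkhoff m q ((T ^^ nat \<lfloor>real n * grid N k\<rfloor>) y)) ^ 4) / (s ^ 4 * (real n)\<^sup>2 * \<delta> ^ 3)"
proof (rule dist_skorohod_le_sup)
  let ?S = "\<lambda>k. max_birkhoff m q ((T ^^ nat \<lfloor>real n * grid N k\<rfloor>) y)"
  let ?E = "(\<Sum>k\<le>N. (?S k) ^ 4) / (s ^ 4 * (real n)\<^sup>2 * \<delta> ^ 3)"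
  have E0: "0 \<le> ?E" using \<delta> s by (intro divide_nonneg_nonneg sum_nonneg) auto
  then show "0 \<le> \<delta> + ?E" using \<delta> by simp
  fix t :: real assume t: "t \<in> {0..1}"
  define k where "k = nat \<lfloor>real N * t\<rfloor>"
  define p where "p = nat \<lfloor>real n * grid N k\<rfloor>"
  define r where "r = nat \<lfloor>real n * t\<rfloor>"
  have Np: "real N > 0" using N by simp
  have kN: "k \<le> N" unfolding k_def by (rule nat_floor_mult_le[OF t])
  have t0: "0 \<le> real N * t" "0 \<le> real n * t" using t by auto
  have k: "real k \<le> real N * t" "real N * t < real k + 1" unfolding k_def using t0 by linarith+
  have g: "grid N k = real k / real N" using kN N by (rule grid_eq)
  have g1: "grid N k \<le> t" "t < grid N k + 1 / real N" unfolding g using k Np by (simp_all add: field_simps)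
  have g0: "0 \<le> real n * grid N k" using grid_mem[of N k] by simp
  have pr: "p \<le> r" unfolding p_def r_def using g1 by (intro nat_mono floor_mono mult_left_mono) auto
  \<comment> \<open>The roundings in \<open>n div N\<close> and in \<open>p\<close> lose less than
    one each; since the resulting inequality r < p + 1 + q is strict and between integers, a single
    extra term suffices.\<close>
  have "r - p \<le> q"
  proof -
    have "real n * t < real n * (grid N k + 1 / real N)" using g1(2) n by (intro mult_strict_left_mono) auto
    then have a: "real n * t < real n * grid N k + real n / real N" by (simp add: distrib_left)
    have "real n < real N * real (n div N + 1)"
      using dividend_less_times_div[OF N, of n] of_nat_less_iff[of n "N + N * (n div N)", where 'a = real]
      by (simp add: algebra_simps)
    then have "real n / real N < real (n div N + 1)" using Np by (simp add: divide_less_eq mult.commute)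
    then have "real r < real p + 1 + real q"
      using a t0(2) g0 unfolding r_def p_def q_def by linarith
    then show ?thesis by linarith
  qed
  then have "\<bar>birkhoff_sum T m (r - p) ((T ^^ p) y)\<bar> \<le> ?S k" unfolding p_def by (rule max_birkhoff_ge)
  moreover have "birkhoff_sum T m r y = birkhoff_sum T m p y + birkhoff_sum T m (r - p) ((T ^^ p) y)"
    using birkhoff_sum_add_index[of m p "r - p" y] pr by simp
  ultimately have d: "\<bar>birkhoff_sum T m r y - birkhoff_sum T m p y\<bar> \<le> ?S k" by simp
  define z where "z = ?S k / (s * sqrt (real n))"
  have sn: "0 < s * sqrt (real n)" using s n by simp
  have "eval_path (partial_sum_path T m s n y) t - eval_path (grid_path m s N n y) t
    = (birkhoff_sum T m r y - birkhoff_sum T m p y) / (s * sqrt (real n))"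
    unfolding partial_sum_path_eq_step_path grid_path_def eval_step_path[OF t] r_def p_def k_def
    by (simp add: diff_divide_distrib)
  also have "\<bar>\<dots>\<bar> \<le> z" unfolding z_def abs_divide abs_of_pos[OF sn] using d sn by (intro divide_right_mono) auto
  also have "\<dots> \<le> \<delta> + z ^ 4 / \<delta> ^ 3" using le_add_power4_div[OF \<delta>, of z] by linarith
  also have "z ^ 4 / \<delta> ^ 3 = (?S k) ^ 4 / (s ^ 4 * (real n)\<^sup>2 * \<delta> ^ 3)"
  proof -
    have "(sqrt (real n)) ^ 4 = (real n)\<^sup>2" by (simp add: power4_eq_xxxx power2_eq_square)
    then show ?thesis by (simp add: z_def power_divide power_mult_distrib)
  qed
  also have "\<delta> + (?S k) ^ 4 / (s ^ 4 * (real n)\<^sup>2 * \<delta> ^ 3) \<le> \<delta> + ?E"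
    using kN \<delta> s by (intro add_left_mono divide_right_mono member_le_sum) auto
  finally show "\<bar>eval_path (partial_sum_path T m s n y) t - eval_path (grid_path m s N n y) t\<bar> \<le> \<delta> + ?E" by simp
qed

text \<open>There are N + 1 windows with fourth moments of order (n/N)^2, against a normalisation
  n^2, so the error is of order 1/N uniformly in n. The constant is 2 * 4096 * 4, from N + 1 \<le> 2
  N and q \<le> 2 n/N; the latter rests on N \<le> n.\<close>

lemma grid_path_error:
  assumes L: "0 \<le> L" and B: "\<And>x. \<bar>f x\<bar> \<le> B" and f: "\<And>x y. \<bar>f x - f y\<bar> \<le> L * dist x y"
    and m: "martingale_difference m" and b: "\<And>x. \<bar>m x\<bar> \<le> b" and s: "s > 0"
    and N: "0 < N" and n: "N \<le> n" and \<delta>: "\<delta> > 0"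
  shows "\<bar>(\<integral>y. f (partial_sum_path T m s n y) \<partial>M) - (\<integral>y. f (grid_path m s N n y) \<partial>M)\<bar>
    \<le> L * (\<delta> + 32768 * b ^ 4 / (s ^ 4 * \<delta> ^ 3) / real N)"
proof -
  have mm[measurable]: "m \<in> borel_measurable M" using martingale_differenceD(1)[OF m] by measurable
  have b0: "0 \<le> b" using b abs_ge_zero order_trans by blast
  have np: "0 < n" using N n by simp
  define q where "q = n div N + 1"
  let ?p = "\<lambda>k. nat \<lfloor>real n * grid N k\<rfloor>"
  let ?c = "s ^ 4 * (real n)\<^sup>2 * \<delta> ^ 3"
  have c0: "0 < ?c" using s np \<delta> by simp
  let ?E = "\<lambda>y. \<delta> + (\<Sum>k\<le>N. (max_birkhoff m q ((T ^^ ?p k) y)) ^ 4) / ?c"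
  note i4 = max_birkhoff_moment4(1)[OF m b, of q]
  have iE: "integrable M ?E"
    by (intro Bochner_Integration.integrable_add integrable_divide Bochner_Integration.integrable_sum integrable_T_pow[OF i4] integrable_const)
  note fm = lipschitz_test_measurable[OF L B f]
  have i1: "integrable M (\<lambda>y. f (partial_sum_path T m s n y))"
    by (rule integrable_bounded_real[OF measurable_compose[OF measurable_partial_sum_path[OF mm] fm] B])
  have "grid_path m s N n \<in> borel_measurable M"
    unfolding grid_path_def[abs_def] by (rule measurable_step_path) measurable
  then have i2: "integrable M (\<lambda>y. f (grid_path m s N n y))"
    by (intro integrable_bounded_real[OF measurable_compose[OF _ fm] B])
  have "\<bar>(\<integral>y. f (partial_sum_path T m s n y) \<partial>M) - (\<integral>y. f (grid_path m s N n y) \<partial>M)\<bar>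
    = \<bar>\<integral>y. f (partial_sum_path T m s n y) - f (grid_path m s N n y) \<partial>M\<bar>" using i1 i2 by simp
  also have "\<dots> \<le> (\<integral>y. \<bar>f (partial_sum_path T m s n y) - f (grid_path m s N n y)\<bar> \<partial>M)"
    by (rule integral_abs_bound)
  also have "\<dots> \<le> (\<integral>y. L * ?E y \<partial>M)"
  proof (rule integral_mono)
    show "integrable M (\<lambda>y. \<bar>f (partial_sum_path T m s n y) - f (grid_path m s N n y)\<bar>)" using i1 i2 by simp
    show "integrable M (\<lambda>y. L * ?E y)" by (intro integrable_mult_right iE)
    show "\<bar>f (partial_sum_path T m s n y) - f (grid_path m s N n y)\<bar> \<le> L * ?E y" for y
      using dist_grid_path_le[OF s N np \<delta>, of m y] unfolding q_def[symmetric]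
      by (intro order_trans[OF f] mult_left_mono L)
  qed
  also have "\<dots> = L * (\<delta> + (\<Sum>k\<le>N. \<integral>y. (max_birkhoff m q y) ^ 4 \<partial>M) / ?c)"
  proof -
    have "(\<integral>y. ?E y \<partial>M) = \<delta> + (\<integral>y. (\<Sum>k\<le>N. (max_birkhoff m q ((T ^^ ?p k) y)) ^ 4) \<partial>M) / ?c"
      using integrable_T_pow[OF i4] by (subst Bochner_Integration.integral_add) (auto simp: prob_space)
    also have "(\<integral>y. (\<Sum>k\<le>N. (max_birkhoff m q ((T ^^ ?p k) y)) ^ 4) \<partial>M) = (\<Sum>k\<le>N. \<integral>y. (max_birkhoff m q ((T ^^ ?p k) y)) ^ 4 \<partial>M)"
      by (intro Bochner_Integration.integral_sum integrable_T_pow[OF i4])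
    also have "\<dots> = (\<Sum>k\<le>N. \<integral>y. (max_birkhoff m q y) ^ 4 \<partial>M)"
      by (intro sum.cong refl integral_T_pow[of "\<lambda>y. (max_birkhoff m q y) ^ 4"]) measurable
    finally show ?thesis by simp
  qed
  also have "\<dots> \<le> L * (\<delta> + 32768 * b ^ 4 / (s ^ 4 * \<delta> ^ 3) / real N)"
  proof (intro mult_left_mono add_left_mono L)
    have Np: "real N > 0" "1 \<le> real N" using N by simp_all
    have q: "real q \<le> 2 * (real n / real N)"
    proof -
      have "1 \<le> real n / real N" using n Np by (simp add: le_divide_eq)
      moreover have "real (n div N) \<le> real n / real N" 
      proof -
        have "real (n div N * N) \<le> real n" unfolding of_nat_le_iff by (rule div_times_less_eq_dividend)
        then show ?thesis using Np by (simp add: pos_le_divide_eq)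
      qed
      ultimately show ?thesis unfolding q_def by simp
    qed
    have "(\<Sum>k\<le>N. \<integral>y. (max_birkhoff m q y) ^ 4 \<partial>M) \<le> (\<Sum>k\<le>N. 4096 * (real q)\<^sup>2 * b ^ 4)"
      by (intro sum_mono max_birkhoff_moment4(2)[OF m b])
    also have "\<dots> = (real N + 1) * (4096 * (real q)\<^sup>2 * b ^ 4)" by simp
    also have "\<dots> \<le> (2 * real N) * (4096 * (2 * (real n / real N))\<^sup>2 * b ^ 4)"
      using Np q b0 by (intro mult_mono power_mono) auto
    also have "\<dots> = 32768 * b ^ 4 * (real n)\<^sup>2 / real N"
      using Np by (simp add: power2_eq_square field_simps)
    finally have "(\<Sum>k\<le>N. \<integral>y. (max_birkhoff m q y) ^ 4 \<partial>M) / ?c \<le> 32768 * b ^ 4 * (real n)\<^sup>2 / real N / ?c"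
      using c0 by (intro divide_right_mono) auto
    also have "\<dots> = 32768 * b ^ 4 / (s ^ 4 * \<delta> ^ 3) / real N" using np by simp
    finally show "(\<Sum>k\<le>N. \<integral>y. (max_birkhoff m q y) ^ 4 \<partial>M) / ?c \<le> 32768 * b ^ 4 / (s ^ 4 * \<delta> ^ 3) / real N" .
  qed
  finally show ?thesis .
qed

text \<open>The grid error is uniform in n, so \<open>N\<close> can be fixed before n grows. Four
  errors below \<open>e / 4\<close> add up: the parameter \<open>\<delta>\<close>, the oscillation
  term, the sampling of Brownian motion, and the convergence on the grid.\<close>

lemma martingale_FCLT:
  assumes L: "0 \<le> L" and B: "\<And>x. \<bar>f x\<bar> \<le> B" and f: "\<And>x y. \<bar>f x - f y\<bar> \<le> L * dist x y"
    and W: "is_wiener_measure W" and erg: "ergodic_transformation M T"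
    and m: "martingale_difference m" and b: "\<And>x. \<bar>m x\<bar> \<le> b" and s: "norm_L2 M m > 0"
  shows "(\<lambda>n. \<integral>y. f (partial_sum_path T m (norm_L2 M m) n y) \<partial>M) \<longlonglongrightarrow> (\<integral>x. f x \<partial>W)"
proof (rule LIMSEQ_I)
  fix e :: real assume e: "e > 0"
  define \<delta> where "\<delta> = e / 4 / (L + 1)"
  have L1: "L + 1 > 0" using L by simp
  then have \<delta>: "\<delta> > 0" using e by (simp add: \<delta>_def)
  have L\<delta>: "L * \<delta> < e / 4"
  proof -
    have "L * \<delta> < (L + 1) * \<delta>" using \<delta> by (simp add: distrib_right)
    also have "\<dots> = e / 4" unfolding \<delta>_def using L1 by (intro nonzero_mult_div_cancel_left[of "L + 1" "e / 4", folded times_divide_eq_right]) simp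
    finally show ?thesis .
  qed
  define C where "C = 32768 * b ^ 4 / ((norm_L2 M m) ^ 4 * \<delta> ^ 3)"
  have "(\<lambda>N. L * C * (1 / real N)) \<longlonglongrightarrow> L * C * 0" by (intro tendsto_mult_left lim_1_over_n)
  then have "\<forall>\<^sub>F N in sequentially. L * C * (1 / real N) < e / 4" using e by (intro order_tendstoD(2)) auto
  moreover have "\<forall>\<^sub>F N in sequentially. dist (\<integral>x. f (brownian_grid N x) \<partial>W) (\<integral>x. f x \<partial>W) < e / 4"
    using brownian_grid_tendsto[OF L B f W] e by (intro tendstoD) auto
  ultimately have "\<forall>\<^sub>F N in sequentially. L * C * (1 / real N) < e / 4 \<and>
      dist (\<integral>x. f (brownian_grid N x) \<partial>W) (\<integral>x. f x \<partial>W) < e / 4 \<and> 0 < N"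
    using eventually_gt_at_top[of 0] by eventually_elim simp
  then obtain N where N: "L * C * (1 / real N) < e / 4" "dist (\<integral>x. f (brownian_grid N x) \<partial>W) (\<integral>x. f x \<partial>W) < e / 4" "0 < N"
    by (auto simp: eventually_sequentially)
  have "\<forall>\<^sub>F n in sequentially. dist (\<integral>y. f (grid_path m (norm_L2 M m) N n y) \<partial>M) (\<integral>x. f (brownian_grid N x) \<partial>W) < e / 4"
    using grid_path_tendsto[OF L B f W N(3) erg m b s] e by (intro tendstoD) auto
  then have "\<forall>\<^sub>F n in sequentially. norm ((\<integral>y. f (partial_sum_path T m (norm_L2 M m) n y) \<partial>M) - (\<integral>x. f x \<partial>W)) < e"
    using eventually_ge_at_top[of N]
  proof eventually_elim
    case (elim n)
    have "\<bar>(\<integral>y. f (partial_sum_path T m (norm_L2 M m) n y) \<partial>M) - (\<integral>y. f (grid_path m (norm_L2 M m) N n y) \<partial>M)\<bar>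
      \<le> L * \<delta> + L * C * (1 / real N)"
      using grid_path_error[OF L B f m b s N(3) elim(2) \<delta>] by (simp add: C_def distrib_left)
    then show ?case using elim(1) N(1,2) L\<delta> unfolding dist_real_def real_norm_def by linarith
  qed
  then show "\<exists>no. \<forall>n\<ge>no. norm ((\<integral>y. f (partial_sum_path T m (norm_L2 M m) n y) \<partial>M) - (\<integral>x. f x \<partial>W)) < e"
    by (simp add: eventually_sequentially)
qed

section \<open>From bounded martingale differences to general square integrable functions\<close>

lemma dist_partial_sum_path_le:
  assumes s: "s > 0" "r > 0" and n: "0 < n"
  shows "dist (partial_sum_path T h s n y) (partial_sum_path T m r n y)
    \<le> max_birkhoff (\<lambda>x. h x - m x) n y / (s * sqrt (real n)) + \<bar>1 / s - 1 / r\<bar> * (max_birkhoff m n y / sqrt (real n))"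
  unfolding partial_sum_path_eq_step_path
proof (rule dist_step_path_le)
  fix k assume k: "k \<le> n"
  have sn: "0 < s * sqrt (real n)" "0 < sqrt (real n)" using s n by simp_all
  have "birkhoff_sum T h k y / (s * sqrt (real n)) - birkhoff_sum T m k y / (r * sqrt (real n))
    = birkhoff_sum T (\<lambda>x. h x - m x) k y / (s * sqrt (real n)) + (1 / s - 1 / r) * (birkhoff_sum T m k y / sqrt (real n))"
    using s n by (simp add: birkhoff_sum_diff field_simps)
  also have "\<bar>\<dots>\<bar> \<le> \<bar>birkhoff_sum T (\<lambda>x. h x - m x) k y / (s * sqrt (real n))\<bar> + \<bar>(1 / s - 1 / r) * (birkhoff_sum T m k y / sqrt (real n))\<bar>"
    by (rule abs_triangle_ineq)
  also have "\<dots> \<le> max_birkhoff (\<lambda>x. h x - m x) n y / (s * sqrt (real n)) + \<bar>1 / s - 1 / r\<bar> * (max_birkhoff m n y / sqrt (real n))"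
    unfolding abs_mult[of "1 / s - 1 / r"] abs_divide[of _ "s * sqrt (real n)"] abs_divide[of _ "sqrt (real n)"] abs_of_pos[OF sn(1)] abs_of_pos[OF sn(2)]
    using sn k by (intro add_mono mult_left_mono divide_right_mono max_birkhoff_ge) auto
  finally show "\<bar>birkhoff_sum T h k y / (s * sqrt (real n)) - birkhoff_sum T m k y / (r * sqrt (real n))\<bar>
    \<le> max_birkhoff (\<lambda>x. h x - m x) n y / (s * sqrt (real n)) + \<bar>1 / s - 1 / r\<bar> * (max_birkhoff m n y / sqrt (real n))" .
qed

lemma integral_max_birkhoff_le: "square_integrable M f \<Longrightarrow> (\<integral>y. max_birkhoff f n y \<partial>M) \<le> norm_L2 M (max_birkhoff f n)"
  using integral_abs_le_norm_L2[OF square_integrable_max_birkhoff(1), of f n] by (simp add: abs_of_nonneg[OF max_birkhoff_nonneg])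

text \<open>The approximating \<open>m\<close> brings its own variance. Its sums have norm exactly
  sqrt n times that of \<open>m\<close>, so the assumed limit forces the norm of \<open>m\<close> to
  lie within \<epsilon> of \<sigma>; changing the normalisation is then one more error, controlled
  by the maximal inequality.\<close>

lemma hannan_FCLT_lipschitz:
  assumes L: "0 \<le> L" and B: "\<And>x. \<bar>f x\<bar> \<le> B" and f: "\<And>x y. \<bar>f x - f y\<bar> \<le> L * dist x y"
    and W: "is_wiener_measure W" and erg: "ergodic_transformation M T"
    and h: "square_integrable M h" and sm: "summable (increment_norm h)"
    and lim0: "(\<lambda>k. norm_L2 M ((P ^^ k) h)) \<longlonglongrightarrow> 0"
    and lim: "(\<lambda>n. norm_L2 M (birkhoff_sum T h n) / sqrt (real n)) \<longlonglongrightarrow> \<sigma>" and \<sigma>: "\<sigma> > 0"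
  shows "(\<lambda>n. \<integral>y. f (partial_sum_path T h \<sigma> n y) \<partial>M) \<longlonglongrightarrow> (\<integral>x. f x \<partial>W)"
proof (rule LIMSEQ_I)
  fix e :: real assume e: "e > 0"
  \<comment> \<open>The bound \<open>\<sigma> / 2\<close> keeps the norm of \<open>m\<close>
    positive. In the other one 36 = 4 * 9, and 9 = 1 + 8 counts the replacement of \<open>h\<close>
    by \<open>m\<close> and, with the factor 8 of the maximal inequality, the change of
    normalisation.\<close>
  define \<epsilon> where "\<epsilon> = min (\<sigma> / 2) (e * \<sigma> / (36 * (L + 1)))"
  have \<epsilon>: "\<epsilon> > 0" "\<epsilon> < \<sigma>" "\<epsilon> \<le> e * \<sigma> / (36 * (L + 1))" 
  proof -
    have "e * \<sigma> / (36 * (L + 1)) > 0" using e \<sigma> L by (intro divide_pos_pos mult_pos_pos) auto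
    then show "\<epsilon> > 0" using \<sigma> by (simp add: \<epsilon>_def)
    have "\<epsilon> \<le> \<sigma> / 2" unfolding \<epsilon>_def by (rule min.cobounded1)
    then show "\<epsilon> < \<sigma>" using \<sigma> by linarith
    show "\<epsilon> \<le> e * \<sigma> / (36 * (L + 1))" unfolding \<epsilon>_def by (rule min.cobounded2)
  qed
  obtain m b K where m: "martingale_difference m" and b: "\<And>x. \<bar>m x\<bar> \<le> b"
    and K: "\<And>n. norm_L2 M (max_birkhoff (\<lambda>x. h x - m x) n) \<le> \<epsilon> * sqrt (real n) + K"
    using martingale_approximation[OF h sm lim0 \<epsilon>(1)] by blast
  define r where "r = norm_L2 M m"
  note m2 = martingale_differenceD(1)[OF m]
  note hm2 = square_integrable_diff[OF h m2]
  have hmeas[measurable]: "h \<in> borel_measurable M" "m \<in> borel_measurable M" using h m2 by measurable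
  have Kn: "(\<lambda>n. K / sqrt (real n)) \<longlonglongrightarrow> 0"
    by (intro tendsto_divide_0[OF tendsto_const] filterlim_at_top_imp_at_infinity
        filterlim_compose[OF sqrt_at_top filterlim_real_sequentially])
  have close: "\<bar>\<sigma> - r\<bar> \<le> \<epsilon>"
  proof (rule LIMSEQ_le)
    show "(\<lambda>n. \<bar>norm_L2 M (birkhoff_sum T h n) / sqrt (real n) - r\<bar>) \<longlonglongrightarrow> \<bar>\<sigma> - r\<bar>"
      by (intro tendsto_intros lim)
    show "(\<lambda>n. \<epsilon> + K / sqrt (real n)) \<longlonglongrightarrow> \<epsilon>" using tendsto_add[OF tendsto_const Kn, of \<epsilon>] by simp
    show "\<exists>n0. \<forall>n\<ge>n0. \<bar>norm_L2 M (birkhoff_sum T h n) / sqrt (real n) - r\<bar> \<le> \<epsilon> + K / sqrt (real n)"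
    proof (intro exI[of _ 1] allI impI)
      fix n :: nat assume n: "1 \<le> n"
      then have sn: "sqrt (real n) > 0" by simp
      have "norm_L2 M (birkhoff_sum T m n) = sqrt (real n * r\<^sup>2)"
        unfolding r_def norm_birkhoff_sum_martingale[OF m, symmetric] by (simp add: norm_L2_def)
      also have "\<dots> = sqrt (real n) * r" by (simp add: real_sqrt_mult r_def norm_L2_nonneg)
      finally have mn: "norm_L2 M (birkhoff_sum T m n) = sqrt (real n) * r" .
      have "\<bar>norm_L2 M (birkhoff_sum T h n) - norm_L2 M (birkhoff_sum T m n)\<bar>
        \<le> norm_L2 M (\<lambda>x. birkhoff_sum T h n x - birkhoff_sum T m n x)"
        by (intro abs_norm_L2_diff square_integrable_birkhoff_sum h m2)
      also have "\<dots> \<le> norm_L2 M (max_birkhoff (\<lambda>x. h x - m x) n)"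
      proof (rule norm_L2_mono[OF _ square_integrable_max_birkhoff(1)[OF hm2]])
        show "\<bar>birkhoff_sum T h n x - birkhoff_sum T m n x\<bar> \<le> \<bar>max_birkhoff (\<lambda>x. h x - m x) n x\<bar>" for x
          using max_birkhoff_ge[of n n "\<lambda>x. h x - m x" x] by (simp add: birkhoff_sum_diff)
      qed measurable
      also have "\<dots> \<le> \<epsilon> * sqrt (real n) + K" by (rule K)
      finally have "\<bar>norm_L2 M (birkhoff_sum T h n) - sqrt (real n) * r\<bar> / sqrt (real n) \<le> (\<epsilon> * sqrt (real n) + K) / sqrt (real n)"
        unfolding mn using sn by (intro divide_right_mono) auto
      moreover have "norm_L2 M (birkhoff_sum T h n) / sqrt (real n) - r = (norm_L2 M (birkhoff_sum T h n) - sqrt (real n) * r) / sqrt (real n)"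
        using sn by (simp add: diff_divide_distrib)
      ultimately show "\<bar>norm_L2 M (birkhoff_sum T h n) / sqrt (real n) - r\<bar> \<le> \<epsilon> + K / sqrt (real n)"
        using sn by (simp add: add_divide_distrib)
    qed
  qed
  then have r: "r > 0" using \<epsilon>(2) by linarith
  note fm = lipschitz_test_measurable[OF L B f]
  have i: "integrable M (\<lambda>y. f (partial_sum_path T g s n y))" if "g \<in> borel_measurable M" for g s n
    by (rule integrable_bounded_real[OF measurable_compose[OF measurable_partial_sum_path[OF that] fm] B])
  have est: "\<bar>(\<integral>y. f (partial_sum_path T h \<sigma> n y) \<partial>M) - (\<integral>y. f (partial_sum_path T m r n y) \<partial>M)\<bar>
    \<le> L * (9 * \<epsilon> / \<sigma> + K / sqrt (real n) / \<sigma>)" if n: "n \<ge> 1" for n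
  proof -
    have sn: "sqrt (real n) > 0" using n by simp
    let ?E = "\<lambda>y. max_birkhoff (\<lambda>x. h x - m x) n y / (\<sigma> * sqrt (real n)) + \<bar>1 / \<sigma> - 1 / r\<bar> * (max_birkhoff m n y / sqrt (real n))"
    note im = square_integrable_integrable[OF square_integrable_max_birkhoff(1)[OF hm2]]
      square_integrable_integrable[OF square_integrable_max_birkhoff(1)[OF m2]]
    have iE: "integrable M ?E"
      by (intro Bochner_Integration.integrable_add integrable_mult_right integrable_divide im)
    have "\<bar>(\<integral>y. f (partial_sum_path T h \<sigma> n y) \<partial>M) - (\<integral>y. f (partial_sum_path T m r n y) \<partial>M)\<bar>
      = \<bar>\<integral>y. f (partial_sum_path T h \<sigma> n y) - f (partial_sum_path T m r n y) \<partial>M\<bar>"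
      using i[OF hmeas(1)] i[OF hmeas(2)] by simp
    also have "\<dots> \<le> (\<integral>y. \<bar>f (partial_sum_path T h \<sigma> n y) - f (partial_sum_path T m r n y)\<bar> \<partial>M)"
      by (rule integral_abs_bound)
    also have "\<dots> \<le> (\<integral>y. L * ?E y \<partial>M)"
    proof (rule integral_mono)
      show "integrable M (\<lambda>y. \<bar>f (partial_sum_path T h \<sigma> n y) - f (partial_sum_path T m r n y)\<bar>)"
        using i[OF hmeas(1)] i[OF hmeas(2)] by simp
      show "integrable M (\<lambda>y. L * ?E y)" by (intro integrable_mult_right iE)
      show "\<bar>f (partial_sum_path T h \<sigma> n y) - f (partial_sum_path T m r n y)\<bar> \<le> L * ?E y" for y
        using n by (intro order_trans[OF f] mult_left_mono L dist_partial_sum_path_le \<sigma> r) simp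
    qed
    also have "\<dots> = L * ((\<integral>y. max_birkhoff (\<lambda>x. h x - m x) n y \<partial>M) / (\<sigma> * sqrt (real n))
        + \<bar>1 / \<sigma> - 1 / r\<bar> * ((\<integral>y. max_birkhoff m n y \<partial>M) / sqrt (real n)))"
      using im by simp
    also have "\<dots> \<le> L * ((\<epsilon> * sqrt (real n) + K) / (\<sigma> * sqrt (real n)) + \<epsilon> / (\<sigma> * r) * (8 * r))"
    proof (intro mult_left_mono add_mono L mult_mono)
      show "(\<integral>y. max_birkhoff (\<lambda>x. h x - m x) n y \<partial>M) / (\<sigma> * sqrt (real n)) \<le> (\<epsilon> * sqrt (real n) + K) / (\<sigma> * sqrt (real n))"
        using sn \<sigma> by (intro divide_right_mono order_trans[OF integral_max_birkhoff_le[OF hm2] K]) simp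
      have "\<bar>1 / \<sigma> - 1 / r\<bar> = \<bar>(r - \<sigma>) / (\<sigma> * r)\<bar>" using \<sigma> r by (simp add: diff_divide_distrib)
      also have "\<dots> = \<bar>\<sigma> - r\<bar> / (\<sigma> * r)" using \<sigma> r by (simp add: abs_mult abs_minus_commute)
      also have "\<dots> \<le> \<epsilon> / (\<sigma> * r)" using close \<sigma> r by (intro divide_right_mono) auto
      finally show "\<bar>1 / \<sigma> - 1 / r\<bar> \<le> \<epsilon> / (\<sigma> * r)" .
      have "(\<integral>y. max_birkhoff m n y \<partial>M) \<le> 8 * sqrt (real n) * r"
        unfolding r_def by (rule order_trans[OF integral_max_birkhoff_le[OF m2] norm_max_birkhoff_martingale[OF m]])
      then show "(\<integral>y. max_birkhoff m n y \<partial>M) / sqrt (real n) \<le> 8 * r" using sn by (simp add: divide_le_eq mult_ac)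
      show "0 \<le> \<epsilon> / (\<sigma> * r)" using \<epsilon> \<sigma> r by simp
      show "0 \<le> (\<integral>y. max_birkhoff m n y \<partial>M) / sqrt (real n)"
        by (intro divide_nonneg_nonneg Bochner_Integration.integral_nonneg max_birkhoff_nonneg) simp
    qed
    also have "(\<epsilon> * sqrt (real n) + K) / (\<sigma> * sqrt (real n)) + \<epsilon> / (\<sigma> * r) * (8 * r) = 9 * \<epsilon> / \<sigma> + K / sqrt (real n) / \<sigma>"
      using sn \<sigma> r by (simp add: field_simps)
    finally show ?thesis .
  qed
  have "L * (9 * \<epsilon> / \<sigma>) < e / 2"
  proof -
    have "9 * \<epsilon> / \<sigma> \<le> 9 * (e * \<sigma> / (36 * (L + 1))) / \<sigma>"
      using \<epsilon>(3) \<sigma> by (intro divide_right_mono mult_left_mono) auto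
    also have "\<dots> = e / (4 * (L + 1))"
    proof -
      have "9 * (e * \<sigma> / (36 * D)) / \<sigma> = e / (4 * D)" if "D > 0" for D
        using \<sigma> that by (simp add: field_simps)
      from this[of "L + 1"] show ?thesis using L by argo
    qed
    finally have "L * (9 * \<epsilon> / \<sigma>) \<le> L * (e / (4 * (L + 1)))" by (rule mult_left_mono) (rule L)
    also have "\<dots> = (L / (L + 1)) * (e / 4)" by simp
    also have "\<dots> \<le> 1 * (e / 4)" using L e by (intro mult_right_mono) auto
    finally show ?thesis using e by linarith
  qed
  moreover have "(\<lambda>n. L * (9 * \<epsilon> / \<sigma> + K / sqrt (real n) / \<sigma>)) \<longlonglongrightarrow> L * (9 * \<epsilon> / \<sigma> + 0 / \<sigma>)"
    by (intro tendsto_intros Kn) (use \<sigma> in simp)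
  ultimately have "\<forall>\<^sub>F n in sequentially. L * (9 * \<epsilon> / \<sigma> + K / sqrt (real n) / \<sigma>) < e / 2"
    by (intro order_tendstoD(2)) auto
  moreover have "\<forall>\<^sub>F n in sequentially. dist (\<integral>y. f (partial_sum_path T m r n y) \<partial>M) (\<integral>x. f x \<partial>W) < e / 2"
    using martingale_FCLT[OF L B f W erg m b] r e unfolding r_def by (intro tendstoD) auto
  ultimately have "\<forall>\<^sub>F n in sequentially. norm ((\<integral>y. f (partial_sum_path T h \<sigma> n y) \<partial>M) - (\<integral>x. f x \<partial>W)) < e"
    using eventually_ge_at_top[of 1]
  proof eventually_elim
    case (elim n)
    then show ?case using est[of n] unfolding dist_real_def real_norm_def by linarith
  qed
  then show "\<exists>no. \<forall>n\<ge>no. norm ((\<integral>y. f (partial_sum_path T h \<sigma> n y) \<partial>M) - (\<integral>x. f x \<partial>W)) < e"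
    by (simp add: eventually_sequentially)
qed

theorem hannan_FCLT:
  assumes W: "is_wiener_measure W" and erg: "ergodic_transformation M T"
    and h: "square_integrable M h" and sm: "summable (increment_norm h)"
    and lim0: "(\<lambda>k. norm_L2 M ((P ^^ k) h)) \<longlonglongrightarrow> 0"
    and lim: "(\<lambda>n. norm_L2 M (birkhoff_sum T h n) / sqrt (real n)) \<longlonglongrightarrow> \<sigma>" and \<sigma>: "\<sigma> > 0"
  shows "weak_conv_measures (\<lambda>n. distr M borel (partial_sum_path T h \<sigma> n)) W"
proof (rule weak_conv_measuresI_lipschitz)
  have hm: "h \<in> borel_measurable M" using h by measurable
  note pm = measurable_partial_sum_path[OF hm]
  show "prob_space (distr M borel (partial_sum_path T h \<sigma> n))" for n by (rule prob_space_distr[OF pm])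
  show "prob_space W" "sets W = sets borel" using is_wiener_measureD[OF W] by auto
  fix f :: "skorohod \<Rightarrow> real" and L B :: real
  assume L: "0 \<le> L" and B: "\<And>x. \<bar>f x\<bar> \<le> B" and f: "\<And>x y. \<bar>f x - f y\<bar> \<le> L * dist x y"
  show "(\<lambda>n. \<integral>x. f x \<partial>distr M borel (partial_sum_path T h \<sigma> n)) \<longlonglongrightarrow> (\<integral>x. f x \<partial>W)"
    unfolding integral_distr[OF pm lipschitz_test_measurable[OF L B f]]
    by (rule hannan_FCLT_lipschitz[OF L B f W erg h sm lim0 lim \<sigma>])
qed simp

lemma FCLT_imp_CLT:
  assumes W: "is_wiener_measure W" and hm: "h \<in> borel_measurable M" and \<sigma>: "\<sigma> > 0"
    and conv: "weak_conv_measures (\<lambda>n. distr M borel (partial_sum_path T h \<sigma> n)) W"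
  shows "CLT M T h \<sigma>"
  unfolding CLT_def
proof (rule integral_bdd_continuous_conv_imp_weak_conv)
  note [measurable] = hm
  show "real_distribution (distr M borel (\<lambda>y. birkhoff_sum T h n y / sqrt (real n)))" for n
    by (rule real_distribution_distr) measurable
  show "real_distribution (density lborel (\<lambda>x. ennreal (normal_density 0 \<sigma> x)))"
    using \<sigma> by (rule real_distribution_normal)
  fix g :: "real \<Rightarrow> real" assume g: "\<And>x. isCont g x" "\<And>x. \<bar>g x\<bar> \<le> 1"
  have gm: "g \<in> borel_measurable borel" using g(1) by (rule isCont_imp_borel_measurable)
  note pm = measurable_partial_sum_path[OF hm]
  interpret W: prob_space W by (rule is_wiener_measureD(1)[OF W])
  \<comment> \<open>The paths are normalised by \<sigma> and the sums in the CLT are not, hence the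
    factor.\<close>
  let ?f = "\<lambda>x. g (\<sigma> * eval_path x 1)"
  have fc: "continuous_on UNIV ?f"
  proof (rule continuous_on_compose2[of UNIV g])
    show "continuous_on UNIV g" using g(1) by (simp add: continuous_at_imp_continuous_on)
    show "continuous_on UNIV (\<lambda>x. \<sigma> * eval_path x 1)"
      by (intro continuous_on_mult_left continuous_on_eval_path_1)
  qed simp
  note fm = borel_measurable_continuous_onI[OF fc]
  have "bounded (range ?f)" unfolding bounded_iff using g(2) by (intro exI[of _ 1]) auto
  then have "(\<lambda>n. \<integral>x. ?f x \<partial>distr M borel (partial_sum_path T h \<sigma> n)) \<longlonglongrightarrow> (\<integral>x. ?f x \<partial>W)"
    using conv fc unfolding weak_conv_measures_def by blast
  moreover have "(\<integral>x. ?f x \<partial>distr M borel (partial_sum_path T h \<sigma> n)) = (\<integral>x. g x \<partial>distr M borel (\<lambda>y. birkhoff_sum T h n y / sqrt (real n)))" for n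
  proof -
    have "\<sigma> * eval_path (partial_sum_path T h \<sigma> n y) 1 = birkhoff_sum T h n y / sqrt (real n)" for y
      using \<sigma> by (simp add: eval_partial_sum_path)
    then show ?thesis
      unfolding integral_distr[OF pm fm] by (subst integral_distr) (use gm in auto)
  qed
  moreover have "(\<integral>x. ?f x \<partial>W) = (\<integral>x. g x \<partial>density lborel (\<lambda>x. ennreal (normal_density 0 \<sigma> x)))"
  proof -
    have "distributed W lborel (\<lambda>x. eval_path x 1 - eval_path x 0) (normal_density 0 1)"
      using is_wiener_measureD(4)[OF W, of 0 1] by simp
    from W.normal_density_affine[OF this, of \<sigma> 0]
    have d: "distributed W lborel (\<lambda>x. \<sigma> * (eval_path x 1 - eval_path x 0)) (normal_density 0 \<sigma>)"
      using \<sigma> by simp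
    have fW: "?f \<in> borel_measurable W"
      using fm measurable_cong_sets[OF is_wiener_measureD(2)[OF W] refl] by blast
    \<comment> \<open>Wiener measure is specified through increments, so the value at time 1 is
      rewritten as the increment from time 0, almost surely the same.\<close>
    have "(\<integral>x. ?f x \<partial>W) = (\<integral>x. g (\<sigma> * (eval_path x 1 - eval_path x 0)) \<partial>W)"
    proof (rule integral_cong_AE)
      show "(\<lambda>x. g (\<sigma> * (eval_path x 1 - eval_path x 0))) \<in> borel_measurable W"
        by (intro measurable_compose[OF _ gm] borel_measurable_times borel_measurable_diff
            measurable_eval_path_wiener[OF W]) auto
      show "AE x in W. ?f x = g (\<sigma> * (eval_path x 1 - eval_path x 0))"
        using is_wiener_measureD(3)[OF W] by eventually_elim simp
    qed (rule fW)
    also have "\<dots> = (\<integral>x. g x \<partial>distr W lborel (\<lambda>x. \<sigma> * (eval_path x 1 - eval_path x 0)))"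
      using gm distributed_measurable[OF d] by (subst integral_distr) auto
    also have "\<dots> = (\<integral>x. g x \<partial>density lborel (\<lambda>x. ennreal (normal_density 0 \<sigma> x)))"
      by (simp add: distributed_distr_eq_density[OF d])
    finally show ?thesis .
  qed
  ultimately show "(\<lambda>n. \<integral>x. g x \<partial>distr M borel (\<lambda>y. birkhoff_sum T h n y / sqrt (real n)))
    \<longlonglongrightarrow> (\<integral>x. g x \<partial>density lborel (\<lambda>x. ennreal (normal_density 0 \<sigma> x)))" by simp
qed

end

theorem theorem1:
  fixes M :: "'a measure" and T :: "'a \<Rightarrow> 'a" and h :: "'a \<Rightarrow> real" and \<beta> \<sigma> :: real
  assumes "prob_space M"
    and "invariant_measure M T"
    and "ergodic_transformation M T"
    and "square_integrable M h"
    and "(\<integral>y. h y \<partial>M) = 0"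
    and "\<beta> > 1/2"
    and "limsup (\<lambda>n. ereal (real n powr \<beta> * norm_L2 M ((transfer_operator M T ^^ n) h))) < \<infinity>"
    and "(\<lambda>n. norm_L2 M (birkhoff_sum T h n) / sqrt (real n)) \<longlonglongrightarrow> \<sigma>"
    and "\<sigma> > 0"
  shows "CLT M T h \<sigma> \<and> FCLT M T h \<sigma>"
proof -
  interpret measure_preserving M T
    by (simp add: measure_preserving_def measure_preserving_axioms_def assms(1,2))
  obtain W where W: "is_wiener_measure W" using wiener_measure_exists by blast
  have "weak_conv_measures (\<lambda>n. distr M borel (partial_sum_path T h \<sigma> n)) W"
    by (rule hannan_FCLT[OF W assms(3,4) hannan_condition[OF assms(4,6,7)] assms(8,9)])
  moreover from this have "CLT M T h \<sigma>"
    using FCLT_imp_CLT[OF W square_integrable_measurable[OF assms(4)] assms(9)] by blast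
  ultimately show ?thesis using W unfolding FCLT_def by blast
qed

end
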